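(* Let $\varepsilon\in(0,1)$ and let $k_\varepsilon$ be the solution of $$\mathbf P(\tilde u>k_\varepsilon)=\varepsilon,\qquad \tilde u=\frac{\int_0^\infty vZ(v)\,dv}{\int_0^\infty Z(v)\,dv},$$ where $Z(u)=\exp\{W^H(u)-|u|^{2H}/2\}$. Consider the Bayes test BT1 $$\tilde\psi_n(X^n)=\mathbb 1_{\{\varphi_n^{-1}(\tilde\vartheta_n-\vartheta_1)>k_\varepsilon\}},$$ where $\tilde\vartheta_n$ is the Bayes estimator. Then $\tilde\psi_n$ belongs to $\mathcal K_\varepsilon$, i.e. $\lim_{n\to\infty}\mathbf E_{\vartheta_1}\tilde\psi_n(X^n)=\varepsilon$, and for every $u_*>0$ its power function under the local alternative $\vartheta=\vartheta_1+\varphi_nu_*$ satisfies, as $n\to\infty$, $$\beta(\tilde\psi_n,u_* )=\mathbf E_{\vartheta_1+\varphi_nu_*}\tilde\psi_n(X^n)\longrightarrow\tilde\beta(u_* )=\mathbf P(\tilde u_*>k_\varepsilon-u_* ),\qquad \tilde u_*=\frac{\int_{-u_*}^\infty vZ(v)\,dv}{\int_{-u_*}^\infty Z(v)\,dv}.$$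
   Context: Model (cusp-type singularity). Fix $\tau>0$, $0<\vartheta_1<b\le\tau$, $\kappa\in(0,1/2)$, $a\ne0$, and a known positive bounded function $h$ on $[0,\tau]$. Let $\Theta=[\vartheta_1,b)$ and $$\lambda(\vartheta,t)=a|t-\vartheta|^\kappa+h(t),\qquad 0\le t\le\tau,\ \vartheta\in\Theta,$$ where the intensity is assumed separated from zero on $[0,\tau]$. Under $\mathbf P_\vartheta$ (expectation $\mathbf E_\vartheta$), the observation is $X^n=(X_1,\dots,X_n)$, where $X_j=(X_j(t),0\le t\le\tau)$ are independent inhomogeneous Poisson processes with intensity function $\lambda(\vartheta,\cdot)$. The likelihood is $$L(\vartheta,X^n)=\exp\left\{\sum_{j=1}^n\int_0^\tau\ln\lambda(\vartheta,t)\,dX_j(t)-n\int_0^\tau[\lambda(\vartheta,t)-1]\,dt\right\}.$$ Prior and Bayes estimator: $p(\theta)$, $\vartheta_1\le\theta<b$, is a continuous and positive probability density, and (quadratic loss) $$\tilde\vartheta_n=\frac{\int_{\vartheta_1}^b\theta p(\theta)L(\theta,X^n)\,d\theta}{\int_{\vartheta_1}^bp(\theta)L(\theta,X^n)\,d\theta}.$$ Normalization: $H=\kappa+\frac12$, $\varphi_n=n^{-\frac1{2H}}\Gamma_{\vartheta_1}^{-\frac1H}$, with $\Gamma_{\vartheta_1}>0$, $\Gamma_{\vartheta_1}^2=\frac{2a^2B(\kappa+1,\kappa+1)}{h(\vartheta_1)}\left[\frac1{\cos(\pi\kappa)}-1\right]$, $B$ being the Beta function. $W^H=(W^H(u),u\in\mathbb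 R)$ is a standard two-sided fractional Brownian motion with Hurst parameter $H$ (centered Gaussian, continuous, $W^H(0)=0$, $\mathbf E|W^H(u)-W^H(v)|^2=|u-v|^{2H}$), and $Z(u)=\exp\{W^H(u)-|u|^{2H}/2\}$, $u\in\mathbb R$. The problem is testing $\vartheta=\vartheta_1$ against $\vartheta>\vartheta_1$. A test $\bar\psi_n$ is a $[0,1]$-valued function of $X^n$ (the probability to reject $\vartheta=\vartheta_1$); $\mathcal K_\varepsilon$ is the class of (sequences of) tests with $\lim_{n\to\infty}\mathbf E_{\vartheta_1}\bar\psi_n(X^n)=\varepsilon$; for $u>0$ the power is $\beta(\bar\psi_n,u)=\mathbf E_{\vartheta_1+\varphi_nu}\bar\psi_n(X^n)$ (defined for $n$ so large that $\vartheta_1+\varphi_nu<b$).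
   Formalization: The function h is additionally assumed Borel measurable on [0,τ] and continuous at the point ϑ₁; without continuity there, changing h at ϑ₁ alone alters φ_n but not the law of the observations, and the claim fails. *)

theory Defs
  imports "HOL-Probability.Probability"
begin

definition counting_path :: "real \<Rightarrow> (real \<Rightarrow> nat) \<Rightarrow> bool" where
  "counting_path \<tau> x \<longleftrightarrow>
     x 0 = 0 \<and> mono_on {0..\<tau>} x \<and> (\<forall>t\<in>{0..\<tau>}. continuous (at t within {t..\<tau>}) x)"

text \<open>Elements of the path space are functions on \<open>[0, \<tau>]\<close> (\<open>undefined\<close> elsewhere), and its
  sigma-algebra is generated by the evaluations at the points of \<open>[0, \<tau>]\<close>. Simplicity of the jumps
  is not built in; it holds almost surely for Poisson processes with an intensity function.\<close>

definition path_space :: "real \<Rightarrow> (real \<Rightarrow> nat) measure" where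
  "path_space \<tau> = restrict_space (\<Pi>\<^sub>M t\<in>{0..\<tau>}. count_space UNIV) {x. counting_path \<tau> x}"

definition sample_space :: "real \<Rightarrow> nat \<Rightarrow> (nat \<Rightarrow> real \<Rightarrow> nat) measure" where
  "sample_space \<tau> n = (\<Pi>\<^sub>M j\<in>{..<n}. path_space \<tau>)"

definition poisson_process ::
  "'a measure \<Rightarrow> real \<Rightarrow> (real \<Rightarrow> real) \<Rightarrow> ('a \<Rightarrow> real \<Rightarrow> nat) \<Rightarrow> bool" where
  "poisson_process M \<tau> l Y \<longleftrightarrow>
     Y \<in> M \<rightarrow>\<^sub>M path_space \<tau> \<and>
     (\<forall>m (t::nat \<Rightarrow> real). mono_on {..m} t \<and> t ` {..m} \<subseteq> {0..\<tau>} \<longrightarrow>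
        prob_space.indep_vars M (\<lambda>_. count_space UNIV)
          (\<lambda>i \<omega>. Y \<omega> (t (Suc i)) - Y \<omega> (t i)) {..<m}) \<and>
     (\<forall>s t. 0 \<le> s \<and> s < t \<and> t \<le> \<tau> \<longrightarrow>
        distr M (count_space UNIV) (\<lambda>\<omega>. Y \<omega> t - Y \<omega> s)
          = measure_pmf (poisson_pmf (LBINT v:{s..t}. l v)))"

definition poisson_sample ::
  "'a measure \<Rightarrow> real \<Rightarrow> nat \<Rightarrow> (real \<Rightarrow> real) \<Rightarrow> (nat \<Rightarrow> 'a \<Rightarrow> real \<Rightarrow> nat) \<Rightarrow> bool" where
  "poisson_sample M \<tau> n l X \<longleftrightarrow>
     prob_space M \<and>
     (\<forall>j<n. poisson_process M \<tau> l (X j)) \<and>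
     prob_space.indep_vars M (\<lambda>_. path_space \<tau>) X {..<n}"

definition expect_sample ::
  "'a measure \<Rightarrow> nat \<Rightarrow> (nat \<Rightarrow> 'a \<Rightarrow> real \<Rightarrow> nat) \<Rightarrow> ((nat \<Rightarrow> real \<Rightarrow> nat) \<Rightarrow> real) \<Rightarrow> real" where
  "expect_sample M n X \<psi> = (LINT \<omega>|M. \<psi> (\<lambda>j\<in>{..<n}. X j \<omega>))"

text \<open>The Lebesgue--Stieltjes measure \<open>dx\<close> of a counting path; the path is continued by constants
  outside \<open>[0, \<tau>]\<close>, so that the measure lives on \<open>(0, \<tau>]\<close>.\<close>

definition path_measure :: "real \<Rightarrow> (real \<Rightarrow> nat) \<Rightarrow> real measure" where
  "path_measure \<tau> x = interval_measure (\<lambda>t. real (x (max 0 (min t \<tau>))))"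

definition likelihood ::
  "real \<Rightarrow> nat \<Rightarrow> (real \<Rightarrow> real) \<Rightarrow> (nat \<Rightarrow> real \<Rightarrow> nat) \<Rightarrow> real" where
  "likelihood \<tau> n l x =
     exp ((\<Sum>j<n. LINT t:{0..\<tau>}|path_measure \<tau> (x j). ln (l t))
          - real n * (LBINT t:{0..\<tau>}. l t - 1))"

definition bayes_estimator ::
  "real \<Rightarrow> (real \<Rightarrow> real \<Rightarrow> real) \<Rightarrow> real set \<Rightarrow> (real \<Rightarrow> real) \<Rightarrow> nat \<Rightarrow> (nat \<Rightarrow> real \<Rightarrow> nat) \<Rightarrow> real" where
  "bayes_estimator \<tau> lam \<Theta> p n x =
     (LBINT \<theta>:\<Theta>. \<theta> * p \<theta> * likelihood \<tau> n (lam \<theta>) x)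
     / (LBINT \<theta>:\<Theta>. p \<theta> * likelihood \<tau> n (lam \<theta>) x)"

definition cusp_intensity :: "real \<Rightarrow> real \<Rightarrow> (real \<Rightarrow> real) \<Rightarrow> real \<Rightarrow> real \<Rightarrow> real" where
  "cusp_intensity a \<kappa> h \<theta> t = a * \<bar>t - \<theta>\<bar> powr \<kappa> + h t"

definition cusp_Gamma :: "real \<Rightarrow> real \<Rightarrow> (real \<Rightarrow> real) \<Rightarrow> real \<Rightarrow> real" where
  "cusp_Gamma a \<kappa> h \<theta> =
     sqrt (2 * a\<^sup>2 * Beta (\<kappa> + 1) (\<kappa> + 1) / h \<theta> * (1 / cos (pi * \<kappa>) - 1))"

definition cusp_rate :: "real \<Rightarrow> real \<Rightarrow> (real \<Rightarrow> real) \<Rightarrow> real \<Rightarrow> nat \<Rightarrow> real" where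
  "cusp_rate a \<kappa> h \<theta> n =
     (let H = \<kappa> + 1 / 2 in real n powr (- 1 / (2 * H)) * cusp_Gamma a \<kappa> h \<theta> powr (- 1 / H))"

definition test_class ::
  "real \<Rightarrow> (nat \<Rightarrow> 'a measure) \<Rightarrow> (nat \<Rightarrow> 'a \<Rightarrow> real \<Rightarrow> nat) \<Rightarrow> real
     \<Rightarrow> (nat \<Rightarrow> (nat \<Rightarrow> real \<Rightarrow> nat) \<Rightarrow> real) set" where
  "test_class \<tau> M X \<epsilon> =
     {\<psi>. (\<forall>n. \<psi> n \<in> borel_measurable (sample_space \<tau> n) \<and>
              (\<forall>x\<in>space (sample_space \<tau> n). \<psi> n x \<in> {0..1})) \<and>
          (\<lambda>n. expect_sample (M n) n X (\<psi> n)) \<longlonglongrightarrow> \<epsilon>}"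

definition bayes_test ::
  "real \<Rightarrow> (real \<Rightarrow> real \<Rightarrow> real) \<Rightarrow> real set \<Rightarrow> (real \<Rightarrow> real) \<Rightarrow> real \<Rightarrow> (nat \<Rightarrow> real) \<Rightarrow> real
     \<Rightarrow> nat \<Rightarrow> (nat \<Rightarrow> real \<Rightarrow> nat) \<Rightarrow> real" where
  "bayes_test \<tau> lam \<Theta> p \<theta>\<^sub>1 \<phi> k n x =
     (if inverse (\<phi> n) * (bayes_estimator \<tau> lam \<Theta> p n x - \<theta>\<^sub>1) > k then 1 else 0)"

text \<open>A process is Gaussian if all its finite linear combinations are normal; the variance
  may be \<open>0\<close>, which \<^const>\<open>normal_density\<close> does not cover.\<close>

definition centered_normal :: "'b measure \<Rightarrow> ('b \<Rightarrow> real) \<Rightarrow> bool" where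
  "centered_normal N Y \<longleftrightarrow>
     Y \<in> borel_measurable N \<and>
     ((AE \<omega> in N. Y \<omega> = 0) \<or> (\<exists>\<sigma>>0. distributed N lborel Y (normal_density 0 \<sigma>)))"

definition fractional_brownian_motion :: "'b measure \<Rightarrow> real \<Rightarrow> (real \<Rightarrow> 'b \<Rightarrow> real) \<Rightarrow> bool" where
  "fractional_brownian_motion N H W \<longleftrightarrow>
     prob_space N \<and>
     (\<forall>u. W u \<in> borel_measurable N) \<and>
     (\<forall>T c. finite T \<longrightarrow> centered_normal N (\<lambda>\<omega>. \<Sum>u\<in>T. c u * W u \<omega>)) \<and>
     (\<forall>\<omega>\<in>space N. W 0 \<omega> = 0 \<and> continuous_on UNIV (\<lambda>u. W u \<omega>)) \<and>
     (\<forall>u v. (LINT \<omega>|N. (W u \<omega> - W v \<omega>)\<^sup>2) = \<bar>u - v\<bar> powr (2 * H))"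

definition limit_likelihood :: "real \<Rightarrow> (real \<Rightarrow> 'b \<Rightarrow> real) \<Rightarrow> real \<Rightarrow> 'b \<Rightarrow> real" where
  "limit_likelihood H W u \<omega> = exp (W u \<omega> - \<bar>u\<bar> powr (2 * H) / 2)"

definition limit_bayes :: "real \<Rightarrow> (real \<Rightarrow> 'b \<Rightarrow> real) \<Rightarrow> real \<Rightarrow> 'b \<Rightarrow> real" where
  "limit_bayes H W c \<omega> =
     (LBINT v:{c..}. v * limit_likelihood H W v \<omega>) / (LBINT v:{c..}. limit_likelihood H W v \<omega>)"

end

theory Submission imports Defs "HOL-Real_Asymp.Real_Asymp" begin

text \<open>Let \<open>\<theta>\<^sub>n = \<theta>\<^sub>1 + \<phi>\<^sub>n u\<close> be the true parameter and \<open>Z\<^sub>n v\<close> the likelihood ratio of \<open>\<theta>\<^sub>n + \<phi>\<^sub>n v\<close> to \<open>\<theta>\<^sub>n\<close>. Clearing the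
  denominator of the Bayes estimator, the test rejects iff the integral of
  \<open>(v - (k - u)) p(\<theta>\<^sub>n + \<phi>\<^sub>n v) Z\<^sub>n v\<close> over \<open>v \<ge> - u\<close> is positive, and the limit event has the same form with
  \<open>p \<theta>\<^sub>1\<close> and \<open>Z\<close>. So it suffices that these integrals converge in law and that the limit has no atom at \<open>0\<close>.

  By Campbell's formula the characteristic functions of the vectors \<open>(ln (Z\<^sub>n x\<^sub>i))\<^sub>i\<close> are exponentials of
  deterministic integrals, which converge by dominated convergence; the covariance of \<open>W\<^sup>H\<close> arises from
  the integral of \<open>(\<bar>s - v\<bar>\<^sup>\<kappa> - \<bar>s - w\<bar>\<^sup>\<kappa>)\<^sup>2\<close>. The bounds \<open>E (\<surd>Z\<^sub>n u - \<surd>Z\<^sub>n v)\<^sup>2 \<le> C \<bar>u - v\<bar>\<close> and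
  \<open>E \<surd>Z\<^sub>n v \<le> exp (- q v)\<close> reduce the integrals to Riemann sums uniformly in \<open>n\<close>, without tightness in a
  function space.

  For the absence of an atom, tilt the law of \<open>W\<^sup>H\<close> by \<open>\<xi> = W\<^sup>H(c) - W\<^sup>H(c - 1)\<close>, \<open>c = - u\<close>. This replaces \<open>Z v\<close> by
  \<open>exp (s g v) Z v\<close> with \<open>g\<close> strictly increasing on \<open>[c, \<infinity>)\<close>, so each path makes the tilted integral vanish for at
  most one \<open>s\<close>. Along a sequence \<open>s \<rightarrow> 0\<close> the events are thus disjoint, while their probabilities tend to that of
  the atom, which is therefore \<open>0\<close>.\<close>

section \<open>The cusp integral\<close>

text \<open>Expectations cannot control the tails: a likelihood ratio has mean 1 at every point, so
  in the limit the integral of \<open>v * Z v\<close> over a half-line has infinite mean. Only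
  square roots have decaying means. Hence errors are measured by the mean of
  \<open>min 1 \<bar>T - S\<bar>\<close>, which suffices for characteristic functions and to which
  \<open>min 1 x \<le> sqrt x\<close> applies. The samples for different n live on unrelated
  probability spaces, so all limits pass through characteristic functions; from the vector of
  log-likelihood ratios to a Riemann sum, one coordinate is exchanged at a time under complex
  weights. \<open>cusp_const\<close> is the integral of \<open>(\<bar>s - 1\<bar> powr \<kappa> -
  \<bar>s\<bar> powr \<kappa>)^2\<close>. Its exact value matters because the rate contains it: n
  times the rate to the power 2H times \<open>a^2 * cusp_const \<kappa>\<close> equals
  \<open>h \<theta>1\<close>, which gives the limit its unit variance scale. Of \<open>h\<close>
  only continuity at the tested point enters the limit; elsewhere bounds suffice. Centring at the
  true parameter treats size and power together: only the left end -u and the threshold k - u depend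
  on u.\<close>

definition cusp_const :: "real \<Rightarrow> real" where
  "cusp_const \<kappa> = 2 * Beta (\<kappa> + 1) (\<kappa> + 1) * (1 / cos (pi * \<kappa>) - 1)"

lemma Gamma_reflection_real:
  fixes x :: real
  shows "Gamma x * Gamma (1 - x) = pi / sin (pi * x)"
proof -
  have "complex_of_real (Gamma x) * complex_of_real (Gamma (1 - x)) = of_real pi / sin (of_real pi * of_real x)"
    using Gamma_reflection_complex[of "of_real x"] Gamma_complex_of_real[of x] Gamma_complex_of_real[of "1 - x"]
    by (simp only: of_real_diff of_real_1)
  also have "sin (of_real pi * of_real x) = complex_of_real (sin (pi * x))"
    by (simp only: sin_of_real of_real_mult[symmetric])
  finally have "complex_of_real (Gamma x * Gamma (1 - x)) = complex_of_real (pi / sin (pi * x))"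
    by (simp only: of_real_mult of_real_divide)
  then show ?thesis by (simp only: of_real_eq_iff)
qed

lemma has_integral_indicator_mult:
  fixes f :: "real \<Rightarrow> real"
  assumes "(f has_integral J) S"
  shows "((\<lambda>s. f s * indicator S s) has_integral J) UNIV"
proof -
  have "(\<lambda>s. f s * indicator S s) = (\<lambda>s. if s \<in> S then f s else 0)"
    by (auto simp: fun_eq_iff)
  then show ?thesis using assms by (simp add: has_integral_restrict_UNIV)
qed

context
  fixes \<kappa> :: real
  assumes kp: "0 < \<kappa>" and kh: "\<kappa> < 1 / 2"
begin

text \<open>The cosine in the rate originates here: the reflection formula at
  \<open>\<kappa>\<close> and at \<open>2 * \<kappa>\<close> produces
  \<open>sin (pi * \<kappa>)\<close> and \<open>sin (2 * pi * \<kappa>)\<close>, and by the double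
  angle formula their quotient leaves a cosine.\<close>

lemma Beta_half_line: "\<kappa> * Beta \<kappa> (1 - 2 * \<kappa>) = (2 * \<kappa> + 1) * Beta (\<kappa> + 1) (\<kappa> + 1) / cos (pi * \<kappa>)"
proof -
  have g: "Gamma \<kappa> > 0" "Gamma (2 * \<kappa>) > 0" "Gamma (1 - \<kappa>) > 0" "Gamma (1 - 2 * \<kappa>) > 0"
    using kp kh by (auto intro!: Gamma_real_pos)
  have "pi * \<kappa> < pi * (1/2)" using kh by (intro mult_strict_left_mono) auto
  then have tr: "cos (pi * \<kappa>) > 0" "sin (pi * \<kappa>) > 0" "pi * \<kappa> < pi"
    using kp pi_gt_zero by (auto intro!: cos_gt_zero sin_gt_zero simp: field_simps)
  have r1: "Gamma \<kappa> * Gamma (1 - \<kappa>) = pi / sin (pi * \<kappa>)" by (rule Gamma_reflection_real)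
  have r2: "Gamma (2 * \<kappa>) * Gamma (1 - 2 * \<kappa>) = pi / (2 * sin (pi * \<kappa>) * cos (pi * \<kappa>))"
    using Gamma_reflection_real[of "2 * \<kappa>"] sin_double[of "pi * \<kappa>"] by (simp add: mult_ac)
  have np: "x \<notin> \<int>\<^sub>\<le>\<^sub>0" if "x > 0" for x :: real
    using that by (auto elim!: nonpos_Ints_cases)
  have p1: "Gamma (\<kappa> + 1) = \<kappa> * Gamma \<kappa>" using kp by (intro Gamma_plus1 np) simp
  have p2: "Gamma (2 * \<kappa> + 1) = 2 * \<kappa> * Gamma (2 * \<kappa>)"
    using kp Gamma_plus1[OF np, of "2 * \<kappa>"] by simp
  have p3: "Gamma (2 * \<kappa> + 2) = (2 * \<kappa> + 1) * Gamma (2 * \<kappa> + 1)"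
    using kp Gamma_plus1[OF np, of "2 * \<kappa> + 1"] by (simp add: add.assoc)
  have r12: "2 * Gamma (2 * \<kappa>) * Gamma (1 - 2 * \<kappa>) * cos (pi * \<kappa>) = Gamma \<kappa> * Gamma (1 - \<kappa>)"
    unfolding r1 using r2 tr by (simp add: field_simps)
  have "\<kappa> + (1 - 2 * \<kappa>) = 1 - \<kappa>" "\<kappa> + 1 + (\<kappa> + 1) = 2 * \<kappa> + 2" by auto
  then have "Beta \<kappa> (1 - 2 * \<kappa>) = Gamma \<kappa> * Gamma (1 - 2 * \<kappa>) / Gamma (1 - \<kappa>)"
    "Beta (\<kappa> + 1) (\<kappa> + 1) = (\<kappa> * Gamma \<kappa>) * (\<kappa> * Gamma \<kappa>) / ((2 * \<kappa> + 1) * (2 * \<kappa> * Gamma (2 * \<kappa>)))"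
    unfolding Beta_def by (simp_all add: p1 p2 p3)
  note B = this
  have alg: "(2 * \<kappa> + 1) * ((\<kappa> * x) * (\<kappa> * x) / ((2 * \<kappa> + 1) * (2 * \<kappa> * y))) / z = \<kappa> * x * (x / (2 * y * z))"
    for x y z :: real
  proof -
    have "(2 * \<kappa> + 1) * ((\<kappa> * x) * (\<kappa> * x) / ((2 * \<kappa> + 1) * (2 * \<kappa> * y))) = (\<kappa> * x) * (\<kappa> * x) / (2 * \<kappa> * y)"
      using kp by simp
    also have "\<dots> = \<kappa> * x * x / (2 * y)" using kp by simp
    finally show ?thesis by simp
  qed
  have q: "Gamma (1 - 2 * \<kappa>) / Gamma (1 - \<kappa>) = Gamma \<kappa> / (2 * Gamma (2 * \<kappa>) * cos (pi * \<kappa>))"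
    using g tr r12 by (subst frac_eq_eq) (auto simp: mult_ac)
  have "\<kappa> * Beta \<kappa> (1 - 2 * \<kappa>) = \<kappa> * Gamma \<kappa> * (Gamma (1 - 2 * \<kappa>) / Gamma (1 - \<kappa>))"
    unfolding B(1) by simp
  then show ?thesis unfolding q B(2) alg .
qed

text \<open>With \<open>A\<close> for \<open>x powr (\<kappa> - 1)\<close> and \<open>C\<close> for
  \<open>(1 - x) powr (- 2 * \<kappa> - 2)\<close>, every power in the derivative below is a
  polynomial in \<open>x\<close>, \<open>A\<close> and \<open>C\<close>, so checking the derivative
  becomes polynomial algebra.\<close>

lemma unit_interval_derivative_identity: "real 2 * ((0 - k * A) * (1 - x * A) ^ (2 - Suc 0)) * ((1 - x) * C) + (2 * k + 1) * C * (1 - x * A)\<^sup>2 +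
    ((k * A - 2 * k * (x * A\<^sup>2)) * ((1 - x)\<^sup>2 * C) + 2 * k * ((1 - x) * C) * (x * A - x\<^sup>2 * A\<^sup>2))
    = (1 - x * A)\<^sup>2 * C * (2 * k + 1) - k * (A * ((1 - x)\<^sup>2 * C))" for x A k C :: real
  by simp algebra

text \<open>The substitution $x = s / (1 + s)$ turns $((1+s)^\kappa - s^\kappa)^2\,ds$ into the integrand below;
  up to a Beta integrand it has an elementary antiderivative.\<close>

lemma unit_interval_integral:
  "((\<lambda>x. (1 - x powr \<kappa>)\<^sup>2 * (1 - x) powr (- 2 * \<kappa> - 2)) has_integral
     (Beta (\<kappa> + 1) (\<kappa> + 1) / cos (pi * \<kappa>) - 1 / (2 * \<kappa> + 1))) {0..1}"
proof -
  \<comment> \<open>The first summand integrates one power of \<open>1 - x\<close>. The cross term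
    this creates is made less singular by the derivative of the second summand, so that only a
    multiple of the Beta integrand with parameters \<open>\<kappa>\<close> and
    \<open>1 - 2 * \<kappa>\<close> is left over.\<close>
  define F where "F x = ((1 - x powr \<kappa>)\<^sup>2 * (1 - x) powr (- 2 * \<kappa> - 1) + (x powr \<kappa> - x powr (2 * \<kappa>)) * (1 - x) powr (- 2 * \<kappa>)) / (2 * \<kappa> + 1)" for x
  define f where "f x = (1 - x powr \<kappa>)\<^sup>2 * (1 - x) powr (- 2 * \<kappa> - 2)" for x
  define c where "c = \<kappa> / (2 * \<kappa> + 1)"
  have d: "((\<lambda>x. F x) has_real_derivative f x - c * (x powr (\<kappa> - 1) * (1 - x) powr (- 2 * \<kappa>))) (at x)" if x: "0 < x" "x < 1" for x
  proof -
    define A where "A = x powr (\<kappa> - 1)"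
    define Bb where "Bb = (1 - x) powr (- 2 * \<kappa> - 2)"
    have e: "x powr \<kappa> = x * A" "x powr (2 * \<kappa>) = x^2 * A^2" "x powr (2 * \<kappa> - 1) = x * A^2"
      "(1 - x) powr (- 2 * \<kappa> - 1) = (1 - x) * Bb" "(1 - x) powr (- 2 * \<kappa>) = (1 - x)^2 * Bb"
      "(1 - x) powr (- 2 * \<kappa> - 2) = Bb" "x powr (\<kappa> - 1) = A"
    proof -
      show 1: "x powr \<kappa> = x * A" unfolding A_def using x powr_add[of x 1 "\<kappa> - 1"] by simp
      have 2: "x powr (2 * \<kappa>) = (x powr \<kappa>)^2" using x by (simp add: power2_eq_square flip: powr_add)
      then show "x powr (2 * \<kappa>) = x^2 * A^2" unfolding 1 by (simp add: power_mult_distrib)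
      then show "x powr (2 * \<kappa> - 1) = x * A^2" using x by (simp add: powr_diff power2_eq_square)
      have "(1 - x) * (1 - x) powr (- 2 * \<kappa> - 2) = (1 - x) powr (1 + (- 2 * \<kappa> - 2))"
        using x by (intro powr_mult_base) simp
      also have "1 + (- 2 * \<kappa> - 2) = - 2 * \<kappa> - 1" by simp
      finally show 3: "(1 - x) powr (- 2 * \<kappa> - 1) = (1 - x) * Bb" unfolding Bb_def ..
      have "(1 - x) * (1 - x) powr (- 2 * \<kappa> - 1) = (1 - x) powr (1 + (- 2 * \<kappa> - 1))"
        using x by (intro powr_mult_base) simp
      also have "1 + (- 2 * \<kappa> - 1) = - 2 * \<kappa>" by simp
      finally show "(1 - x) powr (- 2 * \<kappa>) = (1 - x)^2 * Bb" unfolding 3 by (simp add: power2_eq_square)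
      show "(1 - x) powr (- 2 * \<kappa> - 2) = Bb" "x powr (\<kappa> - 1) = A" unfolding A_def Bb_def by (rule refl)+
    qed
    have P1: "((\<lambda>x. x powr \<kappa>) has_real_derivative \<kappa> * x powr (\<kappa> - 1)) (at x)"
      and P2: "((\<lambda>x. x powr (2 * \<kappa>)) has_real_derivative 2 * \<kappa> * x powr (2 * \<kappa> - 1)) (at x)"
      by (rule has_real_derivative_powr[OF x(1)])+
    have m: "((\<lambda>x. 1 - x) has_real_derivative - 1) (at x)" by (auto intro!: derivative_eq_intros)
    have q: "((\<lambda>x. (1 - x) powr r) has_real_derivative - r * (1 - x) powr (r - 1)) (at x)" for r
      by (rule DERIV_cong[OF DERIV_chain2[OF has_real_derivative_powr m]]) (use x in simp_all)
    have eq: "- (- 2 * \<kappa> - 1) = 2 * \<kappa> + 1" "- 2 * \<kappa> - 1 - 1 = - 2 * \<kappa> - 2" "- (- 2 * \<kappa>) = 2 * \<kappa>" by auto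
    have Q1: "((\<lambda>x. (1 - x) powr (- 2 * \<kappa> - 1)) has_real_derivative (2 * \<kappa> + 1) * (1 - x) powr (- 2 * \<kappa> - 2)) (at x)"
      using q[of "- 2 * \<kappa> - 1"] unfolding eq .
    have Q2: "((\<lambda>x. (1 - x) powr (- 2 * \<kappa>)) has_real_derivative 2 * \<kappa> * (1 - x) powr (- 2 * \<kappa> - 1)) (at x)"
      using q[of "- 2 * \<kappa>"] unfolding eq .
    have k: "2 * \<kappa> + 1 \<noteq> 0" using kp by simp
    show ?thesis
      unfolding F_def
    proof (rule DERIV_cong[OF DERIV_cdivide[OF DERIV_add[OF DERIV_mult[OF DERIV_power[OF DERIV_diff[OF DERIV_const P1], where n=2] Q1] DERIV_mult[OF DERIV_diff[OF P1 P2] Q2]]]])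
      have ck: "(y - c * z) * (2 * \<kappa> + 1) = y * (2 * \<kappa> + 1) - \<kappa> * z" for y z
        unfolding c_def using k by (simp add: field_simps)
      show "(real 2 * ((0 - \<kappa> * x powr (\<kappa> - 1)) * (1 - x powr \<kappa>) ^ (2 - Suc 0)) * (1 - x) powr (- 2 * \<kappa> - 1) +
         (2 * \<kappa> + 1) * (1 - x) powr (- 2 * \<kappa> - 2) * (1 - x powr \<kappa>)\<^sup>2 +
         ((\<kappa> * x powr (\<kappa> - 1) - 2 * \<kappa> * x powr (2 * \<kappa> - 1)) * (1 - x) powr (- 2 * \<kappa>) +
          2 * \<kappa> * (1 - x) powr (- 2 * \<kappa> - 1) * (x powr \<kappa> - x powr (2 * \<kappa>)))) / (2 * \<kappa> + 1)
        = f x - c * (x powr (\<kappa> - 1) * (1 - x) powr (- 2 * \<kappa>))"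
        unfolding nonzero_divide_eq_eq[OF k] ck f_def e by (rule unit_interval_derivative_identity)
    qed
  qed
  have cont: "continuous_on {0..1} F"
  proof -
    \<comment> \<open>At 1 both summands combine a vanishing with an unbounded factor, while
      \<open>F 1\<close> is 0 because \<open>0 powr r\<close> is 0. Continuity there follows from
      \<open>1 - x powr \<kappa> \<le> 1 - x\<close>, which bounds \<open>F\<close> by a power of
      \<open>1 - x\<close> with exponent \<open>1 - 2 * \<kappa> > 0\<close>.\<close>
    have sq: "(F \<longlongrightarrow> F 1) (at 1 within {0..1})"
    proof (rule tendsto_sandwich[where f="\<lambda>_. 0" and h="\<lambda>x. 2 * (1 - x) powr (1 - 2 * \<kappa>)"])
      have *: "0 \<le> F x \<and> F x \<le> 2 * (1 - x) powr (1 - 2 * \<kappa>)" if x: "x \<in> {0..1}" for x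
      proof (cases "x = 1 \<or> x = 0")
        case True
        then show ?thesis using kp by (auto simp: F_def divide_simps)
      next
        case False
        then have x: "0 < x" "x < 1" using x by auto
        have "x powr 1 \<le> x powr \<kappa>" "x powr (2 * \<kappa>) \<le> x powr \<kappa>" "x powr \<kappa> \<le> x powr 0"
          using x kp kh by (intro powr_mono'; simp)+
        then have le: "x \<le> x powr \<kappa>" "x powr \<kappa> \<le> 1" "x powr (2 * \<kappa>) \<le> x powr \<kappa>" using x by auto
        have sq: "x powr (2 * \<kappa>) = (x powr \<kappa>)^2" using x by (simp add: power2_eq_square flip: powr_add)
        have e2: "(1 - x) * (1 - x) powr (- 2 * \<kappa>) = (1 - x) powr (1 + (- 2 * \<kappa>))"
          and e1: "(1 - x) * (1 - x) powr (- 2 * \<kappa> - 1) = (1 - x) powr (1 + (- 2 * \<kappa> - 1))"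
          using x by (intro powr_mult_base; simp)+
        have ee: "1 + (- 2 * \<kappa>) = 1 - 2 * \<kappa>" "1 + (- 2 * \<kappa> - 1) = - 2 * \<kappa>" by auto
        have e: "(1 - x)^2 * (1 - x) powr (- 2 * \<kappa> - 1) = (1 - x) powr (1 - 2 * \<kappa>)"
          "(1 - x) * (1 - x) powr (- 2 * \<kappa>) = (1 - x) powr (1 - 2 * \<kappa>)"
          using e1 e2 unfolding ee by (simp_all only: power2_eq_square mult.assoc)
        have "(1 - x powr \<kappa>)\<^sup>2 \<le> (1 - x)^2" using le by (intro power_mono) auto
        then have 1: "(1 - x powr \<kappa>)\<^sup>2 * (1 - x) powr (- 2 * \<kappa> - 1) \<le> (1 - x) powr (1 - 2 * \<kappa>)"
          unfolding e(1)[symmetric] by (intro mult_right_mono) auto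
        have "x powr \<kappa> - x powr (2 * \<kappa>) = x powr \<kappa> * (1 - x powr \<kappa>)" unfolding sq by (simp add: algebra_simps power2_eq_square)
        also have "\<dots> \<le> 1 * (1 - x)" using le by (intro mult_mono) auto
        finally have 2: "(x powr \<kappa> - x powr (2 * \<kappa>)) * (1 - x) powr (- 2 * \<kappa>) \<le> (1 - x) powr (1 - 2 * \<kappa>)"
          unfolding e(2)[symmetric] by (intro mult_right_mono) auto
        let ?S = "(1 - x powr \<kappa>)\<^sup>2 * (1 - x) powr (- 2 * \<kappa> - 1) + (x powr \<kappa> - x powr (2 * \<kappa>)) * (1 - x) powr (- 2 * \<kappa>)"
        have S0: "0 \<le> ?S" using le by simp
        have "?S / (2 * \<kappa> + 1) \<le> ?S / 1" using S0 kp by (intro divide_left_mono) auto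
        moreover have "0 \<le> ?S / (2 * \<kappa> + 1)" using S0 kp by simp
        ultimately show ?thesis unfolding F_def div_by_1 using 1 2 by (intro conjI; linarith)
      qed
      show "\<forall>\<^sub>F x in at 1 within {0..1}. 0 \<le> F x" "\<forall>\<^sub>F x in at 1 within {0..1}. F x \<le> 2 * (1 - x) powr (1 - 2 * \<kappa>)"
        unfolding eventually_at_filter by (rule always_eventually, use * in blast)+
      have "((\<lambda>x::real. 2 * (1 - x) powr (1 - 2 * \<kappa>)) \<longlongrightarrow> 2 * (1 - 1) powr (1 - 2 * \<kappa>)) (at 1 within {0..1})"
        using kh by (intro tendsto_intros tendsto_powr') (auto simp: eventually_at_filter)
      then show "((\<lambda>x::real. 2 * (1 - x) powr (1 - 2 * \<kappa>)) \<longlongrightarrow> F 1) (at 1 within {0..1})"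
        by (simp add: F_def)
      show "((\<lambda>x::real. 0) \<longlongrightarrow> F 1) (at 1 within {0..1})"
        by (simp add: F_def)
    qed
    have "continuous_on {0..<1} F"
    proof -
      have c1: "continuous_on {0..<1} (\<lambda>x::real. x powr r)" if "r > 0" for r
        by (rule continuous_on_powr'[OF continuous_on_id continuous_on_const]) (use that in auto)
      have c2: "continuous_on {0..<1} (\<lambda>x::real. (1 - x) powr r)" for r
        by (rule continuous_on_powr'[OF continuous_on_diff[OF continuous_on_const continuous_on_id] continuous_on_const]) auto
      show ?thesis unfolding F_def
        by (intro continuous_on_divide continuous_on_add continuous_on_mult continuous_on_power continuous_on_diff c1 c2 continuous_on_const)
           (use kp in auto)
    qed
    have "(F \<longlongrightarrow> F x) (at x within {0..1})" if "x \<in> {0..<1}" for x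
    proof -
      have "at x within {0..<1} = at x within {0..1}"
        using that by (intro at_within_nhd[where S="{..<1}"]) auto
      moreover have "(F \<longlongrightarrow> F x) (at x within {0..<1})"
        using \<open>continuous_on {0..<1} F\<close> that unfolding continuous_on_def by blast
      ultimately show ?thesis by metis
    qed
    note lt = this
    show ?thesis unfolding continuous_on_def
    proof
      fix x :: real assume "x \<in> {0..1}"
      then consider "x = 1" | "x \<in> {0..<1}" by fastforce
      then show "(F \<longlongrightarrow> F x) (at x within {0..1})" using sq lt by cases blast+
    qed
  qed
  have "((\<lambda>x. f x - c * (x powr (\<kappa> - 1) * (1 - x) powr (- 2 * \<kappa>))) has_integral (F 1 - F 0)) {0..1}"
    by (rule fundamental_theorem_of_calculus_interior[OF _ cont]) (use d in \<open>auto simp: has_real_derivative_iff_has_vector_derivative[symmetric]\<close>)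
  moreover have "((\<lambda>x. x powr (\<kappa> - 1) * (1 - x) powr ((1 - 2 * \<kappa>) - 1)) has_integral Beta \<kappa> (1 - 2 * \<kappa>)) {0..1}"
    using kp kh by (intro has_integral_Beta_real) auto
  then have "((\<lambda>x. c * (x powr (\<kappa> - 1) * (1 - x) powr (- 2 * \<kappa>))) has_integral (c * Beta \<kappa> (1 - 2 * \<kappa>))) {0..1}"
    by (intro has_integral_mult_right) simp
  ultimately have "((\<lambda>x. (f x - c * (x powr (\<kappa> - 1) * (1 - x) powr (- 2 * \<kappa>))) + c * (x powr (\<kappa> - 1) * (1 - x) powr (- 2 * \<kappa>))) has_integral (F 1 - F 0) + c * Beta \<kappa> (1 - 2 * \<kappa>)) {0..1}"
    by (rule has_integral_add)
  moreover have "c * Beta \<kappa> (1 - 2 * \<kappa>) = Beta (\<kappa> + 1) (\<kappa> + 1) / cos (pi * \<kappa>)"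
    unfolding c_def using Beta_half_line kp by (simp add: divide_simps)
  moreover have "F 1 = 0" "F 0 = 1 / (2 * \<kappa> + 1)" using kp by (auto simp: F_def)
  ultimately show ?thesis by (simp add: f_def[abs_def])
qed


text \<open>Substituting \<open>s = x / (1 - x)\<close>: homogeneity contributes the exponent
  \<open>- 2 * \<kappa>\<close> of \<open>1 - x\<close> and the Jacobian the remaining
  \<open>- 2\<close>, which together give the integrand on the unit interval.\<close>

lemma half_line_nn_integral:
  "(\<integral>\<^sup>+s. ennreal (((1 + s) powr \<kappa> - s powr \<kappa>)\<^sup>2 * indicator {0<..} s) \<partial>lborel) =
     ennreal (Beta (\<kappa> + 1) (\<kappa> + 1) / cos (pi * \<kappa>) - 1 / (2 * \<kappa> + 1))"
proof -
  define J where "J = Beta (\<kappa> + 1) (\<kappa> + 1) / cos (pi * \<kappa>) - 1 / (2 * \<kappa> + 1)"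
  define f where "f s = ((1 + s) powr \<kappa> - s powr \<kappa>)\<^sup>2" for s :: real
  define g where "g x = x / (1 - x)" for x :: real
  have inj: "inj_on g {0<..<1}"
    by (auto simp: inj_on_def g_def divide_simps algebra_simps)
  have der: "(g has_field_derivative 1 / (1 - x)\<^sup>2) (at x within {0<..<1})" if "x \<in> {0<..<1}" for x
    unfolding g_def using that by (auto intro!: derivative_eq_intros simp: divide_simps power2_eq_square)
  have img: "g ` {0<..<1} = {0<..}"
  proof
    show "g ` {0<..<1} \<subseteq> {0<..}" by (auto simp: g_def)
    show "{0<..} \<subseteq> g ` {0<..<1}"
    proof
      fix s :: real assume "s \<in> {0<..}"
      then show "s \<in> g ` {0<..<1}"
        by (intro image_eqI[of _ _ "s / (1 + s)"]) (auto simp: g_def field_simps)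
    qed
  qed
  have e: "\<bar>1 / (1 - x)\<^sup>2\<bar> * f (g x) = (1 - x powr \<kappa>)\<^sup>2 * (1 - x) powr (- 2 * \<kappa> - 2)" if "x \<in> {0<..<1}" for x
  proof -
    have x: "0 < x" "x < 1" using that by auto
    define y where "y = (1 - x) powr \<kappa>"
    have y0: "y > 0" using x by (simp add: y_def)
    have "1 + g x = 1 / (1 - x)" using x by (simp add: g_def field_simps)
    then have "(1 + g x) powr \<kappa> = 1 / y" "(g x) powr \<kappa> = x powr \<kappa> / y"
      using x by (simp_all add: powr_divide y_def g_def)
    then have 1: "f (g x) = (1 - x powr \<kappa>)\<^sup>2 / y\<^sup>2"
      by (simp add: f_def diff_divide_distrib[symmetric] power_divide)
    have "(1 - x) powr (- 2 * \<kappa> - 2) = 1 / (1 - x) powr (2 * \<kappa> + 2)"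
      using powr_minus_divide[of "1 - x" "2 * \<kappa> + 2"] by simp
    also have "(1 - x) powr (2 * \<kappa> + 2) = y\<^sup>2 * (1 - x)\<^sup>2"
      using x powr_add[of "1 - x" \<kappa> \<kappa>] powr_add[of "1 - x" "2 * \<kappa>" 2] by (simp add: y_def power2_eq_square)
    finally show ?thesis unfolding 1 by (simp add: field_simps)
  qed
  have hi: "((\<lambda>x. \<bar>1 / (1 - x)\<^sup>2\<bar> * f (g x)) has_integral J) {0<..<1}"
    using unit_interval_integral unfolding J_def[symmetric] has_integral_Icc_iff_Ioo
    by (rule has_integral_eq[rotated]) (use e in auto)
  have "(\<lambda>x. \<bar>1 / (1 - x)\<^sup>2\<bar> * f (g x)) absolutely_integrable_on {0<..<1} \<and> integral {0<..<1} (\<lambda>x. \<bar>1 / (1 - x)\<^sup>2\<bar> * f (g x)) = J"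
    using hi by (intro conjI nonnegative_absolutely_integrable_1 integral_unique) (auto simp: f_def)
  then have "f absolutely_integrable_on {0<..} \<and> integral {0<..} f = J"
    using has_absolute_integral_change_of_variables_1'[OF _ der inj, of f J] img by simp
  then have "(f has_integral J) {0<..}"
    using set_lebesgue_integral_eq_integral(1) integrable_integral by blast
  then have "((\<lambda>s. f s * indicator {0<..} s) has_integral J) UNIV"
    by (rule has_integral_indicator_mult)
  then show ?thesis unfolding J_def[symmetric] f_def
    by (intro nn_integral_has_integral_lborel) auto
qed

text \<open>Expanding the square gives two elementary power integrals and, as the mixed term, the
  Beta integral with both parameters \<open>\<kappa> + 1\<close>.\<close>

lemma middle_has_integral:
  "((\<lambda>x. (x powr \<kappa> - (1 - x) powr \<kappa>)\<^sup>2) has_integral 2 / (2 * \<kappa> + 1) - 2 * Beta (\<kappa> + 1) (\<kappa> + 1)) {0<..<1}"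
proof -
  have 1: "((\<lambda>x::real. x powr (2 * \<kappa>)) has_integral (1 / (2 * \<kappa> + 1))) {0..1}"
    using has_integral_powr_from_0[of "2 * \<kappa>" 1] kp by simp
  have "((\<lambda>x::real. (1 - x) powr (2 * \<kappa>)) has_integral (- ((1 - 1) powr (2 * \<kappa> + 1)) / (2 * \<kappa> + 1) - (- ((1 - 0) powr (2 * \<kappa> + 1)) / (2 * \<kappa> + 1)))) {0..1}"
  proof (rule fundamental_theorem_of_calculus_interior)
    show "continuous_on {0..1} (\<lambda>x::real. - ((1 - x) powr (2 * \<kappa> + 1)) / (2 * \<kappa> + 1))"
      using kp by (intro continuous_intros continuous_on_powr') auto
    fix x :: real assume x: "x \<in> {0<..<1}"
    have m: "((\<lambda>x::real. 1 - x) has_real_derivative - 1) (at x)" by (auto intro!: derivative_eq_intros)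
    have "((\<lambda>x. - ((1 - x) powr (2 * \<kappa> + 1)) / (2 * \<kappa> + 1)) has_real_derivative
        - ((2 * \<kappa> + 1) * (1 - x) powr (2 * \<kappa> + 1 - 1) * - 1) / (2 * \<kappa> + 1)) (at x)"
      by (rule DERIV_cdivide[OF DERIV_minus[OF DERIV_chain2[OF has_real_derivative_powr m]]]) (use x in auto)
    then show "((\<lambda>x. - ((1 - x) powr (2 * \<kappa> + 1)) / (2 * \<kappa> + 1)) has_vector_derivative (1 - x) powr (2 * \<kappa>)) (at x)"
      using kp by (simp add: has_real_derivative_iff_has_vector_derivative)
  qed simp
  then have 2: "((\<lambda>x::real. (1 - x) powr (2 * \<kappa>)) has_integral (1 / (2 * \<kappa> + 1))) {0..1}" by simp
  have 3: "((\<lambda>x. x powr (\<kappa> + 1 - 1) * (1 - x) powr (\<kappa> + 1 - 1)) has_integral Beta (\<kappa> + 1) (\<kappa> + 1)) {0..1}"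
    using kp by (intro has_integral_Beta_real) auto
  have "((\<lambda>x. (x powr (2 * \<kappa>) + (1 - x) powr (2 * \<kappa>)) - 2 * (x powr (\<kappa> + 1 - 1) * (1 - x) powr (\<kappa> + 1 - 1))) has_integral
      (1 / (2 * \<kappa> + 1) + 1 / (2 * \<kappa> + 1)) - 2 * Beta (\<kappa> + 1) (\<kappa> + 1)) {0..1}"
    by (intro has_integral_diff has_integral_add has_integral_mult_right 1 2 3)
  then show ?thesis
    unfolding has_integral_Icc_iff_Ioo
    by (rule has_integral_eq_rhs[OF has_integral_eq[rotated]])
       (use powr_add[of _ \<kappa> \<kappa>] in \<open>auto simp: power2_eq_square algebra_simps\<close>)
qed

lemma middle_nn_integral:
  "(\<integral>\<^sup>+s. ennreal ((s powr \<kappa> - (1 - s) powr \<kappa>)\<^sup>2 * indicator {0<..<1} s) \<partial>lborel) =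
     ennreal (2 / (2 * \<kappa> + 1) - 2 * Beta (\<kappa> + 1) (\<kappa> + 1))"
proof -
  note middle_has_integral
  then have "((\<lambda>s. (s powr \<kappa> - (1 - s) powr \<kappa>)\<^sup>2 * indicator {0<..<1} s) has_integral 2 / (2 * \<kappa> + 1) - 2 * Beta (\<kappa> + 1) (\<kappa> + 1)) UNIV"
    by (rule has_integral_indicator_mult)
  then show ?thesis
    by (intro nn_integral_has_integral_lborel) auto
qed

text \<open>The line splits at 0 and 1. Both outer pieces are copies of the half-line integral, by
  translation and by reflection; the terms with \<open>1 / (2 * \<kappa> + 1)\<close> from the outer
  and middle pieces cancel.\<close>

lemma cusp_unit_nn_integral:
  "(\<integral>\<^sup>+s. ennreal ((\<bar>s - 1\<bar> powr \<kappa> - \<bar>s\<bar> powr \<kappa>)\<^sup>2) \<partial>lborel) = ennreal (cusp_const \<kappa>)"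
proof -
  define J where "J = Beta (\<kappa> + 1) (\<kappa> + 1) / cos (pi * \<kappa>) - 1 / (2 * \<kappa> + 1)"
  define m where "m = 2 / (2 * \<kappa> + 1) - 2 * Beta (\<kappa> + 1) (\<kappa> + 1)"
  define K where "K s = (\<bar>s - 1\<bar> powr \<kappa> - \<bar>s\<bar> powr \<kappa>)\<^sup>2" for s :: real
  have [measurable]: "K \<in> borel_measurable borel" unfolding K_def by measurable
  have J0: "J \<ge> 0"
    using has_integral_nonneg[OF unit_interval_integral] by (auto simp: J_def)
  have m0: "m \<ge> 0"
    using has_integral_nonneg[OF middle_has_integral] by (auto simp: m_def)
  have r: "(\<integral>\<^sup>+s. ennreal (K s * indicator {1<..} s) \<partial>lborel) = ennreal J"
    unfolding J_def half_line_nn_integral[symmetric]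
    by (subst nn_integral_real_affine[where t=1 and c=1]) (auto simp: K_def indicator_def power2_commute intro!: nn_integral_cong)
  have l: "(\<integral>\<^sup>+s. ennreal (K s * indicator {..<0} s) \<partial>lborel) = ennreal J"
    unfolding J_def half_line_nn_integral[symmetric]
    by (subst nn_integral_real_affine[where t=0 and c="-1"]) (auto simp: K_def indicator_def intro!: nn_integral_cong)
  have c: "(\<integral>\<^sup>+s. ennreal (K s * indicator {0<..<1} s) \<partial>lborel) = ennreal m"
    unfolding m_def middle_nn_integral[symmetric]
    by (auto simp: K_def indicator_def power2_commute intro!: nn_integral_cong)
  have "(\<integral>\<^sup>+s. ennreal (K s) \<partial>lborel) =
      (\<integral>\<^sup>+s. ennreal (K s * indicator {1<..} s) + (ennreal (K s * indicator {..<0} s) + ennreal (K s * indicator {0<..<1} s)) \<partial>lborel)"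
  proof (rule nn_integral_cong_AE)
    have "AE s in lborel. s \<noteq> (0::real)" "AE s in lborel. s \<noteq> (1::real)"
      by (rule AE_lborel_singleton)+
    then show "AE s in lborel. ennreal (K s) = ennreal (K s * indicator {1<..} s) + (ennreal (K s * indicator {..<0} s) + ennreal (K s * indicator {0<..<1} s))"
      by eventually_elim (auto simp: indicator_def)
  qed
  also have "\<dots> = ennreal J + (ennreal J + ennreal m)"
    by (simp add: nn_integral_add r l c)
  also have "\<dots> = ennreal (J + (J + m))" using J0 m0 by (simp add: ennreal_plus[symmetric] del: ennreal_plus)
  also have "J + (J + m) = cusp_const \<kappa>" unfolding J_def m_def cusp_const_def by (simp add: algebra_simps)
  finally show ?thesis by (simp add: K_def)
qed


lemma cusp_const_pos: "cusp_const \<kappa> > 0"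
proof -
  have "pi * \<kappa> < pi * (1/2)" using kh by (intro mult_strict_left_mono) auto
  then have "0 < pi * \<kappa>" "pi * \<kappa> < pi / 2" using kp by auto
  then have "0 < cos (pi * \<kappa>)" "cos (pi * \<kappa>) < cos 0"
    by (auto intro!: cos_gt_zero cos_monotone_0_pi simp del: cos_zero)
  then have "1 / cos (pi * \<kappa>) > 1" by simp
  moreover have "Beta (\<kappa> + 1) (\<kappa> + 1) > 0"
    using kp by (auto simp: Beta_def intro!: divide_pos_pos mult_pos_pos Gamma_real_pos)
  ultimately show ?thesis by (simp add: cusp_const_def)
qed

text \<open>Translation and scaling to a unit gap: the squared difference contributes the exponent
  \<open>2 * \<kappa>\<close>, the Jacobian the remaining 1. The sum \<open>2 * \<kappa> + 1\<close>
  is twice the Hurst parameter.\<close>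

lemma cusp_nn_integral:
  "(\<integral>\<^sup>+s. ennreal ((\<bar>s - v\<bar> powr \<kappa> - \<bar>s - w\<bar> powr \<kappa>)\<^sup>2) \<partial>lborel) = ennreal (\<bar>v - w\<bar> powr (2 * \<kappa> + 1) * cusp_const \<kappa>)"
proof (cases "v = w")
  case False
  define d where "d = \<bar>v - w\<bar>"
  have d: "d > 0" using False by (simp add: d_def)
  have e: "(\<bar>(w + (v - w) * x) - v\<bar> powr \<kappa> - \<bar>(w + (v - w) * x) - w\<bar> powr \<kappa>)\<^sup>2 = d powr (2 * \<kappa>) * (\<bar>x - 1\<bar> powr \<kappa> - \<bar>x\<bar> powr \<kappa>)\<^sup>2" for x
  proof -
    have "(w + (v - w) * x) - v = (v - w) * (x - 1)" "(w + (v - w) * x) - w = (v - w) * x" by (auto simp: algebra_simps)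
    then have "\<bar>(w + (v - w) * x) - v\<bar> powr \<kappa> = d powr \<kappa> * \<bar>x - 1\<bar> powr \<kappa>" "\<bar>(w + (v - w) * x) - w\<bar> powr \<kappa> = d powr \<kappa> * \<bar>x\<bar> powr \<kappa>"
      by (simp_all add: abs_mult powr_mult d_def)
    moreover have "d powr (2 * \<kappa>) = (d powr \<kappa>)\<^sup>2" using powr_add[of d \<kappa> \<kappa>] by (simp add: power2_eq_square)
    ultimately show ?thesis by (simp add: right_diff_distrib[symmetric] power_mult_distrib)
  qed
  have "(\<integral>\<^sup>+s. ennreal ((\<bar>s - v\<bar> powr \<kappa> - \<bar>s - w\<bar> powr \<kappa>)\<^sup>2) \<partial>lborel)
     = ennreal \<bar>v - w\<bar> * (\<integral>\<^sup>+x. ennreal ((\<bar>(w + (v - w) * x) - v\<bar> powr \<kappa> - \<bar>(w + (v - w) * x) - w\<bar> powr \<kappa>)\<^sup>2) \<partial>lborel)"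
  proof (rule nn_integral_real_affine)
    show "(\<lambda>s. ennreal ((\<bar>s - v\<bar> powr \<kappa> - \<bar>s - w\<bar> powr \<kappa>)\<^sup>2)) \<in> borel_measurable borel" by measurable
    show "v - w \<noteq> 0" using False by simp
  qed
  also have "\<dots> = ennreal d * (\<integral>\<^sup>+x. ennreal (d powr (2 * \<kappa>)) * ennreal ((\<bar>x - 1\<bar> powr \<kappa> - \<bar>x\<bar> powr \<kappa>)\<^sup>2) \<partial>lborel)"
    unfolding e d_def[symmetric] by (simp only: ennreal_mult powr_ge_zero zero_le_power2)
  also have "\<dots> = ennreal d * (ennreal (d powr (2 * \<kappa>)) * ennreal (cusp_const \<kappa>))"
    by (subst nn_integral_cmult) (simp_all add: cusp_unit_nn_integral)
  also have "\<dots> = ennreal (d * (d powr (2 * \<kappa>)) * cusp_const \<kappa>)"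
    using d cusp_const_pos by (simp add: ennreal_mult[symmetric] mult.assoc)
  also have "d * (d powr (2 * \<kappa>)) = d powr (2 * \<kappa> + 1)"
    using d by (simp add: powr_add)
  finally show ?thesis by (simp add: d_def)
next
  case True
  show ?thesis unfolding True by simp
qed

lemma cusp_integrable: "integrable lborel (\<lambda>s. (\<bar>s - v\<bar> powr \<kappa> - \<bar>s - w\<bar> powr \<kappa>)\<^sup>2)"
  and cusp_integral: "(LBINT s. (\<bar>s - v\<bar> powr \<kappa> - \<bar>s - w\<bar> powr \<kappa>)\<^sup>2) = \<bar>v - w\<bar> powr (2 * \<kappa> + 1) * cusp_const \<kappa>"
proof -
  show i: "integrable lborel (\<lambda>s. (\<bar>s - v\<bar> powr \<kappa> - \<bar>s - w\<bar> powr \<kappa>)\<^sup>2)"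
    by (intro integrableI_nn_integral_finite[OF _ _ cusp_nn_integral]) (use cusp_const_pos in auto)
  show "(LBINT s. (\<bar>s - v\<bar> powr \<kappa> - \<bar>s - w\<bar> powr \<kappa>)\<^sup>2) = \<bar>v - w\<bar> powr (2 * \<kappa> + 1) * cusp_const \<kappa>"
    by (subst integral_eq_nn_integral) (use cusp_const_pos in \<open>auto simp: cusp_nn_integral\<close>)
qed

text \<open>Polarisation of \<open>cusp_integral\<close>. The right-hand side is
  \<open>cusp_const\<close> times the covariance of fractional Brownian motion; this is how the
  limit process is recognised.\<close>

lemma cusp_cross_integrable:
  "integrable lborel (\<lambda>s. (\<bar>s - v\<bar> powr \<kappa> - \<bar>s\<bar> powr \<kappa>) * (\<bar>s - w\<bar> powr \<kappa> - \<bar>s\<bar> powr \<kappa>))"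
  and cusp_cross_integral: "(LBINT s. (\<bar>s - v\<bar> powr \<kappa> - \<bar>s\<bar> powr \<kappa>) * (\<bar>s - w\<bar> powr \<kappa> - \<bar>s\<bar> powr \<kappa>))
     = (\<bar>v\<bar> powr (2 * \<kappa> + 1) + \<bar>w\<bar> powr (2 * \<kappa> + 1) - \<bar>v - w\<bar> powr (2 * \<kappa> + 1)) / 2 * cusp_const \<kappa>"
proof -
  have e: "(\<bar>s - v\<bar> powr \<kappa> - \<bar>s\<bar> powr \<kappa>) * (\<bar>s - w\<bar> powr \<kappa> - \<bar>s\<bar> powr \<kappa>) =
     ((\<bar>s - v\<bar> powr \<kappa> - \<bar>s - 0\<bar> powr \<kappa>)\<^sup>2 + (\<bar>s - w\<bar> powr \<kappa> - \<bar>s - 0\<bar> powr \<kappa>)\<^sup>2 - (\<bar>s - v\<bar> powr \<kappa> - \<bar>s - w\<bar> powr \<kappa>)\<^sup>2) / 2" for s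
    by (simp add: power2_eq_square field_simps)
  note i = cusp_integrable[of v 0] cusp_integrable[of w 0] cusp_integrable[of v w]
  note S = Bochner_Integration.integrable_diff[OF Bochner_Integration.integrable_add[OF i(1) i(2)] i(3)]
  show "integrable lborel (\<lambda>s. (\<bar>s - v\<bar> powr \<kappa> - \<bar>s\<bar> powr \<kappa>) * (\<bar>s - w\<bar> powr \<kappa> - \<bar>s\<bar> powr \<kappa>))"
    unfolding e by (rule integrable_divide) (rule S)
  show "(LBINT s. (\<bar>s - v\<bar> powr \<kappa> - \<bar>s\<bar> powr \<kappa>) * (\<bar>s - w\<bar> powr \<kappa> - \<bar>s\<bar> powr \<kappa>))
     = (\<bar>v\<bar> powr (2 * \<kappa> + 1) + \<bar>w\<bar> powr (2 * \<kappa> + 1) - \<bar>v - w\<bar> powr (2 * \<kappa> + 1)) / 2 * cusp_const \<kappa>"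
    unfolding e integral_divide_zero Bochner_Integration.integral_diff[OF Bochner_Integration.integrable_add[OF i(1) i(2)] i(3)]
      Bochner_Integration.integral_add[OF i(1) i(2)] cusp_integral by (simp add: algebra_simps)
qed

end

section \<open>Convergence in law through characteristic functions\<close>

lemma iexp_diff_le: "cmod (iexp x - iexp y) \<le> min 2 \<bar>x - y\<bar>"
proof -
  have "cmod (iexp x - iexp y) = cmod (iexp y * (iexp (x - y) - 1))"
    by (simp add: algebra_simps flip: exp_add)
  also have "\<dots> = cmod (iexp (x - y) - 1)"
    by (simp add: norm_mult)
  also have "\<dots> \<le> \<bar>x - y\<bar>"
    using iexp_approx1[of "x - y" 0] by simp
  finally have "cmod (iexp x - iexp y) \<le> \<bar>x - y\<bar>" .
  moreover have "cmod (iexp x - iexp y) \<le> 2"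
    using norm_triangle_ineq4[of "iexp x" "iexp y"] by simp
  ultimately show ?thesis by simp
qed

lemma norm_diff_triangle4: "cmod (x - y) \<le> cmod (x - s) + cmod (s - s') + cmod (y - s')"
  by norm

text \<open>A three-term estimate in which the approximants may depend on \<open>e\<close>.
  Closeness is measured by the mean of the truncated error, because the Riemann sums are close to
  the integrals in probability only.\<close>

lemma char_approx_conv:
  fixes M :: "nat \<Rightarrow> 'a measure" and N :: "'b measure"
  assumes M: "\<And>n. prob_space (M n)" and N: "prob_space N"
    and T [measurable]: "\<And>n. T n \<in> borel_measurable (M n)" and T' [measurable]: "T' \<in> borel_measurable N"
    and ex: "\<And>e. 0 < e \<Longrightarrow> \<exists>S S'. (\<forall>n. S n \<in> borel_measurable (M n)) \<and> S' \<in> borel_measurable N \<and>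
        (\<forall>\<^sub>F n in sequentially. (LINT \<omega>|M n. min 1 \<bar>T n \<omega> - S n \<omega>\<bar>) \<le> e) \<and>
        (LINT \<omega>|N. min 1 \<bar>T' \<omega> - S' \<omega>\<bar>) \<le> e \<and>
        (\<lambda>n. LINT \<omega>|M n. iexp (t * S n \<omega>)) \<longlonglongrightarrow> (LINT \<omega>|N. iexp (t * S' \<omega>))"
  shows "(\<lambda>n. LINT \<omega>|M n. iexp (t * T n \<omega>)) \<longlonglongrightarrow> (LINT \<omega>|N. iexp (t * T' \<omega>))"
proof (rule LIMSEQ_I)
  \<comment> \<open>Errors beyond 1 are paid for by the trivial bound 2, smaller ones by the
    Lipschitz constant \<open>\<bar>t\<bar>\<close> of the exponential.\<close>
  have key: "cmod ((LINT \<omega>|P. iexp (t * X \<omega>)) - (LINT \<omega>|P. iexp (t * Y \<omega>))) \<le> (2 + \<bar>t\<bar>) * (LINT \<omega>|P. min 1 \<bar>X \<omega> - Y \<omega>\<bar>)"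
    if "prob_space P" and [measurable]: "X \<in> borel_measurable P" "Y \<in> borel_measurable P" for P :: "'c measure" and X Y
  proof -
    interpret prob_space P by fact
    have le: "cmod (iexp (t * X \<omega>) - iexp (t * Y \<omega>)) \<le> (2 + \<bar>t\<bar>) * min 1 \<bar>X \<omega> - Y \<omega>\<bar>" for \<omega>
    proof (cases "\<bar>X \<omega> - Y \<omega>\<bar> \<le> 1")
      case True
      have "cmod (iexp (t * X \<omega>) - iexp (t * Y \<omega>)) \<le> \<bar>t * X \<omega> - t * Y \<omega>\<bar>"
        using iexp_diff_le[of "t * X \<omega>" "t * Y \<omega>"] by simp
      also have "\<dots> = \<bar>t\<bar> * \<bar>X \<omega> - Y \<omega>\<bar>" by (simp flip: right_diff_distrib add: abs_mult)
      also have "\<dots> \<le> (2 + \<bar>t\<bar>) * \<bar>X \<omega> - Y \<omega>\<bar>" by (intro mult_right_mono) auto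
      finally show ?thesis using True by simp
    next
      case False
      then have "min 1 \<bar>X \<omega> - Y \<omega>\<bar> = 1" by simp
      then show ?thesis using iexp_diff_le[of "t * X \<omega>" "t * Y \<omega>"] by (simp only: mult_1_right)
    qed
    have i: "integrable P (\<lambda>\<omega>. iexp (t * X \<omega>))" "integrable P (\<lambda>\<omega>. iexp (t * Y \<omega>))"
      by (auto intro!: integrable_const_bound[where B=1])
    have i2: "integrable P (\<lambda>\<omega>. min 1 \<bar>X \<omega> - Y \<omega>\<bar>)"
      by (auto intro!: integrable_const_bound[where B=1])
    have "cmod ((LINT \<omega>|P. iexp (t * X \<omega>)) - (LINT \<omega>|P. iexp (t * Y \<omega>))) = cmod (LINT \<omega>|P. iexp (t * X \<omega>) - iexp (t * Y \<omega>))"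
      using i by (subst Bochner_Integration.integral_diff) auto
    also have "\<dots> \<le> (LINT \<omega>|P. cmod (iexp (t * X \<omega>) - iexp (t * Y \<omega>)))"
      by (rule integral_norm_bound)
    also have "\<dots> \<le> (LINT \<omega>|P. (2 + \<bar>t\<bar>) * min 1 \<bar>X \<omega> - Y \<omega>\<bar>)"
      by (rule integral_mono) (use i i2 le in auto)
    finally show ?thesis by simp
  qed
  fix r :: real assume r: "0 < r"
  define e where "e = r / (3 * (2 + \<bar>t\<bar>))"
  have e: "e > 0" "(2 + \<bar>t\<bar>) * e = r / 3" using r by (auto simp: e_def field_simps)
  obtain S S' where m: "\<forall>n. S n \<in> borel_measurable (M n)" "S' \<in> borel_measurable N"
    and S: "\<forall>\<^sub>F n in sequentially. (LINT \<omega>|M n. min 1 \<bar>T n \<omega> - S n \<omega>\<bar>) \<le> e"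
    and S': "(LINT \<omega>|N. min 1 \<bar>T' \<omega> - S' \<omega>\<bar>) \<le> e"
    and c: "(\<lambda>n. LINT \<omega>|M n. iexp (t * S n \<omega>)) \<longlonglongrightarrow> (LINT \<omega>|N. iexp (t * S' \<omega>))"
    using ex[OF e(1)] by blast
  note [measurable] = m(1)[rule_format] m(2)
  have "\<forall>\<^sub>F n in sequentially. dist (LINT \<omega>|M n. iexp (t * S n \<omega>)) (LINT \<omega>|N. iexp (t * S' \<omega>)) < r / 3"
    using c r by (intro tendstoD) auto
  with S have "\<forall>\<^sub>F n in sequentially. norm ((LINT \<omega>|M n. iexp (t * T n \<omega>)) - (LINT \<omega>|N. iexp (t * T' \<omega>))) < r"
  proof eventually_elim
    case (elim n)
    have "cmod ((LINT \<omega>|M n. iexp (t * T n \<omega>)) - (LINT \<omega>|M n. iexp (t * S n \<omega>))) \<le> (2 + \<bar>t\<bar>) * e"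
      by (rule order_trans[OF key mult_left_mono]) (use M elim in auto)
    moreover have "cmod ((LINT \<omega>|N. iexp (t * T' \<omega>)) - (LINT \<omega>|N. iexp (t * S' \<omega>))) \<le> (2 + \<bar>t\<bar>) * e"
      by (rule order_trans[OF key mult_left_mono]) (use N S' in auto)
    ultimately show ?case
      using elim(2) e(2) norm_diff_triangle4[of "LINT \<omega>|M n. iexp (t * T n \<omega>)" "LINT \<omega>|N. iexp (t * T' \<omega>)"
          "LINT \<omega>|M n. iexp (t * S n \<omega>)" "LINT \<omega>|N. iexp (t * S' \<omega>)"] unfolding dist_norm by linarith
  qed
  then show "\<exists>no. \<forall>n\<ge>no. norm ((LINT \<omega>|M n. iexp (t * T n \<omega>)) - (LINT \<omega>|N. iexp (t * T' \<omega>))) < r"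
    by (simp add: eventually_sequentially)
qed

text \<open>Levy continuity plus the criterion for continuity sets: the frontier of the open
  half-line is the single point 0, so it suffices that the limit has no atom there.\<close>

lemma char_conv_imp_prob_pos_conv:
  fixes M :: "nat \<Rightarrow> 'a measure" and N :: "'b measure"
  assumes M: "\<And>n. prob_space (M n)" and N: "prob_space N"
    and T [measurable]: "\<And>n. T n \<in> borel_measurable (M n)" and T' [measurable]: "T' \<in> borel_measurable N"
    and conv: "\<And>t. (\<lambda>n. LINT \<omega>|M n. iexp (t * T n \<omega>)) \<longlonglongrightarrow> (LINT \<omega>|N. iexp (t * T' \<omega>))"
    and null: "measure N {\<omega>\<in>space N. T' \<omega> = 0} = 0"
  shows "(\<lambda>n. measure (M n) {\<omega>\<in>space (M n). T n \<omega> > 0}) \<longlonglongrightarrow> measure N {\<omega>\<in>space N. T' \<omega> > 0}"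
proof -
  interpret N: prob_space N by fact
  have rd: "real_distribution (distr (M n) borel (T n))" for n
    using prob_space.real_distribution_distr[OF M T] .
  have rd': "real_distribution (distr N borel T')"
    using prob_space.real_distribution_distr[OF N T'] .
  have w: "weak_conv_m (\<lambda>n. distr (M n) borel (T n)) (distr N borel T')"
    by (rule levy_continuity[OF rd rd']) (simp add: char_def integral_distr conv del: of_real_mult)
  have "(\<lambda>n. measure (distr (M n) borel (T n)) {0<..}) \<longlonglongrightarrow> measure (distr N borel T') {0<..}"
  proof (rule weak_conv_imp_continuity_set_conv[OF rd rd' w])
    have m0: "measure (distr N borel T') {0} = measure N {\<omega>\<in>space N. T' \<omega> = 0}"
      by (subst measure_distr) (auto intro!: arg_cong[where f="measure N"])
    have ray: "{0..} - {0<..} = {0::real}" by auto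
    have "measure (distr N borel T') (frontier {0<..}) = 0"
      using null m0 by (simp add: frontier_def interior_open ray)
    then show "emeasure (distr N borel T') (frontier {0<..}) = 0"
      using finite_measure.emeasure_eq_measure[OF prob_space.finite_measure[OF real_distribution.axioms(1)[OF rd']]] by simp
  qed auto
  moreover have "measure (distr (M n) borel (T n)) {0<..} = measure (M n) {\<omega>\<in>space (M n). T n \<omega> > 0}" for n
    by (subst measure_distr) (auto intro!: arg_cong[where f="measure (M n)"])
  moreover have "measure (distr N borel T') {0<..} = measure N {\<omega>\<in>space N. T' \<omega> > 0}"
    by (subst measure_distr) (auto intro!: arg_cong[where f="measure N"])
  ultimately show ?thesis by simp
qed

definition tilted_law :: "'a measure \<Rightarrow> ('a \<Rightarrow> real) \<Rightarrow> ('a \<Rightarrow> real) \<Rightarrow> real measure" where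
  "tilted_law P D X = distr (density P (\<lambda>\<omega>. ennreal (D \<omega> / (LINT \<omega>|P. D \<omega>)))) borel X"

text \<open>Levy's continuity theorem applies to the laws of \<open>X n\<close> under the normalised densities \<open>D n\<close>.\<close>

lemma density_iexp_conv:
  fixes M :: "nat \<Rightarrow> 'a measure" and N :: "'b measure" and g :: "real \<Rightarrow> complex"
  assumes M: "\<And>n. prob_space (M n)" and N: "prob_space N"
    and X [measurable]: "\<And>n. X n \<in> borel_measurable (M n)" and X' [measurable]: "X' \<in> borel_measurable N"
    and D [measurable]: "\<And>n. D n \<in> borel_measurable (M n)" and D' [measurable]: "D' \<in> borel_measurable N"
    and D1: "\<And>n \<omega>. 1 \<le> D n \<omega>" "\<And>n \<omega>. D n \<omega> \<le> K" and D'1: "\<And>\<omega>. 1 \<le> D' \<omega>" "\<And>\<omega>. D' \<omega> \<le> K"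
    and conv: "\<And>t. (\<lambda>n. LINT \<omega>|M n. of_real (D n \<omega>) * iexp (t * X n \<omega>)) \<longlonglongrightarrow> (LINT \<omega>|N. of_real (D' \<omega>) * iexp (t * X' \<omega>))"
    and g: "\<And>x. isCont g x" "\<And>x. norm (g x) \<le> B"
  shows "(\<lambda>n. LINT \<omega>|M n. of_real (D n \<omega>) * g (X n \<omega>)) \<longlonglongrightarrow> (LINT \<omega>|N. of_real (D' \<omega>) * g (X' \<omega>))"
proof -
  have gm [measurable]: "g \<in> borel_measurable borel"
    using g(1) by (intro borel_measurable_continuous_onI) (simp add: continuous_at_imp_continuous_on)
  have c1: "(LINT \<omega>|P. D \<omega>) \<ge> 1" and rdQ: "real_distribution (tilted_law P D X)"
    and intQ: "\<And>f :: real \<Rightarrow> complex. f \<in> borel_measurable borel \<Longrightarrow> (LINT x|tilted_law P D X. f x) = (LINT \<omega>|P. of_real (D \<omega>) * f (X \<omega>)) / of_real (LINT \<omega>|P. D \<omega>)"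
    if "prob_space P" and [measurable]: "D \<in> borel_measurable P" "X \<in> borel_measurable P"
      and D1: "\<And>\<omega>. 1 \<le> D \<omega>" "\<And>\<omega>. D \<omega> \<le> K" for P :: "'c measure" and D X :: "'c \<Rightarrow> real"
  proof -
    interpret prob_space P by fact
    have D0: "D \<omega> \<ge> 0" for \<omega> using D1(1)[of \<omega>] by simp
    have i: "integrable P D" using D1(2) D0 by (intro integrable_const_bound[where B=K]) auto
    have "(LINT \<omega>|P. 1) \<le> (LINT \<omega>|P. D \<omega>)" by (rule integral_mono) (use i D1 in auto)
    then show c: "(LINT \<omega>|P. D \<omega>) \<ge> 1" by (simp add: prob_space)
    then have c0: "(LINT \<omega>|P. D \<omega>) > 0" by simp
    have "prob_space (density P (\<lambda>\<omega>. ennreal (D \<omega> / (LINT \<omega>|P. D \<omega>))))"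
    proof (rule prob_spaceI)
      have "emeasure (density P (\<lambda>\<omega>. ennreal (D \<omega> / (LINT \<omega>|P. D \<omega>)))) (space P) = (\<integral>\<^sup>+\<omega>. ennreal (D \<omega> / (LINT \<omega>|P. D \<omega>)) \<partial>P)"
        by (simp add: emeasure_density cong: nn_integral_cong)
      also have "\<dots> = ennreal (LINT \<omega>|P. D \<omega> / (LINT \<omega>|P. D \<omega>))"
        using i c0 D0 by (intro nn_integral_eq_integral) auto
      also have "\<dots> = 1" using c0 by simp
      finally show "emeasure (density P (\<lambda>\<omega>. ennreal (D \<omega> / (LINT \<omega>|P. D \<omega>)))) (space (density P (\<lambda>\<omega>. ennreal (D \<omega> / (LINT \<omega>|P. D \<omega>))))) = 1"
        by simp
    qed
    then show "real_distribution (tilted_law P D X)"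
      unfolding tilted_law_def by (rule prob_space.real_distribution_distr) simp
    fix f :: "real \<Rightarrow> complex" assume [measurable]: "f \<in> borel_measurable borel"
    have "(LINT x|tilted_law P D X. f x) = (LINT \<omega>|P. (D \<omega> / (LINT \<omega>|P. D \<omega>)) *\<^sub>R f (X \<omega>))"
      unfolding tilted_law_def using c0 D0 by (simp add: integral_distr integral_density)
    also have "\<dots> = (LINT \<omega>|P. (of_real (D \<omega>) * f (X \<omega>)) / of_real (LINT \<omega>|P. D \<omega>))"
      by (intro Bochner_Integration.integral_cong) (auto simp: scaleR_conv_of_real)
    finally show "(LINT x|tilted_law P D X. f x) = (LINT \<omega>|P. of_real (D \<omega>) * f (X \<omega>)) / of_real (LINT \<omega>|P. D \<omega>)"
      by simp
  qed
  note Qn = c1[OF M D X D1] rdQ[OF M D X D1] intQ[OF M D X D1]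
  note QN = c1[OF N D' X' D'1] rdQ[OF N D' X' D'1] intQ[OF N D' X' D'1]
  \<comment> \<open>At \<open>t = 0\<close> the hypothesis gives convergence of the normalising
    constants. They are at least 1, so dividing by them and multiplying back is harmless.\<close>
  have "(\<lambda>n. (LINT \<omega>|M n. complex_of_real (D n \<omega>))) \<longlonglongrightarrow> (LINT \<omega>|N. complex_of_real (D' \<omega>))"
    using conv[of 0] by simp
  then have cc: "(\<lambda>n. complex_of_real (LINT \<omega>|M n. D n \<omega>)) \<longlonglongrightarrow> complex_of_real (LINT \<omega>|N. D' \<omega>)"
    by simp
  have w: "weak_conv_m (\<lambda>n. tilted_law (M n) (D n) (X n)) (tilted_law N D' X')"
  proof (rule levy_continuity[OF Qn(2) QN(2)])
    fix t
    have "(\<lambda>n. (LINT \<omega>|M n. of_real (D n \<omega>) * iexp (t * X n \<omega>)) / of_real (LINT \<omega>|M n. D n \<omega>))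
        \<longlonglongrightarrow> (LINT \<omega>|N. of_real (D' \<omega>) * iexp (t * X' \<omega>)) / of_real (LINT \<omega>|N. D' \<omega>)"
      using conv cc QN(1) by (intro tendsto_divide) auto
    then show "(\<lambda>n. char (tilted_law (M n) (D n) (X n)) t) \<longlonglongrightarrow> char (tilted_law N D' X') t"
      unfolding char_def by (subst Qn(3), simp, subst QN(3), simp, simp)
  qed
  have "(\<lambda>n. integral\<^sup>L (tilted_law (M n) (D n) (X n)) g) \<longlonglongrightarrow> integral\<^sup>L (tilted_law N D' X') g"
    by (rule weak_conv_imp_integral_bdd_continuous_conv[OF Qn(2) QN(2) w g])
  then have "(\<lambda>n. (LINT \<omega>|M n. of_real (D n \<omega>) * g (X n \<omega>)) / of_real (LINT \<omega>|M n. D n \<omega>))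
        \<longlonglongrightarrow> (LINT \<omega>|N. of_real (D' \<omega>) * g (X' \<omega>)) / of_real (LINT \<omega>|N. D' \<omega>)"
    by (simp add: Qn(3)[OF gm] QN(3)[OF gm])
  moreover have "(LINT \<omega>|M n. D n \<omega>) \<noteq> 0" "(LINT \<omega>|N. D' \<omega>) \<noteq> 0" for n
    using Qn(1)[of n] QN(1) by auto
  ultimately show ?thesis
    using tendsto_mult[OF _ cc] by fastforce
qed

text \<open>\<open>Re (Y n)\<close> becomes an admissible density after adding \<open>2\<close>.\<close>

lemma weighted_iexp_conv_Re:
  fixes M :: "nat \<Rightarrow> 'a measure" and N :: "'b measure" and g :: "real \<Rightarrow> complex"
  assumes M: "\<And>n. prob_space (M n)" and N: "prob_space N"
    and X [measurable]: "\<And>n. X n \<in> borel_measurable (M n)" and X' [measurable]: "X' \<in> borel_measurable N"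
    and Y [measurable]: "\<And>n. Y n \<in> borel_measurable (M n)" and Y' [measurable]: "Y' \<in> borel_measurable N"
    and Yb: "\<And>n \<omega>. cmod (Y n \<omega>) \<le> 1" "\<And>\<omega>. cmod (Y' \<omega>) \<le> 1"
    and conv0: "\<And>t. (\<lambda>n. LINT \<omega>|M n. iexp (t * X n \<omega>)) \<longlonglongrightarrow> (LINT \<omega>|N. iexp (t * X' \<omega>))"
    and conv: "\<And>t. (\<lambda>n. LINT \<omega>|M n. Y n \<omega> * iexp (t * X n \<omega>)) \<longlonglongrightarrow> (LINT \<omega>|N. Y' \<omega> * iexp (t * X' \<omega>))"
    and g: "\<And>x. isCont g x" "\<And>x. norm (g x) \<le> B"
  shows "(\<lambda>n. LINT \<omega>|M n. of_real (Re (Y n \<omega>)) * g (X n \<omega>)) \<longlonglongrightarrow> (LINT \<omega>|N. of_real (Re (Y' \<omega>)) * g (X' \<omega>))"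
proof -
  have gm [measurable]: "g \<in> borel_measurable borel"
    using g(1) by (intro borel_measurable_continuous_onI) (simp add: continuous_at_imp_continuous_on)
  have iY: "integrable P (\<lambda>\<omega>. Y \<omega> * f (X \<omega>))" if "prob_space P" and [measurable]: "Y \<in> borel_measurable P" "X \<in> borel_measurable P"
    "f \<in> borel_measurable borel" and "\<And>\<omega>. cmod (Y \<omega>) \<le> 1" "\<And>x. cmod (f x) \<le> K"
    for P :: "'c measure" and X and Y :: "'c \<Rightarrow> complex" and f :: "real \<Rightarrow> complex" and K
  proof -
    interpret prob_space P by fact
    have "cmod (Y \<omega> * f (X \<omega>)) \<le> 1 * K" for \<omega>
      unfolding norm_mult using that by (intro mult_mono) auto
    then show ?thesis by (intro integrable_const_bound[where B=K]) auto
  qed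
  \<comment> \<open>The transform at \<open>t\<close> alone mixes real and imaginary parts of
    \<open>Y\<close>. Conjugating the transform at \<open>- t\<close> turns \<open>Y\<close> into
    its conjugate and leaves \<open>iexp (t * X \<omega>)\<close> unchanged, so the average isolates
    the real part.\<close>
  have split: "(LINT \<omega>|P. of_real (Re (Y \<omega>)) * iexp (t * X \<omega>)) =
     ((LINT \<omega>|P. Y \<omega> * iexp (t * X \<omega>)) + cnj (LINT \<omega>|P. Y \<omega> * iexp ((-t) * X \<omega>))) / 2"
    if P: "prob_space P" and [measurable]: "Y \<in> borel_measurable P" "X \<in> borel_measurable P"
      and b: "\<And>\<omega>. cmod (Y \<omega>) \<le> 1" for P :: "'c measure" and X and Y :: "'c \<Rightarrow> complex" and t
  proof -
    have i: "integrable P (\<lambda>\<omega>. Y \<omega> * iexp (s * X \<omega>))" for s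
      using prob_space.finite_measure[OF P]
      by (rule finite_measure.integrable_const_bound[where B=1]) (use b in \<open>auto simp: norm_mult\<close>)
    have "(LINT \<omega>|P. Y \<omega> * iexp (t * X \<omega>)) + cnj (LINT \<omega>|P. Y \<omega> * iexp ((-t) * X \<omega>))
       = (LINT \<omega>|P. Y \<omega> * iexp (t * X \<omega>) + cnj (Y \<omega> * iexp ((-t) * X \<omega>)))"
      using i[of t] i[of "-t"] by (subst Bochner_Integration.integral_add) (auto simp del: complex_cnj_mult)
    also have "\<dots> = (LINT \<omega>|P. 2 * (of_real (Re (Y \<omega>)) * iexp (t * X \<omega>)))"
    proof (intro Bochner_Integration.integral_cong refl)
      fix \<omega>
      have "cnj (iexp ((-t) * X \<omega>)) = iexp (t * X \<omega>)"
        by (simp add: exp_cnj)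
      then have "Y \<omega> * iexp (t * X \<omega>) + cnj (Y \<omega> * iexp ((-t) * X \<omega>)) = (Y \<omega> + cnj (Y \<omega>)) * iexp (t * X \<omega>)"
        by (simp only: complex_cnj_mult distrib_right)
      then show "Y \<omega> * iexp (t * X \<omega>) + cnj (Y \<omega> * iexp ((-t) * X \<omega>)) = 2 * (of_real (Re (Y \<omega>)) * iexp (t * X \<omega>))"
        by (simp add: complex_add_cnj)
    qed
    finally show ?thesis by simp
  qed
  have convRe: "(\<lambda>n. LINT \<omega>|M n. of_real (Re (Y n \<omega>)) * iexp (t * X n \<omega>)) \<longlonglongrightarrow> (LINT \<omega>|N. of_real (Re (Y' \<omega>)) * iexp (t * X' \<omega>))" for t
    unfolding split[OF M Y X Yb(1)] split[OF N Y' X' Yb(2)]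
    by (intro tendsto_intros conv) simp
  have reb: "\<bar>Re (Y n \<omega>)\<bar> \<le> 1" "\<bar>Re (Y' \<omega>')\<bar> \<le> 1" for n \<omega> \<omega>'
    using Yb(1)[of n \<omega>] Yb(2)[of \<omega>'] abs_Re_le_cmod order_trans by blast+
  have c2: "(\<lambda>n. LINT \<omega>|M n. of_real (2 + Re (Y n \<omega>)) * f (X n \<omega>)) \<longlonglongrightarrow> (LINT \<omega>|N. of_real (2 + Re (Y' \<omega>)) * f (X' \<omega>))
     \<longleftrightarrow> (\<lambda>n. 2 * (LINT \<omega>|M n. f (X n \<omega>)) + (LINT \<omega>|M n. of_real (Re (Y n \<omega>)) * f (X n \<omega>)))
        \<longlonglongrightarrow> 2 * (LINT \<omega>|N. f (X' \<omega>)) + (LINT \<omega>|N. of_real (Re (Y' \<omega>)) * f (X' \<omega>))"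
    if [measurable]: "f \<in> borel_measurable borel" and fB: "\<And>x. cmod (f x) \<le> K" for f :: "real \<Rightarrow> complex" and K
  proof -
    have e: "(LINT \<omega>|P. of_real (2 + Re (Y \<omega>)) * f (X \<omega>)) = 2 * (LINT \<omega>|P. f (X \<omega>)) + (LINT \<omega>|P. of_real (Re (Y \<omega>)) * f (X \<omega>))"
      if P: "prob_space P" and [measurable]: "Y \<in> borel_measurable P" "X \<in> borel_measurable P"
      and b: "\<And>\<omega>. \<bar>Re (Y \<omega>)\<bar> \<le> 1" for P :: "'c measure" and X and Y :: "'c \<Rightarrow> complex"
    proof -
      have 1: "integrable P (\<lambda>\<omega>. of_real (Re (Y \<omega>)) * f (X \<omega>))"
        by (rule iY[OF P]) (use b fB in auto)
      have 2: "integrable P (\<lambda>\<omega>. 1 * f (X \<omega>))"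
        by (rule iY[OF P]) (use b fB in auto)
      have "(LINT \<omega>|P. of_real (2 + Re (Y \<omega>)) * f (X \<omega>)) = (LINT \<omega>|P. 2 * f (X \<omega>) + of_real (Re (Y \<omega>)) * f (X \<omega>))"
        by (intro Bochner_Integration.integral_cong) (auto simp: algebra_simps)
      then show ?thesis using 1 2 by simp
    qed
    show ?thesis unfolding e[OF M Y X reb(1)] e[OF N Y' X' reb(2)] ..
  qed
  have "(\<lambda>n. LINT \<omega>|M n. of_real (2 + Re (Y n \<omega>)) * g (X n \<omega>)) \<longlonglongrightarrow> (LINT \<omega>|N. of_real (2 + Re (Y' \<omega>)) * g (X' \<omega>))"
  proof (rule density_iexp_conv[OF M N X X' _ _ _ _ _ _ _ g, where K=3])
    fix t
    show "(\<lambda>n. LINT \<omega>|M n. of_real (2 + Re (Y n \<omega>)) * iexp (t * X n \<omega>)) \<longlonglongrightarrow> (LINT \<omega>|N. of_real (2 + Re (Y' \<omega>)) * iexp (t * X' \<omega>))"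
      by (subst c2[of "\<lambda>x. iexp (t * x)" 1]) (auto intro!: tendsto_add tendsto_mult tendsto_const conv0 convRe simp del: of_real_mult)
  next
    show "1 \<le> 2 + Re (Y n \<omega>)" "2 + Re (Y n \<omega>) \<le> 3" for n \<omega> using reb(1)[of n \<omega>] by auto
    show "1 \<le> 2 + Re (Y' \<omega>)" "2 + Re (Y' \<omega>) \<le> 3" for \<omega> using reb(2)[of \<omega>] by auto
  qed measurable
  then have A: "(\<lambda>n. 2 * (LINT \<omega>|M n. g (X n \<omega>)) + (LINT \<omega>|M n. of_real (Re (Y n \<omega>)) * g (X n \<omega>)))
        \<longlonglongrightarrow> 2 * (LINT \<omega>|N. g (X' \<omega>)) + (LINT \<omega>|N. of_real (Re (Y' \<omega>)) * g (X' \<omega>))"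
    by (rule iffD1[OF c2[OF gm g(2)]])
  have "(\<lambda>n. LINT \<omega>|M n. of_real 1 * g (X n \<omega>)) \<longlonglongrightarrow> (LINT \<omega>|N. of_real 1 * g (X' \<omega>))"
    by (rule density_iexp_conv[OF M N X X' _ _ _ _ _ _ _ g, where K=3])
       (use conv0 in \<open>auto simp del: of_real_mult\<close>)
  then have B: "(\<lambda>n. 2 * (LINT \<omega>|M n. g (X n \<omega>))) \<longlonglongrightarrow> 2 * (LINT \<omega>|N. g (X' \<omega>))"
    by (intro tendsto_intros) simp
  show ?thesis using tendsto_diff[OF A B] by simp
qed

text \<open>The imaginary part is the real part of \<open>- \<i> * Y\<close>. The complex weight
  makes an induction over coordinates possible: while one coordinate passes from exponentials to a
  general \<open>g\<close>, the weight carries all the others.\<close>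

lemma weighted_iexp_conv:
  fixes M :: "nat \<Rightarrow> 'a measure" and N :: "'b measure" and g :: "real \<Rightarrow> complex"
  assumes M: "\<And>n. prob_space (M n)" and N: "prob_space N"
    and X [measurable]: "\<And>n. X n \<in> borel_measurable (M n)" and X' [measurable]: "X' \<in> borel_measurable N"
    and Y [measurable]: "\<And>n. Y n \<in> borel_measurable (M n)" and Y' [measurable]: "Y' \<in> borel_measurable N"
    and Yb: "\<And>n \<omega>. cmod (Y n \<omega>) \<le> 1" "\<And>\<omega>. cmod (Y' \<omega>) \<le> 1"
    and conv0: "\<And>t. (\<lambda>n. LINT \<omega>|M n. iexp (t * X n \<omega>)) \<longlonglongrightarrow> (LINT \<omega>|N. iexp (t * X' \<omega>))"
    and conv: "\<And>t. (\<lambda>n. LINT \<omega>|M n. Y n \<omega> * iexp (t * X n \<omega>)) \<longlonglongrightarrow> (LINT \<omega>|N. Y' \<omega> * iexp (t * X' \<omega>))"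
    and g: "\<And>x. isCont g x" "\<And>x. norm (g x) \<le> B"
  shows "(\<lambda>n. LINT \<omega>|M n. Y n \<omega> * g (X n \<omega>)) \<longlonglongrightarrow> (LINT \<omega>|N. Y' \<omega> * g (X' \<omega>))"
proof -
  have gm [measurable]: "g \<in> borel_measurable borel"
    using g(1) by (intro borel_measurable_continuous_onI) (simp add: continuous_at_imp_continuous_on)
  have R: "(\<lambda>n. LINT \<omega>|M n. of_real (Re (Y n \<omega>)) * g (X n \<omega>)) \<longlonglongrightarrow> (LINT \<omega>|N. of_real (Re (Y' \<omega>)) * g (X' \<omega>))"
    by (rule weighted_iexp_conv_Re[OF M N X X' Y Y' Yb conv0 conv g])
  have "(\<lambda>n. LINT \<omega>|M n. of_real (Re ((- \<i>) * Y n \<omega>)) * g (X n \<omega>)) \<longlonglongrightarrow> (LINT \<omega>|N. of_real (Re ((- \<i>) * Y' \<omega>)) * g (X' \<omega>))"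
  proof (rule weighted_iexp_conv_Re[OF M N X X' _ _ _ _ conv0 _ g])
    fix t
    show "(\<lambda>n. LINT \<omega>|M n. - \<i> * Y n \<omega> * iexp (t * X n \<omega>)) \<longlonglongrightarrow> (LINT \<omega>|N. - \<i> * Y' \<omega> * iexp (t * X' \<omega>))"
      using tendsto_mult[OF tendsto_const[of "- \<i>"] conv[of t]] by (simp add: mult.assoc)
  qed (use Yb in \<open>auto simp: norm_mult\<close>)
  then have I: "(\<lambda>n. LINT \<omega>|M n. of_real (Im (Y n \<omega>)) * g (X n \<omega>)) \<longlonglongrightarrow> (LINT \<omega>|N. of_real (Im (Y' \<omega>)) * g (X' \<omega>))"
    by simp
  have e: "(LINT \<omega>|P. Y \<omega> * g (X \<omega>)) = (LINT \<omega>|P. of_real (Re (Y \<omega>)) * g (X \<omega>)) + \<i> * (LINT \<omega>|P. of_real (Im (Y \<omega>)) * g (X \<omega>))"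
    if P: "prob_space P" and [measurable]: "Y \<in> borel_measurable P" "X \<in> borel_measurable P"
      and b: "\<And>\<omega>. cmod (Y \<omega>) \<le> 1" for P :: "'c measure" and X and Y :: "'c \<Rightarrow> complex"
  proof -
    interpret prob_space P by fact
    have b': "\<bar>Re (Y \<omega>)\<bar> \<le> 1" "\<bar>Im (Y \<omega>)\<bar> \<le> 1" for \<omega>
      by (rule order_trans[OF abs_Re_le_cmod b], rule order_trans[OF abs_Im_le_cmod b])
    have "cmod (of_real (Re (Y \<omega>)) * g (X \<omega>)) \<le> 1 * B" "cmod (of_real (Im (Y \<omega>)) * g (X \<omega>)) \<le> 1 * B" for \<omega>
      unfolding norm_mult using b'[of \<omega>] g(2) by (intro mult_mono; simp)+
    then have i: "integrable P (\<lambda>\<omega>. of_real (Re (Y \<omega>)) * g (X \<omega>))" "integrable P (\<lambda>\<omega>. of_real (Im (Y \<omega>)) * g (X \<omega>))"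
      by (auto intro!: integrable_const_bound[where B=B])
    have "(LINT \<omega>|P. Y \<omega> * g (X \<omega>)) = (LINT \<omega>|P. of_real (Re (Y \<omega>)) * g (X \<omega>) + \<i> * (of_real (Im (Y \<omega>)) * g (X \<omega>)))"
      by (intro Bochner_Integration.integral_cong refl) (subst complex_eq, simp add: algebra_simps)
    then show ?thesis using i by simp
  qed
  show ?thesis unfolding e[OF M Y X Yb(1)] e[OF N Y' X' Yb(2)]
    by (intro tendsto_intros R I)
qed

text \<open>A multivariate continuity theorem for products, obtained from the one-dimensional one:
  coordinates in \<open>J\<close> are already general, the rest are still exponentials, and one is
  moved at a time. Products suffice because the exponential of a Riemann sum factorises over its
  nodes.\<close>

lemma fdd_char_conv_imp_prod_conv:
  fixes M :: "nat \<Rightarrow> 'a measure" and N :: "'b measure" and g :: "'i \<Rightarrow> real \<Rightarrow> complex"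
  assumes M: "\<And>n. prob_space (M n)" and N: "prob_space N" and I: "finite I"
    and X: "\<And>n i. i \<in> I \<Longrightarrow> X n i \<in> borel_measurable (M n)" and X': "\<And>i. i \<in> I \<Longrightarrow> X' i \<in> borel_measurable N"
    and conv: "\<And>t. (\<lambda>n. LINT \<omega>|M n. iexp (\<Sum>i\<in>I. t i * X n i \<omega>)) \<longlonglongrightarrow> (LINT \<omega>|N. iexp (\<Sum>i\<in>I. t i * X' i \<omega>))"
    and g: "\<And>i x. isCont (g i) x" "\<And>i x. norm (g i x) \<le> 1"
  shows "(\<lambda>n. LINT \<omega>|M n. (\<Prod>i\<in>I. g i (X n i \<omega>))) \<longlonglongrightarrow> (LINT \<omega>|N. (\<Prod>i\<in>I. g i (X' i \<omega>)))"
proof -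
  have gm [measurable]: "g i \<in> borel_measurable borel" for i
    using g(1) by (intro borel_measurable_continuous_onI) (simp add: continuous_at_imp_continuous_on)
  have "\<forall>t. (\<lambda>n. LINT \<omega>|M n. (\<Prod>i\<in>J. g i (X n i \<omega>)) * iexp (\<Sum>i\<in>I - J. t i * X n i \<omega>))
     \<longlonglongrightarrow> (LINT \<omega>|N. (\<Prod>i\<in>J. g i (X' i \<omega>)) * iexp (\<Sum>i\<in>I - J. t i * X' i \<omega>))" if "J \<subseteq> I" for J
    using finite_subset[OF that I] that
  proof (induction J rule: finite_induct)
    case empty
    then show ?case using conv by simp
  next
    case (insert j J)
    have jI: "j \<in> I" "j \<notin> J" "j \<in> I - J" "finite (I - J)" "J \<subseteq> I" using insert I by auto
    show ?case
    proof
      fix t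
      have norm_le: "norm ((\<Prod>i\<in>J. g i (x i)) * iexp r) \<le> 1" for x r
        using prod_mono[of J "\<lambda>i. norm (g i (x i))" "\<lambda>_. 1"] g(2) by (simp add: norm_mult prod_norm)
      have meas: "(\<lambda>\<omega>. (\<Prod>i\<in>J. g i (X n i \<omega>)) * iexp (\<Sum>i\<in>I - insert j J. t i * X n i \<omega>)) \<in> borel_measurable (M n)" for n
      proof -
        have [measurable]: "(\<lambda>\<omega>. \<Sum>i\<in>I - insert j J. t i * X n i \<omega>) \<in> borel_measurable (M n)"
          using X by (intro borel_measurable_sum borel_measurable_times) auto
        have [measurable]: "(\<lambda>\<omega>. \<Prod>i\<in>J. g i (X n i \<omega>)) \<in> borel_measurable (M n)"
          using X jI by (intro borel_measurable_prod measurable_compose[OF _ gm]) auto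
        show ?thesis by measurable
      qed
      have meas': "(\<lambda>\<omega>. (\<Prod>i\<in>J. g i (X' i \<omega>)) * iexp (\<Sum>i\<in>I - insert j J. t i * X' i \<omega>)) \<in> borel_measurable N"
      proof -
        have [measurable]: "(\<lambda>\<omega>. \<Sum>i\<in>I - insert j J. t i * X' i \<omega>) \<in> borel_measurable N"
          using X' by (intro borel_measurable_sum borel_measurable_times) auto
        have [measurable]: "(\<lambda>\<omega>. \<Prod>i\<in>J. g i (X' i \<omega>)) \<in> borel_measurable N"
          using X' jI by (intro borel_measurable_prod measurable_compose[OF _ gm]) auto
        show ?thesis by measurable
      qed
      have "(\<lambda>n. LINT \<omega>|M n. ((\<Prod>i\<in>J. g i (X n i \<omega>)) * iexp (\<Sum>i\<in>I - insert j J. t i * X n i \<omega>)) * g j (X n j \<omega>))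
     \<longlonglongrightarrow> (LINT \<omega>|N. ((\<Prod>i\<in>J. g i (X' i \<omega>)) * iexp (\<Sum>i\<in>I - insert j J. t i * X' i \<omega>)) * g j (X' j \<omega>))"
      proof (rule weighted_iexp_conv[OF M N X[OF jI(1)] X'[OF jI(1)] meas meas' norm_le norm_le _ _ g])
        fix s
        have "(\<Sum>i\<in>I. (if i = j then s else 0) * z i) = s * z j" for z :: "'i \<Rightarrow> real"
        proof -
          have "(\<Sum>i\<in>I. (if i = j then s else 0) * z i) = (\<Sum>i\<in>I. (if i = j then s * z j else 0))"
            by (intro sum.cong) auto
          then show ?thesis using jI I by simp
        qed
        then show "(\<lambda>n. LINT \<omega>|M n. iexp (s * X n j \<omega>)) \<longlonglongrightarrow> (LINT \<omega>|N. iexp (s * X' j \<omega>))"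
          using conv[of "\<lambda>i. if i = j then s else 0"] by simp
        \<comment> \<open>With frequency \<open>s\<close> at \<open>j\<close> and \<open>t\<close>
          elsewhere, the induction hypothesis becomes convergence with an extra exponential in
          coordinate \<open>j\<close>, which is what the weighted theorem asks for.\<close>
        have s: "(\<Sum>i\<in>I - J. (t(j := s)) i * z i) = (\<Sum>i\<in>I - insert j J. t i * z i) + s * z j" for z
        proof -
          have "I - insert j J = (I - J) - {j}" by auto
          then show ?thesis
            using jI by (subst sum.remove[of _ j]) (auto intro!: sum.cong)
        qed
        have e: "iexp (\<Sum>i\<in>I - J. (t(j := s)) i * z i) = iexp (\<Sum>i\<in>I - insert j J. t i * z i) * iexp (s * z j)" for z
          unfolding s by (simp add: algebra_simps flip: exp_add)
        show "(\<lambda>n. LINT \<omega>|M n. (\<Prod>i\<in>J. g i (X n i \<omega>)) * iexp (\<Sum>i\<in>I - insert j J. t i * X n i \<omega>) * iexp (s * X n j \<omega>))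
          \<longlonglongrightarrow> (LINT \<omega>|N. (\<Prod>i\<in>J. g i (X' i \<omega>)) * iexp (\<Sum>i\<in>I - insert j J. t i * X' i \<omega>) * iexp (s * X' j \<omega>))"
          using insert.IH[OF jI(5), rule_format, of "t(j := s)"] unfolding e by (simp add: mult.assoc)
      qed
      then show "(\<lambda>n. LINT \<omega>|M n. (\<Prod>i\<in>insert j J. g i (X n i \<omega>)) * iexp (\<Sum>i\<in>I - insert j J. t i * X n i \<omega>))
        \<longlonglongrightarrow> (LINT \<omega>|N. (\<Prod>i\<in>insert j J. g i (X' i \<omega>)) * iexp (\<Sum>i\<in>I - insert j J. t i * X' i \<omega>))"
        using insert.hyps by (simp add: mult_ac)
    qed
  qed
  from this[of I] show ?thesis by simp
qed

section \<open>Campbell's formula for Poisson processes\<close>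

text \<open>Complex \<open>z\<close> is kept because the formula serves twice: imaginary exponents
  give characteristic functions, real ones the moments of square roots of likelihood ratios.\<close>

lemma poisson_exp:
  fixes z :: complex
  assumes "0 < \<mu>"
  shows "integrable (measure_pmf (poisson_pmf \<mu>)) (\<lambda>k. exp (z * of_nat k))" (is ?goalA)
    and "(LINT k|measure_pmf (poisson_pmf \<mu>). exp (z * of_nat k)) = exp (of_real \<mu> * (exp z - 1))" (is ?goalB)
proof -
  define f where "f k = pmf (poisson_pmf \<mu>) k *\<^sub>R exp (z * of_nat k)" for k
  define w where "w = of_real \<mu> * exp z"
  have f: "f k = exp (- of_real \<mu>) * (w ^ k /\<^sub>R fact k)" for k
  proof -
    have "complex_of_real (exp (- \<mu>)) = exp (- of_real \<mu>)" by (simp flip: exp_of_real)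
    then show ?thesis
      using assms by (simp add: f_def w_def scaleR_conv_of_real power_mult_distrib exp_of_nat2_mult
          divide_inverse mult_ac)
  qed
  have nf: "norm (f k) = exp (- \<mu>) * (norm w ^ k /\<^sub>R fact k)" for k
    unfolding f by (simp add: norm_mult norm_power)
  have "(\<lambda>k. exp (- \<mu>) * (norm w ^ k /\<^sub>R fact k)) sums (exp (- \<mu>) * exp (norm w))"
    by (intro sums_mult exp_converges)
  then have s: "summable (\<lambda>k. norm (f k))" unfolding nf by (rule sums_summable)
  then have i: "integrable (count_space UNIV) f" by (simp add: integrable_count_space_nat_iff)
  have "f sums (exp (- of_real \<mu>) * exp w)"
    unfolding f[abs_def] by (intro sums_mult exp_converges)
  also have "exp (- of_real \<mu>) * exp w = exp (of_real \<mu> * (exp z - 1))"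
    unfolding w_def by (simp add: algebra_simps flip: exp_add)
  finally have sm: "f sums exp (of_real \<mu> * (exp z - 1))" .
  show ?goalA
    unfolding measure_pmf_eq_density by (subst integrable_density) (use i in \<open>auto simp: f_def[abs_def]\<close>)
  have "(LINT k|measure_pmf (poisson_pmf \<mu>). exp (z * of_nat k)) = integral\<^sup>L (count_space UNIV) f"
    unfolding measure_pmf_eq_density by (subst integral_density) (auto simp: f_def[abs_def])
  also have "\<dots> = suminf f" by (rule integral_count_space_nat[OF i])
  finally show ?goalB
    using sums_unique[OF sm] by simp
qed

lemma poisson_nn_mean:
  assumes "0 < \<mu>"
  shows "(\<integral>\<^sup>+k. ennreal (real k) \<partial>measure_pmf (poisson_pmf \<mu>)) = ennreal \<mu>"
proof -
  have "(\<lambda>k. (\<mu> * exp (- \<mu>)) * (\<mu> ^ k /\<^sub>R fact k)) sums ((\<mu> * exp (- \<mu>)) * exp \<mu>)"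
    by (intro sums_mult exp_converges)
  moreover have "(\<mu> * exp (- \<mu>)) * (\<mu> ^ k /\<^sub>R fact k) = pmf (poisson_pmf \<mu>) (Suc k) * real (Suc k)" for k
    using assms by (simp add: divide_simps)
  moreover have "(\<mu> * exp (- \<mu>)) * exp \<mu> = \<mu>" by (simp add: exp_minus)
  ultimately have "(\<lambda>k. pmf (poisson_pmf \<mu>) (Suc k) * real (Suc k)) sums \<mu>" by simp
  then have s: "(\<lambda>k. pmf (poisson_pmf \<mu>) k * real k) sums \<mu>"
    by (subst (asm) sums_Suc_iff) simp
  have "(\<integral>\<^sup>+k. ennreal (real k) \<partial>measure_pmf (poisson_pmf \<mu>)) = (\<Sum>k. ennreal (pmf (poisson_pmf \<mu>) k) * ennreal (real k))"
    by (simp add: nn_integral_measure_pmf nn_integral_count_space_nat)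
  also have "\<dots> = (\<Sum>k. ennreal (pmf (poisson_pmf \<mu>) k * real k))" by (simp add: ennreal_mult)
  also have "\<dots> = ennreal \<mu>"
    using sums_unique[OF s] sums_summable[OF s] by (subst suminf_ennreal2) auto
  finally show ?thesis .
qed

section \<open>Counting paths as measures on the line\<close>

definition path_cdf :: "real \<Rightarrow> (real \<Rightarrow> nat) \<Rightarrow> real \<Rightarrow> real" where
  "path_cdf \<tau> x t = real (x (max 0 (min t \<tau>)))"

lemma path_measure_eq: "path_measure \<tau> x = interval_measure (path_cdf \<tau> x)"
  by (simp add: path_measure_def path_cdf_def[abs_def])

lemma sets_path_measure [simp, measurable_cong]: "sets (path_measure \<tau> x) = sets borel"
  by (simp add: path_measure_def)

lemma space_path_measure [simp]: "space (path_measure \<tau> x) = UNIV"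
  by (simp add: path_measure_def)

lemma counting_path_space: "x \<in> space (path_space \<tau>) \<Longrightarrow> counting_path \<tau> x"
  by (auto simp: path_space_def space_restrict_space)

lemma measurable_path_eval [measurable]:
  assumes "t \<in> {0..\<tau>}"
  shows "(\<lambda>x. x t) \<in> path_space \<tau> \<rightarrow>\<^sub>M count_space UNIV"
  unfolding path_space_def by (intro measurable_restrict_space1 measurable_component_singleton assms)

lemma measurable_path_eval_real:
  "t \<in> {0..\<tau>} \<Longrightarrow> (\<lambda>x. real (x t)) \<in> borel_measurable (path_space \<tau>)"
  by (rule measurable_compose[OF measurable_path_eval]) auto

context
  fixes \<tau> :: real and x :: "real \<Rightarrow> nat"
  assumes tau: "0 < \<tau>" and x: "counting_path \<tau> x"
begin

lemma path_cdf_mono: "s \<le> t \<Longrightarrow> path_cdf \<tau> x s \<le> path_cdf \<tau> x t"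
proof -
  assume "s \<le> t"
  moreover have "mono_on {0..\<tau>} x" using x by (simp add: counting_path_def)
  ultimately have "x (max 0 (min s \<tau>)) \<le> x (max 0 (min t \<tau>))"
    by (elim mono_onD) (use tau in auto)
  then show ?thesis by (simp add: path_cdf_def)
qed

lemma path_cdf_right_continuous: "continuous (at_right t) (path_cdf \<tau> x)"
proof -
  have "eventually (\<lambda>s. path_cdf \<tau> x s = path_cdf \<tau> x t) (at_right t)"
  proof -
    consider "t < 0" | "\<tau> \<le> t" | "0 \<le> t" "t < \<tau>" by linarith
    then show ?thesis
    proof cases
      case 1
      then have "eventually (\<lambda>s. s \<in> {t<..<0}) (at_right t)" by (rule eventually_at_right_real)
      then show ?thesis by eventually_elim (use 1 tau in \<open>auto simp: path_cdf_def min_def max_def\<close>)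
    next
      case 2
      have "eventually (\<lambda>s. s \<in> {t<..<t + 1}) (at_right t)" by (rule eventually_at_right_real) simp
      then show ?thesis by eventually_elim (use 2 tau in \<open>auto simp: path_cdf_def min_def max_def\<close>)
    next
      case 3
      then have "continuous (at t within {t..\<tau>}) x" using x by (simp add: counting_path_def)
      \<comment> \<open>A path is integer valued, so right continuity means that it is constant on
        some interval to the right.\<close>
      then have "eventually (\<lambda>s. x s = x t) (at_right t)"
        using 3 by (simp add: continuous_within tendsto_discrete at_within_Icc_at_right)
      moreover have "eventually (\<lambda>s. s \<in> {t<..<\<tau>}) (at_right t)" using 3 by (intro eventually_at_right_real)
      ultimately show ?thesis by eventually_elim (use 3 tau in \<open>auto simp: path_cdf_def min_def max_def\<close>)
    qed
  qed
  then show ?thesis unfolding continuous_within by (rule tendsto_eventually)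
qed

lemma emeasure_path_Ioc:
  "a \<le> b \<Longrightarrow> emeasure (path_measure \<tau> x) {a<..b} = ennreal (path_cdf \<tau> x b - path_cdf \<tau> x a)"
  unfolding path_measure_eq by (intro emeasure_interval_measure_Ioc path_cdf_mono path_cdf_right_continuous)

lemma emeasure_path_UNIV: "emeasure (path_measure \<tau> x) UNIV = ennreal (real (x \<tau>))"
proof -
  have inc: "incseq (\<lambda>n. {- real n<..real n})"
    by (auto simp: incseq_def)
  have un: "(\<Union>n. {- real n<..real n}) = UNIV"
  proof (intro set_eqI iffI UNIV_I)
    fix y :: real
    obtain n where "\<bar>y\<bar> < real n" using reals_Archimedean2 by blast
    then show "y \<in> (\<Union>n. {- real n<..real n})" by (intro UN_I[of n]) auto
  qed
  have "(\<lambda>n. emeasure (path_measure \<tau> x) {- real n<..real n}) \<longlonglongrightarrow> emeasure (path_measure \<tau> x) (\<Union>n. {- real n<..real n})"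
    by (rule Lim_emeasure_incseq[OF _ inc]) auto
  moreover have "(\<lambda>n. emeasure (path_measure \<tau> x) {- real n<..real n}) \<longlonglongrightarrow> ennreal (real (x \<tau>))"
  proof (rule tendsto_eventually)
    obtain k where k: "\<tau> < real k" using reals_Archimedean2 by blast
    show "\<forall>\<^sub>F n in sequentially. emeasure (path_measure \<tau> x) {- real n<..real n} = ennreal (real (x \<tau>))"
      using eventually_ge_at_top[of k]
    proof eventually_elim
      case (elim n)
      then have "max 0 (min (real n) \<tau>) = \<tau>" "max 0 (min (- real n) \<tau>) = 0" using k tau by auto
      moreover have "x 0 = 0" using x by (simp add: counting_path_def)
      ultimately show ?case by (simp add: emeasure_path_Ioc path_cdf_def)
    qed
  qed
  ultimately show ?thesis unfolding un by (rule LIMSEQ_unique)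
qed

lemma finite_path_measure: "finite_measure (path_measure \<tau> x)"
  by (rule finite_measureI) (simp add: emeasure_path_UNIV)

lemma measure_path_UNIV: "measure (path_measure \<tau> x) UNIV = real (x \<tau>)"
  by (simp add: measure_def emeasure_path_UNIV)

lemma AE_path_measure: "AE t in path_measure \<tau> x. t \<in> {0<..\<tau>}"
proof (rule AE_I)
  interpret finite_measure "path_measure \<tau> x" by (rule finite_path_measure)
  have "x 0 = 0" using x by (simp add: counting_path_def)
  then have "emeasure (path_measure \<tau> x) {0<..\<tau>} = ennreal (real (x \<tau>))"
    using tau by (simp add: emeasure_path_Ioc path_cdf_def)
  then have "emeasure (path_measure \<tau> x) (space (path_measure \<tau> x) - {0<..\<tau>}) = 0"
    by (subst emeasure_compl) (auto simp: emeasure_path_UNIV)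
  then show "emeasure (path_measure \<tau> x) (UNIV - {0<..\<tau>}) = 0" by simp
qed auto

lemma path_integrable_bounded:
  fixes f :: "real \<Rightarrow> 'b::{banach, second_countable_topology}"
  assumes "f \<in> borel_measurable borel" "\<And>t. norm (f t) \<le> B"
  shows "integrable (path_measure \<tau> x) f"
    and "norm (LINT t|path_measure \<tau> x. f t) \<le> B * real (x \<tau>)" (is ?goal)
proof -
  interpret finite_measure "path_measure \<tau> x" by (rule finite_path_measure)
  show i: "integrable (path_measure \<tau> x) f"
    by (rule integrable_const_bound[where B=B]) (use assms in auto)
  have "norm (LINT t|path_measure \<tau> x. f t) \<le> (LINT t|path_measure \<tau> x. norm (f t))" by (rule integral_norm_bound)
  also have "\<dots> \<le> (LINT t|path_measure \<tau> x. B)" by (rule integral_mono) (use i assms in auto)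
  finally show ?goal by (simp add: measure_path_UNIV mult.commute)
qed

end

text \<open>Dividing by \<open>1 + real (x \<tau>)\<close> makes each path measure a subprobability,
  so that measurability of the kernel can be tested on the intersection-stable family of half-open
  intervals.\<close>

lemma path_kernel_measurable:
  assumes tau: "0 < \<tau>"
  shows "(\<lambda>x. density (path_measure \<tau> x) (\<lambda>_. ennreal (1 / (1 + real (x \<tau>))))) \<in> path_space \<tau> \<rightarrow>\<^sub>M subprob_algebra borel"
proof (rule measurable_subprob_algebra_generated[where \<Omega>=UNIV and G="range (\<lambda>(a, b). {a <.. b::real})"])
  show "sets borel = sigma_sets UNIV (range (\<lambda>(a, b). {a <.. b::real}))"
    by (subst borel_sigma_sets_Ioc) simp
  show "Int_stable (range (\<lambda>(a, b). {a <.. b::real}))"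
    by (auto simp: Int_stable_def Int_greaterThanAtMost)
next
  fix x assume "x \<in> space (path_space \<tau>)"
  note x = tau counting_path_space[OF this]
  have "ennreal (1 / (1 + real (x \<tau>))) * ennreal (real (x \<tau>)) \<le> 1"
    by (simp add: ennreal_mult[symmetric] del: ennreal_mult' flip: ennreal_1) 
  then show "subprob_space (density (path_measure \<tau> x) (\<lambda>_. ennreal (1 / (1 + real (x \<tau>)))))"
    by (intro subprob_spaceI) (auto simp: emeasure_density_const emeasure_path_UNIV[OF x])
  show "sets (density (path_measure \<tau> x) (\<lambda>_. ennreal (1 / (1 + real (x \<tau>))))) = sets borel" by simp
next
  have [measurable]: "(\<lambda>x. path_cdf \<tau> x t) \<in> borel_measurable (path_space \<tau>)" for t
    unfolding path_cdf_def by (rule measurable_path_eval_real) (use tau in auto)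
  have [measurable]: "(\<lambda>x. real (x \<tau>)) \<in> borel_measurable (path_space \<tau>)"
    by (rule measurable_path_eval_real) (use tau in auto)
  have "(\<lambda>x. ennreal (1 / (1 + real (x \<tau>))) * ennreal (real (x \<tau>))) \<in> borel_measurable (path_space \<tau>)" by measurable
  then show "(\<lambda>x. emeasure (density (path_measure \<tau> x) (\<lambda>_. ennreal (1 / (1 + real (x \<tau>))))) UNIV) \<in> borel_measurable (path_space \<tau>)"
    by (rule measurable_cong[THEN iffD1, rotated])
       (simp add: emeasure_density_const emeasure_path_UNIV[OF tau counting_path_space])
  fix A assume "A \<in> range (\<lambda>(a, b). {a <.. b::real})"
  then obtain a b where A: "A = {a<..b}" by auto
  show "(\<lambda>x. emeasure (density (path_measure \<tau> x) (\<lambda>_. ennreal (1 / (1 + real (x \<tau>))))) A) \<in> borel_measurable (path_space \<tau>)"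
  proof (cases "a \<le> b")
    case True
    have "(\<lambda>x. ennreal (1 / (1 + real (x \<tau>))) * ennreal (path_cdf \<tau> x b - path_cdf \<tau> x a)) \<in> borel_measurable (path_space \<tau>)"
      by measurable
    then show ?thesis
      by (rule measurable_cong[THEN iffD1, rotated])
         (simp add: A emeasure_density_const emeasure_path_Ioc[OF tau counting_path_space True])
  next
    case False
    then show ?thesis by (simp add: A)
  qed
qed auto

text \<open>The factor divided out in the kernel is multiplied back. The parameter \<open>y\<close>
  will be the statistical parameter: posterior integrals need measurability jointly in it and in the
  path.\<close>

lemma path_nn_integral_measurable:
  assumes tau: "0 < \<tau>" and f [measurable]: "(\<lambda>(y, t). f y t) \<in> borel_measurable (Y \<Otimes>\<^sub>M borel)"
  shows "(\<lambda>(y, x). \<integral>\<^sup>+t. f y t \<partial>path_measure \<tau> x) \<in> borel_measurable (Y \<Otimes>\<^sub>M path_space \<tau>)"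
proof -
  define K where "K x = density (path_measure \<tau> x) (\<lambda>_. ennreal (1 / (1 + real (x \<tau>))))" for x
  have K [measurable]: "K \<in> path_space \<tau> \<rightarrow>\<^sub>M subprob_algebra borel"
    unfolding K_def by (rule path_kernel_measurable[OF tau])
  have [measurable]: "(\<lambda>x. real (x \<tau>)) \<in> borel_measurable (path_space \<tau>)"
    by (rule measurable_path_eval_real) (use tau in auto)
  have "(\<lambda>z. \<integral>\<^sup>+t. f (fst z) t \<partial>K (snd z)) \<in> borel_measurable (Y \<Otimes>\<^sub>M path_space \<tau>)"
  proof (rule nn_integral_measurable_subprob_algebra2[where N=borel])
    have "(\<lambda>w. (fst (fst w), snd w)) \<in> (Y \<Otimes>\<^sub>M path_space \<tau>) \<Otimes>\<^sub>M borel \<rightarrow>\<^sub>M Y \<Otimes>\<^sub>M borel" by measurable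
    from measurable_compose[OF this f]
    show "(\<lambda>(z, t). f (fst z) t) \<in> borel_measurable ((Y \<Otimes>\<^sub>M path_space \<tau>) \<Otimes>\<^sub>M borel)"
      by (simp add: case_prod_beta')
  qed (rule measurable_compose[OF measurable_snd K])
  then have m: "(\<lambda>z. ennreal (1 + real (snd z \<tau>)) * (\<integral>\<^sup>+t. f (fst z) t \<partial>K (snd z))) \<in> borel_measurable (Y \<Otimes>\<^sub>M path_space \<tau>)"
    by measurable
  have "ennreal (1 + real (x \<tau>)) * (\<integral>\<^sup>+t. f y t \<partial>K x) = (\<integral>\<^sup>+t. f y t \<partial>path_measure \<tau> x)" if "y \<in> space Y" for y x
  proof -
    have [measurable]: "f y \<in> borel_measurable borel" using that measurable_Pair2[OF f] by simp
    have "(\<integral>\<^sup>+t. f y t \<partial>K x) = ennreal (1 / (1 + real (x \<tau>))) * (\<integral>\<^sup>+t. f y t \<partial>path_measure \<tau> x)"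
      unfolding K_def by (subst nn_integral_density) (auto intro!: nn_integral_cmult)
    moreover have "ennreal (1 + real (x \<tau>)) * ennreal (1 / (1 + real (x \<tau>))) = 1"
      by (subst ennreal_mult[symmetric]) auto
    ultimately show ?thesis by (simp add: mult.assoc[symmetric])
  qed
  then show ?thesis
    by (intro measurable_cong[THEN iffD1, OF _ m]) (auto simp: space_pair_measure)
qed

lemma path_integral_measurable:
  fixes f :: "'p \<Rightarrow> real \<Rightarrow> real"
  assumes tau: "0 < \<tau>" and f [measurable]: "(\<lambda>(y, t). f y t) \<in> borel_measurable (Y \<Otimes>\<^sub>M borel)"
    and B: "\<And>y t. y \<in> space Y \<Longrightarrow> \<bar>f y t\<bar> \<le> B"
  shows "(\<lambda>(y, x). LINT t|path_measure \<tau> x. f y t) \<in> borel_measurable (Y \<Otimes>\<^sub>M path_space \<tau>)"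
proof -
  have [measurable]: "(\<lambda>x. real (x \<tau>)) \<in> borel_measurable (path_space \<tau>)"
    by (rule measurable_path_eval_real) (use tau in auto)
  \<comment> \<open>A bounded integrand is shifted by \<open>B\<close> to become nonnegative; the
    shift costs \<open>B\<close> times the total mass \<open>x \<tau>\<close>.\<close>
  have [measurable]: "(\<lambda>(y, x). \<integral>\<^sup>+t. ennreal (f y t + B) \<partial>path_measure \<tau> x) \<in> borel_measurable (Y \<Otimes>\<^sub>M path_space \<tau>)"
    by (rule path_nn_integral_measurable[OF tau]) measurable
  have m: "(\<lambda>(y, x). enn2real (\<integral>\<^sup>+t. ennreal (f y t + B) \<partial>path_measure \<tau> x) - B * real (x \<tau>)) \<in> borel_measurable (Y \<Otimes>\<^sub>M path_space \<tau>)"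
    by measurable
  have "enn2real (\<integral>\<^sup>+t. ennreal (f y t + B) \<partial>path_measure \<tau> x) - B * real (x \<tau>) = (LINT t|path_measure \<tau> x. f y t)"
    if "y \<in> space Y" "x \<in> space (path_space \<tau>)" for y x
  proof -
    note x = tau counting_path_space[OF that(2)]
    interpret finite_measure "path_measure \<tau> x" by (rule finite_path_measure[OF x])
    have [measurable]: "f y \<in> borel_measurable borel" using that measurable_Pair2[OF f] by simp
    have i: "integrable (path_measure \<tau> x) (f y)"
      by (rule path_integrable_bounded[OF x]) (use B that in auto)
    have "(LINT t|path_measure \<tau> x. f y t + B) = enn2real (\<integral>\<^sup>+t. ennreal (f y t + B) \<partial>path_measure \<tau> x)"
    proof (rule integral_eq_nn_integral)
      show "AE t in path_measure \<tau> x. 0 \<le> f y t + B"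
      proof (rule AE_I2)
        fix t show "0 \<le> f y t + B" using B[OF that(1), of t] by linarith
      qed
    qed simp
    moreover have "(LINT t|path_measure \<tau> x. f y t + B) = (LINT t|path_measure \<tau> x. f y t) + B * real (x \<tau>)"
      using i by (simp add: measure_path_UNIV[OF x])
    ultimately show ?thesis by simp
  qed
  then show ?thesis
    by (intro measurable_cong[THEN iffD1, OF _ m]) (auto simp: space_pair_measure)
qed

lemma path_integral_measurable_complex:
  fixes f :: "real \<Rightarrow> complex"
  assumes tau: "0 < \<tau>" and f [measurable]: "f \<in> borel_measurable borel" and B: "\<And>t. cmod (f t) \<le> B"
  shows "(\<lambda>x. LINT t|path_measure \<tau> x. f t) \<in> borel_measurable (path_space \<tau>)"
proof -
  have r: "(\<lambda>x. LINT t|path_measure \<tau> x. g t) \<in> borel_measurable (path_space \<tau>)"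
    if [measurable]: "g \<in> borel_measurable borel" and g: "\<And>t. \<bar>g t\<bar> \<le> B" for g :: "real \<Rightarrow> real"
  proof -
    have "(\<lambda>((y::unit), x). LINT t|path_measure \<tau> x. g t) \<in> borel_measurable (count_space UNIV \<Otimes>\<^sub>M path_space \<tau>)"
      by (rule path_integral_measurable[OF tau, where B=B]) (use g in auto)
    from measurable_compose[OF measurable_Pair1' this, of "()"] show ?thesis by simp
  qed
  have [measurable]: "(\<lambda>x. LINT t|path_measure \<tau> x. Re (f t)) \<in> borel_measurable (path_space \<tau>)"
    by (rule r) (simp, rule order_trans[OF abs_Re_le_cmod B])
  have [measurable]: "(\<lambda>x. LINT t|path_measure \<tau> x. Im (f t)) \<in> borel_measurable (path_space \<tau>)"
    by (rule r) (simp, rule order_trans[OF abs_Im_le_cmod B])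
  have m: "(\<lambda>x. complex_of_real (LINT t|path_measure \<tau> x. Re (f t)) + \<i> * complex_of_real (LINT t|path_measure \<tau> x. Im (f t))) \<in> borel_measurable (path_space \<tau>)"
    by measurable
  show ?thesis
  proof (rule measurable_cong[THEN iffD1, OF _ m])
    fix x assume "x \<in> space (path_space \<tau>)"
    note x = tau counting_path_space[OF this]
    have i: "integrable (path_measure \<tau> x) f" by (rule path_integrable_bounded[OF x f B])
    show "complex_of_real (LINT t|path_measure \<tau> x. Re (f t)) + \<i> * complex_of_real (LINT t|path_measure \<tau> x. Im (f t)) = (LINT t|path_measure \<tau> x. f t)"
      unfolding integral_Re[OF i] integral_Im[OF i] by (rule complex_eq[symmetric])
  qed
qed

text \<open>Exactly one cell contains \<open>u\<close>, and its right end point is \<open>u\<close>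
  rounded up to the grid. Cells are open on the left so that a path increment is the mass of a
  cell.\<close>

lemma grid_step_sum:
  fixes g :: "real \<Rightarrow> complex" and u \<tau> :: real
  assumes "0 < \<tau>" "0 < m" "u \<in> {0<..\<tau>}"
  shows "(\<Sum>i<m. indicator {real i * \<tau> / real m<..real (Suc i) * \<tau> / real m} u *\<^sub>R g (real (Suc i) * \<tau> / real m))
     = g (real_of_int \<lceil>u * real m / \<tau>\<rceil> * \<tau> / real m)"
proof -
  define j where "j = nat \<lceil>u * real m / \<tau>\<rceil>"
  have pos: "0 < u * real m / \<tau>" and le: "u * real m / \<tau> \<le> real m"
    using assms by (auto simp: field_simps)
  have j: "real_of_int \<lceil>u * real m / \<tau>\<rceil> = real j" "0 < j" "j \<le> m"
    using pos le by (auto simp: j_def ceiling_le_iff)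
  have iff: "u \<in> {real i * \<tau> / real m<..real (Suc i) * \<tau> / real m} \<longleftrightarrow> Suc i = j" for i
  proof -
    have "u \<in> {real i * \<tau> / real m<..real (Suc i) * \<tau> / real m} \<longleftrightarrow> real i < u * real m / \<tau> \<and> u * real m / \<tau> \<le> real (Suc i)"
      using assms by (auto simp: field_simps)
    also have "\<dots> \<longleftrightarrow> \<lceil>u * real m / \<tau>\<rceil> = int (Suc i)"
      by (auto simp: ceiling_eq_iff)
    also have "\<dots> \<longleftrightarrow> Suc i = j" using j(1) by linarith
    finally show ?thesis .
  qed
  have "(\<Sum>i<m. indicator {real i * \<tau> / real m<..real (Suc i) * \<tau> / real m} u *\<^sub>R g (real (Suc i) * \<tau> / real m))
     = (\<Sum>i<m. if i = j - 1 then g (real (Suc i) * \<tau> / real m) else 0)"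
    unfolding indicator_def iff using j by (intro sum.cong) auto
  also have "\<dots> = g (real j * \<tau> / real m)" using j by simp
  finally show ?thesis using j by simp
qed

lemma grid_ceiling_tendsto:
  fixes u \<tau> :: real
  assumes "0 < \<tau>"
  shows "(\<lambda>m. real_of_int \<lceil>u * real (Suc m) / \<tau>\<rceil> * \<tau> / real (Suc m)) \<longlonglongrightarrow> u"
proof (rule tendsto_sandwich[where f="\<lambda>_. u" and h="\<lambda>m. u + \<tau> / real (Suc m)"])
  have "(\<lambda>m. u + \<tau> / real (Suc m)) \<longlonglongrightarrow> u + 0"
    by (intro tendsto_add tendsto_const LIMSEQ_Suc[OF lim_const_over_n])
  then show "(\<lambda>m. u + \<tau> / real (Suc m)) \<longlonglongrightarrow> u" by simp
  have *: "u \<le> real_of_int \<lceil>u * real (Suc m) / \<tau>\<rceil> * \<tau> / real (Suc m)" 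
    "real_of_int \<lceil>u * real (Suc m) / \<tau>\<rceil> * \<tau> / real (Suc m) \<le> u + \<tau> / real (Suc m)" for m
  proof -
    define c where "c = real_of_int \<lceil>u * real (Suc m) / \<tau>\<rceil>"
    have c: "u * real (Suc m) / \<tau> \<le> c" "c < u * real (Suc m) / \<tau> + 1" unfolding c_def by linarith+
    have c': "u * real (Suc m) \<le> c * \<tau>" "c * \<tau> \<le> u * real (Suc m) + \<tau>"
      using c assms by (simp_all add: field_simps)
    have "0 < real (Suc m)" by simp
    then have "u \<le> c * \<tau> / real (Suc m)" "c * \<tau> / real (Suc m) \<le> u + \<tau> / real (Suc m)"
      using c' by (simp_all only: pos_le_divide_eq pos_divide_le_eq distrib_right) auto
    then show "u \<le> real_of_int \<lceil>u * real (Suc m) / \<tau>\<rceil> * \<tau> / real (Suc m)"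
      "real_of_int \<lceil>u * real (Suc m) / \<tau>\<rceil> * \<tau> / real (Suc m) \<le> u + \<tau> / real (Suc m)"
      unfolding c_def by blast+
  qed
  show "\<forall>\<^sub>F m in sequentially. u \<le> real_of_int \<lceil>u * real (Suc m) / \<tau>\<rceil> * \<tau> / real (Suc m)"
    "\<forall>\<^sub>F m in sequentially. real_of_int \<lceil>u * real (Suc m) / \<tau>\<rceil> * \<tau> / real (Suc m) \<le> u + \<tau> / real (Suc m)"
    by (intro always_eventually allI *)+
qed auto

section \<open>Campbell's formula for a single process\<close>

locale poisson_path = prob_space M for M :: "'a measure" +
  fixes \<tau> :: real and l :: "real \<Rightarrow> real" and Y :: "'a \<Rightarrow> real \<Rightarrow> nat" and c L :: real
  assumes tau: "0 < \<tau>" and poisson: "poisson_process M \<tau> l Y"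
    and l_measurable [measurable]: "l \<in> borel_measurable borel"
    and c_pos: "0 < c" and l_ge: "\<And>t. t \<in> {0..\<tau>} \<Longrightarrow> c \<le> l t" and l_le: "\<And>t. t \<in> {0..\<tau>} \<Longrightarrow> l t \<le> L"
begin

lemma Y_measurable [measurable]: "Y \<in> M \<rightarrow>\<^sub>M path_space \<tau>"
  using poisson by (simp add: poisson_process_def)

lemma Y_path: "\<omega> \<in> space M \<Longrightarrow> counting_path \<tau> (Y \<omega>)"
  using measurable_space[OF Y_measurable] counting_path_space by blast

lemma Y_eval_measurable: "t \<in> {0..\<tau>} \<Longrightarrow> (\<lambda>\<omega>. Y \<omega> t) \<in> M \<rightarrow>\<^sub>M count_space UNIV"
  by (rule measurable_compose[OF Y_measurable measurable_path_eval])

definition \<Lambda> :: "real \<Rightarrow> real \<Rightarrow> real" where "\<Lambda> s t = (LBINT v:{s..t}. l v)"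

lemma l_integrable: "0 \<le> s \<Longrightarrow> t \<le> \<tau> \<Longrightarrow> set_integrable lborel {s..t} l"
  unfolding set_integrable_def
proof (rule integrableI_bounded_set[where A="{s..t}" and B="max 0 L"])
  assume st: "0 \<le> s" "t \<le> \<tau>"
  show "AE x in lborel. x \<in> {s..t} \<longrightarrow> norm (indicator {s..t} x *\<^sub>R l x) \<le> max 0 L"
  proof (rule AE_I2, rule impI)
    fix x assume "x \<in> {s..t}"
    then have "x \<in> {0..\<tau>}" using st by auto
    then show "norm (indicator {s..t} x *\<^sub>R l x) \<le> max 0 L" using l_ge[of x] l_le[of x] c_pos by (auto simp: indicator_def)
  qed
qed (auto simp: emeasure_lborel_Icc_eq)

lemma \<Lambda>_pos: "0 \<le> s \<Longrightarrow> s < t \<Longrightarrow> t \<le> \<tau> \<Longrightarrow> 0 < \<Lambda> s t"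
proof -
  assume st: "0 \<le> s" "s < t" "t \<le> \<tau>"
  have "(LBINT v:{s..t}. c) \<le> \<Lambda> s t"
    unfolding \<Lambda>_def using st l_ge
    by (intro set_integral_mono l_integrable) (auto simp: set_integrable_def emeasure_lborel_Icc_eq)
  moreover have "(LBINT v:{s..t}. c) = c * (t - s)" using st by (simp add: set_lebesgue_integral_def)
  ultimately show ?thesis using st c_pos mult_pos_pos[of c "t - s"] by linarith
qed

lemma nn_\<Lambda>: "0 \<le> s \<Longrightarrow> t \<le> \<tau> \<Longrightarrow> (\<integral>\<^sup>+v. ennreal (l v) * indicator {s<..t} v \<partial>lborel) = ennreal (\<Lambda> s t)"
proof -
  assume st: "0 \<le> s" "t \<le> \<tau>"
  have "(\<integral>\<^sup>+v. ennreal (l v) * indicator {s<..t} v \<partial>lborel) = (\<integral>\<^sup>+v. ennreal (indicator {s..t} v *\<^sub>R l v) \<partial>lborel)"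
  proof (rule nn_integral_cong_AE)
    show "AE v in lborel. ennreal (l v) * indicator {s<..t} v = ennreal (indicator {s..t} v *\<^sub>R l v)"
      using AE_lborel_singleton[of s] by eventually_elim (auto simp: indicator_def)
  qed
  also have "\<dots> = ennreal (\<Lambda> s t)"
    unfolding \<Lambda>_def set_lebesgue_integral_def
  proof (rule nn_integral_eq_integral)
    show "integrable lborel (\<lambda>v. indicator {s..t} v *\<^sub>R l v)" using l_integrable[OF st] by (simp add: set_integrable_def)
    show "AE v in lborel. 0 \<le> indicator {s..t} v *\<^sub>R l v"
    proof (rule AE_I2)
      fix v show "0 \<le> indicator {s..t} v *\<^sub>R l v" using st l_ge[of v] c_pos by (auto simp: indicator_def)
    qed
  qed
  finally show ?thesis .
qed

lemma increment_distr:
  "0 \<le> s \<Longrightarrow> s < t \<Longrightarrow> t \<le> \<tau> \<Longrightarrow> distr M (count_space UNIV) (\<lambda>\<omega>. Y \<omega> t - Y \<omega> s) = measure_pmf (poisson_pmf (\<Lambda> s t))"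
  using poisson unfolding poisson_process_def \<Lambda>_def by blast

lemma increment_measurable: "s \<in> {0..\<tau>} \<Longrightarrow> t \<in> {0..\<tau>} \<Longrightarrow> (\<lambda>\<omega>. Y \<omega> t - Y \<omega> s) \<in> M \<rightarrow>\<^sub>M count_space UNIV"
  by (rule measurable_compose_countable[where g="\<lambda>\<omega>. Y \<omega> t" and f="\<lambda>k \<omega>. k - Y \<omega> s"])
     (auto intro: Y_eval_measurable measurable_compose[OF Y_eval_measurable])

lemma Y_mono: "\<omega> \<in> space M \<Longrightarrow> 0 \<le> s \<Longrightarrow> s \<le> t \<Longrightarrow> t \<le> \<tau> \<Longrightarrow> Y \<omega> s \<le> Y \<omega> t"
  using Y_path[of \<omega>] unfolding counting_path_def mono_on_def by auto

lemma increment_nn_mean: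
  assumes "0 \<le> s" "s \<le> t" "t \<le> \<tau>"
  shows "(\<integral>\<^sup>+\<omega>. ennreal (real (Y \<omega> t) - real (Y \<omega> s)) \<partial>M) = ennreal (\<Lambda> s t)"
proof (cases "s = t")
  case True
  have "\<Lambda> t t = 0" unfolding \<Lambda>_def set_lebesgue_integral_def
  proof (rule integral_eq_zero_AE)
    show "AE x in lborel. indicator {t..t} x *\<^sub>R l x = 0"
      using AE_lborel_singleton[of t] by eventually_elim (auto simp: indicator_def)
  qed
  then show ?thesis using True by simp
next
  case False
  then have st: "s < t" using assms by simp
  \<comment> \<open>Subtraction of natural numbers truncates; monotonicity of the paths makes it
    agree with the real difference.\<close>
  have "(\<integral>\<^sup>+\<omega>. ennreal (real (Y \<omega> t) - real (Y \<omega> s)) \<partial>M) = (\<integral>\<^sup>+\<omega>. ennreal (real (Y \<omega> t - Y \<omega> s)) \<partial>M)"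
    using Y_mono assms by (intro nn_integral_cong) (auto simp: of_nat_diff)
  also have "\<dots> = (\<integral>\<^sup>+k. ennreal (real k) \<partial>distr M (count_space UNIV) (\<lambda>\<omega>. Y \<omega> t - Y \<omega> s))"
    using assms by (subst nn_integral_distr) (auto intro!: increment_measurable)
  also have "\<dots> = ennreal (\<Lambda> s t)"
    unfolding increment_distr[OF assms(1) st assms(3)] by (rule poisson_nn_mean[OF \<Lambda>_pos[OF assms(1) st assms(3)]])
  finally show ?thesis .
qed

lemma emeasure_path_measurable:
  assumes [measurable]: "A \<in> sets borel"
  shows "(\<lambda>\<omega>. emeasure (path_measure \<tau> (Y \<omega>)) A) \<in> borel_measurable M"
proof -
  have "(\<lambda>((y::unit), x). \<integral>\<^sup>+t. indicator A t \<partial>path_measure \<tau> x) \<in> borel_measurable (count_space UNIV \<Otimes>\<^sub>M path_space \<tau>)"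
    by (rule path_nn_integral_measurable[OF tau]) measurable
  from measurable_compose[OF measurable_Pair1' this, of "()"]
  have "(\<lambda>x. \<integral>\<^sup>+t. indicator A t \<partial>path_measure \<tau> x) \<in> borel_measurable (path_space \<tau>)" by simp
  from measurable_compose[OF Y_measurable this] show ?thesis by simp
qed

text \<open>Mean counts agree with the intensity on half-open intervals, and Dynkin's argument
  extends this to Borel sets. The complement step cancels a common summand from equal totals, which
  requires the finiteness \<open>fin\<close>.\<close>

lemma mean_measure:
  assumes "A \<in> sets borel"
  shows "(\<integral>\<^sup>+\<omega>. emeasure (path_measure \<tau> (Y \<omega>)) A \<partial>M) = (\<integral>\<^sup>+v. ennreal (l v) * indicator (A \<inter> {0<..\<tau>}) v \<partial>lborel)"
proof -
  let ?G = "range (\<lambda>(a, b). {a <.. b::real})"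
  have gen: "sets borel = sigma_sets UNIV ?G" by (subst borel_sigma_sets_Ioc) simp
  have st: "Int_stable ?G" by (auto simp: Int_stable_def Int_greaterThanAtMost)
  have U: "(\<integral>\<^sup>+\<omega>. emeasure (path_measure \<tau> (Y \<omega>)) UNIV \<partial>M) = ennreal (\<Lambda> 0 \<tau>)"
  proof -
    have "(\<integral>\<^sup>+\<omega>. emeasure (path_measure \<tau> (Y \<omega>)) UNIV \<partial>M) = (\<integral>\<^sup>+\<omega>. ennreal (real (Y \<omega> \<tau>) - real (Y \<omega> 0)) \<partial>M)"
      using Y_path by (intro nn_integral_cong) (auto simp: emeasure_path_UNIV[OF tau] counting_path_def)
    also have "\<dots> = ennreal (\<Lambda> 0 \<tau>)" using tau by (intro increment_nn_mean) auto
    finally show ?thesis .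
  qed
  have cl: "?G \<subseteq> Pow UNIV" by auto
  have "A \<in> sigma_sets UNIV ?G" using assms by (simp only: gen)
  then show ?thesis
  proof (induction A rule: sigma_sets_induct_disjoint[OF st cl, consumes 1, case_names basic empty compl union])
    case (basic A)
    then obtain a b where A: "A = {a<..b}" by auto
    show ?case
    proof (cases "a \<le> b")
      case True
      define a' b' where "a' = max 0 (min a \<tau>)" and "b' = max 0 (min b \<tau>)"
      have ab: "0 \<le> a'" "a' \<le> b'" "b' \<le> \<tau>" using True tau by (auto simp: a'_def b'_def)
      have "(\<integral>\<^sup>+\<omega>. emeasure (path_measure \<tau> (Y \<omega>)) A \<partial>M) = (\<integral>\<^sup>+\<omega>. ennreal (real (Y \<omega> b') - real (Y \<omega> a')) \<partial>M)"
        by (intro nn_integral_cong) (simp add: A emeasure_path_Ioc[OF tau Y_path True] path_cdf_def a'_def b'_def)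
      also have "\<dots> = ennreal (\<Lambda> a' b')" by (rule increment_nn_mean[OF ab])
      also have "\<dots> = (\<integral>\<^sup>+v. ennreal (l v) * indicator {a'<..b'} v \<partial>lborel)" by (rule nn_\<Lambda>[symmetric]) (use ab in auto)
      also have "{a'<..b'} = A \<inter> {0<..\<tau>}" using True tau by (auto simp: A a'_def b'_def)
      finally show ?thesis .
    qed (simp add: A)
  next
    case empty
    then show ?case by simp
  next
    case (compl A)
    then have [measurable]: "A \<in> sets borel" by (simp only: gen)
    have fin: "(\<integral>\<^sup>+v. ennreal (l v) * indicator (A \<inter> {0<..\<tau>}) v \<partial>lborel) \<noteq> \<infinity>"
    proof -
      have "(\<integral>\<^sup>+v. ennreal (l v) * indicator (A \<inter> {0<..\<tau>}) v \<partial>lborel) \<le> (\<integral>\<^sup>+v. ennreal (l v) * indicator {0<..\<tau>} v \<partial>lborel)"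
        by (intro nn_integral_mono) (auto simp: indicator_def)
      then show ?thesis using nn_\<Lambda>[of 0 \<tau>] by (auto simp: top_unique)
    qed
    have "ennreal (\<Lambda> 0 \<tau>) = (\<integral>\<^sup>+\<omega>. emeasure (path_measure \<tau> (Y \<omega>)) (UNIV - A) + emeasure (path_measure \<tau> (Y \<omega>)) A \<partial>M)"
      unfolding U[symmetric] by (intro nn_integral_cong, subst plus_emeasure) (auto simp: Un_commute intro!: arg_cong2[where f=emeasure])
    also have "\<dots> = (\<integral>\<^sup>+\<omega>. emeasure (path_measure \<tau> (Y \<omega>)) (UNIV - A) \<partial>M) + (\<integral>\<^sup>+\<omega>. emeasure (path_measure \<tau> (Y \<omega>)) A \<partial>M)"
      by (intro nn_integral_add emeasure_path_measurable) auto
    finally have 1: "ennreal (\<Lambda> 0 \<tau>) = (\<integral>\<^sup>+\<omega>. emeasure (path_measure \<tau> (Y \<omega>)) (UNIV - A) \<partial>M) + (\<integral>\<^sup>+v. ennreal (l v) * indicator (A \<inter> {0<..\<tau>}) v \<partial>lborel)"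
      unfolding compl.IH .
    have "ennreal (\<Lambda> 0 \<tau>) = (\<integral>\<^sup>+v. ennreal (l v) * indicator ((UNIV - A) \<inter> {0<..\<tau>}) v + ennreal (l v) * indicator (A \<inter> {0<..\<tau>}) v \<partial>lborel)"
      using tau by (subst nn_\<Lambda>[symmetric]) (auto intro!: nn_integral_cong simp: indicator_def)
    also have "\<dots> = (\<integral>\<^sup>+v. ennreal (l v) * indicator ((UNIV - A) \<inter> {0<..\<tau>}) v \<partial>lborel) + (\<integral>\<^sup>+v. ennreal (l v) * indicator (A \<inter> {0<..\<tau>}) v \<partial>lborel)"
      by (rule nn_integral_add) auto
    finally have 2: "ennreal (\<Lambda> 0 \<tau>) = (\<integral>\<^sup>+v. ennreal (l v) * indicator ((UNIV - A) \<inter> {0<..\<tau>}) v \<partial>lborel) + (\<integral>\<^sup>+v. ennreal (l v) * indicator (A \<inter> {0<..\<tau>}) v \<partial>lborel)" .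
    have canc: "x = y" if "x + z = y + z" "z \<noteq> \<infinity>" for x y z :: ennreal
      using that ennreal_add_left_cancel[of z x y] by (simp add: add.commute)
    show ?case by (rule canc[OF _ fin]) (simp only: 1[symmetric] 2[symmetric])
  next
    case (union A)
    have [measurable]: "A i \<in> sets borel" for i using union(2) unfolding gen by blast
    have "(\<integral>\<^sup>+\<omega>. emeasure (path_measure \<tau> (Y \<omega>)) (\<Union>i. A i) \<partial>M) = (\<integral>\<^sup>+\<omega>. (\<Sum>i. emeasure (path_measure \<tau> (Y \<omega>)) (A i)) \<partial>M)"
      using union(1,2) by (intro nn_integral_cong suminf_emeasure[symmetric]) auto
    also have "\<dots> = (\<Sum>i. \<integral>\<^sup>+\<omega>. emeasure (path_measure \<tau> (Y \<omega>)) (A i) \<partial>M)"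
      by (intro nn_integral_suminf emeasure_path_measurable) auto
    also have "\<dots> = (\<Sum>i. \<integral>\<^sup>+v. ennreal (l v) * indicator (A i \<inter> {0<..\<tau>}) v \<partial>lborel)"
      unfolding union.IH ..
    also have "\<dots> = (\<integral>\<^sup>+v. (\<Sum>i. ennreal (l v) * indicator (A i \<inter> {0<..\<tau>}) v) \<partial>lborel)"
      by (intro nn_integral_suminf[symmetric]) auto
    also have "\<dots> = (\<integral>\<^sup>+v. ennreal (l v) * indicator ((\<Union>i. A i) \<inter> {0<..\<tau>}) v \<partial>lborel)"
    proof (intro nn_integral_cong)
      fix v
      have d: "disjoint_family (\<lambda>i. A i \<inter> {0<..\<tau>})" using union(1) by (auto simp: disjoint_family_on_def)
      have "(\<Sum>i. indicator (A i \<inter> {0<..\<tau>}) v :: ennreal) = indicator (\<Union>i. A i \<inter> {0<..\<tau>}) v"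
        by (rule suminf_indicator[OF d])
      then show "(\<Sum>i. ennreal (l v) * indicator (A i \<inter> {0<..\<tau>}) v) = ennreal (l v) * indicator ((\<Union>i. A i) \<inter> {0<..\<tau>}) v"
        by (simp add: ennreal_suminf_cmult)
    qed
    finally show ?case .
  qed
qed

text \<open>Path measures are purely atomic, yet a fixed Lebesgue null set is almost surely missed
  by all their atoms. Almost everywhere limits of test functions may therefore be taken under the
  path integral.\<close>

lemma AE_path_null:
  assumes "A \<in> null_sets lborel"
  shows "AE \<omega> in M. emeasure (path_measure \<tau> (Y \<omega>)) A = 0"
proof -
  have A [measurable]: "A \<in> sets borel" using assms by auto
  have "(\<integral>\<^sup>+\<omega>. emeasure (path_measure \<tau> (Y \<omega>)) A \<partial>M) = (\<integral>\<^sup>+v. ennreal (l v) * indicator (A \<inter> {0<..\<tau>}) v \<partial>lborel)"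
    by (rule mean_measure[OF A])
  also have "\<dots> = 0"
    using AE_not_in[OF assms] by (subst nn_integral_0_iff_AE) (auto simp: indicator_def)
  finally show ?thesis
    by (subst (asm) nn_integral_0_iff_AE) (auto intro: emeasure_path_measurable)
qed

text \<open>For test functions bounded by \<open>B\<close> this is the common dominating function of
  all exponentials of path integrals.\<close>

lemma total_exp_integrable: "integrable M (\<lambda>\<omega>. exp (B * real (Y \<omega> \<tau>)))"
proof -
  have "integrable (measure_pmf (poisson_pmf (\<Lambda> 0 \<tau>))) (\<lambda>k. exp (complex_of_real B * of_nat k))"
    by (rule poisson_exp(1)[OF \<Lambda>_pos]) (use tau in auto)
  then have "integrable (distr M (count_space UNIV) (\<lambda>\<omega>. Y \<omega> \<tau> - Y \<omega> 0)) (\<lambda>k. exp (complex_of_real B * of_nat k))"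
    using increment_distr[of 0 \<tau>] tau by simp
  then have "integrable M (\<lambda>\<omega>. exp (complex_of_real B * of_nat (Y \<omega> \<tau> - Y \<omega> 0)))"
    by (rule integrable_distr[rotated]) (use tau in \<open>auto intro!: increment_measurable\<close>)
  then have i: "integrable M (\<lambda>\<omega>. cmod (exp (complex_of_real B * of_nat (Y \<omega> \<tau> - Y \<omega> 0))))"
    by (rule integrable_norm)
  show ?thesis
    by (rule Bochner_Integration.integrable_cong[THEN iffD1, OF refl _ i]) (use Y_path in \<open>auto simp: counting_path_def norm_exp_eq_Re\<close>)
qed


lemma Lambda_complex:
  assumes "0 \<le> s" "t \<le> \<tau>"
  shows "integrable lborel (\<lambda>u. indicator {s<..t} u *\<^sub>R (C * complex_of_real (l u)))" (is ?goalA)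
    and "(LBINT u. indicator {s<..t} u *\<^sub>R (C * complex_of_real (l u))) = C * of_real (\<Lambda> s t)" (is ?goalB)
proof -
  have i: "integrable lborel (\<lambda>u. indicator {s..t} u *\<^sub>R l u)"
    using l_integrable[OF assms] by (simp add: set_integrable_def)
  have ae: "AE u in lborel. C * complex_of_real (indicator {s..t} u *\<^sub>R l u) = indicator {s<..t} u *\<^sub>R (C * complex_of_real (l u))"
    using AE_lborel_singleton[of s] by eventually_elim (auto simp: indicator_def)
  have i2: "integrable lborel (\<lambda>u. C * complex_of_real (indicator {s..t} u *\<^sub>R l u))"
    by (intro integrable_mult_right integrable_of_real i)
  show ?goalA
    by (rule integrable_cong_AE_imp[OF i2]) (use ae in \<open>auto elim: eventually_mono\<close>)
  have "(LBINT u. indicator {s<..t} u *\<^sub>R (C * complex_of_real (l u))) = (LBINT u. C * complex_of_real (indicator {s..t} u *\<^sub>R l u))"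
    by (rule integral_cong_AE) (use ae in \<open>auto elim: eventually_mono\<close>)
  also have "\<dots> = C * of_real (\<Lambda> s t)"
    unfolding \<Lambda>_def set_lebesgue_integral_def integral_mult_right_zero integral_complex_of_real ..
  finally show ?goalB .
qed

text \<open>The exponential Campbell formula as a predicate, so that its validity can be carried
  from step functions through continuous to bounded measurable ones. Integrability is part of it,
  since the integral of a non-integrable function is 0 by convention.\<close>

definition campbell :: "(real \<Rightarrow> complex) \<Rightarrow> bool" where
  "campbell f \<longleftrightarrow> integrable M (\<lambda>\<omega>. exp (LINT u|path_measure \<tau> (Y \<omega>). f u)) \<and>
     (LINT \<omega>|M. exp (LINT u|path_measure \<tau> (Y \<omega>). f u)) =
       exp (LBINT u:{0<..\<tau>}. (exp (f u) - 1) * complex_of_real (l u))"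

definition step_fun :: "(real \<Rightarrow> complex) \<Rightarrow> nat \<Rightarrow> real \<Rightarrow> complex" where
  "step_fun g m u = (\<Sum>i<m. indicator {real i * \<tau> / real m<..real (Suc i) * \<tau> / real m} u *\<^sub>R g (real (Suc i) * \<tau> / real m))"

lemma grid_in: "0 < m \<Longrightarrow> i \<le> m \<Longrightarrow> real i * \<tau> / real m \<in> {0..\<tau>}"
  using tau by (auto simp: field_simps intro!: mult_right_mono)

lemma campbell_step:
  assumes m: "0 < m"
  shows "campbell (step_fun g m)"
proof -
  define t where "t i = real i * \<tau> / real m" for i
  define c where "c i = g (t (Suc i))" for i
  have tin: "t i \<in> {0..\<tau>}" if "i \<le> m" for i using grid_in[OF m that] by (simp add: t_def)
  have tlt: "t i < t (Suc i)" for i using m tau by (simp add: t_def divide_strict_right_mono)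
  have pint: "(LINT u|path_measure \<tau> (Y \<omega>). step_fun g m u) = (\<Sum>i<m. c i * of_nat (Y \<omega> (t (Suc i)) - Y \<omega> (t i)))"
    if w: "\<omega> \<in> space M" for \<omega>
  proof -
    interpret F: finite_measure "path_measure \<tau> (Y \<omega>)" by (rule finite_path_measure[OF tau Y_path[OF w]])
    have "(LINT u|path_measure \<tau> (Y \<omega>). step_fun g m u) = (\<Sum>i<m. LINT u|path_measure \<tau> (Y \<omega>). indicator {t i<..t (Suc i)} u *\<^sub>R c i)"
      unfolding step_fun_def t_def[symmetric] c_def
      by (rule Bochner_Integration.integral_sum) (auto intro!: integrable_scaleR_left simp: F.emeasure_finite less_top[symmetric])
    also have "\<dots> = (\<Sum>i<m. c i * of_nat (Y \<omega> (t (Suc i)) - Y \<omega> (t i)))"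
    proof (intro sum.cong refl)
      fix i assume i: "i \<in> {..<m}"
      have e: "max 0 (min (t i) \<tau>) = t i" "max 0 (min (t (Suc i)) \<tau>) = t (Suc i)"
        using tin[of i] tin[of "Suc i"] i by auto
      have "Y \<omega> (t i) \<le> Y \<omega> (t (Suc i))" using Y_mono[OF w] tin[of i] tin[of "Suc i"] tlt[of i] i by auto
      then have "measure (path_measure \<tau> (Y \<omega>)) {t i<..t (Suc i)} = real (Y \<omega> (t (Suc i)) - Y \<omega> (t i))"
        using tlt[of i] by (simp add: measure_def emeasure_path_Ioc[OF tau Y_path[OF w]] path_cdf_def e of_nat_diff)
      then show "(LINT u|path_measure \<tau> (Y \<omega>). indicator {t i<..t (Suc i)} u *\<^sub>R c i) = c i * of_nat (Y \<omega> (t (Suc i)) - Y \<omega> (t i))"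
        by (subst integral_scaleR_left) (simp_all add: scaleR_conv_of_real F.emeasure_finite less_top[symmetric])
    qed
    finally show ?thesis .
  qed
  have ind0: "indep_vars (\<lambda>_. count_space UNIV) (\<lambda>i \<omega>. Y \<omega> (t (Suc i)) - Y \<omega> (t i)) {..<m}"
  proof -
    have "mono_on {..m} t" using tau by (auto simp: mono_on_def t_def intro!: divide_right_mono mult_right_mono)
    moreover have "t ` {..m} \<subseteq> {0..\<tau>}" using tin by auto
    ultimately show ?thesis using poisson unfolding poisson_process_def by blast
  qed
  have ind: "indep_vars (\<lambda>_. borel) (\<lambda>i \<omega>. exp (c i * of_nat (Y \<omega> (t (Suc i)) - Y \<omega> (t i)))) {..<m}"
    by (rule indep_vars_compose2[OF ind0]) auto
  have each: "integrable M (\<lambda>\<omega>. exp (c i * of_nat (Y \<omega> (t (Suc i)) - Y \<omega> (t i)))) \<and>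
      (LINT \<omega>|M. exp (c i * of_nat (Y \<omega> (t (Suc i)) - Y \<omega> (t i)))) = exp (of_real (\<Lambda> (t i) (t (Suc i))) * (exp (c i) - 1))"
    if i: "i \<in> {..<m}" for i
  proof -
    have ti: "0 \<le> t i" "t i < t (Suc i)" "t (Suc i) \<le> \<tau>" using tin[of i] tin[of "Suc i"] tlt[of i] i by auto
    have [measurable]: "(\<lambda>\<omega>. Y \<omega> (t (Suc i)) - Y \<omega> (t i)) \<in> M \<rightarrow>\<^sub>M count_space UNIV"
      using ti by (intro increment_measurable) auto
    note pe = poisson_exp[OF \<Lambda>_pos[OF ti], of "c i"]
    note pe' = pe[folded increment_distr[OF ti]]
    show ?thesis
      using pe' by (subst (asm) integrable_distr_eq, simp, simp, subst (asm) integral_distr, simp, simp) auto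
  qed
  have E: "integrable M (\<lambda>\<omega>. exp (\<Sum>i<m. c i * of_nat (Y \<omega> (t (Suc i)) - Y \<omega> (t i))))"
    "(LINT \<omega>|M. exp (\<Sum>i<m. c i * of_nat (Y \<omega> (t (Suc i)) - Y \<omega> (t i)))) = (\<Prod>i<m. exp (of_real (\<Lambda> (t i) (t (Suc i))) * (exp (c i) - 1)))"
    using indep_vars_lebesgue_integral[OF _ ind] indep_vars_integrable[OF _ ind] each by (auto simp: exp_sum)
  have "(LBINT u:{0<..\<tau>}. (exp (step_fun g m u) - 1) * complex_of_real (l u))
      = (LBINT u. (\<Sum>i<m. indicator {t i<..t (Suc i)} u *\<^sub>R ((exp (c i) - 1) * complex_of_real (l u))))"
    unfolding set_lebesgue_integral_def
  proof (intro Bochner_Integration.integral_cong refl)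
    fix u
    show "indicator {0<..\<tau>} u *\<^sub>R ((exp (step_fun g m u) - 1) * complex_of_real (l u)) = (\<Sum>i<m. indicator {t i<..t (Suc i)} u *\<^sub>R ((exp (c i) - 1) * complex_of_real (l u)))"
    proof (cases "u \<in> {0<..\<tau>}")
      case True
      have "(\<Sum>i<m. indicator {t i<..t (Suc i)} u *\<^sub>R ((exp (c i) - 1) * complex_of_real (l u))) = (\<Sum>i<m. indicator {t i<..t (Suc i)} u *\<^sub>R (exp (c i) - 1)) * complex_of_real (l u)"
        by (simp add: sum_distrib_right)
      \<comment> \<open>Only one cell contributes at each point, so applying \<open>exp\<close> and
        subtracting 1 commutes with forming the step function.\<close>
      also have "(\<Sum>i<m. indicator {t i<..t (Suc i)} u *\<^sub>R (exp (c i) - 1)) = exp (step_fun g m u) - 1"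
        using grid_step_sum[OF tau m True, of g] grid_step_sum[OF tau m True, of "\<lambda>x. exp (g x) - 1"]
        unfolding step_fun_def t_def c_def by simp
      finally show ?thesis using True by simp
    next
      case False
      then have "u \<notin> {t i<..t (Suc i)}" if "i < m" for i using tin[of i] tin[of "Suc i"] that by auto
      then have "(\<Sum>i<m. indicator {t i<..t (Suc i)} u *\<^sub>R ((exp (c i) - 1) * complex_of_real (l u))) = 0"
        by (intro sum.neutral) auto
      then show ?thesis using False by simp
    qed
  qed
  also have "\<dots> = (\<Sum>i<m. (exp (c i) - 1) * of_real (\<Lambda> (t i) (t (Suc i))))"
  proof (subst Bochner_Integration.integral_sum)
    fix i assume "i \<in> {..<m}"
    then show "integrable lborel (\<lambda>u. indicator {t i<..t (Suc i)} u *\<^sub>R ((exp (c i) - 1) * complex_of_real (l u)))"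
      using tin[of i] tin[of "Suc i"] by (intro Lambda_complex) auto
  next
    show "(\<Sum>i<m. LBINT u. indicator {t i<..t (Suc i)} u *\<^sub>R ((exp (c i) - 1) * complex_of_real (l u))) = (\<Sum>i<m. (exp (c i) - 1) * of_real (\<Lambda> (t i) (t (Suc i))))"
    proof (intro sum.cong refl)
      fix i assume "i \<in> {..<m}"
      then show "(LBINT u. indicator {t i<..t (Suc i)} u *\<^sub>R ((exp (c i) - 1) * complex_of_real (l u))) = (exp (c i) - 1) * of_real (\<Lambda> (t i) (t (Suc i)))"
        using tin[of i] tin[of "Suc i"] by (intro Lambda_complex) auto
    qed
  qed
  finally have R: "exp (LBINT u:{0<..\<tau>}. (exp (step_fun g m u) - 1) * complex_of_real (l u)) = (\<Prod>i<m. exp (of_real (\<Lambda> (t i) (t (Suc i))) * (exp (c i) - 1)))"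
    by (simp add: exp_sum mult.commute)
  have i: "integrable M (\<lambda>\<omega>. exp (LINT u|path_measure \<tau> (Y \<omega>). step_fun g m u))"
    by (rule Bochner_Integration.integrable_cong[THEN iffD1, OF refl _ E(1)]) (simp only: pint)
  have e: "(LINT \<omega>|M. exp (LINT u|path_measure \<tau> (Y \<omega>). step_fun g m u)) = (LINT \<omega>|M. exp (\<Sum>i<m. c i * of_nat (Y \<omega> (t (Suc i)) - Y \<omega> (t i))))"
    by (rule Bochner_Integration.integral_cong[OF refl]) (simp only: pint)
  show ?thesis unfolding campbell_def R e E(2) using i by simp
qed

text \<open>Dominated convergence at three levels: for each path measure, for the expectation, and
  for the Lebesgue integral in the exponent. At the first level the null set \<open>A\<close> is
  harmless by \<open>AE_path_null\<close>.\<close>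

lemma campbell_limit:
  assumes f: "\<And>m. campbell (f m)" and [measurable]: "\<And>m. f m \<in> borel_measurable borel" "F \<in> borel_measurable borel"
    and B: "\<And>m u. cmod (f m u) \<le> B" "\<And>u. cmod (F u) \<le> B"
    and A: "A \<in> null_sets lborel" and lim: "\<And>u. u \<in> {0<..\<tau>} - A \<Longrightarrow> (\<lambda>m. f m u) \<longlonglongrightarrow> F u"
  shows "campbell F"
proof -
  have [measurable]: "A \<in> sets borel" using A by auto
  have e: "cmod (exp z) \<le> exp b" if "cmod z \<le> b" for z b
    using that complex_Re_le_cmod[of z] by (simp add: norm_exp_eq_Re)
  have plim: "AE \<omega> in M. (\<lambda>m. exp (LINT u|path_measure \<tau> (Y \<omega>). f m u)) \<longlonglongrightarrow> exp (LINT u|path_measure \<tau> (Y \<omega>). F u)"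
    using AE_path_null[OF A] AE_space
  proof eventually_elim
    case (elim \<omega>)
    note x = tau Y_path[OF elim(2)]
    interpret Q: finite_measure "path_measure \<tau> (Y \<omega>)" by (rule finite_path_measure[OF x])
    have nA: "AE u in path_measure \<tau> (Y \<omega>). u \<notin> A"
      using elim(1) by (intro AE_not_in) (auto simp: null_sets_def)
    have "(\<lambda>m. LINT u|path_measure \<tau> (Y \<omega>). f m u) \<longlonglongrightarrow> (LINT u|path_measure \<tau> (Y \<omega>). F u)"
    proof (rule integral_dominated_convergence[where w="\<lambda>_. B"])
      show "AE u in path_measure \<tau> (Y \<omega>). (\<lambda>m. f m u) \<longlonglongrightarrow> F u"
        using nA AE_path_measure[OF x] by eventually_elim (use lim in auto)
    qed (use B in auto)
    then show ?case by (rule tendsto_exp)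
  qed
  have dom: "AE \<omega> in M. cmod (exp (LINT u|path_measure \<tau> (Y \<omega>). G u)) \<le> exp (B * real (Y \<omega> \<tau>))"
    if "G \<in> borel_measurable borel" "\<And>u. cmod (G u) \<le> B" for G
  proof (rule AE_I2)
    fix \<omega> assume "\<omega> \<in> space M"
    from path_integrable_bounded(2)[OF tau Y_path[OF this] that]
    show "cmod (exp (LINT u|path_measure \<tau> (Y \<omega>). G u)) \<le> exp (B * real (Y \<omega> \<tau>))" by (rule e)
  qed
  have meas: "(\<lambda>\<omega>. exp (LINT u|path_measure \<tau> (Y \<omega>). G u)) \<in> borel_measurable M"
    if "G \<in> borel_measurable borel" "\<And>u. cmod (G u) \<le> B" for G
    using measurable_compose[OF Y_measurable path_integral_measurable_complex[OF tau that]] by measurable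
  have i: "integrable M (\<lambda>\<omega>. exp (LINT u|path_measure \<tau> (Y \<omega>). F u))"
    by (rule Bochner_Integration.integrable_bound[OF total_exp_integrable[of B] meas]) (use dom[of F] B in auto)
  have 1: "(\<lambda>m. LINT \<omega>|M. exp (LINT u|path_measure \<tau> (Y \<omega>). f m u)) \<longlonglongrightarrow> (LINT \<omega>|M. exp (LINT u|path_measure \<tau> (Y \<omega>). F u))"
    by (rule integral_dominated_convergence[OF meas meas total_exp_integrable[of B] plim dom]) (use B in auto)
  have "(\<lambda>m. LBINT u. indicator {0<..\<tau>} u *\<^sub>R ((exp (f m u) - 1) * complex_of_real (l u))) \<longlonglongrightarrow> (LBINT u. indicator {0<..\<tau>} u *\<^sub>R ((exp (F u) - 1) * complex_of_real (l u)))"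
  proof (rule integral_dominated_convergence[where w="\<lambda>u. indicator {0<..\<tau>} u *\<^sub>R ((exp B + 1) * L)"])
    show "integrable lborel (\<lambda>u. indicator {0<..\<tau>} u *\<^sub>R ((exp B + 1) * L))"
      by (intro integrable_scaleR_left) (auto simp: emeasure_lborel_Ioc tau less_imp_le)
    show "AE u in lborel. (\<lambda>m. indicator {0<..\<tau>} u *\<^sub>R ((exp (f m u) - 1) * complex_of_real (l u))) \<longlonglongrightarrow> indicator {0<..\<tau>} u *\<^sub>R ((exp (F u) - 1) * complex_of_real (l u))"
      using AE_not_in[OF A]
    proof eventually_elim
      case (elim u)
      then show ?case
        by (cases "u \<in> {0<..\<tau>}") (auto intro!: tendsto_intros lim)
    qed
    fix m
    show "AE u in lborel. norm (indicator {0<..\<tau>} u *\<^sub>R ((exp (f m u) - 1) * complex_of_real (l u))) \<le> indicator {0<..\<tau>} u *\<^sub>R ((exp B + 1) * L)"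
    proof (rule AE_I2)
      fix u
      show "norm (indicator {0<..\<tau>} u *\<^sub>R ((exp (f m u) - 1) * complex_of_real (l u))) \<le> indicator {0<..\<tau>} u *\<^sub>R ((exp B + 1) * L)"
      proof (cases "u \<in> {0<..\<tau>}")
        case True
        have "cmod (exp (f m u) - 1) \<le> exp B + 1"
          using norm_triangle_ineq4[of "exp (f m u)" 1] e[OF B(1)[of m u]] unfolding norm_one by linarith
        moreover have "\<bar>l u\<bar> \<le> L" using True l_ge[of u] l_le[of u] c_pos by auto
        ultimately have "cmod (exp (f m u) - 1) * \<bar>l u\<bar> \<le> (exp B + 1) * L"
          by (intro mult_mono) (auto intro: add_nonneg_nonneg)
        then show ?thesis using True by (simp add: norm_mult)
      qed simp
    qed
  qed measurable
  then have "(\<lambda>m. exp (LBINT u:{0<..\<tau>}. (exp (f m u) - 1) * complex_of_real (l u))) \<longlonglongrightarrow> exp (LBINT u:{0<..\<tau>}. (exp (F u) - 1) * complex_of_real (l u))"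
    unfolding set_lebesgue_integral_def by (rule tendsto_exp)
  moreover have "exp (LBINT u:{0<..\<tau>}. (exp (f m u) - 1) * complex_of_real (l u)) = (LINT \<omega>|M. exp (LINT u|path_measure \<tau> (Y \<omega>). f m u))" for m
    using f[of m] by (simp add: campbell_def)
  ultimately have "(LINT \<omega>|M. exp (LINT u|path_measure \<tau> (Y \<omega>). F u)) = exp (LBINT u:{0<..\<tau>}. (exp (F u) - 1) * complex_of_real (l u))"
    using LIMSEQ_unique[OF 1] by simp
  with i show ?thesis by (simp add: campbell_def)
qed

lemma campbell_continuous:
  assumes g: "continuous_on UNIV g" and B: "\<And>u. cmod (g u) \<le> B"
  shows "campbell g"
proof (rule campbell_limit[where f="\<lambda>m. step_fun g (Suc m)" and A="{}"])
  show "campbell (step_fun g (Suc m))" for m by (rule campbell_step) simp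
  show "step_fun g (Suc m) \<in> borel_measurable borel" for m unfolding step_fun_def by measurable
  show "g \<in> borel_measurable borel" using g by (rule borel_measurable_continuous_onI)
  show "cmod (step_fun g (Suc m) u) \<le> B" for m u
  proof (cases "u \<in> {0<..\<tau>}")
    case True
    show ?thesis using grid_step_sum[OF tau _ True, of "Suc m" g] B unfolding step_fun_def by simp
  next
    case False
    have "u \<notin> {real i * \<tau> / real (Suc m)<..real (Suc i) * \<tau> / real (Suc m)}" if "i < Suc m" for i
      using grid_in[of "Suc m" i] grid_in[of "Suc m" "Suc i"] that False by auto
    then have "step_fun g (Suc m) u = 0" unfolding step_fun_def by (intro sum.neutral) auto
    then show ?thesis using order_trans[OF norm_ge_zero B[of 0]] by simp
  qed
  show "(\<lambda>m. step_fun g (Suc m) u) \<longlonglongrightarrow> g u" if "u \<in> {0<..\<tau>} - {}" for u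
  proof -
    have "isCont g u" using g by (simp add: continuous_on_eq_continuous_at)
    then have "(\<lambda>m. g (real_of_int \<lceil>u * real (Suc m) / \<tau>\<rceil> * \<tau> / real (Suc m))) \<longlonglongrightarrow> g u"
      using grid_ceiling_tendsto[OF tau] by (rule isCont_tendsto_compose)
    moreover have "step_fun g (Suc m) u = g (real_of_int \<lceil>u * real (Suc m) / \<tau>\<rceil> * \<tau> / real (Suc m))" for m
      using grid_step_sum[OF tau _, of "Suc m" u g] that unfolding step_fun_def by simp
    ultimately show ?thesis by simp
  qed
qed (use B in auto)

text \<open>A measurable function is an almost everywhere limit of continuous ones, but these need
  not be bounded. A continuous radial truncation gives them a common bound and leaves the values of
  \<open>f\<close> fixed.\<close>

lemma campbell_measurable:
  assumes f [measurable]: "f \<in> borel_measurable borel" and B: "\<And>u. cmod (f u) \<le> B"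
  shows "campbell f"
proof -
  \<comment> \<open>Adding 1 makes the truncation radius positive even if \<open>B\<close> is
    0.\<close>
  define K where "K = B + 1"
  have K: "K > 0" "cmod (f u) \<le> K" for u using B[of u] order_trans[OF norm_ge_zero B[of u]] by (auto simp: K_def)
  have "f \<in> borel_measurable lborel" by simp
  then have "f measurable_on UNIV"
    by (intro lebesgue_measurable_imp_measurable_on measurable_completion) auto
  then obtain A g where A: "negligible A" and g': "\<forall>n. continuous_on UNIV (g n)"
    and lim': "\<forall>x. x \<notin> A \<longrightarrow> (\<lambda>n. g n x) \<longlonglongrightarrow> (if x \<in> UNIV then f x else 0)"
    unfolding measurable_on_def by blast
  have g: "continuous_on UNIV (g n)" for n using g' by blast
  have lim: "(\<lambda>n. g n x) \<longlonglongrightarrow> f x" if "x \<notin> A" for x using lim' that by simp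
  \<comment> \<open>The exceptional set is null for the completed measure only, so it is enlarged to
    a Borel null set.\<close>
  have "A \<in> null_sets (completion lborel)" using A by (simp add: negligible_iff_null_sets)
  then obtain A' where A': "A' \<in> null_sets lborel" "A \<subseteq> A'"
    by (auto simp: null_sets_completion_iff2)
  define clip where "clip z = complex_of_real (K / max K (cmod z)) * z" for z
  have mx: "max K (cmod z) \<noteq> 0" for z using K(1) by linarith
  have clip_cont: "continuous_on UNIV clip" unfolding clip_def
    by (intro continuous_on_mult continuous_on_of_real continuous_on_divide continuous_on_max continuous_on_norm
        continuous_on_const continuous_on_id) (simp add: mx)
  have clip_le: "cmod (clip z) \<le> K" for z
  proof (cases "cmod z \<le> K")
    case True
    then have "clip z = z" using K(1) by (simp add: clip_def max_absorb1)
    then show ?thesis using True by simp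
  next
    case False
    then have "cmod (clip z) = K / cmod z * cmod z" using K(1) by (simp add: clip_def norm_mult norm_divide max_absorb2)
    then show ?thesis using False K(1) by simp
  qed
  have clip_id: "clip (f x) = f x" for x using K by (simp add: clip_def max_absorb1)
  show ?thesis
  proof (rule campbell_limit[where f="\<lambda>n u. clip (g n u)" and A=A' and B=K])
    show "campbell (\<lambda>u. clip (g n u))" for n
      by (rule campbell_continuous[OF _ clip_le]) (rule continuous_on_compose2[OF clip_cont g], auto)
    show "(\<lambda>u. clip (g n u)) \<in> borel_measurable borel" for n
      by (intro borel_measurable_continuous_onI continuous_on_compose2[OF clip_cont g]) auto
    show "(\<lambda>n. clip (g n u)) \<longlonglongrightarrow> f u" if "u \<in> {0<..\<tau>} - A'" for u
    proof -
      have "isCont clip (f u)" using clip_cont by (simp add: continuous_on_eq_continuous_at)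
      then have "(\<lambda>n. clip (g n u)) \<longlonglongrightarrow> clip (f u)"
        by (rule isCont_tendsto_compose) (use lim A' that in auto)
      then show ?thesis by (simp add: clip_id)
    qed
  qed (use clip_le K A' in auto)
qed

end

section \<open>Weighted integrals of likelihood fields\<close>

text \<open>Countable subadditivity of truncation at 1: the tail can be cut into blocks, each
  truncated separately before any moment bound is applied.\<close>

lemma min_one_suminf_le: "min 1 (\<Sum>m. x m) \<le> (\<Sum>m. min 1 (x m))" for x :: "nat \<Rightarrow> ennreal"
proof (cases "\<exists>j. x j > 1")
  case True
  then obtain j where j: "x j > 1" by blast
  have "(1::ennreal) = (\<Sum>m\<in>{j}. min 1 (x m))" using j by (simp add: min_absorb1)
  also have "\<dots> \<le> (\<Sum>m. min 1 (x m))" by (rule sum_le_suminf) auto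
  finally show ?thesis by (rule order_trans[OF min.cobounded1])
next
  case False
  then have "min 1 (x m) = x m" for m by (simp add: min_absorb2 not_less)
  then show ?thesis by simp
qed

lemma min_one_add_le: "min 1 (a + b) \<le> a + min 1 b" for a b :: ennreal
  by (simp add: min_def add_increasing2 add_increasing)

lemma min_one_sum_le:
  fixes x :: "'i \<Rightarrow> ennreal"
  assumes "finite I"
  shows "min 1 (\<Sum>i\<in>I. x i) \<le> (\<Sum>i\<in>I. min 1 (x i))"
  using assms
proof induction
  case (insert i I)
  have "min 1 (x i + (\<Sum>i\<in>I. x i)) \<le> min 1 (x i) + min 1 (\<Sum>i\<in>I. x i)"
    by (auto simp: min_def add_increasing add_increasing2)
  also have "\<dots> \<le> min 1 (x i) + (\<Sum>i\<in>I. min 1 (x i))" by (intro add_left_mono insert.IH)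
  finally show ?case using insert.hyps by simp
qed simp

lemma min_one_le_sqrt: "0 \<le> b \<Longrightarrow> min 1 (ennreal b) \<le> ennreal (sqrt b)"
proof (cases "b \<le> 1")
  case True
  assume "0 \<le> b"
  then have "sqrt b * sqrt b \<le> sqrt b * 1" using True by (intro mult_left_mono) auto
  then have "b \<le> sqrt b" using \<open>0 \<le> b\<close> by simp
  then show ?thesis by (intro min.coboundedI2 ennreal_leI)
next
  case False
  then have "ennreal 1 \<le> ennreal (sqrt b)" by (intro ennreal_leI) simp
  then show ?thesis by (intro min.coboundedI1) simp
qed

abbreviation block :: "real \<Rightarrow> nat \<Rightarrow> real set" where
  "block c m \<equiv> {c + real m..<c + real (Suc m)}"

abbreviation grid_floor :: "real \<Rightarrow> nat \<Rightarrow> real \<Rightarrow> real" where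
  "grid_floor c N v \<equiv> c + real_of_int \<lfloor>real N * (v - c)\<rfloor> / real N"

text \<open>The general \<open>h\<close> serves two purposes: it presents a Riemann sum as the
  integral of a step function, and with \<open>h = 1\<close> it is the partition of an interval into
  cells.\<close>

lemma grid_floor_sum:
  fixes h :: "real \<Rightarrow> 'b::real_vector" and c :: real
  assumes N: "0 < N"
  shows "indicator {c..<c + real D} v *\<^sub>R h (grid_floor c N v) =
    (\<Sum>i<D * N. indicator {c + real i / real N..<c + real (Suc i) / real N} v *\<^sub>R h (c + real i / real N))"
proof -
  have iff: "v \<in> {c + real i / real N..<c + real (Suc i) / real N} \<longleftrightarrow> \<lfloor>real N * (v - c)\<rfloor> = int i" for i
  proof -
    have "v \<in> {c + real i / real N..<c + real (Suc i) / real N} \<longleftrightarrow> real i \<le> real N * (v - c) \<and> real N * (v - c) < real i + 1"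
      using N by (auto simp: field_simps)
    also have "\<dots> \<longleftrightarrow> \<lfloor>real N * (v - c)\<rfloor> = int i" by (simp add: floor_eq_iff)
    finally show ?thesis .
  qed
  show ?thesis
  proof (cases "v \<in> {c..<c + real D}")
    case True
    define j where "j = nat \<lfloor>real N * (v - c)\<rfloor>"
    have "0 \<le> real N * (v - c)" "real N * (v - c) < real (D * N)" using True N by (auto simp: mult.commute)
    then have j: "\<lfloor>real N * (v - c)\<rfloor> = int j" "j < D * N" unfolding j_def by linarith+
    have "(\<Sum>i<D * N. indicator {c + real i / real N..<c + real (Suc i) / real N} v *\<^sub>R h (c + real i / real N)) =
       (\<Sum>i<D * N. if i = j then h (c + real i / real N) else 0)"
      unfolding indicator_def iff j(1) by (intro sum.cong) auto
    also have "\<dots> = h (c + real j / real N)" using j by simp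
    finally show ?thesis using True j by simp
  next
    case False
    have "v \<notin> {c + real i / real N..<c + real (Suc i) / real N}" if "i < D * N" for i
    proof
      assume v: "v \<in> {c + real i / real N..<c + real (Suc i) / real N}"
      have "real (Suc i) \<le> real (D * N)" using that by (intro of_nat_mono) simp
      then have "real (Suc i) / real N \<le> real D" using N by (simp add: divide_le_eq)
      moreover have "0 \<le> real i / real N" by simp
      ultimately have "v \<in> {c..<c + real D}" using v by (simp only: atLeastLessThan_iff) linarith
      with False show False by simp
    qed
    then have "(\<Sum>i<D * N. indicator {c + real i / real N..<c + real (Suc i) / real N} v *\<^sub>R h (c + real i / real N)) = 0"
      by (intro sum.neutral) auto
    then show ?thesis using False by simp
  qed
qed

lemma grid_floor_bounds:
  fixes c :: real
  assumes "0 < N"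
  shows "grid_floor c N v \<le> v" "v - (grid_floor c N v) \<le> 1 / real N"
    "c \<le> v \<Longrightarrow> c \<le> grid_floor c N v"
proof -
  define f where "f = real_of_int \<lfloor>real N * (v - c)\<rfloor>"
  have f: "f \<le> real N * (v - c)" "real N * (v - c) \<le> f + 1" unfolding f_def by linarith+
  have N: "0 < real N" using assms by simp
  have "f / real N \<le> v - c" using f(1) N by (simp add: divide_le_eq mult.commute)
  moreover have "v - c \<le> f / real N + 1 / real N"
    unfolding add_divide_distrib[symmetric] using f(2) N by (simp add: le_divide_eq mult.commute)
  ultimately show "grid_floor c N v \<le> v" "v - (grid_floor c N v) \<le> 1 / real N"
    unfolding f_def by linarith+
  assume "c \<le> v"
  then have "0 \<le> f" unfolding f_def using N by simp
  then show "c \<le> grid_floor c N v" using N unfolding f_def by simp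
qed

lemma integral_grid_floor:
  fixes h :: "real \<Rightarrow> real" and c :: real
  assumes N: "0 < N"
  shows "integrable lborel (\<lambda>v. indicator {c..<c + real D} v *\<^sub>R h (grid_floor c N v))" (is ?goalA)
    and "(LBINT v. indicator {c..<c + real D} v *\<^sub>R h (grid_floor c N v)) = (\<Sum>i<D * N. h (c + real i / real N) / real N)" (is ?goalB)
proof -
  have i: "integrable lborel (\<lambda>v. indicator {c + real i / real N..<c + real (Suc i) / real N} v *\<^sub>R h (c + real i / real N))" for i
    by (intro integrable_scaleR_left) (auto simp: emeasure_lborel_Ico divide_right_mono)
  show ?goalA
    unfolding grid_floor_sum[OF N] by (intro Bochner_Integration.integrable_sum i)
  have "measure lborel {c + real i / real N..<c + real (Suc i) / real N} = 1 / real N" for i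
    by (subst measure_lborel_Ico) (simp_all add: divide_right_mono diff_divide_distrib[symmetric])
  then show ?goalB
    unfolding grid_floor_sum[OF N] by (subst Bochner_Integration.integral_sum[OF i]) (simp add: divide_right_mono)
qed

text \<open>First term: squared root increments over \<open>(m + 1) ^ 5\<close> cells; the linear
  factor and the weight mass, both of order \<open>m + 1\<close>, against the mesh leave at most an
  inverse square. Second term: \<open>(m + 1) ^ 5\<close> nodes and one factor \<open>m + 1\<close>
  from the square root of linear factor times mass, against exponential decay.\<close>

definition tail_rate :: "real \<Rightarrow> real \<Rightarrow> real \<Rightarrow> real \<Rightarrow> real \<Rightarrow> nat \<Rightarrow> real" where
  "tail_rate c C q A K m = 2 * (1 + \<bar>c\<bar> + K) * A * C / (real m + 1)\<^sup>2 +
     sqrt (2 * (1 + \<bar>c\<bar> + K) * A) * exp (- q * c) * ((real m + 1) ^ 6 * exp (- q * real m))"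

definition tail_sum :: "real \<Rightarrow> real \<Rightarrow> real \<Rightarrow> real \<Rightarrow> real \<Rightarrow> nat \<Rightarrow> real" where
  "tail_sum c C q A K D = (\<Sum>m. tail_rate c C q A K (m + D))"

lemma tail_rate_summable:
  assumes q: "0 < q"
  shows "summable (tail_rate c C q A K)"
  unfolding tail_rate_def
proof (intro summable_add summable_mult)
  have "summable (\<lambda>n. inverse (real (Suc n) ^ 2))"
    using inverse_power_summable[of 2, where ?'a=real] by (subst summable_Suc_iff) auto
  then have "summable (\<lambda>n. (2 * (1 + \<bar>c\<bar> + K) * A * C) * inverse (real (Suc n) ^ 2))" by (rule summable_mult)
  then show "summable (\<lambda>m. 2 * (1 + \<bar>c\<bar> + K) * A * C / (real m + 1)\<^sup>2)"
    by (simp add: divide_inverse add.commute)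
  \<comment> \<open>Half of the exponential rate absorbs the polynomial; the other half gives a
    geometric series.\<close>
  have "(\<lambda>m. (real m + 1) ^ 6 * exp (- (q / 2) * real m)) \<longlonglongrightarrow> 0" using q by real_asymp
  then have "Bseq (\<lambda>m. (real m + 1) ^ 6 * exp (- (q / 2) * real m))" by (intro convergent_imp_Bseq) (auto simp: convergent_def)
  then obtain b where b: "b > 0" "\<And>m. norm ((real m + 1) ^ 6 * exp (- (q / 2) * real m)) \<le> b" unfolding Bseq_def by blast
  show "summable (\<lambda>m. (real m + 1) ^ 6 * exp (- q * real m))"
  proof (rule summable_comparison_test)
    show "summable (\<lambda>m. b * exp (- (q / 2)) ^ m)" using q by (intro summable_mult summable_geometric) auto
    show "\<exists>n0. \<forall>m\<ge>n0. norm ((real m + 1) ^ 6 * exp (- q * real m)) \<le> b * exp (- (q / 2)) ^ m"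
    proof (intro exI allI impI)
      fix m :: nat
      have "exp (- q * real m) = exp (- (q / 2) * real m) * exp (- (q / 2)) ^ m"
        by (simp add: exp_of_nat_mult[symmetric] exp_add[symmetric] algebra_simps)
      then have "norm ((real m + 1) ^ 6 * exp (- q * real m)) = norm ((real m + 1) ^ 6 * exp (- (q / 2) * real m)) * exp (- (q / 2)) ^ m"
        by (simp add: abs_mult)
      also have "\<dots> \<le> b * exp (- (q / 2)) ^ m" by (intro mult_right_mono b) simp
      finally show "norm ((real m + 1) ^ 6 * exp (- q * real m)) \<le> b * exp (- (q / 2)) ^ m" .
    qed
  qed
qed

lemma tail_sum_tendsto: "0 < q \<Longrightarrow> tail_sum c C q A K \<longlonglongrightarrow> 0"
  unfolding tail_sum_def using suminf_exist_split2[OF tail_rate_summable] by simp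

lemma ennreal_lin3:
  "0 \<le> k \<Longrightarrow> 0 \<le> x \<Longrightarrow> 0 \<le> e \<Longrightarrow> 0 \<le> y \<Longrightarrow> 0 \<le> z \<Longrightarrow>
    ennreal (k * x + e * y + e * z) = ennreal k * ennreal x + (ennreal e * ennreal y + ennreal e * ennreal z)"
  by (simp add: ennreal_mult add.assoc)

definition weighted_integral :: "(real \<Rightarrow> 'a \<Rightarrow> real) \<Rightarrow> (real \<Rightarrow> real) \<Rightarrow> real \<Rightarrow> 'a \<Rightarrow> real" where
  "weighted_integral Z w k \<omega> = (LBINT v. (v - k) * w v * Z v \<omega>)"

text \<open>Only finitely many values of \<open>Z\<close> enter, and the weight is frozen at its
  limit \<open>b\<close>, so that the sum is the same function of these values in every experiment
  and in the limit.\<close>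

definition grid_sum :: "(real \<Rightarrow> 'a \<Rightarrow> real) \<Rightarrow> real \<Rightarrow> real \<Rightarrow> real \<Rightarrow> nat \<Rightarrow> nat \<Rightarrow> 'a \<Rightarrow> real" where
  "grid_sum Z c b k D N \<omega> = (\<Sum>i<D * N. b * (c + real i / real N - k) * Z (c + real i / real N) \<omega> / real N)"

text \<open>The constants \<open>c\<close>, \<open>C\<close>, \<open>q\<close>, \<open>A\<close> are
  shared by all experiments and by the limit, which makes the bounds below uniform. Moments are
  assumed only on \<open>S\<close>, the local parameters inside the model, and the weight vanishes
  elsewhere. It is controlled by its mass on unit blocks and may be unbounded.\<close>

locale likelihood_field = prob_space M for M :: "'a measure" +
  fixes Z :: "real \<Rightarrow> 'a \<Rightarrow> real" and S :: "real set" and w :: "real \<Rightarrow> real" and c C q A :: real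
  assumes Z_measurable [measurable]: "(\<lambda>(v, \<omega>). Z v \<omega>) \<in> borel_measurable (borel \<Otimes>\<^sub>M M)"
    and w_measurable [measurable]: "w \<in> borel_measurable borel"
    and Z_nonneg: "\<And>v \<omega>. 0 \<le> Z v \<omega>" and w_nonneg: "\<And>v. 0 \<le> w v"
    and S_ge: "S \<subseteq> {c..}" and w_outside: "\<And>v. v \<notin> S \<Longrightarrow> w v = 0"
    and C_nonneg: "0 \<le> C" and A_nonneg: "0 \<le> A" and q_pos: "0 < q"
    and Z_mean: "\<And>v. v \<in> S \<Longrightarrow> (\<integral>\<^sup>+\<omega>. ennreal (Z v \<omega>) \<partial>M) \<le> 1"
    and Z_sqrt_diff: "\<And>u v. u \<in> S \<Longrightarrow> v \<in> S \<Longrightarrow> \<bar>u - v\<bar> \<le> 1 \<Longrightarrow>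
        (\<integral>\<^sup>+\<omega>. ennreal ((sqrt (Z u \<omega>) - sqrt (Z v \<omega>))\<^sup>2) \<partial>M) \<le> ennreal (C * \<bar>u - v\<bar>)"
    and Z_sqrt_tail: "\<And>v. v \<in> S \<Longrightarrow> 1 \<le> v \<Longrightarrow> (\<integral>\<^sup>+\<omega>. ennreal (sqrt (Z v \<omega>)) \<partial>M) \<le> ennreal (exp (- q * v))"
    and w_mass: "\<And>m. (\<integral>\<^sup>+v. ennreal (w v) * indicator (block c m) v \<partial>lborel) \<le> ennreal (A * (1 + real m))"
begin

sublocale P: pair_sigma_finite lborel M ..

lemma Z_measurable1 [measurable]: "Z v \<in> borel_measurable M"
  using measurable_Pair2[OF Z_measurable, of v] by simp

lemma Z_measurable': "(\<lambda>x. Z (fst x) (snd x)) \<in> borel_measurable (borel \<Otimes>\<^sub>M M)"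
  using Z_measurable by (simp add: case_prod_beta')

lemma Z_comp_measurable [measurable (raw)]:
  "f \<in> borel_measurable Q \<Longrightarrow> g \<in> Q \<rightarrow>\<^sub>M M \<Longrightarrow> (\<lambda>x. Z (f x) (g x)) \<in> borel_measurable Q"
  using measurable_compose[OF measurable_Pair Z_measurable', of f Q g] by simp

text \<open>A difference of squares factors into difference and sum of the roots. The
  arithmetic-geometric inequality, weighted by the root \<open>e\<close> of the distance, balances
  the small second moment of the difference against the bounded one of the sum; hence the order one
  half in the distance.\<close>

lemma Z_diff:
  assumes uv: "u \<in> S" "v \<in> S" "\<bar>u - v\<bar> \<le> 1"
  shows "(\<integral>\<^sup>+\<omega>. ennreal \<bar>Z u \<omega> - Z v \<omega>\<bar> \<partial>M) \<le> ennreal ((C / 2 + 2) * sqrt \<bar>u - v\<bar>)"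
proof (cases "u = v")
  case False
  define e where "e = sqrt \<bar>u - v\<bar>"
  have e: "e > 0" "e * e = \<bar>u - v\<bar>" using False by (auto simp: e_def)
  have le: "\<bar>Z u \<omega> - Z v \<omega>\<bar> \<le> 1 / (2 * e) * (sqrt (Z u \<omega>) - sqrt (Z v \<omega>))\<^sup>2 + e * Z u \<omega> + e * Z v \<omega>" for \<omega>
  proof -
    define a b where "a = sqrt (Z u \<omega>)" and "b = sqrt (Z v \<omega>)"
    have ab: "Z u \<omega> = a\<^sup>2" "Z v \<omega> = b\<^sup>2" using Z_nonneg by (auto simp: a_def b_def)
    have "0 \<le> (\<bar>a - b\<bar> - e * \<bar>a + b\<bar>)\<^sup>2" by simp
    then have "2 * e * (\<bar>a - b\<bar> * \<bar>a + b\<bar>) \<le> (a - b)\<^sup>2 + e\<^sup>2 * (a + b)\<^sup>2"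
      by (simp add: power2_diff power_mult_distrib algebra_simps)
    moreover have "e\<^sup>2 * (a + b)\<^sup>2 \<le> e\<^sup>2 * (2 * a\<^sup>2 + 2 * b\<^sup>2)"
    proof (rule mult_left_mono)
      show "(a + b)\<^sup>2 \<le> 2 * a\<^sup>2 + 2 * b\<^sup>2"
        using zero_le_power2[of "a - b"] by (simp add: power2_eq_square algebra_simps)
    qed simp
    moreover have "\<bar>a - b\<bar> * \<bar>a + b\<bar> = \<bar>a\<^sup>2 - b\<^sup>2\<bar>"
      unfolding abs_mult[symmetric] by (simp add: power2_eq_square algebra_simps)
    ultimately have 1: "2 * e * \<bar>a\<^sup>2 - b\<^sup>2\<bar> \<le> (a - b)\<^sup>2 + e\<^sup>2 * (2 * a\<^sup>2 + 2 * b\<^sup>2)"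
      by simp
    have "\<bar>a\<^sup>2 - b\<^sup>2\<bar> \<le> ((a - b)\<^sup>2 + e\<^sup>2 * (2 * a\<^sup>2 + 2 * b\<^sup>2)) / (2 * e)"
      using 1 e(1) by (simp add: le_divide_eq mult.commute)
    also have "e\<^sup>2 * (2 * a\<^sup>2 + 2 * b\<^sup>2) = (2 * e) * (e * a\<^sup>2 + e * b\<^sup>2)"
      by (simp add: power2_eq_square algebra_simps)
    also have "((a - b)\<^sup>2 + (2 * e) * (e * a\<^sup>2 + e * b\<^sup>2)) / (2 * e) = 1 / (2 * e) * (a - b)\<^sup>2 + e * a\<^sup>2 + e * b\<^sup>2"
      using e(1) by (simp add: add_divide_distrib)
    finally have "\<bar>a\<^sup>2 - b\<^sup>2\<bar> \<le> 1 / (2 * e) * (a - b)\<^sup>2 + e * a\<^sup>2 + e * b\<^sup>2" .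
    then show ?thesis unfolding ab[symmetric] by (simp only: a_def b_def)
  qed
  have "(\<integral>\<^sup>+\<omega>. ennreal \<bar>Z u \<omega> - Z v \<omega>\<bar> \<partial>M) \<le> (\<integral>\<^sup>+\<omega>. ennreal (1 / (2 * e)) * ennreal ((sqrt (Z u \<omega>) - sqrt (Z v \<omega>))\<^sup>2) + (ennreal e * ennreal (Z u \<omega>) + ennreal e * ennreal (Z v \<omega>)) \<partial>M)"
  proof (rule nn_integral_mono)
    fix \<omega>
    have "ennreal \<bar>Z u \<omega> - Z v \<omega>\<bar> \<le> ennreal (1 / (2 * e) * (sqrt (Z u \<omega>) - sqrt (Z v \<omega>))\<^sup>2 + e * Z u \<omega> + e * Z v \<omega>)"
      by (intro ennreal_leI le)
    also have "\<dots> = ennreal (1 / (2 * e)) * ennreal ((sqrt (Z u \<omega>) - sqrt (Z v \<omega>))\<^sup>2) + (ennreal e * ennreal (Z u \<omega>) + ennreal e * ennreal (Z v \<omega>))"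
      by (rule ennreal_lin3) (use e(1) Z_nonneg in auto)
    finally show "ennreal \<bar>Z u \<omega> - Z v \<omega>\<bar> \<le> ennreal (1 / (2 * e)) * ennreal ((sqrt (Z u \<omega>) - sqrt (Z v \<omega>))\<^sup>2) + (ennreal e * ennreal (Z u \<omega>) + ennreal e * ennreal (Z v \<omega>))" .
  qed
  also have "\<dots> = ennreal (1 / (2 * e)) * (\<integral>\<^sup>+\<omega>. ennreal ((sqrt (Z u \<omega>) - sqrt (Z v \<omega>))\<^sup>2) \<partial>M) + (ennreal e * (\<integral>\<^sup>+\<omega>. ennreal (Z u \<omega>) \<partial>M) + ennreal e * (\<integral>\<^sup>+\<omega>. ennreal (Z v \<omega>) \<partial>M))"
    by (simp add: nn_integral_add nn_integral_cmult)
  also have "\<dots> \<le> ennreal (1 / (2 * e)) * ennreal (C * \<bar>u - v\<bar>) + (ennreal e * 1 + ennreal e * 1)"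
    by (intro add_mono mult_left_mono Z_sqrt_diff Z_mean uv) auto
  also have "\<dots> = ennreal (1 / (2 * e) * (C * \<bar>u - v\<bar>) + (e + e))"
    using e(1) C_nonneg by (simp add: ennreal_mult'[symmetric] ennreal_plus[symmetric] del: ennreal_plus)
  also have "1 / (2 * e) * (C * \<bar>u - v\<bar>) + (e + e) = (C / 2 + 2) * e"
    using e(1) unfolding e(2)[symmetric] by (simp add: field_simps)
  finally show ?thesis by (simp add: e_def)
qed simp

definition cell :: "nat \<Rightarrow> nat \<Rightarrow> nat \<Rightarrow> real set" where
  "cell m N i = {c + real m + real i / real N..<c + real m + real (Suc i) / real N}"

text \<open>On each of the \<open>(m + 1)\<^sup>5\<close> cells, \<open>Z v\<close> is at most twice \<open>Z (p i)\<close> plus twice the squared increment of \<open>\<surd>Z\<close>: the increments have small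
  mean, and \<open>min 1 x \<le> \<surd>x\<close> brings the decay of \<open>E (\<surd>Z)\<close> to bear on the node values.\<close>

lemma block_tail:
  assumes K: "0 \<le> K" and m: "1 \<le> c + real m"
  shows "(\<integral>\<^sup>+\<omega>. min 1 (\<integral>\<^sup>+v. ennreal ((\<bar>v\<bar> + K) * w v * Z v \<omega>) * indicator (block c m) v \<partial>lborel) \<partial>M)
    \<le> ennreal (tail_rate c C q A K m)"
proof -
  define N where "N = (m + 1) ^ 5"
  have N: "0 < N" by (simp add: N_def)
  define W where "W = (1 + \<bar>c\<bar> + K) * (real m + 1)"
  have W: "0 < W" using K by (auto simp: W_def intro!: mult_pos_pos add_pos_nonneg)
  have W_ge: "\<bar>v\<bar> + K \<le> W" if "v \<in> block c m" for v
  proof -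
    have "\<bar>v\<bar> + K \<le> \<bar>c\<bar> + real m + 1 + K" using that by auto
    also have "\<dots> \<le> W" using K by (auto simp: W_def algebra_simps intro!: add_nonneg_nonneg)
    finally show ?thesis .
  qed
  \<comment> \<open>Moment bounds hold only on \<open>S\<close>, so a node is chosen inside
    \<open>S\<close> in each cell that meets \<open>S\<close>; on the other cells the weight
    vanishes.\<close>
  define p where "p i = (SOME v. v \<in> cell m N i \<inter> S)" for i
  have p: "p i \<in> cell m N i \<inter> S" if "cell m N i \<inter> S \<noteq> {}" for i
    unfolding p_def by (rule someI_ex) (use that in blast)
  have cell_sub: "cell m N i \<subseteq> block c m" if "i < N" for i
  proof -
    have "real (Suc i) / real N \<le> 1" using that N by simp
    moreover have "0 \<le> real i / real N" by simp
    ultimately have "c + real m \<le> c + real m + real i / real N" "c + real m + real (Suc i) / real N \<le> c + real (Suc m)" by auto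
    then show ?thesis unfolding cell_def by (intro subsetI, unfold atLeastLessThan_iff) linarith
  qed
  have cell_meas [measurable]: "cell m N i \<in> sets borel" for i by (simp add: cell_def)
  define I where "I = {i. i < N \<and> cell m N i \<inter> S \<noteq> {}}"
  have I: "finite I" by (simp add: I_def)
  define \<mu> where "\<mu> i = enn2real (\<integral>\<^sup>+v. ennreal (w v) * indicator (cell m N i) v \<partial>lborel)" for i
  have \<mu>_fin: "(\<integral>\<^sup>+v. ennreal (w v) * indicator (cell m N i) v \<partial>lborel) \<le> ennreal (A * (1 + real m))" if "i < N" for i
    using cell_sub[OF that] by (intro order_trans[OF nn_integral_mono w_mass[of m]]) (auto simp: indicator_def)
  have \<mu>: "(\<integral>\<^sup>+v. ennreal (w v) * indicator (cell m N i) v \<partial>lborel) = ennreal (\<mu> i)" "0 \<le> \<mu> i" "\<mu> i \<le> A * (1 + real m)" if "i < N" for i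
  proof -
    show 1: "(\<integral>\<^sup>+v. ennreal (w v) * indicator (cell m N i) v \<partial>lborel) = ennreal (\<mu> i)"
      unfolding \<mu>_def using \<mu>_fin[OF that] by (intro ennreal_enn2real[symmetric]) (auto simp: le_less_trans)
    show "0 \<le> \<mu> i" by (simp add: \<mu>_def)
    show "\<mu> i \<le> A * (1 + real m)" using \<mu>_fin[OF that] A_nonneg unfolding 1 by (subst (asm) ennreal_le_iff) auto
  qed
  define X where "X i \<omega> = (\<integral>\<^sup>+v. ennreal (2 * W * w v * (sqrt (Z v \<omega>) - sqrt (Z (p i) \<omega>))\<^sup>2) * indicator (cell m N i) v \<partial>lborel)" for i \<omega>
  have X_meas [measurable]: "X i \<in> borel_measurable M" for i unfolding X_def by measurable
  have split: "(\<integral>\<^sup>+v. ennreal ((\<bar>v\<bar> + K) * w v * Z v \<omega>) * indicator (block c m) v \<partial>lborel)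
      \<le> (\<Sum>i\<in>I. X i \<omega>) + (\<Sum>i\<in>I. ennreal (2 * W * \<mu> i * Z (p i) \<omega>))" if om: "\<omega> \<in> space M" for \<omega>
  proof -
    have m1 [measurable]: "(\<lambda>v. Z v \<omega>) \<in> borel_measurable borel"
      by (rule Z_comp_measurable) (use om in auto)
    have "(\<integral>\<^sup>+v. ennreal ((\<bar>v\<bar> + K) * w v * Z v \<omega>) * indicator (block c m) v \<partial>lborel)
       \<le> (\<integral>\<^sup>+v. (\<Sum>i\<in>I. ennreal (2 * W * w v * (sqrt (Z v \<omega>) - sqrt (Z (p i) \<omega>))\<^sup>2) * indicator (cell m N i) v + ennreal (2 * W * Z (p i) \<omega>) * (ennreal (w v) * indicator (cell m N i) v)) \<partial>lborel)"
    proof (rule nn_integral_mono)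
      fix v
      show "ennreal ((\<bar>v\<bar> + K) * w v * Z v \<omega>) * indicator (block c m) v
        \<le> (\<Sum>i\<in>I. ennreal (2 * W * w v * (sqrt (Z v \<omega>) - sqrt (Z (p i) \<omega>))\<^sup>2) * indicator (cell m N i) v + ennreal (2 * W * Z (p i) \<omega>) * (ennreal (w v) * indicator (cell m N i) v))"
        (is "?L \<le> sum ?f I")
      proof (cases "v \<in> block c m \<and> v \<in> S")
        case False
        then have 0: "?L = 0" by (auto simp: w_outside indicator_def)
        show ?thesis unfolding 0 by (rule zero_le)
      next
        case True
        then have v: "v \<in> {c + real m..<c + real m + real 1}" "v \<in> S" by auto
        have "(1::real) = indicator {c + real m..<c + real m + real 1} v *\<^sub>R 1" using v by simp
        also have "\<dots> = (\<Sum>i<1 * N. indicator {c + real m + real i / real N..<c + real m + real (Suc i) / real N} v *\<^sub>R 1)"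
          by (rule grid_floor_sum[OF N])
        finally have "\<exists>j<N. v \<in> cell m N j"
          by (rule contrapos_pp) (auto simp: cell_def intro!: sum.neutral)
        then obtain j where j: "j < N" "v \<in> cell m N j" by blast
        then have jI: "j \<in> I" using v by (auto simp: I_def)
        define a b where "a = sqrt (Z v \<omega>)" and "b = sqrt (Z (p j) \<omega>)"
        have ab: "Z v \<omega> = a\<^sup>2" "Z (p j) \<omega> = b\<^sup>2" using Z_nonneg by (auto simp: a_def b_def)
        \<comment> \<open>Rearranging this square bounds \<open>a^2\<close> by twice
          \<open>(a - b)^2\<close> plus twice \<open>b^2\<close>.\<close>
        have "0 \<le> (a - 2 * b)\<^sup>2" by simp
        then have "a\<^sup>2 \<le> 2 * (a - b)\<^sup>2 + 2 * b\<^sup>2" by (simp add: power2_eq_square algebra_simps)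
        then have "(\<bar>v\<bar> + K) * w v * Z v \<omega> \<le> W * w v * (2 * (a - b)\<^sup>2 + 2 * b\<^sup>2)"
          unfolding ab using W_ge[of v] True W K w_nonneg by (intro mult_mono mult_nonneg_nonneg) auto
        also have "\<dots> = 2 * W * w v * (a - b)\<^sup>2 + (2 * W * b\<^sup>2) * w v" by (simp add: algebra_simps)
        finally have "ennreal ((\<bar>v\<bar> + K) * w v * Z v \<omega>) \<le> ennreal (2 * W * w v * (a - b)\<^sup>2 + (2 * W * b\<^sup>2) * w v)" by (rule ennreal_leI)
        also have "\<dots> = ennreal (2 * W * w v * (a - b)\<^sup>2) + ennreal (2 * W * b\<^sup>2) * ennreal (w v)"
          using W w_nonneg[of v] by (simp add: ennreal_mult)
        finally have "?L \<le> ?f j" using True j by (simp add: a_def b_def Z_nonneg)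
        also have "\<dots> \<le> sum ?f I" using jI I by (intro member_le_sum) auto
        finally show ?thesis .
      qed
    qed
    also have "\<dots> = (\<Sum>i\<in>I. X i \<omega> + ennreal (2 * W * Z (p i) \<omega>) * ennreal (\<mu> i))"
    proof -
      have "(\<integral>\<^sup>+v. ennreal (2 * W * w v * (sqrt (Z v \<omega>) - sqrt (Z (p i) \<omega>))\<^sup>2) * indicator (cell m N i) v + ennreal (2 * W * Z (p i) \<omega>) * (ennreal (w v) * indicator (cell m N i) v) \<partial>lborel)
          = X i \<omega> + ennreal (2 * W * Z (p i) \<omega>) * ennreal (\<mu> i)" if "i \<in> I" for i
      proof -
        have "i < N" using that by (simp add: I_def)
        then show ?thesis unfolding X_def \<mu>(1)[OF \<open>i < N\<close>, symmetric]
          by (subst nn_integral_add, measurable, subst nn_integral_cmult, measurable)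
      qed
      then show ?thesis by (subst nn_integral_sum) (auto intro!: sum.cong)
    qed
    also have "\<dots> = (\<Sum>i\<in>I. X i \<omega>) + (\<Sum>i\<in>I. ennreal (2 * W * \<mu> i * Z (p i) \<omega>))"
      unfolding sum.distrib using W Z_nonneg \<mu>(2)
      by (intro arg_cong2[where f="(+)"] refl sum.cong) (auto simp: ennreal_mult'[symmetric] I_def mult_ac)
    finally show ?thesis .
  qed
  have EX: "(\<integral>\<^sup>+\<omega>. X i \<omega> \<partial>M) \<le> ennreal (2 * W * C / real N) * (\<integral>\<^sup>+v. ennreal (w v) * indicator (cell m N i) v \<partial>lborel)" if i: "i \<in> I" for i
  proof -
    have "(\<integral>\<^sup>+\<omega>. X i \<omega> \<partial>M) = (\<integral>\<^sup>+v. (\<integral>\<^sup>+\<omega>. ennreal (2 * W * w v * (sqrt (Z v \<omega>) - sqrt (Z (p i) \<omega>))\<^sup>2) * indicator (cell m N i) v \<partial>M) \<partial>lborel)"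
      unfolding X_def by (rule P.Fubini') measurable
    also have "\<dots> \<le> (\<integral>\<^sup>+v. ennreal (2 * W * C / real N) * (ennreal (w v) * indicator (cell m N i) v) \<partial>lborel)"
    proof (rule nn_integral_mono)
      fix v
      show "(\<integral>\<^sup>+\<omega>. ennreal (2 * W * w v * (sqrt (Z v \<omega>) - sqrt (Z (p i) \<omega>))\<^sup>2) * indicator (cell m N i) v \<partial>M)
        \<le> ennreal (2 * W * C / real N) * (ennreal (w v) * indicator (cell m N i) v)"
      proof (cases "v \<in> cell m N i \<and> v \<in> S")
        case False
        then show ?thesis by (auto simp: w_outside)
      next
        case True
        have pi: "p i \<in> cell m N i" "p i \<in> S" using p[of i] i by (auto simp: I_def)
        have d: "\<bar>v - p i\<bar> \<le> 1 / real N" using True pi(1) unfolding cell_def by (auto simp: add_divide_distrib)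
        have "1 / real N \<le> 1" using N by simp
        then have d1: "\<bar>v - p i\<bar> \<le> 1" using d by linarith
        have "(\<integral>\<^sup>+\<omega>. ennreal (2 * W * w v * (sqrt (Z v \<omega>) - sqrt (Z (p i) \<omega>))\<^sup>2) * indicator (cell m N i) v \<partial>M)
           = ennreal (2 * W * w v) * (\<integral>\<^sup>+\<omega>. ennreal ((sqrt (Z v \<omega>) - sqrt (Z (p i) \<omega>))\<^sup>2) \<partial>M)"
          using True W w_nonneg[of v] by (subst nn_integral_cmult[symmetric]) (auto simp: ennreal_mult)
        also have "\<dots> \<le> ennreal (2 * W * w v) * ennreal (C * \<bar>v - p i\<bar>)"
          using True pi d1 by (intro mult_left_mono Z_sqrt_diff) auto
        also have "\<dots> \<le> ennreal (2 * W * w v) * ennreal (C * (1 / real N))"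
          using d C_nonneg by (intro mult_left_mono ennreal_leI) auto
        also have "\<dots> = ennreal (2 * W * C / real N) * (ennreal (w v) * indicator (cell m N i) v)"
          using True W w_nonneg[of v] C_nonneg by (simp add: ennreal_mult'[symmetric] mult_ac)
        finally show ?thesis .
      qed
    qed
    also have "\<dots> = ennreal (2 * W * C / real N) * (\<integral>\<^sup>+v. ennreal (w v) * indicator (cell m N i) v \<partial>lborel)"
      by (rule nn_integral_cmult) simp
    finally show ?thesis .
  qed
  have sum\<mu>: "(\<Sum>i\<in>I. \<integral>\<^sup>+v. ennreal (w v) * indicator (cell m N i) v \<partial>lborel) \<le> ennreal (A * (1 + real m))"
  proof -
    have "(\<Sum>i\<in>I. \<integral>\<^sup>+v. ennreal (w v) * indicator (cell m N i) v \<partial>lborel) \<le> (\<Sum>i<N. \<integral>\<^sup>+v. ennreal (w v) * indicator (cell m N i) v \<partial>lborel)"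
      by (rule sum_mono2) (auto simp: I_def)
    also have "\<dots> = (\<integral>\<^sup>+v. (\<Sum>i<N. ennreal (w v) * indicator (cell m N i) v) \<partial>lborel)"
      by (subst nn_integral_sum) auto
    also have "\<dots> = (\<integral>\<^sup>+v. ennreal (w v) * indicator (block c m) v \<partial>lborel)"
    proof (rule nn_integral_cong)
      fix v
      have "indicator {c + real m..<c + real m + real 1} v *\<^sub>R (1::real) = (\<Sum>i<1 * N. indicator {c + real m + real i / real N..<c + real m + real (Suc i) / real N} v *\<^sub>R 1)"
        by (rule grid_floor_sum[OF N])
      then have "(\<Sum>i<N. indicator (cell m N i) v) = (indicator (block c m) v :: real)"
        by (simp add: cell_def add_ac)
      then have "ennreal (\<Sum>i<N. indicator (cell m N i) v) = ennreal (indicator (block c m) v)" by simp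
      then have "(\<Sum>i<N. indicator (cell m N i) v) = (indicator (block c m) v :: ennreal)"
        by (simp add: sum_ennreal[symmetric] ennreal_indicator)
      then show "(\<Sum>i<N. ennreal (w v) * indicator (cell m N i) v) = ennreal (w v) * indicator (block c m) v"
        by (simp add: sum_distrib_left[symmetric])
    qed
    also have "\<dots> \<le> ennreal (A * (1 + real m))" by (rule w_mass)
    finally show ?thesis .
  qed
  have Ep: "(\<integral>\<^sup>+\<omega>. ennreal (sqrt (2 * W * \<mu> i * Z (p i) \<omega>)) \<partial>M) \<le> ennreal (sqrt (2 * W * (A * (1 + real m))) * exp (- q * (c + real m)))" if i: "i \<in> I" for i
  proof -
    have iN: "i < N" using i by (simp add: I_def)
    have pi: "p i \<in> cell m N i" "p i \<in> S" using p[of i] i by (auto simp: I_def)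
    then have pg: "c + real m \<le> p i" using cell_sub[OF iN] by auto
    have "(\<integral>\<^sup>+\<omega>. ennreal (sqrt (2 * W * \<mu> i * Z (p i) \<omega>)) \<partial>M) = ennreal (sqrt (2 * W * \<mu> i)) * (\<integral>\<^sup>+\<omega>. ennreal (sqrt (Z (p i) \<omega>)) \<partial>M)"
      using W \<mu>(2)[OF iN] Z_nonneg by (subst nn_integral_cmult[symmetric]) (auto simp: real_sqrt_mult ennreal_mult)
    also have "\<dots> \<le> ennreal (sqrt (2 * W * (A * (1 + real m)))) * ennreal (exp (- q * (c + real m)))"
    proof (intro mult_mono)
      show "ennreal (sqrt (2 * W * \<mu> i)) \<le> ennreal (sqrt (2 * W * (A * (1 + real m))))"
        using W \<mu>(3)[OF iN] by (intro ennreal_leI real_sqrt_le_mono mult_left_mono) auto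
      have "(\<integral>\<^sup>+\<omega>. ennreal (sqrt (Z (p i) \<omega>)) \<partial>M) \<le> ennreal (exp (- q * p i))" using pi pg m by (intro Z_sqrt_tail) auto
      also have "\<dots> \<le> ennreal (exp (- q * (c + real m)))" using pg q_pos by (intro ennreal_leI) auto
      finally show "(\<integral>\<^sup>+\<omega>. ennreal (sqrt (Z (p i) \<omega>)) \<partial>M) \<le> ennreal (exp (- q * (c + real m)))" .
    qed auto
    also have "\<dots> = ennreal (sqrt (2 * W * (A * (1 + real m))) * exp (- q * (c + real m)))"
      using W A_nonneg by (intro ennreal_mult[symmetric]) auto
    finally show ?thesis .
  qed
  \<comment> \<open>The increment sum stays untruncated, since its mean is small. The node sum, for
    which the mean gives no decay, is truncated and then passed to square roots.\<close>
  have "(\<integral>\<^sup>+\<omega>. min 1 (\<integral>\<^sup>+v. ennreal ((\<bar>v\<bar> + K) * w v * Z v \<omega>) * indicator (block c m) v \<partial>lborel) \<partial>M)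
     \<le> (\<integral>\<^sup>+\<omega>. (\<Sum>i\<in>I. X i \<omega>) + (\<Sum>i\<in>I. ennreal (sqrt (2 * W * \<mu> i * Z (p i) \<omega>))) \<partial>M)"
  proof (rule nn_integral_mono)
    fix \<omega> assume om: "\<omega> \<in> space M"
    have "min 1 (\<integral>\<^sup>+v. ennreal ((\<bar>v\<bar> + K) * w v * Z v \<omega>) * indicator (block c m) v \<partial>lborel)
      \<le> min 1 ((\<Sum>i\<in>I. X i \<omega>) + (\<Sum>i\<in>I. ennreal (2 * W * \<mu> i * Z (p i) \<omega>)))"
      by (intro min.mono order_refl split om)
    also have "\<dots> \<le> (\<Sum>i\<in>I. X i \<omega>) + min 1 (\<Sum>i\<in>I. ennreal (2 * W * \<mu> i * Z (p i) \<omega>))" by (rule min_one_add_le)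
    also have "\<dots> \<le> (\<Sum>i\<in>I. X i \<omega>) + (\<Sum>i\<in>I. min 1 (ennreal (2 * W * \<mu> i * Z (p i) \<omega>)))"
      by (intro add_left_mono min_one_sum_le I)
    also have "\<dots> \<le> (\<Sum>i\<in>I. X i \<omega>) + (\<Sum>i\<in>I. ennreal (sqrt (2 * W * \<mu> i * Z (p i) \<omega>)))"
      using W Z_nonneg \<mu>(2) by (intro add_left_mono sum_mono min_one_le_sqrt) (auto simp: I_def)
    finally show "min 1 (\<integral>\<^sup>+v. ennreal ((\<bar>v\<bar> + K) * w v * Z v \<omega>) * indicator (block c m) v \<partial>lborel) \<le> (\<Sum>i\<in>I. X i \<omega>) + (\<Sum>i\<in>I. ennreal (sqrt (2 * W * \<mu> i * Z (p i) \<omega>)))" .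
  qed
  also have "\<dots> = (\<Sum>i\<in>I. \<integral>\<^sup>+\<omega>. X i \<omega> \<partial>M) + (\<Sum>i\<in>I. \<integral>\<^sup>+\<omega>. ennreal (sqrt (2 * W * \<mu> i * Z (p i) \<omega>)) \<partial>M)"
    by (simp add: nn_integral_add nn_integral_sum)
  also have "\<dots> \<le> (\<Sum>i\<in>I. ennreal (2 * W * C / real N) * (\<integral>\<^sup>+v. ennreal (w v) * indicator (cell m N i) v \<partial>lborel)) + (\<Sum>i\<in>I. ennreal (sqrt (2 * W * (A * (1 + real m))) * exp (- q * (c + real m))))"
    by (intro add_mono sum_mono EX Ep)
  also have "\<dots> \<le> ennreal (2 * W * C / real N) * ennreal (A * (1 + real m)) + of_nat N * ennreal (sqrt (2 * W * (A * (1 + real m))) * exp (- q * (c + real m)))"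
  proof (intro add_mono)
    show "(\<Sum>i\<in>I. ennreal (2 * W * C / real N) * (\<integral>\<^sup>+v. ennreal (w v) * indicator (cell m N i) v \<partial>lborel)) \<le> ennreal (2 * W * C / real N) * ennreal (A * (1 + real m))"
      unfolding sum_distrib_left[symmetric] by (intro mult_left_mono sum\<mu>) simp
    have "card I \<le> card {..<N}" by (intro card_mono) (auto simp: I_def)
    then have "(of_nat (card I) :: ennreal) \<le> of_nat N" by simp
    then show "(\<Sum>i\<in>I. ennreal (sqrt (2 * W * (A * (1 + real m))) * exp (- q * (c + real m)))) \<le> of_nat N * ennreal (sqrt (2 * W * (A * (1 + real m))) * exp (- q * (c + real m)))"
      unfolding sum_constant by (rule mult_right_mono) simp
  qed
  also have "\<dots> = ennreal (2 * W * C / real N * (A * (1 + real m)) + real N * (sqrt (2 * W * (A * (1 + real m))) * exp (- q * (c + real m))))"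
    using W C_nonneg A_nonneg by (simp add: ennreal_mult'[symmetric] ennreal_plus[symmetric] ennreal_of_nat_eq_real_of_nat del: ennreal_plus)
  also have "\<dots> \<le> ennreal (tail_rate c C q A K m)"
  proof (rule ennreal_leI)
    define x where "x = real m + 1"
    define L where "L = 1 + \<bar>c\<bar> + K"
    have x: "1 \<le> x" "real N = x ^ 5" "1 + real m = x" "W = L * x" by (auto simp: x_def N_def W_def L_def add.commute)
    have L: "0 < L" using K by (simp add: L_def add_pos_nonneg)
    have "2 * W * C / real N * (A * (1 + real m)) = (2 * L * A * C) * (x * x / x ^ 5)" unfolding x by simp
    also have "x * x / x ^ 5 \<le> 1 / x\<^sup>2"
      using x(1) by (simp add: divide_simps power_numeral_reduce) 
    finally have 1: "2 * W * C / real N * (A * (1 + real m)) \<le> 2 * L * A * C / x\<^sup>2"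
      using L A_nonneg C_nonneg by (simp add: mult_left_mono)
    have "sqrt (2 * W * (A * (1 + real m))) = sqrt ((2 * L * A) * x\<^sup>2)" unfolding x by (simp add: power2_eq_square mult_ac)
    also have "\<dots> = sqrt (2 * L * A) * x" using x(1) by (simp add: real_sqrt_mult)
    finally have "real N * (sqrt (2 * W * (A * (1 + real m))) * exp (- q * (c + real m))) = x ^ 5 * (sqrt (2 * L * A) * x * (exp (- q * c) * exp (- q * real m)))"
      unfolding x(2) by (simp add: exp_add[symmetric] algebra_simps)
    also have "\<dots> = sqrt (2 * L * A) * exp (- q * c) * (x ^ 6 * exp (- q * real m))" by (simp add: power_numeral_reduce)
    finally show "2 * W * C / real N * (A * (1 + real m)) + real N * (sqrt (2 * W * (A * (1 + real m))) * exp (- q * (c + real m))) \<le> tail_rate c C q A K m"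
      using 1 unfolding tail_rate_def x_def L_def by simp
  qed
  finally show ?thesis .
qed


lemma tail_rate_nonneg: "0 \<le> K \<Longrightarrow> 0 \<le> tail_rate c C q A K m"
  unfolding tail_rate_def using A_nonneg C_nonneg by (intro add_nonneg_nonneg mult_nonneg_nonneg divide_nonneg_nonneg) auto

text \<open>The unit blocks beyond \<open>c + real D\<close> are summed by subadditivity of
  truncation; truncating only the total would leave nothing to which the single block bounds
  apply.\<close>

lemma tail:
  assumes K: "0 \<le> K" and D: "1 \<le> c + real D"
  shows "(\<integral>\<^sup>+\<omega>. min 1 (\<integral>\<^sup>+v. ennreal ((\<bar>v\<bar> + K) * w v * Z v \<omega>) * indicator {c + real D..} v \<partial>lborel) \<partial>M)
    \<le> ennreal (tail_sum c C q A K D)"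
proof -
  define b where "b m = {c + real (m + D)..<c + real (Suc (m + D))}" for m
  define f where "f v \<omega> = ennreal ((\<bar>v\<bar> + K) * w v * Z v \<omega>)" for v \<omega>
  have disj: "disjoint_family b"
    unfolding disjoint_family_on_def
  proof (intro ballI impI)
    fix i j :: nat assume "i \<noteq> j"
    then consider "Suc i \<le> j" | "Suc j \<le> i" by linarith
    then show "b i \<inter> b j = {}"
    proof cases
      case 1
      then have "real (Suc i) \<le> real j" by (rule of_nat_mono)
      then show ?thesis by (auto simp: b_def)
    next
      case 2
      then have "real (Suc j) \<le> real i" by (rule of_nat_mono)
      then show ?thesis by (auto simp: b_def)
    qed
  qed
  have un: "(\<Union>m. b m) = {c + real D..}"
  proof
    show "(\<Union>m. b m) \<subseteq> {c + real D..}" by (auto simp: b_def)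
    show "{c + real D..} \<subseteq> (\<Union>m. b m)"
    proof
      fix v assume v: "v \<in> {c + real D..}"
      define m where "m = nat \<lfloor>v - c - real D\<rfloor>"
      have "0 \<le> v - c - real D" using v by simp
      then have "real m \<le> v - c - real D" "v - c - real D < real m + 1" unfolding m_def by linarith+
      then show "v \<in> (\<Union>m. b m)" by (intro UN_I[of m]) (auto simp: b_def)
    qed
  qed
  have "(\<integral>\<^sup>+\<omega>. min 1 (\<integral>\<^sup>+v. f v \<omega> * indicator {c + real D..} v \<partial>lborel) \<partial>M)
    \<le> (\<integral>\<^sup>+\<omega>. (\<Sum>m. min 1 (\<integral>\<^sup>+v. f v \<omega> * indicator (b m) v \<partial>lborel)) \<partial>M)"
  proof (rule nn_integral_mono)
    fix \<omega> assume om: "\<omega> \<in> space M"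
    have [measurable]: "(\<lambda>v. Z v \<omega>) \<in> borel_measurable borel"
      by (rule Z_comp_measurable) (use om in auto)
    have [measurable]: "b m \<in> sets borel" for m by (simp add: b_def)
    have "(\<integral>\<^sup>+v. f v \<omega> * indicator {c + real D..} v \<partial>lborel) = (\<integral>\<^sup>+v. (\<Sum>m. f v \<omega> * indicator (b m) v) \<partial>lborel)"
      unfolding un[symmetric] ennreal_suminf_cmult suminf_indicator[OF disj] ..
    also have "\<dots> = (\<Sum>m. \<integral>\<^sup>+v. f v \<omega> * indicator (b m) v \<partial>lborel)"
      unfolding f_def by (rule nn_integral_suminf) measurable
    finally show "min 1 (\<integral>\<^sup>+v. f v \<omega> * indicator {c + real D..} v \<partial>lborel) \<le> (\<Sum>m. min 1 (\<integral>\<^sup>+v. f v \<omega> * indicator (b m) v \<partial>lborel))"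
      using min_one_suminf_le by simp
  qed
  also have "\<dots> = (\<Sum>m. \<integral>\<^sup>+\<omega>. min 1 (\<integral>\<^sup>+v. f v \<omega> * indicator (b m) v \<partial>lborel) \<partial>M)"
    unfolding f_def b_def by (rule nn_integral_suminf) measurable
  also have "\<dots> \<le> (\<Sum>m. ennreal (tail_rate c C q A K (m + D)))"
    unfolding f_def b_def using D by (intro suminf_le block_tail K) auto
  also have "\<dots> = ennreal (tail_sum c C q A K D)"
    unfolding tail_sum_def using tail_rate_nonneg[OF K] tail_rate_summable[OF q_pos]
    by (intro suminf_ennreal2 summable_ignore_initial_segment) auto
  finally show ?thesis unfolding f_def .
qed

lemma w_mass_upto: "(\<integral>\<^sup>+v. ennreal (w v) * indicator {c..<c + real D} v \<partial>lborel) < \<infinity>"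
proof (induction D)
  case (Suc D)
  have "(\<integral>\<^sup>+v. ennreal (w v) * indicator {c..<c + real (Suc D)} v \<partial>lborel) = (\<integral>\<^sup>+v. ennreal (w v) * indicator {c..<c + real D} v + ennreal (w v) * indicator {c + real D..<c + real (Suc D)} v \<partial>lborel)"
    by (intro nn_integral_cong) (auto simp: indicator_def)
  also have "\<dots> = (\<integral>\<^sup>+v. ennreal (w v) * indicator {c..<c + real D} v \<partial>lborel) + (\<integral>\<^sup>+v. ennreal (w v) * indicator {c + real D..<c + real (Suc D)} v \<partial>lborel)"
    by (rule nn_integral_add) auto
  also have "\<dots> < \<infinity>"
    using Suc.IH le_less_trans[OF w_mass[of D] ennreal_less_top] by (simp add: less_top[symmetric])
  finally show ?case .
qed simp

text \<open>The mean over the whole half-line may be infinite. Over bounded pieces it is finite, so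
  an infinite total forces an infinite tail beyond every \<open>D\<close>; the truncated tail then
  equals 1, while its mean tends to 0 as \<open>D\<close> grows.\<close>

lemma AE_total_finite:
  assumes K: "0 \<le> K"
  shows "AE \<omega> in M. (\<integral>\<^sup>+v. ennreal ((\<bar>v\<bar> + K) * w v * Z v \<omega>) \<partial>lborel) \<noteq> \<infinity>"
proof -
  define f where "f v \<omega> = ennreal ((\<bar>v\<bar> + K) * w v * Z v \<omega>)" for v \<omega>
  have fm [measurable]: "(\<lambda>(v, \<omega>). f v \<omega>) \<in> borel_measurable (borel \<Otimes>\<^sub>M M)" unfolding f_def by measurable
  have fm' [measurable]: "(\<lambda>(\<omega>, v). f v \<omega>) \<in> borel_measurable (M \<Otimes>\<^sub>M borel)" unfolding f_def by measurable
  have loc: "AE \<omega> in M. (\<integral>\<^sup>+v. f v \<omega> * indicator {c..<c + real D} v \<partial>lborel) \<noteq> \<infinity>" for D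
  proof (rule nn_integral_PInf_AE)
    show "(\<lambda>\<omega>. \<integral>\<^sup>+v. f v \<omega> * indicator {c..<c + real D} v \<partial>lborel) \<in> borel_measurable M" by measurable
    have "(\<integral>\<^sup>+\<omega>. (\<integral>\<^sup>+v. f v \<omega> * indicator {c..<c + real D} v \<partial>lborel) \<partial>M) = (\<integral>\<^sup>+v. (\<integral>\<^sup>+\<omega>. f v \<omega> * indicator {c..<c + real D} v \<partial>M) \<partial>lborel)"
      by (rule P.Fubini') measurable
    also have "\<dots> \<le> (\<integral>\<^sup>+v. ennreal (\<bar>c\<bar> + real D + K) * (ennreal (w v) * indicator {c..<c + real D} v) \<partial>lborel)"
    proof (rule nn_integral_mono)
      fix v
      show "(\<integral>\<^sup>+\<omega>. f v \<omega> * indicator {c..<c + real D} v \<partial>M) \<le> ennreal (\<bar>c\<bar> + real D + K) * (ennreal (w v) * indicator {c..<c + real D} v)"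
      proof (cases "v \<in> {c..<c + real D} \<and> v \<in> S")
        case False
        then show ?thesis by (auto simp: f_def w_outside)
      next
        case True
        have "(\<integral>\<^sup>+\<omega>. f v \<omega> * indicator {c..<c + real D} v \<partial>M) = ennreal ((\<bar>v\<bar> + K) * w v) * (\<integral>\<^sup>+\<omega>. ennreal (Z v \<omega>) \<partial>M)"
          using True K w_nonneg[of v] Z_nonneg by (subst nn_integral_cmult[symmetric]) (auto simp: f_def ennreal_mult)
        also have "\<dots> \<le> ennreal ((\<bar>v\<bar> + K) * w v) * 1" using True by (intro mult_left_mono Z_mean) auto
        also have "\<dots> \<le> ennreal ((\<bar>c\<bar> + real D + K) * w v)" unfolding mult_1_right
          using True w_nonneg[of v] by (intro ennreal_leI mult_right_mono) auto
        also have "\<dots> = ennreal (\<bar>c\<bar> + real D + K) * (ennreal (w v) * indicator {c..<c + real D} v)"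
          using True K w_nonneg[of v] by (simp add: ennreal_mult)
        finally show ?thesis .
      qed
    qed
    also have "\<dots> = ennreal (\<bar>c\<bar> + real D + K) * (\<integral>\<^sup>+v. ennreal (w v) * indicator {c..<c + real D} v \<partial>lborel)"
      by (rule nn_integral_cmult) auto
    also have "\<dots> < \<infinity>" using w_mass_upto[of D] by (simp add: ennreal_mult_less_top)
    finally show "(\<integral>\<^sup>+\<omega>. (\<integral>\<^sup>+v. f v \<omega> * indicator {c..<c + real D} v \<partial>lborel) \<partial>M) \<noteq> \<infinity>" by simp
  qed
  define B where "B = {\<omega> \<in> space M. (\<integral>\<^sup>+v. f v \<omega> \<partial>lborel) = \<infinity>}"
  have [measurable]: "B \<in> sets M" unfolding B_def by measurable
  have le: "emeasure M B \<le> ennreal (tail_sum c C q A K D)" if D: "1 \<le> c + real D" for D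
  proof -
    have "emeasure M B = (\<integral>\<^sup>+\<omega>. indicator B \<omega> \<partial>M)" by simp
    also have "\<dots> \<le> (\<integral>\<^sup>+\<omega>. min 1 (\<integral>\<^sup>+v. f v \<omega> * indicator {c + real D..} v \<partial>lborel) \<partial>M)"
    proof (rule nn_integral_mono_AE)
      show "AE \<omega> in M. indicator B \<omega> \<le> min 1 (\<integral>\<^sup>+v. f v \<omega> * indicator {c + real D..} v \<partial>lborel)"
        using loc[of D] AE_space
      proof eventually_elim
        case (elim \<omega>)
        have [measurable]: "(\<lambda>v. Z v \<omega>) \<in> borel_measurable borel"
          by (rule Z_comp_measurable) (use elim in auto)
        have "(\<integral>\<^sup>+v. f v \<omega> \<partial>lborel) = (\<integral>\<^sup>+v. f v \<omega> * indicator {c..<c + real D} v + f v \<omega> * indicator {c + real D..} v \<partial>lborel)"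
        proof (rule nn_integral_cong)
          fix v
          show "f v \<omega> = f v \<omega> * indicator {c..<c + real D} v + f v \<omega> * indicator {c + real D..} v"
          proof (cases "c \<le> v")
            case True then show ?thesis by (auto simp: indicator_def)
          next
            case False
            then have "v \<notin> S" using S_ge by auto
            then show ?thesis by (simp add: f_def w_outside)
          qed
        qed
        also have "\<dots> = (\<integral>\<^sup>+v. f v \<omega> * indicator {c..<c + real D} v \<partial>lborel) + (\<integral>\<^sup>+v. f v \<omega> * indicator {c + real D..} v \<partial>lborel)"
          unfolding f_def by (rule nn_integral_add) measurable
        finally show ?case using elim(1) by (auto simp: B_def indicator_def)
      qed
    qed
    also have "\<dots> \<le> ennreal (tail_sum c C q A K D)" unfolding f_def by (rule tail[OF K D])
    finally show ?thesis .
  qed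
  have "(\<lambda>D. ennreal (tail_sum c C q A K D)) \<longlonglongrightarrow> ennreal 0"
    by (intro tendsto_ennrealI tail_sum_tendsto q_pos)
  moreover obtain k :: nat where k: "1 - c \<le> real k" using real_arch_simple by blast
  have "\<forall>\<^sub>F D in sequentially. emeasure M B \<le> ennreal (tail_sum c C q A K D)"
    using eventually_ge_at_top[of k] by eventually_elim (rule le, use k in linarith)
  ultimately have "emeasure M B \<le> ennreal 0" by (rule tendsto_lowerbound) simp
  then have "emeasure M B = 0" by simp
  then show ?thesis
    by (intro AE_I[of _ _ B]) (auto simp: B_def f_def)
qed

lemma weighted_integral_measurable [measurable]: "weighted_integral Z w k \<in> borel_measurable M"
  unfolding weighted_integral_def by measurable

lemma AE_weighted_integrable: "AE \<omega> in M. integrable lborel (\<lambda>v. (v - k) * w v * Z v \<omega>)"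
  using AE_total_finite[of "\<bar>k\<bar>", OF abs_ge_zero] AE_space
proof eventually_elim
  case (elim \<omega>)
  have [measurable]: "(\<lambda>v. Z v \<omega>) \<in> borel_measurable borel"
    by (rule Z_comp_measurable) (use elim in auto)
  have "(\<integral>\<^sup>+v. ennreal (norm ((v - k) * w v * Z v \<omega>)) \<partial>lborel) \<le> (\<integral>\<^sup>+v. ennreal ((\<bar>v\<bar> + \<bar>k\<bar>) * w v * Z v \<omega>) \<partial>lborel)"
    using w_nonneg Z_nonneg by (intro nn_integral_mono ennreal_leI) (auto simp: abs_mult intro!: mult_right_mono)
  also have "\<dots> < \<infinity>" using elim(1) by (simp add: less_top)
  finally show ?case by (intro integrableI_bounded) auto
qed

lemma grid_sum_measurable [measurable]: "grid_sum Z c b k D N \<in> borel_measurable M"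
  unfolding grid_sum_def by measurable

definition grid_pt :: "nat \<Rightarrow> real \<Rightarrow> real" where
  "grid_pt N v = grid_floor c N v"

lemma grid_pt_measurable [measurable]: "grid_pt N \<in> borel_measurable borel"
  unfolding grid_pt_def by measurable

text \<open>The truncated error beyond \<open>c + real D\<close> plus the error on the bounded part
  in mean. The three terms multiplied by \<open>real D\<close> come from freezing the weight, from
  moving \<open>v - k\<close> to the node and from moving \<open>Z\<close> to the node.\<close>

lemma weighted_integral_grid:
  assumes D: "1 \<le> c + real D" and N: "0 < N" and sub: "{c..<c + real D} \<subseteq> S"
    and b: "0 \<le> b" and \<delta>: "0 \<le> \<delta>" "\<And>v. v \<in> {c..<c + real D} \<Longrightarrow> \<bar>w v - b\<bar> \<le> \<delta>"
  shows "(LINT \<omega>|M. min 1 \<bar>weighted_integral Z w k \<omega> - grid_sum Z c b k D N \<omega>\<bar>) \<le> tail_sum c C q A \<bar>k\<bar> D +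
     real D * ((\<bar>c\<bar> + real D + \<bar>k\<bar>) * \<delta> + b / real N + b * (\<bar>c\<bar> + real D + \<bar>k\<bar>) * ((C / 2 + 2) * sqrt (1 / real N)))"
proof -
  define W where "W = \<bar>c\<bar> + real D + \<bar>k\<bar>"
  have W: "0 \<le> W" by (simp add: W_def)
  define E where "E = W * \<delta> + b / real N + b * W * ((C / 2 + 2) * sqrt (1 / real N))"
  have E: "0 \<le> E" unfolding E_def using W b \<delta>(1) C_nonneg by (intro add_nonneg_nonneg mult_nonneg_nonneg) auto
  define J where "J = {c..<c + real D}"
  have Jm [measurable]: "J \<in> sets borel" by (simp add: J_def)
  define Tl where "Tl \<omega> = (\<integral>\<^sup>+v. ennreal ((\<bar>v\<bar> + \<bar>k\<bar>) * w v * Z v \<omega>) * indicator {c + real D..} v \<partial>lborel)" for \<omega>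
  define G where "G \<omega> = (\<integral>\<^sup>+v. ennreal \<bar>(v - k) * w v * Z v \<omega> - b * (grid_pt N v - k) * Z (grid_pt N v) \<omega>\<bar> * indicator J v \<partial>lborel)" for \<omega>
  have [measurable]: "Tl \<in> borel_measurable M" "G \<in> borel_measurable M" unfolding Tl_def G_def by measurable
  have EG: "(\<integral>\<^sup>+\<omega>. G \<omega> \<partial>M) \<le> ennreal (real D * E)"
  proof -
    have "(\<integral>\<^sup>+\<omega>. G \<omega> \<partial>M) = (\<integral>\<^sup>+v. (\<integral>\<^sup>+\<omega>. ennreal \<bar>(v - k) * w v * Z v \<omega> - b * (grid_pt N v - k) * Z (grid_pt N v) \<omega>\<bar> * indicator J v \<partial>M) \<partial>lborel)"
      unfolding G_def by (rule P.Fubini') measurable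
    also have "\<dots> \<le> (\<integral>\<^sup>+v. ennreal E * indicator J v \<partial>lborel)"
    proof (rule nn_integral_mono)
      fix v
      show "(\<integral>\<^sup>+\<omega>. ennreal \<bar>(v - k) * w v * Z v \<omega> - b * (grid_pt N v - k) * Z (grid_pt N v) \<omega>\<bar> * indicator J v \<partial>M) \<le> ennreal E * indicator J v"
      proof (cases "v \<in> J")
        case True
        define g where "g = grid_pt N v"
        have cv: "c \<le> v" "v < c + real D" using True by (auto simp: J_def)
        have g: "c \<le> g" "g \<le> v" "v - g \<le> 1 / real N"
          using grid_floor_bounds[OF N, where c=c and v=v] cv by (auto simp: g_def grid_pt_def)
        have gS: "v \<in> S" "g \<in> S" using sub cv g by auto
        have vg: "\<bar>v - g\<bar> \<le> 1 / real N" using g by simp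
        have "1 / real N \<le> 1" using N by simp
        then have vg1: "\<bar>v - g\<bar> \<le> 1" using vg by linarith
        have Wv: "\<bar>v - k\<bar> \<le> W" "\<bar>g - k\<bar> \<le> W" using cv g by (auto simp: W_def)
        have pt: "\<bar>(v - k) * w v * Z v \<omega> - b * (g - k) * Z g \<omega>\<bar> \<le> (W * \<delta> + b / real N) * Z v \<omega> + (b * W) * \<bar>Z v \<omega> - Z g \<omega>\<bar>" for \<omega>
        proof -
          \<comment> \<open>Telescoping over the three replacements. The first two differences keep
            the factor \<open>Z v\<close>, whose mean is at most 1; the third is handled by
            \<open>Z_diff\<close>.\<close>
          have "(v - k) * w v * Z v \<omega> - b * (g - k) * Z g \<omega> = (v - k) * (w v - b) * Z v \<omega> + b * (v - g) * Z v \<omega> + b * (g - k) * (Z v \<omega> - Z g \<omega>)"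
            by (simp add: algebra_simps)
          then have "\<bar>(v - k) * w v * Z v \<omega> - b * (g - k) * Z g \<omega>\<bar> \<le> \<bar>(v - k) * (w v - b) * Z v \<omega>\<bar> + \<bar>b * (v - g) * Z v \<omega>\<bar> + \<bar>b * (g - k) * (Z v \<omega> - Z g \<omega>)\<bar>"
            by linarith
          moreover have "\<bar>(v - k) * (w v - b) * Z v \<omega>\<bar> \<le> W * \<delta> * Z v \<omega>"
            unfolding abs_mult using Wv \<delta> W Z_nonneg True by (intro mult_mono) (auto simp: J_def intro: mult_mono)
          moreover have "\<bar>b * (v - g) * Z v \<omega>\<bar> \<le> b * (1 / real N) * Z v \<omega>"
            unfolding abs_mult using b vg Z_nonneg by (intro mult_mono) auto
          moreover have "\<bar>b * (g - k) * (Z v \<omega> - Z g \<omega>)\<bar> \<le> b * W * \<bar>Z v \<omega> - Z g \<omega>\<bar>"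
            unfolding abs_mult using b Wv by (intro mult_mono) auto
          ultimately show ?thesis by (simp add: distrib_right)
        qed
        have "(\<integral>\<^sup>+\<omega>. ennreal \<bar>(v - k) * w v * Z v \<omega> - b * (grid_pt N v - k) * Z (grid_pt N v) \<omega>\<bar> * indicator J v \<partial>M)
          \<le> (\<integral>\<^sup>+\<omega>. ennreal (W * \<delta> + b / real N) * ennreal (Z v \<omega>) + ennreal (b * W) * ennreal \<bar>Z v \<omega> - Z g \<omega>\<bar> \<partial>M)"
        proof (rule nn_integral_mono)
          fix \<omega>
          have "ennreal \<bar>(v - k) * w v * Z v \<omega> - b * (g - k) * Z g \<omega>\<bar> \<le> ennreal ((W * \<delta> + b / real N) * Z v \<omega> + (b * W) * \<bar>Z v \<omega> - Z g \<omega>\<bar>)"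
            by (rule ennreal_leI[OF pt])
          also have "\<dots> = ennreal (W * \<delta> + b / real N) * ennreal (Z v \<omega>) + ennreal (b * W) * ennreal \<bar>Z v \<omega> - Z g \<omega>\<bar>"
          proof -
            have "0 \<le> W * \<delta> + b / real N" "0 \<le> b * W" using W \<delta> b by auto
            then show ?thesis using Z_nonneg by (simp only: ennreal_plus ennreal_mult mult_nonneg_nonneg abs_ge_zero)
          qed
          finally show "ennreal \<bar>(v - k) * w v * Z v \<omega> - b * (grid_pt N v - k) * Z (grid_pt N v) \<omega>\<bar> * indicator J v
             \<le> ennreal (W * \<delta> + b / real N) * ennreal (Z v \<omega>) + ennreal (b * W) * ennreal \<bar>Z v \<omega> - Z g \<omega>\<bar>"
            using True by (simp add: g_def)
        qed
        also have "\<dots> = ennreal (W * \<delta> + b / real N) * (\<integral>\<^sup>+\<omega>. ennreal (Z v \<omega>) \<partial>M) + ennreal (b * W) * (\<integral>\<^sup>+\<omega>. ennreal \<bar>Z v \<omega> - Z g \<omega>\<bar> \<partial>M)"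
          by (simp add: nn_integral_add nn_integral_cmult)
        also have "\<dots> \<le> ennreal (W * \<delta> + b / real N) * 1 + ennreal (b * W) * ennreal ((C / 2 + 2) * sqrt \<bar>v - g\<bar>)"
          using gS vg1 by (intro add_mono mult_left_mono Z_mean Z_diff) auto
        also have "\<dots> \<le> ennreal (W * \<delta> + b / real N) * 1 + ennreal (b * W) * ennreal ((C / 2 + 2) * sqrt (1 / real N))"
          using vg C_nonneg by (intro add_mono mult_left_mono ennreal_leI order_refl real_sqrt_le_mono) auto
        also have "\<dots> = ennreal E"
          unfolding E_def mult_1_right using W \<delta> b C_nonneg by (subst ennreal_mult[symmetric], simp, simp, subst ennreal_plus[symmetric]) auto
        finally show ?thesis using True by simp
      qed simp
    qed
    also have "\<dots> = ennreal (real D * E)"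
      using E by (subst nn_integral_cmult_indicator) (auto simp: J_def ennreal_mult[symmetric] mult.commute)
    finally show ?thesis .
  qed
  have ae: "AE \<omega> in M. ennreal (min 1 \<bar>weighted_integral Z w k \<omega> - grid_sum Z c b k D N \<omega>\<bar>) \<le> min 1 (Tl \<omega>) + G \<omega>"
    using AE_weighted_integrable[of k] AE_space
  proof eventually_elim
    case (elim \<omega>)
    have [measurable]: "(\<lambda>v. Z v \<omega>) \<in> borel_measurable borel"
      by (rule Z_comp_measurable) (use elim in auto)
    define f where "f v = (v - k) * w v * Z v \<omega>" for v
    have f: "integrable lborel f" using elim(1) by (simp add: f_def[abs_def])
    have fJ: "integrable lborel (\<lambda>v. indicator J v *\<^sub>R f v)"
      by (rule integrable_mult_indicator[OF _ f]) simp
    have fT: "integrable lborel (\<lambda>v. indicator {c + real D..} v *\<^sub>R f v)"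
      by (rule integrable_mult_indicator[OF _ f]) simp
    define h where "h x = b * (x - k) * Z x \<omega>" for x
    have gi: "integrable lborel (\<lambda>v. indicator J v *\<^sub>R h (grid_pt N v))"
      and gs: "(LBINT v. indicator J v *\<^sub>R h (grid_pt N v)) = grid_sum Z c b k D N \<omega>"
      using integral_grid_floor[OF N, of c D h] by (simp_all add: J_def grid_pt_def h_def grid_sum_def)
    have "f v = indicator J v *\<^sub>R f v + indicator {c + real D..} v *\<^sub>R f v" for v
    proof (cases "c \<le> v")
      case True then show ?thesis by (auto simp: indicator_def J_def)
    next
      case False
      then have "v \<notin> S" using S_ge by auto
      then show ?thesis by (simp add: f_def w_outside)
    qed
    then have "weighted_integral Z w k \<omega> = (LBINT v. indicator J v *\<^sub>R f v + indicator {c + real D..} v *\<^sub>R f v)"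
      unfolding weighted_integral_def f_def[symmetric] by simp
    also have "\<dots> = (LBINT v. indicator J v *\<^sub>R f v) + (LBINT v. indicator {c + real D..} v *\<^sub>R f v)"
      by (rule Bochner_Integration.integral_add[OF fJ fT])
    finally have "weighted_integral Z w k \<omega> - grid_sum Z c b k D N \<omega> = (LBINT v. indicator {c + real D..} v *\<^sub>R f v) + (LBINT v. indicator J v *\<^sub>R f v - indicator J v *\<^sub>R h (grid_pt N v))"
      unfolding Bochner_Integration.integral_diff[OF fJ gi] gs by simp
    then have "ennreal \<bar>weighted_integral Z w k \<omega> - grid_sum Z c b k D N \<omega>\<bar> \<le> ennreal (norm (LBINT v. indicator {c + real D..} v *\<^sub>R f v) + norm (LBINT v. indicator J v *\<^sub>R f v - indicator J v *\<^sub>R h (grid_pt N v)))"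
      by (intro ennreal_leI) (metis norm_triangle_ineq real_norm_def)
    also have "\<dots> = ennreal (norm (LBINT v. indicator {c + real D..} v *\<^sub>R f v)) + ennreal (norm (LBINT v. indicator J v *\<^sub>R f v - indicator J v *\<^sub>R h (grid_pt N v)))"
      by (intro ennreal_plus) auto
    also have "\<dots> \<le> Tl \<omega> + G \<omega>"
    proof (intro add_mono)
      have "ennreal (norm (LBINT v. indicator {c + real D..} v *\<^sub>R f v)) \<le> (\<integral>\<^sup>+v. norm (indicator {c + real D..} v *\<^sub>R f v) \<partial>lborel)"
        by (rule integral_norm_bound_ennreal[OF fT])
      also have "\<dots> \<le> Tl \<omega>"
        unfolding Tl_def f_def using w_nonneg Z_nonneg
        by (intro nn_integral_mono) (auto simp: abs_mult indicator_def intro!: ennreal_leI mult_right_mono)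
      finally show "ennreal (norm (LBINT v. indicator {c + real D..} v *\<^sub>R f v)) \<le> Tl \<omega>" .
      have "ennreal (norm (LBINT v. indicator J v *\<^sub>R f v - indicator J v *\<^sub>R h (grid_pt N v))) \<le> (\<integral>\<^sup>+v. norm (indicator J v *\<^sub>R f v - indicator J v *\<^sub>R h (grid_pt N v)) \<partial>lborel)"
        by (rule integral_norm_bound_ennreal[OF Bochner_Integration.integrable_diff[OF fJ gi]])
      also have "\<dots> = G \<omega>"
        unfolding G_def f_def h_def by (intro nn_integral_cong) (auto simp: indicator_def)
      finally show "ennreal (norm (LBINT v. indicator J v *\<^sub>R f v - indicator J v *\<^sub>R h (grid_pt N v))) \<le> G \<omega>" .
    qed
    finally have le: "ennreal \<bar>weighted_integral Z w k \<omega> - grid_sum Z c b k D N \<omega>\<bar> \<le> G \<omega> + Tl \<omega>"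
      by (simp only: add.commute)
    have "ennreal (min 1 \<bar>weighted_integral Z w k \<omega> - grid_sum Z c b k D N \<omega>\<bar>) \<le> min (ennreal 1) (ennreal \<bar>weighted_integral Z w k \<omega> - grid_sum Z c b k D N \<omega>\<bar>)"
      by (intro min.boundedI ennreal_leI) auto
    also have "\<dots> \<le> min 1 (G \<omega> + Tl \<omega>)"
      unfolding ennreal_1 by (intro min.mono order_refl le)
    also have "\<dots> \<le> G \<omega> + min 1 (Tl \<omega>)" by (rule min_one_add_le)
    finally show ?case by (simp only: add.commute)
  qed
  have i: "integrable M (\<lambda>\<omega>. min 1 \<bar>weighted_integral Z w k \<omega> - grid_sum Z c b k D N \<omega>\<bar>)"
    by (rule integrable_const_bound[where B=1]) auto
  have "ennreal (LINT \<omega>|M. min 1 \<bar>weighted_integral Z w k \<omega> - grid_sum Z c b k D N \<omega>\<bar>) = (\<integral>\<^sup>+\<omega>. ennreal (min 1 \<bar>weighted_integral Z w k \<omega> - grid_sum Z c b k D N \<omega>\<bar>) \<partial>M)"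
    by (rule nn_integral_eq_integral[symmetric, OF i]) auto
  also have "\<dots> \<le> (\<integral>\<^sup>+\<omega>. min 1 (Tl \<omega>) + G \<omega> \<partial>M)" by (rule nn_integral_mono_AE[OF ae])
  also have "\<dots> = (\<integral>\<^sup>+\<omega>. min 1 (Tl \<omega>) \<partial>M) + (\<integral>\<^sup>+\<omega>. G \<omega> \<partial>M)" by (rule nn_integral_add) auto
  also have "\<dots> \<le> ennreal (tail_sum c C q A \<bar>k\<bar> D) + ennreal (real D * E)"
    unfolding Tl_def by (intro add_mono tail D EG) simp
  also have "\<dots> = ennreal (tail_sum c C q A \<bar>k\<bar> D + real D * E)"
    using E tail_rate_nonneg[of "\<bar>k\<bar>"] unfolding tail_sum_def
    by (intro ennreal_plus[symmetric] suminf_nonneg summable_ignore_initial_segment tail_rate_summable q_pos) auto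
  finally have "ennreal (LINT \<omega>|M. min 1 \<bar>weighted_integral Z w k \<omega> - grid_sum Z c b k D N \<omega>\<bar>) \<le> ennreal (tail_sum c C q A \<bar>k\<bar> D + real D * E)" .
  moreover have "0 \<le> tail_sum c C q A \<bar>k\<bar> D + real D * E"
    using E tail_rate_nonneg[of "\<bar>k\<bar>"] unfolding tail_sum_def
    by (intro add_nonneg_nonneg suminf_nonneg summable_ignore_initial_segment tail_rate_summable q_pos) auto
  ultimately show ?thesis unfolding E_def W_def by (subst (asm) ennreal_le_iff) auto
qed

end

text \<open>The order of choices matters: the cut-off \<open>D\<close> first, by the uniform tail,
  then the mesh \<open>Nn\<close> for that \<open>D\<close>, then the accuracy
  \<open>\<delta>\<close> of the weight. Only afterwards does n tend to infinity, with finitely many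
  nodes fixed.\<close>

theorem weighted_integral_char_conv:
  fixes M :: "nat \<Rightarrow> 'a measure" and N :: "'b measure"
  assumes field: "\<And>n. likelihood_field (M n) (Z n) (S n) (w n) c C q A"
    and field': "likelihood_field N Z' {c..} (\<lambda>v. if c \<le> v then b else 0) c C q A"
    and pos: "\<And>n v \<omega>. 0 < Z n v \<omega>" "\<And>v \<omega>. 0 < Z' v \<omega>" and b: "0 \<le> b"
    and S: "\<And>D. \<forall>\<^sub>F n in sequentially. {c..<c + real D} \<subseteq> S n"
    and w: "\<And>D e. 0 < e \<Longrightarrow> \<forall>\<^sub>F n in sequentially. \<forall>v\<in>{c..<c + real D}. \<bar>w n v - b\<bar> \<le> e"
    and fdd: "\<And>m t x. (\<And>i. c \<le> x i) \<Longrightarrow> (\<lambda>n. LINT \<omega>|M n. iexp (\<Sum>i<m. t i * ln (Z n (x i) \<omega>)))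
      \<longlonglongrightarrow> (LINT \<omega>|N. iexp (\<Sum>i<m::nat. t i * ln (Z' (x i) \<omega>)))"
  shows "(\<lambda>n. LINT \<omega>|M n. iexp (s * weighted_integral (Z n) (w n) k \<omega>))
    \<longlonglongrightarrow> (LINT \<omega>|N. iexp (s * weighted_integral Z' (\<lambda>v. if c \<le> v then b else 0) k \<omega>))"
proof (rule char_approx_conv)
  interpret F: likelihood_field "M n" "Z n" "S n" "w n" c C q A for n by (rule field)
  interpret F': likelihood_field N Z' "{c..}" "\<lambda>v. if c \<le> v then b else 0" c C q A by (rule field')
  show "prob_space (M n)" for n by (rule F.prob_space_axioms)
  show "prob_space N" by (rule F'.prob_space_axioms)
  show "weighted_integral (Z n) (w n) k \<in> borel_measurable (M n)" for n by (rule F.weighted_integral_measurable)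
  show "weighted_integral Z' (\<lambda>v. if c \<le> v then b else 0) k \<in> borel_measurable N" by (rule F'.weighted_integral_measurable)
  fix e :: real assume e: "0 < e"
  obtain D0 :: nat where D0: "1 - c \<le> real D0" using real_arch_simple by blast
  have "\<forall>\<^sub>F D in sequentially. tail_sum c C q A \<bar>k\<bar> D < e / 2"
    using e by (intro order_tendstoD[OF tail_sum_tendsto[OF F'.q_pos]]) auto
  from eventually_happens'[OF sequentially_bot eventually_conj[OF eventually_ge_at_top[of D0] this]]
  obtain D where D: "D0 \<le> D" "tail_sum c C q A \<bar>k\<bar> D < e / 2" by blast
  have cD: "1 \<le> c + real D" using D0 of_nat_mono[OF D(1), where 'a=real] by linarith
  define W where "W = \<bar>c\<bar> + real D + \<bar>k\<bar>"
  have W: "0 \<le> W" by (simp add: W_def)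
  have "(\<lambda>N. real D * (b / real N + b * W * ((C / 2 + 2) * sqrt (1 / real N)))) \<longlonglongrightarrow> real D * (0 + b * W * ((C / 2 + 2) * sqrt 0))"
    by (intro tendsto_intros lim_const_over_n lim_1_over_n)
  then have "\<forall>\<^sub>F N in sequentially. real D * (b / real N + b * W * ((C / 2 + 2) * sqrt (1 / real N))) < e / 4"
    using e by (intro order_tendstoD) auto
  from eventually_happens'[OF sequentially_bot eventually_conj[OF eventually_gt_at_top[of 0] this]]
  obtain Nn where Nn: "0 < Nn" "real D * (b / real Nn + b * W * ((C / 2 + 2) * sqrt (1 / real Nn))) < e / 4" by blast
  define \<delta> where "\<delta> = e / (4 * (real D * W + 1))"
  have dw: "0 < real D * W + 1" using W by (intro add_nonneg_pos mult_nonneg_nonneg) auto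
  then have \<delta>: "0 < \<delta>" "real D * (W * \<delta>) \<le> e / 4"
    using e by (auto simp: \<delta>_def divide_simps algebra_simps)
  have bound: "tail_sum c C q A \<bar>k\<bar> D + real D * (W * d + b / real Nn + b * W * ((C / 2 + 2) * sqrt (1 / real Nn))) \<le> e"
    if "real D * (W * d) \<le> e / 4" for d
    using D(2) Nn(2) that e unfolding distrib_left by linarith
  show "\<exists>Sn S'. (\<forall>n. Sn n \<in> borel_measurable (M n)) \<and> S' \<in> borel_measurable N \<and>
     (\<forall>\<^sub>F n in sequentially. (LINT \<omega>|M n. min 1 \<bar>weighted_integral (Z n) (w n) k \<omega> - Sn n \<omega>\<bar>) \<le> e) \<and>
     (LINT \<omega>|N. min 1 \<bar>weighted_integral Z' (\<lambda>v. if c \<le> v then b else 0) k \<omega> - S' \<omega>\<bar>) \<le> e \<and>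
     (\<lambda>n. LINT \<omega>|M n. iexp (s * Sn n \<omega>)) \<longlonglongrightarrow> (LINT \<omega>|N. iexp (s * S' \<omega>))"
  proof (intro exI conjI allI)
    show "grid_sum (Z n) c b k D Nn \<in> borel_measurable (M n)" for n by (rule F.grid_sum_measurable)
    show "grid_sum Z' c b k D Nn \<in> borel_measurable N" by (rule F'.grid_sum_measurable)
    show "\<forall>\<^sub>F n in sequentially. (LINT \<omega>|M n. min 1 \<bar>weighted_integral (Z n) (w n) k \<omega> - grid_sum (Z n) c b k D Nn \<omega>\<bar>) \<le> e"
      using S[of D] w[OF \<delta>(1), of D]
    proof eventually_elim
      case (elim n)
      show ?case
        using F.weighted_integral_grid[OF cD Nn(1) elim(1) b less_imp_le[OF \<delta>(1)], of k] elim(2) bound[OF \<delta>(2)]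
        unfolding W_def by (meson order_trans)
    qed
    have "(LINT \<omega>|N. min 1 \<bar>weighted_integral Z' (\<lambda>v. if c \<le> v then b else 0) k \<omega> - grid_sum Z' c b k D Nn \<omega>\<bar>) \<le>
       tail_sum c C q A \<bar>k\<bar> D + real D * (W * 0 + b / real Nn + b * W * ((C / 2 + 2) * sqrt (1 / real Nn)))"
      unfolding W_def by (rule F'.weighted_integral_grid[OF cD Nn(1) _ b]) auto
    then show "(LINT \<omega>|N. min 1 \<bar>weighted_integral Z' (\<lambda>v. if c \<le> v then b else 0) k \<omega> - grid_sum Z' c b k D Nn \<omega>\<bar>) \<le> e"
      using bound[of 0] e by simp
    define x where "x i = c + real i / real Nn" for i
    define a where "a i = s * (b * (x i - k) / real Nn)" for i
    \<comment> \<open>The exponential of a sum over nodes is a product of bounded continuous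
      functions of the logarithms, the form in which finite-dimensional convergence is
      available.\<close>
    have r1: "iexp (s * grid_sum (Z n) c b k D Nn \<omega>) = (\<Prod>i<D * Nn. iexp (a i * exp (ln (Z n (x i) \<omega>))))" for n \<omega>
      unfolding grid_sum_def sum_distrib_left of_real_sum exp_sum[OF finite_lessThan]
      by (intro prod.cong) (auto simp: a_def x_def pos mult.assoc)
    have r2: "iexp (s * grid_sum Z' c b k D Nn \<omega>) = (\<Prod>i<D * Nn. iexp (a i * exp (ln (Z' (x i) \<omega>))))" for \<omega>
      unfolding grid_sum_def sum_distrib_left of_real_sum exp_sum[OF finite_lessThan]
      by (intro prod.cong) (auto simp: a_def x_def pos mult.assoc)
    have "(\<lambda>n. LINT \<omega>|M n. (\<Prod>i<D * Nn. iexp (a i * exp (ln (Z n (x i) \<omega>))))) \<longlonglongrightarrow> (LINT \<omega>|N. (\<Prod>i<D * Nn. iexp (a i * exp (ln (Z' (x i) \<omega>)))))"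
    proof (rule fdd_char_conv_imp_prod_conv[where X="\<lambda>n i \<omega>. ln (Z n (x i) \<omega>)" and X'="\<lambda>i \<omega>. ln (Z' (x i) \<omega>)" and g="\<lambda>i y. iexp (a i * exp y)"])
      show "(\<lambda>n. LINT \<omega>|M n. iexp (\<Sum>i<D * Nn. t i * ln (Z n (x i) \<omega>))) \<longlonglongrightarrow> (LINT \<omega>|N. iexp (\<Sum>i<D * Nn. t i * ln (Z' (x i) \<omega>)))" for t
        by (rule fdd) (simp add: x_def)
      show "isCont (\<lambda>y. iexp (a i * exp y)) y" for i y by (intro continuous_intros)
    qed (auto simp: F'.prob_space_axioms F.prob_space_axioms)
    then show "(\<lambda>n. LINT \<omega>|M n. iexp (s * grid_sum (Z n) c b k D Nn \<omega>)) \<longlonglongrightarrow> (LINT \<omega>|N. iexp (s * grid_sum Z' c b k D Nn \<omega>))"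
      unfolding r1 r2 .
  qed
qed

section \<open>The limit likelihood field\<close>

text \<open>Completing the square turns the factor \<open>exp (s * x)\<close> into a shift of the
  density by \<open>s\<close>.\<close>

lemma std_normal_exp:
  "integrable lborel (\<lambda>x. std_normal_density x *\<^sub>R (exp (s * x) *\<^sub>R iexp (t * x)))"
  "(LBINT x. std_normal_density x *\<^sub>R (exp (s * x) *\<^sub>R iexp (t * x))) = exp (s\<^sup>2 / 2 - t\<^sup>2 / 2) *\<^sub>R iexp (s * t)"
proof -
  have e: "std_normal_density x *\<^sub>R (exp (s * x) *\<^sub>R iexp (t * x)) = exp (s\<^sup>2 / 2) *\<^sub>R (iexp (s * t) * (std_normal_density (x - s) *\<^sub>R iexp (t * (x - s))))" for x
  proof -
    have "std_normal_density x * exp (s * x) = exp (s\<^sup>2 / 2) * std_normal_density (x - s)"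
      unfolding std_normal_density_def by (simp add: exp_add[symmetric] power2_diff field_simps)
    moreover have "iexp (t * x) = iexp (s * t) * iexp (t * (x - s))"
      by (simp add: exp_add[symmetric] algebra_simps)
    ultimately have "(std_normal_density x * exp (s * x)) *\<^sub>R iexp (t * x) = (exp (s\<^sup>2 / 2) * std_normal_density (x - s)) *\<^sub>R (iexp (s * t) * iexp (t * (x - s)))"
      by (simp only:)
    then show ?thesis by (simp only: scaleR_scaleR[symmetric] mult_scaleR_right)
  qed
  have i: "integrable lborel (\<lambda>x. std_normal_density x *\<^sub>R iexp (t * x))"
    by (rule Bochner_Integration.integrable_bound[OF integrable_normal_density[of 1 0]]) (auto simp: norm_mult)
  have i2: "integrable lborel (\<lambda>x. std_normal_density (x - s) *\<^sub>R iexp (t * (x - s)))"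
    using lborel_integrable_real_affine[OF i, of 1 "- s"] by (simp add: algebra_simps)
  show "integrable lborel (\<lambda>x. std_normal_density x *\<^sub>R (exp (s * x) *\<^sub>R iexp (t * x)))"
    unfolding e by (intro integrable_scaleR_right integrable_mult_right i2)
  have "(LBINT x. std_normal_density x *\<^sub>R iexp (t * x)) = char std_normal_distribution t"
    unfolding char_def by (subst integral_density) auto
  also have "\<dots> = of_real (exp (- (t\<^sup>2) / 2))" by (simp only: char_std_normal_distribution)
  finally have c: "(LBINT x. std_normal_density x *\<^sub>R iexp (t * x)) = of_real (exp (- (t\<^sup>2) / 2))" .
  have "(LBINT x. std_normal_density x *\<^sub>R iexp (t * x)) = (LBINT x. std_normal_density (x - s) *\<^sub>R iexp (t * (x - s)))"
    using lborel_integral_real_affine[of 1 "\<lambda>x. std_normal_density x *\<^sub>R iexp (t * x)" "- s"] by (simp add: algebra_simps)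
  then have "(LBINT x. std_normal_density x *\<^sub>R (exp (s * x) *\<^sub>R iexp (t * x))) = exp (s\<^sup>2 / 2) *\<^sub>R (iexp (s * t) * of_real (exp (- (t\<^sup>2) / 2)))"
    unfolding e c by (subst integral_scaleR_right, subst integral_mult_right_zero) simp
  also have "\<dots> = exp (s\<^sup>2 / 2 - t\<^sup>2 / 2) *\<^sub>R iexp (s * t)"
  proof -
    have "exp (s\<^sup>2 / 2 - t\<^sup>2 / 2) = exp (s\<^sup>2 / 2) * exp (- (t\<^sup>2) / 2)" by (simp flip: exp_add)
    then show ?thesis unfolding scaleR_conv_of_real by (simp only: of_real_mult mult_ac)
  qed
  finally show "(LBINT x. std_normal_density x *\<^sub>R (exp (s * x) *\<^sub>R iexp (t * x))) = exp (s\<^sup>2 / 2 - t\<^sup>2 / 2) *\<^sub>R iexp (s * t)" .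
qed

text \<open>The transform at the complex point \<open>s + \<i> * t\<close>: the exponent is half the
  square of that point times the variance, with real and imaginary parts written separately.
  Vanishing variance is a case of its own, in which there is no density.\<close>

lemma (in prob_space) centered_normal_props:
  assumes Y: "centered_normal M Y"
  shows "integrable M (\<lambda>\<omega>. (Y \<omega>)\<^sup>2)"
    and "integrable M (\<lambda>\<omega>. exp (s * Y \<omega>) *\<^sub>R iexp (t * Y \<omega>))"
    and "(LINT \<omega>|M. exp (s * Y \<omega>) *\<^sub>R iexp (t * Y \<omega>)) =
      exp ((s\<^sup>2 / 2 - t\<^sup>2 / 2) * (LINT \<omega>|M. (Y \<omega>)\<^sup>2)) *\<^sub>R iexp (s * t * (LINT \<omega>|M. (Y \<omega>)\<^sup>2))"
proof -
  have [measurable]: "Y \<in> borel_measurable M" using Y by (simp add: centered_normal_def)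
  have "integrable M (\<lambda>\<omega>. (Y \<omega>)\<^sup>2) \<and> integrable M (\<lambda>\<omega>. exp (s * Y \<omega>) *\<^sub>R iexp (t * Y \<omega>)) \<and>
    (LINT \<omega>|M. exp (s * Y \<omega>) *\<^sub>R iexp (t * Y \<omega>)) =
      exp ((s\<^sup>2 / 2 - t\<^sup>2 / 2) * (LINT \<omega>|M. (Y \<omega>)\<^sup>2)) *\<^sub>R iexp (s * t * (LINT \<omega>|M. (Y \<omega>)\<^sup>2))"
  proof (cases "AE \<omega> in M. Y \<omega> = 0")
    case True
    have v: "(LINT \<omega>|M. (Y \<omega>)\<^sup>2) = 0" by (rule integral_eq_zero_AE) (use True in auto)
    have a: "AE \<omega> in M. exp (s * Y \<omega>) *\<^sub>R iexp (t * Y \<omega>) = (1::complex)" using True by eventually_elim simp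
    have "integrable M (\<lambda>\<omega>. (Y \<omega>)\<^sup>2)"
      by (rule integrable_cong_AE_imp[of _ "\<lambda>_. 0"]) (use True in \<open>auto elim: eventually_mono\<close>)
    moreover have "integrable M (\<lambda>\<omega>. exp (s * Y \<omega>) *\<^sub>R iexp (t * Y \<omega>))"
      by (rule integrable_cong_AE_imp[of _ "\<lambda>_. 1"]) (use a in \<open>auto elim: eventually_mono\<close>)
    moreover have "(LINT \<omega>|M. exp (s * Y \<omega>) *\<^sub>R iexp (t * Y \<omega>)) = (LINT \<omega>|M. (1::complex))"
      by (rule integral_cong_AE) (use a in auto)
    ultimately show ?thesis unfolding v by (simp add: prob_space)
  next
    case False
    then obtain \<sigma> where \<sigma>: "\<sigma> > 0" and d: "distributed M lborel Y (normal_density 0 \<sigma>)"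
      using Y by (auto simp: centered_normal_def)
    define U where "U \<omega> = Y \<omega> / \<sigma>" for \<omega>
    have [measurable]: "U \<in> borel_measurable M" unfolding U_def by measurable
    have dU: "distributed M lborel U std_normal_density"
      using d normal_standard_normal_convert[OF \<sigma>, of Y 0] by (simp add: U_def[abs_def])
    have dist: "distr M lborel U = std_normal_distribution" by (rule distributed_distr_eq_density[OF dU])
    have Y': "Y \<omega> = \<sigma> * U \<omega>" for \<omega> using \<sigma> by (simp add: U_def)
    have "integrable lborel (\<lambda>x. std_normal_density x *\<^sub>R x\<^sup>2)" using integrable_std_normal_moment[of 2] by simp
    then have "integrable std_normal_distribution (\<lambda>x. x\<^sup>2)" by (subst integrable_density) auto
    then have i: "integrable M (\<lambda>\<omega>. (U \<omega>)\<^sup>2)" unfolding dist[symmetric] by (subst (asm) integrable_distr_eq) auto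
    have "(LINT \<omega>|M. (U \<omega>)\<^sup>2) = (LINT x|std_normal_distribution. x\<^sup>2)" unfolding dist[symmetric] by (subst integral_distr) auto
    also have "\<dots> = (LBINT x. std_normal_density x * x\<^sup>2)" by (subst integral_density) auto
    also have "\<dots> = 1" using integral_std_normal_moment_even[of 1] by simp
    finally have v1: "(LINT \<omega>|M. (U \<omega>)\<^sup>2) = 1" .
    have v: "(LINT \<omega>|M. (Y \<omega>)\<^sup>2) = \<sigma>\<^sup>2" unfolding Y' power_mult_distrib using v1 by simp
    have iY: "integrable M (\<lambda>\<omega>. (Y \<omega>)\<^sup>2)" unfolding Y' power_mult_distrib using i by simp
    have "integrable std_normal_distribution (\<lambda>x. exp ((s * \<sigma>) * x) *\<^sub>R iexp ((t * \<sigma>) * x))"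
      by (subst integrable_density) (use std_normal_exp(1)[of "s * \<sigma>" "t * \<sigma>"] in auto)
    then have i3: "integrable M (\<lambda>\<omega>. exp ((s * \<sigma>) * U \<omega>) *\<^sub>R iexp ((t * \<sigma>) * U \<omega>))"
      unfolding dist[symmetric] by (subst (asm) integrable_distr_eq) auto
    have "(LINT \<omega>|M. exp ((s * \<sigma>) * U \<omega>) *\<^sub>R iexp ((t * \<sigma>) * U \<omega>)) = (LINT x|std_normal_distribution. exp ((s * \<sigma>) * x) *\<^sub>R iexp ((t * \<sigma>) * x))"
      unfolding dist[symmetric] by (subst integral_distr) auto
    also have "\<dots> = (LBINT x. std_normal_density x *\<^sub>R (exp ((s * \<sigma>) * x) *\<^sub>R iexp ((t * \<sigma>) * x)))"
      by (subst integral_density) auto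
    also have "\<dots> = exp ((s * \<sigma>)\<^sup>2 / 2 - (t * \<sigma>)\<^sup>2 / 2) *\<^sub>R iexp ((s * \<sigma>) * (t * \<sigma>))" by (rule std_normal_exp(2))
    also have "(s * \<sigma>)\<^sup>2 / 2 - (t * \<sigma>)\<^sup>2 / 2 = (s\<^sup>2 / 2 - t\<^sup>2 / 2) * \<sigma>\<^sup>2" by (simp add: power_mult_distrib algebra_simps)
    also have "(s * \<sigma>) * (t * \<sigma>) = s * t * \<sigma>\<^sup>2" by (simp add: power2_eq_square)
    finally show ?thesis using i3 iY unfolding v by (simp add: Y' mult.assoc)
  qed
  then show "integrable M (\<lambda>\<omega>. (Y \<omega>)\<^sup>2)" "integrable M (\<lambda>\<omega>. exp (s * Y \<omega>) *\<^sub>R iexp (t * Y \<omega>))"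
    "(LINT \<omega>|M. exp (s * Y \<omega>) *\<^sub>R iexp (t * Y \<omega>)) =
      exp ((s\<^sup>2 / 2 - t\<^sup>2 / 2) * (LINT \<omega>|M. (Y \<omega>)\<^sup>2)) *\<^sub>R iexp (s * t * (LINT \<omega>|M. (Y \<omega>)\<^sup>2))" by auto
qed

section \<open>Gaussian calculus for fractional Brownian motion\<close>

locale fbm = prob_space N for N :: "'b measure" +
  fixes H :: real and W :: "real \<Rightarrow> 'b \<Rightarrow> real"
  assumes fbm: "fractional_brownian_motion N H W" and H: "1 / 2 < H"
begin

lemma W_measurable [measurable]: "W u \<in> borel_measurable N"
  using fbm by (simp add: fractional_brownian_motion_def)

lemma W_zero: "\<omega> \<in> space N \<Longrightarrow> W 0 \<omega> = 0"
  and W_continuous: "\<omega> \<in> space N \<Longrightarrow> continuous_on UNIV (\<lambda>u. W u \<omega>)"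
  using fbm by (simp_all add: fractional_brownian_motion_def)

lemma W_increment: "(LINT \<omega>|N. (W u \<omega> - W v \<omega>)\<^sup>2) = \<bar>u - v\<bar> powr (2 * H)"
  using fbm by (simp add: fractional_brownian_motion_def)

text \<open>The linear span of the process. Its members are centred normal, so the transforms below
  reduce to computing second moments.\<close>

definition lin :: "('b \<Rightarrow> real) \<Rightarrow> bool" where
  "lin Y \<longleftrightarrow> (\<exists>T a. finite T \<and> Y = (\<lambda>\<omega>. \<Sum>u\<in>T. a u * W u \<omega>))"

lemma lin_W: "lin (W u)"
  unfolding lin_def by (intro exI[of _ "{u}"] exI[of _ "\<lambda>_. 1"]) auto

lemma lin_scale: "lin Y \<Longrightarrow> lin (\<lambda>\<omega>. r * Y \<omega>)"
  unfolding lin_def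
proof (elim exE conjE)
  fix T a assume "finite T" "Y = (\<lambda>\<omega>. \<Sum>u\<in>T. a u * W u \<omega>)"
  then show "\<exists>T a. finite T \<and> (\<lambda>\<omega>. r * Y \<omega>) = (\<lambda>\<omega>. \<Sum>u\<in>T. a u * W u \<omega>)"
    by (intro exI[of _ T] exI[of _ "\<lambda>u. r * a u"]) (auto simp: sum_distrib_left mult.assoc)
qed

lemma lin_add: "lin X \<Longrightarrow> lin Y \<Longrightarrow> lin (\<lambda>\<omega>. X \<omega> + Y \<omega>)"
  unfolding lin_def
proof (elim exE conjE)
  fix T a T' a' assume T: "finite T" "finite T'" and X: "X = (\<lambda>\<omega>. \<Sum>u\<in>T. a u * W u \<omega>)" and Y: "Y = (\<lambda>\<omega>. \<Sum>u\<in>T'. a' u * W u \<omega>)"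
  have e: "(\<Sum>u\<in>B. f u * W u \<omega>) = (\<Sum>u\<in>T \<union> T'. (if u \<in> B then f u else 0) * W u \<omega>)" if "B \<subseteq> T \<union> T'" for B f \<omega>
    using T that by (intro sum.mono_neutral_cong_left) auto
  show "\<exists>T a. finite T \<and> (\<lambda>\<omega>. X \<omega> + Y \<omega>) = (\<lambda>\<omega>. \<Sum>u\<in>T. a u * W u \<omega>)"
  proof (intro exI[of _ "T \<union> T'"] exI[of _ "\<lambda>u. (if u \<in> T then a u else 0) + (if u \<in> T' then a' u else 0)"] conjI ext)
    fix \<omega>
    show "X \<omega> + Y \<omega> = (\<Sum>u\<in>T \<union> T'. ((if u \<in> T then a u else 0) + (if u \<in> T' then a' u else 0)) * W u \<omega>)"
      unfolding X Y distrib_right sum.distrib using e[of T a \<omega>] e[of T' a' \<omega>] by (simp only: Un_upper1 Un_upper2)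
  qed (use T in auto)
qed

lemma lin_sum: "lin (\<lambda>\<omega>. \<Sum>i<m::nat. t i * W (x i) \<omega>)"
proof (induction m)
  case 0
  show ?case unfolding lin_def by (intro exI[of _ "{}"]) auto
next
  case (Suc m)
  show ?case using lin_add[OF Suc lin_scale[OF lin_W[of "x m"], of "t m"]] by simp
qed

lemma lin_normal: "lin Y \<Longrightarrow> centered_normal N Y"
  using fbm unfolding lin_def fractional_brownian_motion_def by auto

lemma lin_measurable: "lin Y \<Longrightarrow> Y \<in> borel_measurable N"
  using lin_normal by (simp add: centered_normal_def)

lemma lin_square_integrable: "lin Y \<Longrightarrow> integrable N (\<lambda>\<omega>. (Y \<omega>)\<^sup>2)"
  by (rule centered_normal_props(1)[OF lin_normal])

lemma lin_prod_integrable: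
  assumes "lin X" "lin Y"
  shows "integrable N (\<lambda>\<omega>. X \<omega> * Y \<omega>)"
proof -
  have "integrable N (\<lambda>\<omega>. ((X \<omega> + Y \<omega>)\<^sup>2 - (X \<omega>)\<^sup>2 - (Y \<omega>)\<^sup>2) / 2)"
    by (intro integrable_divide Bochner_Integration.integrable_diff lin_square_integrable lin_add assms)
  moreover have "((X \<omega> + Y \<omega>)\<^sup>2 - (X \<omega>)\<^sup>2 - (Y \<omega>)\<^sup>2) / 2 = X \<omega> * Y \<omega>" for \<omega>
    by (simp add: power2_sum)
  ultimately show ?thesis by simp
qed

lemma lin_iexp:
  assumes "lin Y"
  shows "(LINT \<omega>|N. iexp (Y \<omega>)) = of_real (exp (- (LINT \<omega>|N. (Y \<omega>)\<^sup>2) / 2))"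
  using centered_normal_props(3)[OF lin_normal[OF assms], of 0 1] by (simp add: scaleR_conv_of_real)

lemma lin_exp:
  assumes "lin Y"
  shows "integrable N (\<lambda>\<omega>. exp (Y \<omega>))" "(LINT \<omega>|N. exp (Y \<omega>)) = exp ((LINT \<omega>|N. (Y \<omega>)\<^sup>2) / 2)" (is ?goal)
proof -
  have "integrable N (\<lambda>\<omega>. complex_of_real (exp (Y \<omega>)))"
    using centered_normal_props(2)[OF lin_normal[OF assms], of 1 0] by (simp add: scaleR_conv_of_real)
  then show "integrable N (\<lambda>\<omega>. exp (Y \<omega>))" using integrable_Re by fastforce
  have "(LINT \<omega>|N. complex_of_real (exp (Y \<omega>))) = complex_of_real (exp ((LINT \<omega>|N. (Y \<omega>)\<^sup>2) / 2))"
    using centered_normal_props(3)[OF lin_normal[OF assms], of 1 0] by (simp add: scaleR_conv_of_real)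
  then show ?goal
    unfolding integral_complex_of_real of_real_eq_iff .
qed

definition K :: "real \<Rightarrow> real \<Rightarrow> real" where
  "K u v = (\<bar>u\<bar> powr (2 * H) + \<bar>v\<bar> powr (2 * H) - \<bar>u - v\<bar> powr (2 * H)) / 2"

lemma W_square: "(LINT \<omega>|N. (W u \<omega>)\<^sup>2) = \<bar>u\<bar> powr (2 * H)"
proof -
  have "(LINT \<omega>|N. (W u \<omega>)\<^sup>2) = (LINT \<omega>|N. (W u \<omega> - W 0 \<omega>)\<^sup>2)"
    by (intro Bochner_Integration.integral_cong) (auto simp: W_zero)
  then show ?thesis using W_increment[of u 0] by simp
qed

lemma W_cov: "(LINT \<omega>|N. W u \<omega> * W v \<omega>) = K u v"
proof -
  have l: "lin (\<lambda>\<omega>. W u \<omega> - W v \<omega>)"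
    using lin_add[OF lin_W[of u] lin_scale[OF lin_W[of v], of "-1"]] by simp
  have e: "W u \<omega> * W v \<omega> = ((W u \<omega>)\<^sup>2 + (W v \<omega>)\<^sup>2 - (W u \<omega> - W v \<omega>)\<^sup>2) / 2" for \<omega>
    by (simp add: power2_diff)
  show ?thesis unfolding e integral_divide_zero K_def
    using lin_square_integrable[OF lin_W[of u]] lin_square_integrable[OF lin_W[of v]] lin_square_integrable[OF l]
    by (simp add: W_square W_increment)
qed

lemma sum_square:
  "(LINT \<omega>|N. (\<Sum>i<m::nat. t i * W (x i) \<omega>)\<^sup>2) = (\<Sum>i<m. \<Sum>j<m. t i * t j * K (x i) (x j))"
proof -
  have e: "(\<Sum>i<m. t i * W (x i) \<omega>)\<^sup>2 = (\<Sum>i<m. \<Sum>j<m. (t i * t j) * (W (x i) \<omega> * W (x j) \<omega>))" for \<omega>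
    unfolding power2_eq_square sum_product by (intro sum.cong) auto
  have i: "integrable N (\<lambda>\<omega>. (t i * t j) * (W (x i) \<omega> * W (x j) \<omega>))" for i j
    by (intro integrable_mult_right lin_prod_integrable lin_W)
  show ?thesis unfolding e
    by (subst Bochner_Integration.integral_sum, intro Bochner_Integration.integrable_sum i,
        intro sum.cong refl, subst Bochner_Integration.integral_sum, rule i, intro sum.cong refl, subst integral_mult_right_zero, simp only: W_cov)
qed

lemma sum_iexp:
  "(LINT \<omega>|N. iexp (\<Sum>i<m::nat. t i * W (x i) \<omega>)) = of_real (exp (- (\<Sum>i<m. \<Sum>j<m. t i * t j * K (x i) (x j)) / 2))"
  using lin_iexp[OF lin_sum] by (simp add: sum_square)

text \<open>Continuity of paths turns measurability at each fixed time into joint measurability: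
  time is rounded down to ever finer grids, on which only countably many values occur.\<close>

lemma W_pair_measurable [measurable]: "(\<lambda>(u, \<omega>). W u \<omega>) \<in> borel_measurable (borel \<Otimes>\<^sub>M N)"
proof (rule borel_measurable_LIMSEQ_real)
  fix m :: nat
  have "(\<lambda>p. (\<lambda>k p. W (real_of_int k / real (Suc m)) (snd p)) \<lfloor>real (Suc m) * fst p\<rfloor> p) \<in> borel_measurable (borel \<Otimes>\<^sub>M N)"
    by (rule measurable_compose_countable) measurable
  then show "(\<lambda>(u, \<omega>). W (real_of_int \<lfloor>real (Suc m) * u\<rfloor> / real (Suc m)) \<omega>) \<in> borel_measurable (borel \<Otimes>\<^sub>M N)"
    by (simp add: case_prod_beta')
next
  fix p :: "real \<times> 'b" assume "p \<in> space (borel \<Otimes>\<^sub>M N)"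
  then obtain u \<omega> where p: "p = (u, \<omega>)" "\<omega> \<in> space N" by (auto simp: space_pair_measure)
  have "(\<lambda>m. real_of_int \<lfloor>real (Suc m) * u\<rfloor> / real (Suc m)) \<longlonglongrightarrow> u"
  proof (rule tendsto_sandwich[where f="\<lambda>m. u - 1 / real (Suc m)" and h="\<lambda>_. u"])
    have "(\<lambda>m. u - 1 / real (Suc m)) \<longlonglongrightarrow> u - 0" by (intro tendsto_intros LIMSEQ_Suc[OF lim_1_over_n])
    then show "(\<lambda>m. u - 1 / real (Suc m)) \<longlonglongrightarrow> u" by simp
    show "\<forall>\<^sub>F m in sequentially. u - 1 / real (Suc m) \<le> real_of_int \<lfloor>real (Suc m) * u\<rfloor> / real (Suc m)"
      "\<forall>\<^sub>F m in sequentially. real_of_int \<lfloor>real (Suc m) * u\<rfloor> / real (Suc m) \<le> u"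
      using grid_floor_bounds(1,2)[where c=0 and v=u and N="Suc m" for m] by (auto intro!: always_eventually simp: algebra_simps simp del: of_nat_Suc)
  qed auto
  moreover have "isCont (\<lambda>u. W u \<omega>) u" using W_continuous[OF p(2)] by (simp add: continuous_on_eq_continuous_at)
  ultimately show "(\<lambda>m. (\<lambda>(u, \<omega>). W (real_of_int \<lfloor>real (Suc m) * u\<rfloor> / real (Suc m)) \<omega>) p) \<longlonglongrightarrow> (\<lambda>(u, \<omega>). W u \<omega>) p"
    unfolding p by (simp del: of_nat_Suc add: isCont_tendsto_compose[of u "\<lambda>u. W u \<omega>"])
qed

definition Z :: "real \<Rightarrow> 'b \<Rightarrow> real" where "Z = limit_likelihood H W"

lemma Z_def': "Z v \<omega> = exp (W v \<omega> - \<bar>v\<bar> powr (2 * H) / 2)"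
  by (simp add: Z_def limit_likelihood_def)

lemma Z_pos: "0 < Z v \<omega>" by (simp add: Z_def')

lemma sqrt_Z: "sqrt (Z v \<omega>) = exp (1 / 2 * W v \<omega> - \<bar>v\<bar> powr (2 * H) / 4)"
proof -
  have "Z v \<omega> = (exp (1 / 2 * W v \<omega> - \<bar>v\<bar> powr (2 * H) / 4))\<^sup>2"
    unfolding Z_def' power2_eq_square exp_add[symmetric] by simp
  then show ?thesis by simp
qed

lemma scaled_W_square: "(LINT \<omega>|N. (r * W v \<omega>)\<^sup>2) = r\<^sup>2 * \<bar>v\<bar> powr (2 * H)"
  unfolding power_mult_distrib integral_mult_right_zero W_square ..

lemma nn_Z: "(\<integral>\<^sup>+\<omega>. ennreal (Z v \<omega>) \<partial>N) = 1"
proof -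
  have i: "integrable N (\<lambda>\<omega>. exp (W v \<omega>) * exp (- (\<bar>v\<bar> powr (2 * H)) / 2))"
    by (intro integrable_mult_left lin_exp lin_W)
  have e: "Z v \<omega> = exp (W v \<omega>) * exp (- (\<bar>v\<bar> powr (2 * H)) / 2)" for \<omega> unfolding Z_def' exp_add[symmetric] by simp
  have "(LINT \<omega>|N. Z v \<omega>) = 1"
    unfolding e integral_mult_left_zero lin_exp(2)[OF lin_W] W_square by (simp flip: exp_add)
  then show ?thesis
    using nn_integral_eq_integral[of N "Z v"] i Z_pos less_imp_le[OF Z_pos] unfolding e[symmetric] by auto
qed

lemma nn_sqrt_Z: "(\<integral>\<^sup>+\<omega>. ennreal (sqrt (Z v \<omega>)) \<partial>N) = ennreal (exp (- (\<bar>v\<bar> powr (2 * H)) / 8))"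
proof -
  have i: "integrable N (\<lambda>\<omega>. exp (1 / 2 * W v \<omega>) * exp (- (\<bar>v\<bar> powr (2 * H)) / 4))"
    by (intro integrable_mult_left lin_exp lin_W lin_scale)
  have e: "sqrt (Z v \<omega>) = exp (1 / 2 * W v \<omega>) * exp (- (\<bar>v\<bar> powr (2 * H)) / 4)" for \<omega> unfolding sqrt_Z exp_add[symmetric] by simp
  have "(LINT \<omega>|N. sqrt (Z v \<omega>)) = exp (- (\<bar>v\<bar> powr (2 * H)) / 8)"
    unfolding e integral_mult_left_zero lin_exp(2)[OF lin_scale[OF lin_W]] scaled_W_square by (simp add: power2_eq_square flip: exp_add)
  then show ?thesis
    using nn_integral_eq_integral[of N "\<lambda>\<omega>. sqrt (Z v \<omega>)"] i less_imp_le[OF Z_pos] unfolding e[symmetric] by auto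
qed

text \<open>Expanding the square leaves \<open>2 - 2 * exp (- d / 8)\<close> with
  \<open>d = \<bar>u - v\<bar> powr (2 * H)\<close>, because the mean of the product of the two
  roots depends on the increment alone.\<close>

lemma nn_sqrt_Z_diff: "(\<integral>\<^sup>+\<omega>. ennreal ((sqrt (Z u \<omega>) - sqrt (Z v \<omega>))\<^sup>2) \<partial>N) \<le> ennreal (\<bar>u - v\<bar> powr (2 * H) / 4)"
proof -
  have lS: "lin (\<lambda>\<omega>. 1 / 2 * (W u \<omega> + W v \<omega>))" by (intro lin_scale lin_add lin_W)
  have S2: "(LINT \<omega>|N. (1 / 2 * (W u \<omega> + W v \<omega>))\<^sup>2) = (2 * \<bar>u\<bar> powr (2 * H) + 2 * \<bar>v\<bar> powr (2 * H) - \<bar>u - v\<bar> powr (2 * H)) / 4"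
  proof -
    have "(1 / 2 * (W u \<omega> + W v \<omega>))\<^sup>2 = 1 / 4 * (W u \<omega>)\<^sup>2 + (1 / 4 * (W v \<omega>)\<^sup>2 + 1 / 2 * (W u \<omega> * W v \<omega>))" for \<omega>
      by (simp add: power2_eq_square field_simps)
    then show ?thesis
      using lin_square_integrable[OF lin_W[of u]] lin_square_integrable[OF lin_W[of v]] lin_prod_integrable[OF lin_W[of u] lin_W[of v]]
      by (simp add: W_square W_cov K_def field_simps)
  qed
  define c where "c = exp (- (\<bar>u\<bar> powr (2 * H) + \<bar>v\<bar> powr (2 * H)) / 4)"
  have e: "(sqrt (Z u \<omega>) - sqrt (Z v \<omega>))\<^sup>2 = Z u \<omega> + (Z v \<omega> - 2 * (c * exp (1 / 2 * (W u \<omega> + W v \<omega>))))" for \<omega>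
  proof -
    have "sqrt (Z u \<omega>) * sqrt (Z v \<omega>) = c * exp (1 / 2 * (W u \<omega> + W v \<omega>))"
      unfolding sqrt_Z c_def exp_add[symmetric] by (simp add: field_simps)
    then show ?thesis using Z_pos[of u \<omega>] Z_pos[of v \<omega>] by (simp add: power2_diff)
  qed
  have iZ: "integrable N (Z w)" for w
    using nn_Z[of w] less_imp_le[OF Z_pos] by (intro integrableI_nn_integral_finite[where x=1]) (auto simp: Z_def'[abs_def])
  have eZ: "(LINT \<omega>|N. Z w \<omega>) = 1" for w
    using nn_Z[of w] less_imp_le[OF Z_pos] by (subst integral_eq_nn_integral) (auto simp: Z_def'[abs_def])
  have i: "integrable N (\<lambda>\<omega>. c * exp (1 / 2 * (W u \<omega> + W v \<omega>)))" by (intro integrable_mult_right lin_exp lS)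
  have i': "integrable N (\<lambda>\<omega>. (sqrt (Z u \<omega>) - sqrt (Z v \<omega>))\<^sup>2)" unfolding e using iZ i by simp
  have "(LINT \<omega>|N. (sqrt (Z u \<omega>) - sqrt (Z v \<omega>))\<^sup>2) = 2 - 2 * (c * exp ((LINT \<omega>|N. (1 / 2 * (W u \<omega> + W v \<omega>))\<^sup>2) / 2))"
    unfolding e using iZ i by (simp add: eZ lin_exp(2)[OF lS, simplified])
  also have "c * exp ((LINT \<omega>|N. (1 / 2 * (W u \<omega> + W v \<omega>))\<^sup>2) / 2) = exp (- (\<bar>u - v\<bar> powr (2 * H)) / 8)"
    unfolding S2 c_def exp_add[symmetric] by (simp add: field_simps)
  also have "2 - 2 * exp (- (\<bar>u - v\<bar> powr (2 * H)) / 8) \<le> \<bar>u - v\<bar> powr (2 * H) / 4"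
    using exp_ge_add_one_self[of "- (\<bar>u - v\<bar> powr (2 * H)) / 8"] by simp
  finally show ?thesis using i' by (subst nn_integral_eq_integral) (auto intro: ennreal_leI)
qed

lemma powr_2H_ge: "1 \<le> x \<Longrightarrow> x \<le> x powr (2 * H)"
  using powr_mono[of 1 "2 * H" x] H by simp

lemma powr_2H_le: "0 \<le> x \<Longrightarrow> x \<le> 1 \<Longrightarrow> x powr (2 * H) \<le> x"
  using powr_mono'[of 1 "2 * H" x] H by simp

text \<open>As \<open>2 * H > 1\<close>, the power is at most linear up to distance 1 and at least
  linear beyond, so the limit meets the same linear bounds as the experiments. The thresholds 1/4
  and 1/8 come from the moment formulas for the root.\<close>

lemma limit_field:
  assumes "0 \<le> b" "b \<le> A" "1 / 4 \<le> C" "0 < q" "q \<le> 1 / 8"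
  shows "likelihood_field N Z {c..} (\<lambda>v. if c \<le> v then b else 0) c C q A"
proof
  show "(\<lambda>(v, \<omega>). Z v \<omega>) \<in> borel_measurable (borel \<Otimes>\<^sub>M N)"
    unfolding Z_def' case_prod_beta' using W_pair_measurable unfolding case_prod_beta' by measurable
  show "0 \<le> Z v \<omega>" for v \<omega> using Z_pos less_imp_le by blast
  show "(\<integral>\<^sup>+\<omega>. ennreal (Z v \<omega>) \<partial>N) \<le> 1" for v by (simp add: nn_Z)
  show "(\<integral>\<^sup>+\<omega>. ennreal ((sqrt (Z u \<omega>) - sqrt (Z v \<omega>))\<^sup>2) \<partial>N) \<le> ennreal (C * \<bar>u - v\<bar>)" if "\<bar>u - v\<bar> \<le> 1" for u v
  proof (rule order_trans[OF nn_sqrt_Z_diff ennreal_leI])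
    have "\<bar>u - v\<bar> powr (2 * H) / 4 \<le> 1 / 4 * \<bar>u - v\<bar>" using powr_2H_le[OF _ that] by simp
    also have "\<dots> \<le> C * \<bar>u - v\<bar>" using assms by (intro mult_right_mono) auto
    finally show "\<bar>u - v\<bar> powr (2 * H) / 4 \<le> C * \<bar>u - v\<bar>" .
  qed
  show "(\<integral>\<^sup>+\<omega>. ennreal (sqrt (Z v \<omega>)) \<partial>N) \<le> ennreal (exp (- q * v))" if "1 \<le> v" for v
  proof -
    have "q * v \<le> 1 / 8 * v" using that assms by (intro mult_right_mono) auto
    moreover have "\<bar>v\<bar> = v" using that by simp
    ultimately have "q * v \<le> \<bar>v\<bar> powr (2 * H) / 8" using powr_2H_ge[OF that] by linarith
    then show ?thesis unfolding nn_sqrt_Z by (intro ennreal_leI) simp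
  qed
  show "(\<integral>\<^sup>+v. ennreal (if c \<le> v then b else 0) * indicator (block c m) v \<partial>lborel) \<le> ennreal (A * (1 + real m))" for m
  proof -
    have "(\<integral>\<^sup>+v. ennreal (if c \<le> v then b else 0) * indicator (block c m) v \<partial>lborel) \<le> (\<integral>\<^sup>+v. ennreal b * indicator (block c m) v \<partial>lborel)"
      by (intro nn_integral_mono) (auto simp: indicator_def)
    also have "\<dots> = ennreal b" by (subst nn_integral_cmult_indicator) auto
    also have "\<dots> \<le> ennreal (A * (1 + real m))"
      using assms mult_left_mono[of 1 "1 + real m" A] by (intro ennreal_leI) auto
    finally show ?thesis .
  qed
qed (use assms in auto)

end

section \<open>Absence of an atom\<close>

lemma grid_sum_tendsto:
  fixes h :: "real \<Rightarrow> real"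
  assumes h: "continuous_on UNIV h"
  shows "(\<lambda>n. \<Sum>i<D * Suc n. h (c + real i / real (Suc n)) / real (Suc n)) \<longlonglongrightarrow> (LBINT v. indicator {c..<c + real D} v *\<^sub>R h v)"
proof -
  have [measurable]: "h \<in> borel_measurable borel" using h by (rule borel_measurable_continuous_onI)
  have "compact (h ` {c..c + real D})"
    by (intro compact_continuous_image continuous_on_subset[OF h]) auto
  then have "bounded (h ` {c..c + real D})" by (rule compact_imp_bounded)
  then obtain B where "\<forall>y\<in>h ` {c..c + real D}. norm y \<le> B" unfolding bounded_iff by blast
  then have B: "norm (h x) \<le> B" if "x \<in> {c..c + real D}" for x using that by blast
  have lim: "(\<lambda>n. grid_floor c (Suc n) v) \<longlonglongrightarrow> v" for v
  proof (rule tendsto_sandwich[where f="\<lambda>n. v - 1 / real (Suc n)" and h="\<lambda>_. v"])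
    have "(\<lambda>n. v - 1 / real (Suc n)) \<longlonglongrightarrow> v - 0" by (intro tendsto_intros LIMSEQ_Suc[OF lim_1_over_n])
    then show "(\<lambda>n. v - 1 / real (Suc n)) \<longlonglongrightarrow> v" by simp
    show "\<forall>\<^sub>F n in sequentially. v - 1 / real (Suc n) \<le> grid_floor c (Suc n) v"
      "\<forall>\<^sub>F n in sequentially. grid_floor c (Suc n) v \<le> v"
      using grid_floor_bounds(1,2)[where c=c and v=v and N="Suc n" for n] by (auto intro!: always_eventually simp: algebra_simps simp del: of_nat_Suc)
  qed auto
  have "(\<lambda>n. LBINT v. indicator {c..<c + real D} v *\<^sub>R h (grid_floor c (Suc n) v))
    \<longlonglongrightarrow> (LBINT v. indicator {c..<c + real D} v *\<^sub>R h v)"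
  proof (rule integral_dominated_convergence[where w="\<lambda>v. indicator {c..<c + real D} v *\<^sub>R B"])
    show "integrable lborel (\<lambda>v. indicator {c..<c + real D} v *\<^sub>R B)"
      by (intro integrable_scaleR_left) auto
    show "AE v in lborel. (\<lambda>n. indicator {c..<c + real D} v *\<^sub>R h (grid_floor c (Suc n) v)) \<longlonglongrightarrow> indicator {c..<c + real D} v *\<^sub>R h v"
    proof (rule AE_I2)
      fix v
      have "isCont h v" using h by (simp add: continuous_on_eq_continuous_at)
      from isCont_tendsto_compose[OF this lim] show "(\<lambda>n. indicator {c..<c + real D} v *\<^sub>R h (grid_floor c (Suc n) v)) \<longlonglongrightarrow> indicator {c..<c + real D} v *\<^sub>R h v"
        by (intro tendsto_scaleR tendsto_const)
    qed
    show "AE v in lborel. norm (indicator {c..<c + real D} v *\<^sub>R h (grid_floor c (Suc n) v)) \<le> indicator {c..<c + real D} v *\<^sub>R B" for n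
    proof (rule AE_I2)
      fix v
      show "norm (indicator {c..<c + real D} v *\<^sub>R h (grid_floor c (Suc n) v)) \<le> indicator {c..<c + real D} v *\<^sub>R B"
      proof (cases "v \<in> {c..<c + real D}")
        case True
        then have "grid_floor c (Suc n) v \<in> {c..c + real D}"
          using grid_floor_bounds[where c=c and v=v and N="Suc n"] by (auto simp del: of_nat_Suc)
        from B[OF this] True show ?thesis by simp
      qed simp
    qed
  qed measurable
  then show ?thesis by (subst (asm) integral_grid_floor) auto
qed

lemma integral_Ico_tendsto:
  fixes f :: "real \<Rightarrow> real"
  assumes f: "integrable lborel (\<lambda>v. indicator {c..} v *\<^sub>R f v)" and [measurable]: "f \<in> borel_measurable borel"
  shows "(\<lambda>D. LBINT v. indicator {c..<c + real D} v *\<^sub>R f v) \<longlonglongrightarrow> (LBINT v. indicator {c..} v *\<^sub>R f v)"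
proof (rule integral_dominated_convergence[where w="\<lambda>v. norm (indicator {c..} v *\<^sub>R f v)"])
  show "integrable lborel (\<lambda>v. norm (indicator {c..} v *\<^sub>R f v))" by (intro integrable_norm f)
  show "AE v in lborel. (\<lambda>D. indicator {c..<c + real D} v *\<^sub>R f v) \<longlonglongrightarrow> indicator {c..} v *\<^sub>R f v"
  proof (rule AE_I2)
    fix v
    obtain k :: nat where k: "v - c < real k" using reals_Archimedean2 by blast
    have "\<forall>\<^sub>F D in sequentially. indicator {c..<c + real D} v *\<^sub>R f v = indicator {c..} v *\<^sub>R f v"
      using eventually_ge_at_top[of k]
    proof eventually_elim
      case (elim D)
      then have "v < c + real D" using k by linarith
      then show ?case by (auto simp: indicator_def)
    qed
    then show "(\<lambda>D. indicator {c..<c + real D} v *\<^sub>R f v) \<longlonglongrightarrow> indicator {c..} v *\<^sub>R f v" by (rule tendsto_eventually)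
  qed
qed (auto simp: indicator_def)

text \<open>Strict convexity of the power: the derivative of the unit increment is positive.\<close>

lemma powr_increment_less:
  fixes p x y :: real
  assumes p: "1 < p" and xy: "0 \<le> x" "x < y"
  shows "(x + 1) powr p - x powr p < (y + 1) powr p - y powr p"
proof (rule DERIV_pos_imp_increasing_open[OF xy(2)])
  fix z assume z: "x < z" "z < y"
  have "((\<lambda>z. (z + 1) powr p - z powr p) has_real_derivative p * (z + 1) powr (p - 1) * 1 - p * z powr (p - 1)) (at z)"
    using z xy by (intro DERIV_diff DERIV_chain2[OF has_real_derivative_powr] has_real_derivative_powr) (auto intro!: derivative_eq_intros)
  moreover have "p * z powr (p - 1) < p * (z + 1) powr (p - 1)"
    using p z xy by (intro mult_strict_left_mono powr_less_mono2) auto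
  ultimately show "\<exists>d. ((\<lambda>z. (z + 1) powr p - z powr p) has_real_derivative d) (at z) \<and> 0 < d" by (intro exI conjI) auto
next
  show "continuous_on {x..y} (\<lambda>z. (z + 1) powr p - z powr p)"
    using p xy by (intro continuous_on_diff continuous_on_powr' continuous_on_add continuous_on_id continuous_on_const) auto
qed

context fbm
begin

text \<open>An increment of unit length and unit variance, placed immediately to the left of the
  half-line \<open>{c..}\<close>. Seen from \<open>v \<ge> c\<close>, its covariance
  \<open>g c v\<close> with \<open>W v\<close> is, up to an additive constant, half a unit increment
  of a strictly convex power; this makes it strictly increasing.\<close>

definition \<xi> :: "real \<Rightarrow> 'b \<Rightarrow> real" where "\<xi> c \<omega> = W c \<omega> - W (c - 1) \<omega>"
definition g :: "real \<Rightarrow> real \<Rightarrow> real" where "g c v = K v c - K v (c - 1)"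

lemma lin_\<xi>: "lin (\<xi> c)"
  using lin_add[OF lin_W[of c] lin_scale[OF lin_W[of "c - 1"], of "-1"]] by (simp add: \<xi>_def[abs_def])

lemma \<xi>_square: "(LINT \<omega>|N. (\<xi> c \<omega>)\<^sup>2) = 1"
  using W_increment[of c "c - 1"] by (simp add: \<xi>_def)

lemma W_\<xi>: "(LINT \<omega>|N. W v \<omega> * \<xi> c \<omega>) = g c v"
  unfolding \<xi>_def right_diff_distrib g_def
  by (subst Bochner_Integration.integral_diff) (auto intro: lin_prod_integrable lin_W simp: W_cov)

lemma \<xi>_measurable [measurable]: "\<xi> c \<in> borel_measurable N"
  by (rule lin_measurable[OF lin_\<xi>])

text \<open>The Cameron-Martin formula in one direction. \<open>X\<close> splits into a multiple of
  \<open>\<xi> c\<close> and a part \<open>X0\<close> uncorrelated with it. Of their independence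
  only this is used: the exponential of \<open>X0\<close> may be replaced by its mean against
  functions of \<open>\<xi> c\<close>.\<close>

lemma lin_iexp_tilted:
  fixes c s :: real
  assumes X: "lin X"
  defines "\<rho> \<equiv> (LINT \<omega>|N. X \<omega> * \<xi> c \<omega>)"
  shows "(LINT \<omega>|N. exp (s * \<xi> c \<omega>) *\<^sub>R iexp (X \<omega>)) = of_real (exp (s\<^sup>2 / 2) * exp (- (LINT \<omega>|N. (X \<omega>)\<^sup>2) / 2)) * iexp (s * \<rho>)"
proof -
  have [measurable]: "X \<in> borel_measurable N" by (rule lin_measurable[OF X])
  define X0 where "X0 \<omega> = X \<omega> + (- \<rho>) * \<xi> c \<omega>" for \<omega>
  have X0: "lin X0" unfolding X0_def[abs_def] by (intro lin_add lin_scale X lin_\<xi>)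
  have [measurable]: "X0 \<in> borel_measurable N" by (rule lin_measurable[OF X0])
  have i: "integrable N (\<lambda>\<omega>. (X \<omega>)\<^sup>2)" "integrable N (\<lambda>\<omega>. (\<xi> c \<omega>)\<^sup>2)" "integrable N (\<lambda>\<omega>. X \<omega> * \<xi> c \<omega>)"
    by (intro lin_square_integrable lin_prod_integrable X lin_\<xi>)+
  have sq: "(LINT \<omega>|N. (X \<omega> + r * \<xi> c \<omega>)\<^sup>2) = (LINT \<omega>|N. (X \<omega>)\<^sup>2) + 2 * r * \<rho> + r\<^sup>2" for r
  proof -
    have "(X \<omega> + r * \<xi> c \<omega>)\<^sup>2 = (X \<omega>)\<^sup>2 + (2 * r * (X \<omega> * \<xi> c \<omega>) + r\<^sup>2 * (\<xi> c \<omega>)\<^sup>2)" for \<omega>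
      by (simp add: power2_eq_square algebra_simps)
    then show ?thesis using i by (simp add: \<rho>_def \<xi>_square)
  qed
  have v0: "(LINT \<omega>|N. (X0 \<omega>)\<^sup>2) = (LINT \<omega>|N. (X \<omega>)\<^sup>2) - \<rho>\<^sup>2"
    unfolding X0_def sq by (simp add: power2_eq_square)
  have v1: "(LINT \<omega>|N. (X0 \<omega> + t * \<xi> c \<omega>)\<^sup>2) = (LINT \<omega>|N. (X0 \<omega>)\<^sup>2) + t\<^sup>2" for t
    using sq[of "t - \<rho>"] unfolding v0 by (simp add: X0_def power2_eq_square algebra_simps)
  define \<kappa>0 where "\<kappa>0 = complex_of_real (exp (- (LINT \<omega>|N. (X0 \<omega>)\<^sup>2) / 2))"
  have k1: "cmod \<kappa>0 \<le> 1" by (simp add: \<kappa>0_def)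
  have xi_char: "(LINT \<omega>|N. iexp (t * \<xi> c \<omega>)) = of_real (exp (- (t\<^sup>2) / 2))" for t
    using lin_iexp[OF lin_scale[OF lin_\<xi>[of c], of t]] by (simp add: power_mult_distrib \<xi>_square)
  have conv: "(LINT \<omega>|N. iexp (X0 \<omega>) * iexp (t * \<xi> c \<omega>)) = (LINT \<omega>|N. \<kappa>0 * iexp (t * \<xi> c \<omega>))" for t
  proof -
    have "(LINT \<omega>|N. iexp (X0 \<omega>) * iexp (t * \<xi> c \<omega>)) = (LINT \<omega>|N. iexp (X0 \<omega> + t * \<xi> c \<omega>))"
      by (simp add: exp_add[symmetric] distrib_left)
    also have "\<dots> = of_real (exp (- ((LINT \<omega>|N. (X0 \<omega>)\<^sup>2) + t\<^sup>2) / 2))"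
      using lin_iexp[OF lin_add[OF X0 lin_scale[OF lin_\<xi>[of c], of t]]] unfolding v1 .
    also have "\<dots> = \<kappa>0 * of_real (exp (- (t\<^sup>2) / 2))"
      unfolding \<kappa>0_def of_real_mult[symmetric] exp_add[symmetric] by (simp add: field_simps)
    also have "\<dots> = (LINT \<omega>|N. \<kappa>0 * iexp (t * \<xi> c \<omega>))" unfolding xi_char[symmetric] by simp
    finally show ?thesis .
  qed
  \<comment> \<open>The tilting exponential is unbounded, so it is capped at \<open>m\<close> to fit
    the continuity theorem; dominated convergence then removes the cap.\<close>
  define G where "G m y = iexp (\<rho> * y) * of_real (min (exp (s * y)) (real m))" for m y
  have eqG: "(LINT \<omega>|N. iexp (X0 \<omega>) * G m (\<xi> c \<omega>)) = (LINT \<omega>|N. \<kappa>0 * G m (\<xi> c \<omega>))" for m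
  proof -
    \<comment> \<open>For constant sequences the continuity theorem is a uniqueness theorem:
      agreement for exponentials of \<open>\<xi> c\<close> implies agreement for
      \<open>G m\<close>.\<close>
    have "(\<lambda>n::nat. LINT \<omega>|N. iexp (X0 \<omega>) * G m (\<xi> c \<omega>)) \<longlonglongrightarrow> (LINT \<omega>|N. \<kappa>0 * G m (\<xi> c \<omega>))"
    proof (rule weighted_iexp_conv[where B="real m"])
      show "(\<lambda>n::nat. LINT \<omega>|N. iexp (X0 \<omega>) * iexp (t * \<xi> c \<omega>)) \<longlonglongrightarrow> (LINT \<omega>|N. \<kappa>0 * iexp (t * \<xi> c \<omega>))" for t
        unfolding conv by (rule tendsto_const)
      show "isCont (G m) y" for y unfolding G_def by (intro continuous_intros)
      show "cmod (G m y) \<le> real m" for y unfolding G_def by (simp add: norm_mult)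
    qed (use k1 prob_space_axioms in auto)
    from LIMSEQ_unique[OF tendsto_const this] show ?thesis .
  qed
  have iE: "integrable N (\<lambda>\<omega>. exp (s * \<xi> c \<omega>))" by (intro lin_exp lin_scale lin_\<xi>)
  have Glim: "(\<lambda>m. G m y) \<longlonglongrightarrow> exp (s * y) *\<^sub>R iexp (\<rho> * y)" for y
  proof (rule tendsto_eventually)
    obtain k :: nat where k: "exp (s * y) \<le> real k" using real_arch_simple by blast
    show "\<forall>\<^sub>F m in sequentially. G m y = exp (s * y) *\<^sub>R iexp (\<rho> * y)"
      using eventually_ge_at_top[of k]
    proof eventually_elim
      case (elim m)
      then have "min (exp (s * y)) (real m) = exp (s * y)" using k by linarith
      then show ?case unfolding G_def by (simp add: scaleR_conv_of_real)
    qed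
  qed
  have lim: "(\<lambda>m. LINT \<omega>|N. f \<omega> * G m (\<xi> c \<omega>)) \<longlonglongrightarrow> (LINT \<omega>|N. f \<omega> * (exp (s * \<xi> c \<omega>) *\<^sub>R iexp (\<rho> * \<xi> c \<omega>)))"
    if [measurable]: "f \<in> borel_measurable N" and f: "\<And>\<omega>. cmod (f \<omega>) \<le> 1" for f
  proof (rule integral_dominated_convergence[OF _ _ iE])
    have [measurable]: "G m \<in> borel_measurable borel" for m unfolding G_def by measurable
    show "(\<lambda>\<omega>. f \<omega> * G m (\<xi> c \<omega>)) \<in> borel_measurable N" for m by measurable
    show "AE \<omega> in N. (\<lambda>m. f \<omega> * G m (\<xi> c \<omega>)) \<longlonglongrightarrow> f \<omega> * (exp (s * \<xi> c \<omega>) *\<^sub>R iexp (\<rho> * \<xi> c \<omega>))"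
      by (intro AE_I2 tendsto_mult tendsto_const Glim)
    show "AE \<omega> in N. norm (f \<omega> * G m (\<xi> c \<omega>)) \<le> exp (s * \<xi> c \<omega>)" for m
    proof (rule AE_I2)
      fix \<omega>
      have "norm (f \<omega>) * norm (G m (\<xi> c \<omega>)) \<le> 1 * exp (s * \<xi> c \<omega>)"
        using f[of \<omega>] by (intro mult_mono) (auto simp: G_def norm_mult)
      then show "norm (f \<omega> * G m (\<xi> c \<omega>)) \<le> exp (s * \<xi> c \<omega>)" by (simp add: norm_mult)
    qed
  qed measurable
  have "(LINT \<omega>|N. iexp (X0 \<omega>) * (exp (s * \<xi> c \<omega>) *\<^sub>R iexp (\<rho> * \<xi> c \<omega>))) = (LINT \<omega>|N. \<kappa>0 * (exp (s * \<xi> c \<omega>) *\<^sub>R iexp (\<rho> * \<xi> c \<omega>)))"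
  proof (rule LIMSEQ_unique[OF lim])
    show "(\<lambda>m. LINT \<omega>|N. iexp (X0 \<omega>) * G m (\<xi> c \<omega>)) \<longlonglongrightarrow> (LINT \<omega>|N. \<kappa>0 * (exp (s * \<xi> c \<omega>) *\<^sub>R iexp (\<rho> * \<xi> c \<omega>)))"
      unfolding eqG by (rule lim) (use k1 in auto)
  qed auto
  also have "(LINT \<omega>|N. \<kappa>0 * (exp (s * \<xi> c \<omega>) *\<^sub>R iexp (\<rho> * \<xi> c \<omega>))) = \<kappa>0 * (exp ((s\<^sup>2 / 2 - \<rho>\<^sup>2 / 2) * 1) *\<^sub>R iexp (s * \<rho> * 1))"
    unfolding integral_mult_right_zero centered_normal_props(3)[OF lin_normal[OF lin_\<xi>]] \<xi>_square ..
  also have "\<dots> = of_real (exp (s\<^sup>2 / 2) * exp (- (LINT \<omega>|N. (X \<omega>)\<^sup>2) / 2)) * iexp (s * \<rho>)"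
  proof -
    have "exp (- (LINT \<omega>|N. (X0 \<omega>)\<^sup>2) / 2) * exp ((s\<^sup>2 / 2 - \<rho>\<^sup>2 / 2) * 1) = exp (s\<^sup>2 / 2) * exp (- (LINT \<omega>|N. (X \<omega>)\<^sup>2) / 2)"
      unfolding v0 exp_add[symmetric] by (simp add: field_simps)
    then show ?thesis unfolding \<kappa>0_def scaleR_conv_of_real mult.assoc[symmetric] of_real_mult[symmetric] by (simp only: mult_1_right)
  qed
  also have "(LINT \<omega>|N. iexp (X0 \<omega>) * (exp (s * \<xi> c \<omega>) *\<^sub>R iexp (\<rho> * \<xi> c \<omega>))) = (LINT \<omega>|N. exp (s * \<xi> c \<omega>) *\<^sub>R iexp (X \<omega>))"
  proof (intro Bochner_Integration.integral_cong refl)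
    fix \<omega>
    have "iexp (X0 \<omega>) * iexp (\<rho> * \<xi> c \<omega>) = iexp (X \<omega>)"
      unfolding exp_add[symmetric] distrib_left[symmetric] of_real_add[symmetric] by (simp add: X0_def)
    then show "iexp (X0 \<omega>) * (exp (s * \<xi> c \<omega>) *\<^sub>R iexp (\<rho> * \<xi> c \<omega>)) = exp (s * \<xi> c \<omega>) *\<^sub>R iexp (X \<omega>)"
      by (simp only: mult_scaleR_right)
  qed
  finally show ?thesis .
qed

definition Q :: "real \<Rightarrow> real \<Rightarrow> 'b measure" where
  "Q c s = density N (\<lambda>\<omega>. ennreal (exp (s * \<xi> c \<omega> - s\<^sup>2 / 2)))"

lemma sets_Q [measurable_cong, simp]: "sets (Q c s) = sets N" and space_Q [simp]: "space (Q c s) = space N"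
  by (simp_all add: Q_def)

lemma Q_exp_integrable: "integrable N (\<lambda>\<omega>. exp (s * \<xi> c \<omega> - s\<^sup>2 / 2))"
proof -
  have "integrable N (\<lambda>\<omega>. exp (s * \<xi> c \<omega>) * exp (- (s\<^sup>2) / 2))"
    by (intro integrable_mult_left lin_exp lin_scale lin_\<xi>)
  then show ?thesis by (simp add: exp_add[symmetric])
qed

lemma prob_space_Q: "prob_space (Q c s)"
proof (rule prob_spaceI)
  have "(LINT \<omega>|N. exp (s * \<xi> c \<omega> - s\<^sup>2 / 2)) = (LINT \<omega>|N. exp (s * \<xi> c \<omega>) * exp (- (s\<^sup>2) / 2))"
    by (simp add: exp_add[symmetric])
  also have "\<dots> = 1"
    unfolding integral_mult_left_zero lin_exp(2)[OF lin_scale[OF lin_\<xi>]] power_mult_distrib integral_mult_right_zero \<xi>_square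
    by (simp add: exp_add[symmetric])
  finally have "(\<integral>\<^sup>+\<omega>. ennreal (exp (s * \<xi> c \<omega> - s\<^sup>2 / 2)) \<partial>N) = 1"
    using nn_integral_eq_integral[OF Q_exp_integrable[of s c]] by simp
  then show "emeasure (Q c s) (space (Q c s)) = 1"
    by (simp add: Q_def emeasure_density cong: nn_integral_cong)
qed

definition Zs :: "real \<Rightarrow> real \<Rightarrow> real \<Rightarrow> 'b \<Rightarrow> real" where
  "Zs c s v \<omega> = exp (s * g c v) * Z v \<omega>"

text \<open>Under \<open>Q c s\<close> the vector of values \<open>W (x i)\<close> has the law of
  the vector shifted by \<open>s * g c (x i)\<close> under \<open>N\<close>. The product form of the
  exponential of a grid sum transfers this to its characteristic function, again through constant
  sequences.\<close>

lemma tilted_grid_sum: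
  "(LINT \<omega>|Q c s. iexp (t * grid_sum Z c b k D n \<omega>)) = (LINT \<omega>|N. iexp (t * grid_sum (Zs c s) c b k D n \<omega>))"
proof -
  define x where "x i = c + real i / real n" for i
  define a where "a i = t * (b * (x i - k) / real n)" for i
  define G where "G i y = iexp (a i * (exp y * exp (- (\<bar>x i\<bar> powr (2 * H)) / 2)))" for i y
  have Zf: "Z v \<omega> = exp (W v \<omega>) * exp (- (\<bar>v\<bar> powr (2 * H)) / 2)" for v \<omega>
    by (simp add: Z_def' flip: exp_add)
  have Zsf: "Zs c s v \<omega> = exp (W v \<omega> + s * g c v) * exp (- (\<bar>v\<bar> powr (2 * H)) / 2)" for v \<omega>
    unfolding Zs_def Z_def' exp_add[symmetric] by (simp add: algebra_simps)
  have al: "t * (b * (x i - k) * z / real n) = a i * z" for i z by (simp add: a_def)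
  have r1: "iexp (t * grid_sum Z c b k D n \<omega>) = (\<Prod>i<D * n. G i (W (x i) \<omega>))" for \<omega>
    unfolding grid_sum_def sum_distrib_left x_def[symmetric] al G_def Zf of_real_sum exp_sum[OF finite_lessThan] ..
  have r2: "iexp (t * grid_sum (Zs c s) c b k D n \<omega>) = (\<Prod>i<D * n. G i (W (x i) \<omega> + s * g c (x i)))" for \<omega>
    unfolding grid_sum_def sum_distrib_left x_def[symmetric] al G_def Zsf of_real_sum exp_sum[OF finite_lessThan] ..
  have "(\<lambda>_::nat. LINT \<omega>|Q c s. (\<Prod>i<D * n. G i (W (x i) \<omega>))) \<longlonglongrightarrow> (LINT \<omega>|N. (\<Prod>i<D * n. G i (W (x i) \<omega> + s * g c (x i))))"
  proof (rule fdd_char_conv_imp_prod_conv[where X="\<lambda>_ i \<omega>. W (x i) \<omega>" and X'="\<lambda>i \<omega>. W (x i) \<omega> + s * g c (x i)"])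
    fix \<theta>
    define X where "X \<omega> = (\<Sum>i<D * n. \<theta> i * W (x i) \<omega>)" for \<omega>
    define r where "r = (\<Sum>i<D * n. \<theta> i * g c (x i))"
    have X: "lin X" unfolding X_def[abs_def] by (rule lin_sum)
    have [measurable]: "X \<in> borel_measurable N" by (rule lin_measurable[OF X])
    have "(LINT \<omega>|N. X \<omega> * \<xi> c \<omega>) = (LINT \<omega>|N. (\<Sum>i<D * n. \<theta> i * (W (x i) \<omega> * \<xi> c \<omega>)))"
      unfolding X_def sum_distrib_right by (simp only: mult.assoc)
    also have "\<dots> = r"
      unfolding r_def by (subst Bochner_Integration.integral_sum) (auto intro!: lin_prod_integrable lin_W lin_\<xi> simp: W_\<xi>)
    finally have rho: "(LINT \<omega>|N. X \<omega> * \<xi> c \<omega>) = r" .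
    have "(LINT \<omega>|Q c s. iexp (X \<omega>)) = (LINT \<omega>|N. exp (s * \<xi> c \<omega> - s\<^sup>2 / 2) *\<^sub>R iexp (X \<omega>))"
      unfolding Q_def by (subst integral_density) auto
    also have "\<dots> = (LINT \<omega>|N. exp (- (s\<^sup>2) / 2) *\<^sub>R (exp (s * \<xi> c \<omega>) *\<^sub>R iexp (X \<omega>)))"
      by (simp add: exp_add[symmetric])
    also have "\<dots> = exp (- (s\<^sup>2) / 2) *\<^sub>R (of_real (exp (s\<^sup>2 / 2) * exp (- (LINT \<omega>|N. (X \<omega>)\<^sup>2) / 2)) * iexp (s * r))"
      unfolding integral_scaleR_right lin_iexp_tilted[OF X] rho ..
    also have "\<dots> = of_real (exp (- (LINT \<omega>|N. (X \<omega>)\<^sup>2) / 2)) * iexp (s * r)"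
    proof -
      have "exp (- (s\<^sup>2) / 2) * (exp (s\<^sup>2 / 2) * exp (- (LINT \<omega>|N. (X \<omega>)\<^sup>2) / 2)) = exp (- (LINT \<omega>|N. (X \<omega>)\<^sup>2) / 2)"
        unfolding exp_add[symmetric] by simp
      then show ?thesis unfolding scaleR_conv_of_real mult.assoc[symmetric] of_real_mult[symmetric] by (simp only:)
    qed
    also have "\<dots> = (LINT \<omega>|N. iexp (X \<omega>) * iexp (s * r))"
      unfolding integral_mult_left_zero lin_iexp[OF X] ..
    also have "\<dots> = (LINT \<omega>|N. iexp (\<Sum>i<D * n. \<theta> i * (W (x i) \<omega> + s * g c (x i))))"
    proof (intro Bochner_Integration.integral_cong refl)
      fix \<omega>
      have "(\<Sum>i<D * n. \<theta> i * (W (x i) \<omega> + s * g c (x i))) = X \<omega> + s * r"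
        unfolding X_def r_def distrib_left sum.distrib sum_distrib_left by (simp add: mult.left_commute)
      then show "iexp (X \<omega>) * iexp (s * r) = iexp (\<Sum>i<D * n. \<theta> i * (W (x i) \<omega> + s * g c (x i)))"
        unfolding exp_add[symmetric] distrib_left[symmetric] of_real_add[symmetric] by (simp only:)
    qed
    finally show "(\<lambda>_::nat. LINT \<omega>|Q c s. iexp (\<Sum>i<D * n. \<theta> i * W (x i) \<omega>)) \<longlonglongrightarrow> (LINT \<omega>|N. iexp (\<Sum>i<D * n. \<theta> i * (W (x i) \<omega> + s * g c (x i))))"
      unfolding X_def by simp
  next
    show "isCont (G i) y" for i y unfolding G_def by (intro continuous_intros)
    show "cmod (G i y) \<le> 1" for i y by (simp add: G_def)
  qed (auto simp: prob_space_Q prob_space_axioms)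
  from LIMSEQ_unique[OF tendsto_const this] show ?thesis unfolding r1 r2 .
qed


abbreviation halfline :: "real \<Rightarrow> real \<Rightarrow> real" where
  "halfline c v \<equiv> if c \<le> v then 1 else 0"

lemma g_increasing:
  assumes "c \<le> u" "u < v"
  shows "g c u < g c v"
proof -
  have e: "g c v = ((v - c + 1) powr (2 * H) - (v - c) powr (2 * H) + (\<bar>c\<bar> powr (2 * H) - \<bar>c - 1\<bar> powr (2 * H))) / 2" if "c \<le> v" for v
  proof -
    have "\<bar>v - c\<bar> = v - c" "\<bar>v - (c - 1)\<bar> = v - c + 1" using that by auto
    then show ?thesis by (simp add: g_def K_def field_simps)
  qed
  have "(u - c + 1) powr (2 * H) - (u - c) powr (2 * H) < (v - c + 1) powr (2 * H) - (v - c) powr (2 * H)"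
    using assms H by (intro powr_increment_less) auto
  then show ?thesis using assms by (simp add: e)
qed

lemma g_continuous: "continuous_on UNIV (g c)"
proof -
  have a: "continuous_on UNIV (\<lambda>v. \<bar>v - r\<bar> powr (2 * H))" for r :: real
    using H by (intro continuous_on_powr' continuous_intros) auto
  show ?thesis unfolding g_def K_def using a[of 0] a[of c] a[of "c - 1"]
    by (intro continuous_on_diff continuous_on_divide continuous_on_add continuous_on_const) auto
qed

lemma Zs_continuous: "\<omega> \<in> space N \<Longrightarrow> continuous_on UNIV (\<lambda>v. Zs c s v \<omega>)"
proof -
  assume w: "\<omega> \<in> space N"
  have a: "continuous_on UNIV (\<lambda>v::real. \<bar>v\<bar> powr (2 * H))"
    using H by (intro continuous_on_powr' continuous_intros) auto
  show ?thesis unfolding Zs_def Z_def'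
    by (intro continuous_on_mult continuous_on_exp continuous_on_diff continuous_on_divide continuous_on_const g_continuous W_continuous[OF w] a) auto
qed

text \<open>The factor \<open>\<bar>v\<bar> + (1 + \<bar>k\<bar>)\<close> dominates 1,
  \<open>v\<close> and \<open>v - k\<close> at once, so one almost sure event serves for the
  numerator, the denominator and their combination.\<close>

definition good :: "real \<Rightarrow> real \<Rightarrow> 'b set" where
  "good c k = {\<omega> \<in> space N. (\<integral>\<^sup>+v. ennreal ((\<bar>v\<bar> + (1 + \<bar>k\<bar>)) * halfline c v * Z v \<omega>) \<partial>lborel) \<noteq> \<infinity>}"

lemma good_sets [measurable]: "good c k \<in> sets N"
  and AE_good: "AE \<omega> in N. \<omega> \<in> good c k"
proof -
  interpret F: likelihood_field N Z "{c..}" "\<lambda>v. halfline c v" c "1 / 4" "1 / 8" 1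
    by (rule limit_field) auto
  show "good c k \<in> sets N" unfolding good_def by measurable
  show "AE \<omega> in N. \<omega> \<in> good c k"
    using F.AE_total_finite[of "1 + \<bar>k\<bar>"] AE_space by (auto simp: good_def)
qed

lemma Z_section_measurable: "\<omega> \<in> space N \<Longrightarrow> (\<lambda>v. Z v \<omega>) \<in> borel_measurable borel"
  using Zs_continuous[of \<omega> 0 0] by (intro borel_measurable_continuous_onI) (simp add: Zs_def)

lemma good_integrable:
  assumes w: "\<omega> \<in> good c k" and [measurable]: "f \<in> borel_measurable borel"
    and f: "\<And>v. c \<le> v \<Longrightarrow> \<bar>f v\<bar> \<le> B * (\<bar>v\<bar> + (1 + \<bar>k\<bar>))" and B: "0 \<le> B"
  shows "integrable lborel (\<lambda>v. indicator {c..} v *\<^sub>R (f v * Z v \<omega>))"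
proof -
  have sp: "\<omega> \<in> space N" using w by (simp add: good_def)
  note [measurable] = Z_section_measurable[OF sp]
  have "(\<integral>\<^sup>+v. ennreal (norm (indicator {c..} v *\<^sub>R (f v * Z v \<omega>))) \<partial>lborel) \<le> (\<integral>\<^sup>+v. ennreal B * ennreal ((\<bar>v\<bar> + (1 + \<bar>k\<bar>)) * halfline c v * Z v \<omega>) \<partial>lborel)"
  proof (rule nn_integral_mono)
    fix v
    have "norm (indicator {c..} v *\<^sub>R (f v * Z v \<omega>)) \<le> B * ((\<bar>v\<bar> + (1 + \<bar>k\<bar>)) * halfline c v * Z v \<omega>)"
    proof (cases "c \<le> v")
      case True
      have "\<bar>f v\<bar> * Z v \<omega> \<le> B * (\<bar>v\<bar> + (1 + \<bar>k\<bar>)) * Z v \<omega>"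
        using f[OF True] less_imp_le[OF Z_pos] by (intro mult_right_mono) auto
      then show ?thesis using True Z_pos[of v \<omega>] by (simp add: abs_mult mult.assoc)
    qed simp
    then show "ennreal (norm (indicator {c..} v *\<^sub>R (f v * Z v \<omega>))) \<le> ennreal B * ennreal ((\<bar>v\<bar> + (1 + \<bar>k\<bar>)) * halfline c v * Z v \<omega>)"
      using B by (subst ennreal_mult'[symmetric]) (auto intro: ennreal_leI)
  qed
  also have "\<dots> = ennreal B * (\<integral>\<^sup>+v. ennreal ((\<bar>v\<bar> + (1 + \<bar>k\<bar>)) * halfline c v * Z v \<omega>) \<partial>lborel)"
    by (rule nn_integral_cmult) measurable
  also have "\<dots> < \<infinity>" using w by (simp add: good_def ennreal_mult_less_top less_top)
  finally show ?thesis by (intro integrableI_bounded) auto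
qed

lemma weighted_integral_eq:
  "weighted_integral Y (\<lambda>v. halfline c v) k \<omega> = (LBINT v. indicator {c..} v *\<^sub>R ((v - k) * Y v \<omega>))"
  unfolding weighted_integral_def by (intro Bochner_Integration.integral_cong) (auto simp: indicator_def)

text \<open>Here the sign of \<open>s\<close> enters: \<open>g c\<close> is increasing on the
  half-line, so for \<open>s \<le> 0\<close> the tilting factor is at most its value at
  \<open>c\<close>, and integrability is inherited from \<open>Z\<close>.\<close>

lemma Zs_integrable:
  assumes w: "\<omega> \<in> good c k" and s: "s \<le> 0"
  shows "integrable lborel (\<lambda>v. indicator {c..} v *\<^sub>R ((v - k) * Zs c s v \<omega>))"
proof -
  have [measurable]: "g c \<in> borel_measurable borel" by (intro borel_measurable_continuous_onI g_continuous)
  have "integrable lborel (\<lambda>v. indicator {c..} v *\<^sub>R (((v - k) * exp (s * g c v)) * Z v \<omega>))"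
  proof (rule good_integrable[OF w, where B="exp (s * g c c)"])
    fix v assume v: "c \<le> v"
    have "g c c \<le> g c v" using g_increasing[of c c v] v by (cases "v = c") auto
    then have "exp (s * g c v) \<le> exp (s * g c c)" using s by (simp add: mult_left_mono_neg)
    then have "exp (s * g c v) * \<bar>v - k\<bar> \<le> exp (s * g c c) * (\<bar>v\<bar> + (1 + \<bar>k\<bar>))" by (intro mult_mono) auto
    then show "\<bar>(v - k) * exp (s * g c v)\<bar> \<le> exp (s * g c c) * (\<bar>v\<bar> + (1 + \<bar>k\<bar>))" by (simp add: abs_mult mult.commute)
  qed auto
  then show ?thesis by (simp add: Zs_def mult.assoc)
qed

lemma Zs_pair_measurable [measurable]: "(\<lambda>(v, \<omega>). Zs c s v \<omega>) \<in> borel_measurable (borel \<Otimes>\<^sub>M N)"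
proof -
  have [measurable]: "g c \<in> borel_measurable borel" by (intro borel_measurable_continuous_onI g_continuous)
  show ?thesis
    unfolding Zs_def Z_def' case_prod_beta' using W_pair_measurable unfolding case_prod_beta' by measurable
qed

lemma Zs_0: "Zs c 0 = Z" by (auto simp: Zs_def fun_eq_iff)

lemma weighted_Zs_measurable [measurable]: "weighted_integral (Zs c s) (\<lambda>v. halfline c v) k \<in> borel_measurable N"
proof -
  have "(\<lambda>x. Zs c s (snd x) (fst x)) \<in> borel_measurable (N \<Otimes>\<^sub>M borel)"
    using measurable_compose[OF measurable_Pair[OF measurable_snd measurable_fst] Zs_pair_measurable] by simp
  then show ?thesis unfolding weighted_integral_def by measurable
qed

text \<open>Expresses the characteristic function of the integral through those of the grid sums
  alone, with the mesh sent to 0 first and the length to infinity second. The measure is left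
  general so that the same limit can be read under \<open>N\<close> and under
  \<open>Q c s\<close>.\<close>

lemma grid_sum_iexp_tendsto:
  assumes M: "prob_space M" "sets M = sets N" and ae: "AE \<omega> in M. \<omega> \<in> good c k" and s: "s \<le> 0"
  shows "(\<lambda>D. lim (\<lambda>n. LINT \<omega>|M. iexp (t * grid_sum (Zs c s) c 1 k D (Suc n) \<omega>))) \<longlonglongrightarrow> (LINT \<omega>|M. iexp (t * weighted_integral (Zs c s) (\<lambda>v. halfline c v) k \<omega>))"
proof -
  interpret M: prob_space M by fact
  have spM: "space M = space N" using M(2) by (rule sets_eq_imp_space_eq)
  have [measurable]: "Zs c s v \<in> borel_measurable N" for v
    using measurable_Pair2[OF Zs_pair_measurable, of v c s] by simp
  have gm: "grid_sum (Zs c s) c 1 k D n \<in> borel_measurable M" for D n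
    unfolding measurable_cong_sets[OF M(2) refl] grid_sum_def by measurable
  define I where "I D \<omega> = (LBINT v. indicator {c..<c + real D} v *\<^sub>R ((v - k) * Zs c s v \<omega>))" for D \<omega>
  have Im: "I D \<in> borel_measurable M" for D
  proof -
    have "(\<lambda>x. Zs c s (snd x) (fst x)) \<in> borel_measurable (N \<Otimes>\<^sub>M borel)"
      using measurable_compose[OF measurable_Pair[OF measurable_snd measurable_fst] Zs_pair_measurable] by simp
    then show ?thesis unfolding measurable_cong_sets[OF M(2) refl] I_def by measurable
  qed
  have "(\<lambda>n. LINT \<omega>|M. iexp (t * grid_sum (Zs c s) c 1 k D (Suc n) \<omega>)) \<longlonglongrightarrow> (LINT \<omega>|M. iexp (t * I D \<omega>))" for D
  proof (rule integral_dominated_convergence[where w="\<lambda>_. 1"])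
    show "AE \<omega> in M. (\<lambda>n. iexp (t * grid_sum (Zs c s) c 1 k D (Suc n) \<omega>)) \<longlonglongrightarrow> iexp (t * I D \<omega>)"
    proof (rule AE_I2)
      fix \<omega> assume "\<omega> \<in> space M"
      then have "continuous_on UNIV (\<lambda>v. (v - k) * Zs c s v \<omega>)"
        unfolding spM by (intro continuous_on_mult continuous_on_diff continuous_on_id continuous_on_const Zs_continuous)
      from grid_sum_tendsto[OF this, of c D]
      have "(\<lambda>n. grid_sum (Zs c s) c 1 k D (Suc n) \<omega>) \<longlonglongrightarrow> I D \<omega>" by (simp add: grid_sum_def I_def)
      then show "(\<lambda>n. iexp (t * grid_sum (Zs c s) c 1 k D (Suc n) \<omega>)) \<longlonglongrightarrow> iexp (t * I D \<omega>)"
        by (intro tendsto_intros)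
    qed
  qed (use gm Im in auto)
  then have L: "lim (\<lambda>n. LINT \<omega>|M. iexp (t * grid_sum (Zs c s) c 1 k D (Suc n) \<omega>)) = (LINT \<omega>|M. iexp (t * I D \<omega>))" for D
    by (rule limI)
  have "(\<lambda>D. LINT \<omega>|M. iexp (t * I D \<omega>)) \<longlonglongrightarrow> (LINT \<omega>|M. iexp (t * weighted_integral (Zs c s) (\<lambda>v. halfline c v) k \<omega>))"
  proof (rule integral_dominated_convergence[where w="\<lambda>_. 1"])
    show "(\<lambda>\<omega>. iexp (t * weighted_integral (Zs c s) (\<lambda>v. halfline c v) k \<omega>)) \<in> borel_measurable M"
      unfolding measurable_cong_sets[OF M(2) refl] by measurable
    show "AE \<omega> in M. (\<lambda>D. iexp (t * I D \<omega>)) \<longlonglongrightarrow> iexp (t * weighted_integral (Zs c s) (\<lambda>v. halfline c v) k \<omega>)"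
      using ae
    proof eventually_elim
      case (elim \<omega>)
      then have "\<omega> \<in> space N" by (simp add: good_def)
      then have "(\<lambda>v. (v - k) * Zs c s v \<omega>) \<in> borel_measurable borel"
        by (intro borel_measurable_continuous_onI continuous_on_mult continuous_on_diff continuous_on_id continuous_on_const Zs_continuous)
      from integral_Ico_tendsto[OF Zs_integrable[OF elim s] this]
      show ?case unfolding weighted_integral_eq I_def by (intro tendsto_intros)
    qed
  qed (use Im in auto)
  then show ?thesis unfolding L .
qed

text \<open>Both characteristic functions are the same iterated limit, by
  \<open>tilted_grid_sum\<close>. Uniqueness of characteristic functions identifies the two laws and
  in particular their masses at 0.\<close>

lemma tilted_law:
  assumes s: "s \<le> 0"
  shows "measure N {\<omega>\<in>space N. weighted_integral (Zs c s) (\<lambda>v. halfline c v) k \<omega> = 0} =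
    measure (Q c s) {\<omega>\<in>space N. weighted_integral Z (\<lambda>v. halfline c v) k \<omega> = 0}"
proof -
  interpret Q: prob_space "Q c s" by (rule prob_space_Q)
  have Tm: "weighted_integral Z (\<lambda>v. halfline c v) k \<in> borel_measurable (Q c s)"
    using weighted_Zs_measurable[of c 0 k] by (simp add: Zs_0 measurable_cong_sets[OF sets_Q refl])
  have aeQ: "AE \<omega> in Q c s. \<omega> \<in> good c k"
    unfolding Q_def by (subst AE_density) (use AE_good[of c k] in \<open>auto elim: eventually_mono\<close>)
  have "(LINT \<omega>|N. iexp (t * weighted_integral (Zs c s) (\<lambda>v. halfline c v) k \<omega>)) = (LINT \<omega>|Q c s. iexp (t * weighted_integral Z (\<lambda>v. halfline c v) k \<omega>))" for t
  proof (rule LIMSEQ_unique)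
    show "(\<lambda>D. lim (\<lambda>n. LINT \<omega>|N. iexp (t * grid_sum (Zs c s) c 1 k D (Suc n) \<omega>))) \<longlonglongrightarrow> (LINT \<omega>|N. iexp (t * weighted_integral (Zs c s) (\<lambda>v. halfline c v) k \<omega>))"
      by (rule grid_sum_iexp_tendsto[OF prob_space_axioms refl AE_good s])
    show "(\<lambda>D. lim (\<lambda>n. LINT \<omega>|N. iexp (t * grid_sum (Zs c s) c 1 k D (Suc n) \<omega>))) \<longlonglongrightarrow> (LINT \<omega>|Q c s. iexp (t * weighted_integral Z (\<lambda>v. halfline c v) k \<omega>))"
      using grid_sum_iexp_tendsto[OF prob_space_Q sets_Q aeQ order_refl, of t] unfolding tilted_grid_sum[symmetric] Zs_0 .
  qed
  then have "distr N borel (weighted_integral (Zs c s) (\<lambda>v. halfline c v) k) = distr (Q c s) borel (weighted_integral Z (\<lambda>v. halfline c v) k)"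
    by (intro Levy_uniqueness real_distribution_distr Q.real_distribution_distr weighted_Zs_measurable Tm)
       (simp add: char_def integral_distr Tm fun_eq_iff del: of_real_mult)
  then have "measure (distr N borel (weighted_integral (Zs c s) (\<lambda>v. halfline c v) k)) {0} = measure (distr (Q c s) borel (weighted_integral Z (\<lambda>v. halfline c v) k)) {0}" by simp
  then show ?thesis
    by (simp add: measure_distr Tm vimage_def Int_def conj_commute)
qed

text \<open>Both tilts are normalised to 1 at \<open>k'\<close>, the point of the half-line where
  \<open>v - k\<close> changes sign, or its left end if \<open>k < c\<close>. As \<open>g c\<close>
  is strictly increasing, \<open>v - k\<close> and the difference of the normalised tilts have the
  same sign, so the difference of two vanishing integrals would have to be positive.\<close>

lemma shifted_integral_inj:
  assumes w: "\<omega> \<in> good c k" and s: "s < s'" "s' \<le> 0"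
    and z: "weighted_integral (Zs c s) (\<lambda>v. halfline c v) k \<omega> = 0" "weighted_integral (Zs c s') (\<lambda>v. halfline c v) k \<omega> = 0"
  shows False
proof -
  define k' where "k' = max k c"
  define r where "r = g c k'"
  define f where "f v = indicator {c..} v *\<^sub>R ((v - k) * (exp (s' * (g c v - r)) - exp (s * (g c v - r))) * Z v \<omega>)" for v
  have f: "f v = exp (- s' * r) * (indicator {c..} v *\<^sub>R ((v - k) * Zs c s' v \<omega>)) - exp (- s * r) * (indicator {c..} v *\<^sub>R ((v - k) * Zs c s v \<omega>))" for v
  proof -
    have e: "exp (x * (g c v - r)) = exp (- x * r) * exp (x * g c v)" for x
      unfolding exp_add[symmetric] by (simp add: algebra_simps)
    show ?thesis unfolding f_def e Zs_def by (simp add: algebra_simps)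
  qed
  have i: "integrable lborel f" "(LBINT v. f v) = 0"
    unfolding f[abs_def] using Zs_integrable[OF w, of s] Zs_integrable[OF w, of s'] s z
    by (simp_all add: weighted_integral_eq)
  have cmp: "(v - k) * (exp (s' * (g c v - r)) - exp (s * (g c v - r))) \<ge> 0 \<and> (v \<noteq> k' \<longrightarrow> (v - k) * (exp (s' * (g c v - r)) - exp (s * (g c v - r))) > 0)"
    if v: "c \<le> v" for v
  proof -
    consider "v = k'" | "v < k'" | "k' < v" by linarith
    then show ?thesis
    proof cases
      case 1 then show ?thesis by (simp add: r_def)
    next
      case 2
      then have "v < k" using v by (auto simp: k'_def)
      moreover have "g c v < r" unfolding r_def using 2 v by (intro g_increasing)
      then have "s' * (g c v - r) < s * (g c v - r)" using s by (intro mult_strict_right_mono_neg) auto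
      ultimately have "(v - k) * (exp (s' * (g c v - r)) - exp (s * (g c v - r))) > 0" by (intro mult_neg_neg) auto
      then show ?thesis by simp
    next
      case 3
      then have "k < v" "c \<le> k'" by (auto simp: k'_def)
      moreover have "r < g c v" unfolding r_def using 3 \<open>c \<le> k'\<close> by (intro g_increasing)
      then have "s * (g c v - r) < s' * (g c v - r)" using s by (intro mult_strict_right_mono) auto
      ultimately have "(v - k) * (exp (s' * (g c v - r)) - exp (s * (g c v - r))) > 0" by (intro mult_pos_pos) auto
      then show ?thesis by simp
    qed
  qed
  have f0: "0 \<le> f v" for v
    using cmp[of v] less_imp_le[OF Z_pos[of v \<omega>]] by (auto simp: f_def indicator_def)
  have "AE v in lborel. f v = 0"
    using i f0 by (subst integral_nonneg_eq_0_iff_AE[symmetric]) auto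
  moreover have "AE v in lborel. v \<noteq> k'" by (rule AE_lborel_singleton)
  ultimately have "AE v in lborel. v \<notin> {c..c + 1}"
  proof eventually_elim
    case (elim v)
    show ?case
    proof
      assume "v \<in> {c..c + 1}"
      then have "0 < f v" using cmp[of v] elim(2) Z_pos[of v \<omega>] by (auto simp: f_def)
      with elim(1) show False by simp
    qed
  qed
  from emeasure_eq_0_AE[OF this] have "emeasure lborel {c..c + 1} = 0" by (simp only: space_lborel space_borel UNIV_I simp_thms Collect_mem_eq)
  then show False by simp
qed

lemma no_atom: "measure N {\<omega>\<in>space N. weighted_integral Z (\<lambda>v. halfline c v) k \<omega> = 0} = 0"
proof -
  \<comment> \<open>Negative values keep the tilted integrals finite, and values of at least -1
    allow a common dominating function.\<close>
  define s where "s m = - 1 / real (Suc m)" for m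
  have s: "s m < 0" "- 1 \<le> s m" for m by (auto simp: s_def field_simps)
  define A where "A m = {\<omega> \<in> good c k. weighted_integral (Zs c (s m)) (\<lambda>v. halfline c v) k \<omega> = 0}" for m
  have gsub: "good c k \<subseteq> space N" by (auto simp: good_def)
  have Am [measurable]: "A m \<in> sets N" for m
  proof -
    have "A m = good c k \<inter> {\<omega> \<in> space N. weighted_integral (Zs c (s m)) (\<lambda>v. halfline c v) k \<omega> = 0}" using gsub by (auto simp: A_def)
    then show ?thesis by simp
  qed
  have disj: "disjoint_family A"
    unfolding disjoint_family_on_def
  proof (intro ballI impI)
    fix i j :: nat assume "i \<noteq> j"
    then have "s i \<noteq> s j" by (simp add: s_def divide_simps)
    then consider "s i < s j" | "s j < s i" by linarith
    then show "A i \<inter> A j = {}"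
    proof cases
      case 1
      show ?thesis using shifted_integral_inj[OF _ 1 less_imp_le[OF s(1)]] by (auto simp: A_def)
    next
      case 2
      show ?thesis using shifted_integral_inj[OF _ 2 less_imp_le[OF s(1)]] by (auto simp: A_def)
    qed
  qed
  \<comment> \<open>Disjoint events in a probability space have summable probabilities, so these
    tend to 0.\<close>
  have "(\<lambda>m. measure N (A m)) sums measure N (\<Union>m. A m)"
    by (rule finite_measure_UNION) (use disj in auto)
  then have 0: "(\<lambda>m. measure N (A m)) \<longlonglongrightarrow> 0" by (intro summable_LIMSEQ_zero sums_summable)
  define B where "B = {\<omega>\<in>space N. weighted_integral Z (\<lambda>v. halfline c v) k \<omega> = 0}"
  have [measurable]: "weighted_integral Z (\<lambda>v. halfline c v) k \<in> borel_measurable N"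
    using weighted_Zs_measurable[of c 0 k] by (simp add: Zs_0)
  have Bm [measurable]: "B \<in> sets N" unfolding B_def by measurable
  have eq: "measure N (A m) = (LINT \<omega>|N. indicator B \<omega> * exp (s m * \<xi> c \<omega> - (s m)\<^sup>2 / 2))" for m
  proof -
    have "measure N (A m) = measure N {\<omega>\<in>space N. weighted_integral (Zs c (s m)) (\<lambda>v. halfline c v) k \<omega> = 0}"
      by (rule finite_measure_eq_AE) (use AE_good[of c k] gsub in \<open>auto simp: A_def elim!: eventually_mono\<close>)
    also have "\<dots> = measure (Q c (s m)) B"
      unfolding B_def by (rule tilted_law[OF less_imp_le[OF s(1)]])
    also have "\<dots> = (LINT \<omega>|Q c (s m). indicator B \<omega>)" by simp
    also have "\<dots> = (LINT \<omega>|N. exp (s m * \<xi> c \<omega> - (s m)\<^sup>2 / 2) * indicator B \<omega>)"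
      unfolding Q_def by (subst integral_density) auto
    finally show ?thesis by (simp add: mult.commute)
  qed
  have s0: "s \<longlonglongrightarrow> 0" unfolding s_def using tendsto_minus[OF LIMSEQ_Suc[OF lim_1_over_n]] by (simp del: of_nat_Suc)
  \<comment> \<open>The limit of the same probabilities is computed a second time: the tilting
    densities tend to 1, dominated by 1 where \<open>\<xi> c\<close> is nonnegative and by
    \<open>exp (- 1 * \<xi> c \<omega>)\<close> elsewhere, since
    \<open>- 1 \<le> s m < 0\<close>.\<close>
  have "(\<lambda>m. LINT \<omega>|N. indicator B \<omega> * exp (s m * \<xi> c \<omega> - (s m)\<^sup>2 / 2)) \<longlonglongrightarrow> (LINT \<omega>|N. indicator B \<omega> * exp (0 * \<xi> c \<omega> - 0\<^sup>2 / 2))"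
  proof (rule integral_dominated_convergence[where w="\<lambda>\<omega>. 1 + exp (- 1 * \<xi> c \<omega>)"])
    show "integrable N (\<lambda>\<omega>. 1 + exp (- 1 * \<xi> c \<omega>))"
      by (intro Bochner_Integration.integrable_add lin_exp(1) lin_scale lin_\<xi>) simp
    show "AE \<omega> in N. (\<lambda>m. indicator B \<omega> * exp (s m * \<xi> c \<omega> - (s m)\<^sup>2 / 2)) \<longlonglongrightarrow> indicator B \<omega> * exp (0 * \<xi> c \<omega> - 0\<^sup>2 / 2)"
      by (intro AE_I2 tendsto_intros s0) auto
    show "AE \<omega> in N. norm (indicator B \<omega> * exp (s m * \<xi> c \<omega> - (s m)\<^sup>2 / 2)) \<le> 1 + exp (- 1 * \<xi> c \<omega>)" for m
    proof (rule AE_I2)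
      fix \<omega>
      have "exp (s m * \<xi> c \<omega> - (s m)\<^sup>2 / 2) \<le> exp (s m * \<xi> c \<omega>)" by simp
      also have "\<dots> \<le> 1 + exp (- 1 * \<xi> c \<omega>)"
      proof (cases "0 \<le> \<xi> c \<omega>")
        case True
        then have "s m * \<xi> c \<omega> \<le> 0" using s(1)[of m] by (intro mult_nonpos_nonneg) auto
        then have "exp (s m * \<xi> c \<omega>) \<le> 1" by simp
        then show ?thesis using exp_ge_zero[of "- 1 * \<xi> c \<omega>"] by linarith
      next
        case False
        then have "s m * \<xi> c \<omega> \<le> - 1 * \<xi> c \<omega>" using s(2)[of m] by (intro mult_right_mono_neg) auto
        then have "exp (s m * \<xi> c \<omega>) \<le> exp (- 1 * \<xi> c \<omega>)" by (subst exp_le_cancel_iff)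
        then show ?thesis by linarith
      qed
      finally show "norm (indicator B \<omega> * exp (s m * \<xi> c \<omega> - (s m)\<^sup>2 / 2)) \<le> 1 + exp (- 1 * \<xi> c \<omega>)"
        using exp_ge_zero[of "- 1 * \<xi> c \<omega>"] by (cases "\<omega> \<in> B") (auto simp: add_nonneg_nonneg)
    qed
  qed measurable
  moreover have "(LINT \<omega>|N. indicator B \<omega> * exp (0 * \<xi> c \<omega> - 0\<^sup>2 / 2)) = measure N B" by simp
  ultimately have "(\<lambda>m. measure N (A m)) \<longlonglongrightarrow> measure N B" unfolding eq by simp
  from LIMSEQ_unique[OF this 0] show ?thesis by (simp add: B_def)
qed

lemma no_atom_scaled:
  assumes "0 < b"
  shows "measure N {\<omega>\<in>space N. weighted_integral Z (\<lambda>v. if c \<le> v then b else 0) k \<omega> = 0} = 0"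
proof -
  have "weighted_integral Z (\<lambda>v. if c \<le> v then b else 0) k \<omega> = b * weighted_integral Z (\<lambda>v. halfline c v) k \<omega>" for \<omega>
    unfolding weighted_integral_def integral_mult_right_zero[symmetric] by (intro Bochner_Integration.integral_cong) auto
  then show ?thesis using no_atom[of c k] assms by simp
qed

text \<open>Multiplying out the quotient needs integrability and a positive denominator, both
  available on \<open>good c k\<close>. The factor \<open>b\<close> stands for the prior density at
  the tested point, with which the experiments converge; it does not change the sign.\<close>

lemma limit_bayes_event:
  assumes b: "0 < b"
  shows "measure N {\<omega>\<in>space N. limit_bayes H W c \<omega> > k} = measure N {\<omega>\<in>space N. weighted_integral Z (\<lambda>v. if c \<le> v then b else 0) k \<omega> > 0}"
proof -
  have sc: "weighted_integral Z (\<lambda>v. if c \<le> v then b else 0) k \<omega> = b * weighted_integral Z (\<lambda>v. halfline c v) k \<omega>" for \<omega>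
    unfolding weighted_integral_def integral_mult_right_zero[symmetric] by (intro Bochner_Integration.integral_cong) auto
  have [measurable]: "weighted_integral Z (\<lambda>v. halfline c v) k \<in> borel_measurable N"
    using weighted_Zs_measurable[of c 0 k] by (simp add: Zs_0)
  have Zm [measurable]: "(\<lambda>x. Z (snd x) (fst x)) \<in> borel_measurable (N \<Otimes>\<^sub>M borel)"
    using measurable_compose[OF measurable_Pair[OF measurable_snd measurable_fst] Zs_pair_measurable[of c 0]] by (simp add: Zs_0)
  have [measurable]: "limit_bayes H W c \<in> borel_measurable N"
    unfolding limit_bayes_def Z_def[symmetric] set_lebesgue_integral_def by measurable
  show ?thesis
  proof (rule finite_measure_eq_AE)
    show "AE \<omega> in N. (\<omega> \<in> {\<omega>\<in>space N. limit_bayes H W c \<omega> > k}) = (\<omega> \<in> {\<omega>\<in>space N. weighted_integral Z (\<lambda>v. if c \<le> v then b else 0) k \<omega> > 0})"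
      using AE_good[of c k]
    proof eventually_elim
      case (elim \<omega>)
      have sp: "\<omega> \<in> space N" using elim by (simp add: good_def)
      have i1: "integrable lborel (\<lambda>v. indicator {c..} v *\<^sub>R (v * Z v \<omega>))"
        by (rule good_integrable[OF elim, where B=1]) auto
      have i0: "integrable lborel (\<lambda>v. indicator {c..} v *\<^sub>R (1 * Z v \<omega>))"
        by (rule good_integrable[OF elim, where B=1]) auto
      define den where "den = (LBINT v:{c..}. limit_likelihood H W v \<omega>)"
      define num where "num = (LBINT v:{c..}. v * limit_likelihood H W v \<omega>)"
      have den: "den = (LBINT v. indicator {c..} v *\<^sub>R (1 * Z v \<omega>))"
        and num: "num = (LBINT v. indicator {c..} v *\<^sub>R (v * Z v \<omega>))"
        unfolding den_def num_def set_lebesgue_integral_def Z_def by simp_all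
      have "den \<noteq> 0"
      proof
        assume "den = 0"
        then have "AE v in lborel. indicator {c..} v *\<^sub>R (1 * Z v \<omega>) = 0"
          using i0 less_imp_le[OF Z_pos] unfolding den by (subst integral_nonneg_eq_0_iff_AE[symmetric]) auto
        then have "AE v in lborel. v \<notin> {c..c + 1}"
        proof eventually_elim
          case (elim v)
          then show ?case using Z_pos[of v \<omega>] by auto
        qed
        from emeasure_eq_0_AE[OF this] have "emeasure lborel {c..c + 1} = 0" by (simp only: space_lborel space_borel UNIV_I simp_thms Collect_mem_eq)
        then show False by simp
      qed
      moreover have "0 \<le> den" unfolding den using less_imp_le[OF Z_pos] by (intro integral_nonneg_AE) auto
      ultimately have dpos: "0 < den" by simp
      have "weighted_integral Z (\<lambda>v. halfline c v) k \<omega> = (LBINT v. indicator {c..} v *\<^sub>R (v * Z v \<omega>) - k * (indicator {c..} v *\<^sub>R (1 * Z v \<omega>)))"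
        unfolding weighted_integral_eq by (intro Bochner_Integration.integral_cong) (auto simp: algebra_simps)
      also have "\<dots> = num - k * den"
        unfolding num den using i0 i1 by simp
      finally have wi: "weighted_integral Z (\<lambda>v. halfline c v) k \<omega> = num - k * den" .
      have "limit_bayes H W c \<omega> > k \<longleftrightarrow> num / den > k" by (simp add: limit_bayes_def num_def den_def)
      also have "\<dots> \<longleftrightarrow> 0 < num - k * den" using dpos by (simp add: less_divide_eq)
      also have "\<dots> \<longleftrightarrow> 0 < weighted_integral Z (\<lambda>v. if c \<le> v then b else 0) k \<omega>"
        unfolding sc wi using b by (simp add: zero_less_mult_iff)
      finally show ?case using sp by simp
    qed
  qed (simp_all add: sc)
qed

end

section \<open>Likelihood ratios in the cusp model\<close>

text \<open>\<open>cl\<close> and \<open>hm\<close> name bounds which the final theorem supplies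
  existentially. Here \<open>h\<close> is Borel on the whole line; the final theorem arranges this
  by extending \<open>h\<close> beyond the observation interval.\<close>

locale cusp_model =
  fixes \<tau> \<theta>1 b \<kappa> a :: real and h :: "real \<Rightarrow> real" and cl hm :: real
  assumes tau: "0 < \<tau>" and theta1: "0 < \<theta>1" "\<theta>1 < b" and b_le: "b \<le> \<tau>"
    and kp: "0 < \<kappa>" and kh: "\<kappa> < 1 / 2" and a: "a \<noteq> 0"
    and h_pos: "\<And>t. t \<in> {0..\<tau>} \<Longrightarrow> 0 < h t" and h_le: "\<And>t. t \<in> {0..\<tau>} \<Longrightarrow> h t \<le> hm"
    and h_measurable [measurable]: "h \<in> borel_measurable borel" and h_cont: "isCont h \<theta>1"
    and cl_pos: "0 < cl"
    and sep: "\<And>\<theta> t. \<theta> \<in> {\<theta>1..<b} \<Longrightarrow> t \<in> {0..\<tau>} \<Longrightarrow> cl \<le> cusp_intensity a \<kappa> h \<theta> t"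
begin

abbreviation lam :: "real \<Rightarrow> real \<Rightarrow> real" where "lam \<equiv> cusp_intensity a \<kappa> h"
abbreviation \<Theta> :: "real set" where "\<Theta> \<equiv> {\<theta>1..<b}"
definition Lm :: real where "Lm = \<bar>a\<bar> * \<tau> powr \<kappa> + hm"

lemma lam_measurable [measurable]: "lam \<theta> \<in> borel_measurable borel"
  unfolding cusp_intensity_def[abs_def] by measurable

lemma lam_le: "\<theta> \<in> \<Theta> \<Longrightarrow> t \<in> {0..\<tau>} \<Longrightarrow> lam \<theta> t \<le> Lm"
proof -
  assume t: "\<theta> \<in> \<Theta>" "t \<in> {0..\<tau>}"
  then have "\<bar>t - \<theta>\<bar> \<le> \<tau>" using theta1 b_le by auto
  then have "\<bar>t - \<theta>\<bar> powr \<kappa> \<le> \<tau> powr \<kappa>" using kp by (intro powr_mono2) auto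
  then have "\<bar>a\<bar> * \<bar>t - \<theta>\<bar> powr \<kappa> \<le> \<bar>a\<bar> * \<tau> powr \<kappa>" by (intro mult_left_mono) auto
  moreover have "a * \<bar>t - \<theta>\<bar> powr \<kappa> \<le> \<bar>a\<bar> * \<bar>t - \<theta>\<bar> powr \<kappa>" by (intro mult_right_mono) auto
  ultimately show ?thesis unfolding cusp_intensity_def Lm_def using h_le[OF t(2)] by linarith
qed

lemma lam_pos: "\<theta> \<in> \<Theta> \<Longrightarrow> t \<in> {0..\<tau>} \<Longrightarrow> 0 < lam \<theta> t"
  using sep cl_pos by fastforce

lemma cl_le_Lm: "cl \<le> Lm"
  using sep[of \<theta>1 0] lam_le[of \<theta>1 0] theta1 tau by auto

lemma Lm_pos: "0 < Lm" using cl_le_Lm cl_pos by linarith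

lemma lam_ratio:
  assumes "\<theta> \<in> \<Theta>" "\<theta>' \<in> \<Theta>" "t \<in> {0..\<tau>}"
  shows "cl / Lm \<le> lam \<theta> t / lam \<theta>' t" "lam \<theta> t / lam \<theta>' t \<le> Lm / cl"
  using sep[OF assms(1,3)] lam_le[OF assms(1,3)] sep[OF assms(2,3)] lam_le[OF assms(2,3)] cl_pos Lm_pos
  by (auto intro!: frac_le)

lemma ln_ratio_bound:
  assumes "\<theta> \<in> \<Theta>" "\<theta>' \<in> \<Theta>" "t \<in> {0..\<tau>}"
  shows "\<bar>ln (lam \<theta> t / lam \<theta>' t)\<bar> \<le> ln (Lm / cl)"
proof -
  have "ln (lam \<theta> t / lam \<theta>' t) \<le> ln (Lm / cl)"
    using lam_ratio[OF assms] lam_pos[OF assms(1,3)] lam_pos[OF assms(2,3)] cl_pos Lm_pos by (subst ln_le_cancel_iff) auto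
  moreover have "ln (lam \<theta>' t / lam \<theta> t) \<le> ln (Lm / cl)"
    using lam_ratio[OF assms(2,1,3)] lam_pos[OF assms(1,3)] lam_pos[OF assms(2,3)] cl_pos Lm_pos by (subst ln_le_cancel_iff) auto
  moreover have "ln (lam \<theta>' t / lam \<theta> t) = - ln (lam \<theta> t / lam \<theta>' t)"
    using lam_pos[OF assms(1,3)] lam_pos[OF assms(2,3)] by (simp add: ln_div)
  ultimately show ?thesis by linarith
qed

lemma bounded_set_integrable:
  fixes f :: "real \<Rightarrow> 'c::{banach, second_countable_topology}"
  assumes "f \<in> borel_measurable borel" "\<And>u. u \<in> {0<..\<tau>} \<Longrightarrow> norm (f u) \<le> B"
  shows "set_integrable lborel {0<..\<tau>} f"
  unfolding set_integrable_def using assms tau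
  by (intro integrableI_bounded_set[where A="{0<..\<tau>}" and B=B]) (auto simp: emeasure_lborel_Ioc)

lemma sqrt_diff_bounds:
  fixes x y :: real
  assumes "cl \<le> x" "x \<le> Lm" "cl \<le> y" "y \<le> Lm"
  shows "(sqrt x - sqrt y)\<^sup>2 \<le> (x - y)\<^sup>2 / (4 * cl)" "(x - y)\<^sup>2 / (4 * Lm) \<le> (sqrt x - sqrt y)\<^sup>2"
proof -
  have xy: "0 \<le> x" "0 \<le> y" using assms cl_pos by linarith+
  then have e: "(x - y)\<^sup>2 = (sqrt x - sqrt y)\<^sup>2 * (sqrt x + sqrt y)\<^sup>2"
    unfolding power_mult_distrib[symmetric] by (simp add: algebra_simps)
  have s: "sqrt cl \<le> sqrt x" "sqrt cl \<le> sqrt y" "sqrt x \<le> sqrt Lm" "sqrt y \<le> sqrt Lm" using assms by auto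
  have "2 * sqrt cl \<le> sqrt x + sqrt y" "sqrt x + sqrt y \<le> 2 * sqrt Lm" using s by linarith+
  note ss = this
  have "(2 * sqrt cl)\<^sup>2 \<le> (sqrt x + sqrt y)\<^sup>2" using cl_pos by (intro power_mono ss) auto
  then have 1: "4 * cl \<le> (sqrt x + sqrt y)\<^sup>2" using cl_pos by (simp add: power_mult_distrib)
  have "(sqrt x + sqrt y)\<^sup>2 \<le> (2 * sqrt Lm)\<^sup>2" using xy by (intro power_mono ss) auto
  then have 2: "(sqrt x + sqrt y)\<^sup>2 \<le> 4 * Lm" using Lm_pos by (simp add: power_mult_distrib)
  show "(sqrt x - sqrt y)\<^sup>2 \<le> (x - y)\<^sup>2 / (4 * cl)"
    unfolding e using mult_left_mono[OF 1, of "(sqrt x - sqrt y)\<^sup>2"] cl_pos by (simp add: le_divide_eq)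
  show "(x - y)\<^sup>2 / (4 * Lm) \<le> (sqrt x - sqrt y)\<^sup>2"
    unfolding e using mult_left_mono[OF 2, of "(sqrt x - sqrt y)\<^sup>2"] Lm_pos by (simp add: divide_le_eq)
qed

text \<open>Squared distance of the root intensities, without a factor one half. The mean of a
  product of two root likelihood ratios from n paths is the exponential of \<open>- n / 2\<close>
  times it.\<close>

definition hellinger :: "real \<Rightarrow> real \<Rightarrow> real" where
  "hellinger \<theta> \<theta>' = (LBINT u:{0<..\<tau>}. (sqrt (lam \<theta> u) - sqrt (lam \<theta>' u))\<^sup>2)"

lemma lam_diff: "lam \<theta> u - lam \<theta>' u = a * (\<bar>u - \<theta>\<bar> powr \<kappa> - \<bar>u - \<theta>'\<bar> powr \<kappa>)"
  by (simp add: cusp_intensity_def algebra_simps)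

lemma hellinger_integrable:
  assumes "\<theta> \<in> \<Theta>" "\<theta>' \<in> \<Theta>"
  shows "set_integrable lborel {0<..\<tau>} (\<lambda>u. (sqrt (lam \<theta> u) - sqrt (lam \<theta>' u))\<^sup>2)"
proof (rule bounded_set_integrable[where B="(Lm - cl)\<^sup>2 / (4 * cl)"])
  fix u assume "u \<in> {0<..\<tau>}"
  then have u: "u \<in> {0..\<tau>}" by auto
  have "(lam \<theta> u - lam \<theta>' u)\<^sup>2 \<le> (Lm - cl)\<^sup>2"
    using sep[OF assms(1) u] sep[OF assms(2) u] lam_le[OF assms(1) u] lam_le[OF assms(2) u]
    by (intro power2_le_iff_abs_le[THEN iffD2]) (auto simp: abs_le_iff)
  then have "(lam \<theta> u - lam \<theta>' u)\<^sup>2 / (4 * cl) \<le> (Lm - cl)\<^sup>2 / (4 * cl)" using cl_pos by (intro divide_right_mono) auto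
  then show "norm ((sqrt (lam \<theta> u) - sqrt (lam \<theta>' u))\<^sup>2) \<le> (Lm - cl)\<^sup>2 / (4 * cl)"
    using sqrt_diff_bounds(1)[OF sep[OF assms(1) u] lam_le[OF assms(1) u] sep[OF assms(2) u] lam_le[OF assms(2) u]] by simp
qed measurable

text \<open>For intensities of at least \<open>cl\<close>, differences of roots are controlled by
  differences of intensities, in which \<open>h\<close> cancels; enlarging the domain to the whole
  line then gives the exact cusp integral.\<close>

lemma hellinger_le:
  assumes "\<theta> \<in> \<Theta>" "\<theta>' \<in> \<Theta>"
  shows "hellinger \<theta> \<theta>' \<le> a\<^sup>2 * cusp_const \<kappa> / (4 * cl) * \<bar>\<theta> - \<theta>'\<bar> powr (2 * \<kappa> + 1)"
proof -
  have i: "integrable lborel (\<lambda>s. a\<^sup>2 / (4 * cl) * (\<bar>s - \<theta>\<bar> powr \<kappa> - \<bar>s - \<theta>'\<bar> powr \<kappa>)\<^sup>2)"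
    by (intro integrable_mult_right cusp_integrable kp kh)
  have "hellinger \<theta> \<theta>' \<le> (LBINT s. a\<^sup>2 / (4 * cl) * (\<bar>s - \<theta>\<bar> powr \<kappa> - \<bar>s - \<theta>'\<bar> powr \<kappa>)\<^sup>2)"
    unfolding hellinger_def set_lebesgue_integral_def
  proof (rule integral_mono[OF hellinger_integrable[OF assms, unfolded set_integrable_def] i])
    fix u
    show "indicator {0<..\<tau>} u *\<^sub>R (sqrt (lam \<theta> u) - sqrt (lam \<theta>' u))\<^sup>2 \<le> a\<^sup>2 / (4 * cl) * (\<bar>u - \<theta>\<bar> powr \<kappa> - \<bar>u - \<theta>'\<bar> powr \<kappa>)\<^sup>2"
    proof (cases "u \<in> {0<..\<tau>}")
      case True
      then have u: "u \<in> {0..\<tau>}" by auto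
      have "(sqrt (lam \<theta> u) - sqrt (lam \<theta>' u))\<^sup>2 \<le> (lam \<theta> u - lam \<theta>' u)\<^sup>2 / (4 * cl)"
        by (rule sqrt_diff_bounds(1)[OF sep[OF assms(1) u] lam_le[OF assms(1) u] sep[OF assms(2) u] lam_le[OF assms(2) u]])
      then show ?thesis using True unfolding lam_diff by (simp add: power_mult_distrib)
    next
      case False
      then show ?thesis using cl_pos by simp
    qed
  qed
  also have "\<dots> = a\<^sup>2 / (4 * cl) * (\<bar>\<theta> - \<theta>'\<bar> powr (2 * \<kappa> + 1) * cusp_const \<kappa>)"
    unfolding integral_mult_right_zero cusp_integral[OF kp kh] ..
  finally show ?thesis by (simp add: mult_ac)
qed

definition gap :: real where "gap = (3 / 4) powr \<kappa> - (1 / 4) powr \<kappa>"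

lemma gap_pos: "0 < gap"
  unfolding gap_def using kp powr_less_mono2[of \<kappa> "1 / 4" "3 / 4"] by simp

text \<open>Near \<open>\<theta>\<close>, on a quarter of the way to \<open>\<theta>'\<close>, the two cusps differ by at least \<open>gap \<bar>\<theta> - \<theta>'\<bar>\<^sup>\<kappa>\<close>.\<close>

lemma hellinger_ge:
  assumes "\<theta> \<in> \<Theta>" "\<theta>' \<in> \<Theta>"
  shows "a\<^sup>2 * gap\<^sup>2 / (16 * Lm) * \<bar>\<theta> - \<theta>'\<bar> powr (2 * \<kappa> + 1) \<le> hellinger \<theta> \<theta>'"
proof -
  \<comment> \<open>By symmetry the case \<open>\<theta> < \<theta>'\<close> suffices. The interval
    \<open>J\<close> then points from \<open>\<theta>\<close> towards \<open>\<theta>'\<close> and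
    stays within the observation window.\<close>
  have main: "a\<^sup>2 * gap\<^sup>2 / (16 * Lm) * (\<theta>' - \<theta>) powr (2 * \<kappa> + 1) \<le> hellinger \<theta> \<theta>'"
    if th: "\<theta> \<in> \<Theta>" "\<theta>' \<in> \<Theta>" and lt: "\<theta> < \<theta>'" for \<theta> \<theta>'
  proof -
    define d where "d = \<theta>' - \<theta>"
    have d: "0 < d" using lt by (simp add: d_def)
    define J where "J = {\<theta>..\<theta> + d / 4}"
    have J: "J \<subseteq> {0<..\<tau>}"
    proof
      fix x assume "x \<in> J"
      then have "\<theta> \<le> x" "x \<le> \<theta> + (\<theta>' - \<theta>) / 4" by (auto simp: J_def d_def)
      moreover have "\<theta>1 \<le> \<theta>" "\<theta>' < b" using th by auto
      moreover have "(\<theta>' - \<theta>) / 4 < \<theta>' - \<theta>" using lt by simp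
      ultimately have "0 < x" "x < b" using theta1 by linarith+
      then have "0 < x" "x \<le> \<tau>" using b_le by linarith+
      then show "x \<in> {0<..\<tau>}" by simp
    qed
    have pt: "a\<^sup>2 * gap\<^sup>2 / (4 * Lm) * d powr (2 * \<kappa>) \<le> (sqrt (lam \<theta> u) - sqrt (lam \<theta>' u))\<^sup>2" if u: "u \<in> J" for u
    proof -
      have u': "u \<in> {0..\<tau>}" using J u by auto
      have "\<bar>u - \<theta>\<bar> powr \<kappa> \<le> (1 / 4 * d) powr \<kappa>" using u kp by (intro powr_mono2) (auto simp: J_def)
      moreover have "3 / 4 * d \<le> \<bar>u - \<theta>'\<bar>"
      proof -
        have "u \<le> \<theta> + d / 4" using u by (simp add: J_def)
        moreover have "\<theta>' = \<theta> + d" by (simp add: d_def)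
        ultimately show ?thesis by linarith
      qed
      then have "(3 / 4 * d) powr \<kappa> \<le> \<bar>u - \<theta>'\<bar> powr \<kappa>" using kp d by (intro powr_mono2) auto
      ultimately have "gap * d powr \<kappa> \<le> \<bar>u - \<theta>'\<bar> powr \<kappa> - \<bar>u - \<theta>\<bar> powr \<kappa>"
        unfolding gap_def left_diff_distrib powr_mult by linarith
      then have "(gap * d powr \<kappa>)\<^sup>2 \<le> (\<bar>u - \<theta>\<bar> powr \<kappa> - \<bar>u - \<theta>'\<bar> powr \<kappa>)\<^sup>2"
        using gap_pos by (subst power2_commute) (intro power_mono, auto)
      moreover have "d powr (2 * \<kappa>) = (d powr \<kappa>)\<^sup>2" using powr_add[of d \<kappa> \<kappa>] by (simp add: power2_eq_square)
      ultimately have "a\<^sup>2 * (gap\<^sup>2 * d powr (2 * \<kappa>)) \<le> (lam \<theta> u - lam \<theta>' u)\<^sup>2"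
        unfolding lam_diff power_mult_distrib by (intro mult_left_mono) auto
      then have "a\<^sup>2 * (gap\<^sup>2 * d powr (2 * \<kappa>)) / (4 * Lm) \<le> (lam \<theta> u - lam \<theta>' u)\<^sup>2 / (4 * Lm)"
        using Lm_pos by (intro divide_right_mono) auto
      also have "\<dots> \<le> (sqrt (lam \<theta> u) - sqrt (lam \<theta>' u))\<^sup>2"
        by (rule sqrt_diff_bounds(2)[OF sep[OF th(1) u'] lam_le[OF th(1) u'] sep[OF th(2) u'] lam_le[OF th(2) u']])
      finally show ?thesis by (simp add: mult_ac)
    qed
    have "(LBINT u. indicator J u *\<^sub>R (a\<^sup>2 * gap\<^sup>2 / (4 * Lm) * d powr (2 * \<kappa>))) \<le> hellinger \<theta> \<theta>'"
      unfolding hellinger_def set_lebesgue_integral_def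
    proof (rule integral_mono[OF _ hellinger_integrable[OF th, unfolded set_integrable_def]])
      show "integrable lborel (\<lambda>u. indicator J u *\<^sub>R (a\<^sup>2 * gap\<^sup>2 / (4 * Lm) * d powr (2 * \<kappa>)))"
        by (intro integrable_scaleR_left integrable_real_indicator) (use d in \<open>auto simp: J_def\<close>)
      fix u
      show "indicator J u *\<^sub>R (a\<^sup>2 * gap\<^sup>2 / (4 * Lm) * d powr (2 * \<kappa>)) \<le> indicator {0<..\<tau>} u *\<^sub>R (sqrt (lam \<theta> u) - sqrt (lam \<theta>' u))\<^sup>2"
        using pt[of u] J by (cases "u \<in> J") (auto simp: indicator_def)
    qed
    moreover have "(LBINT u. indicator J u *\<^sub>R (a\<^sup>2 * gap\<^sup>2 / (4 * Lm) * d powr (2 * \<kappa>))) = a\<^sup>2 * gap\<^sup>2 / (16 * Lm) * d powr (2 * \<kappa> + 1)"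
    proof -
      have "measure lborel J = d / 4" using d by (simp add: J_def)
      moreover have "d powr (2 * \<kappa> + 1) = d powr (2 * \<kappa>) * d" using d by (simp add: powr_add)
      ultimately show ?thesis using d by (simp add: J_def)
    qed
    ultimately show ?thesis by (simp add: d_def)
  qed
  have comm: "hellinger \<theta> \<theta>' = hellinger \<theta>' \<theta>" for \<theta> \<theta>'
    unfolding hellinger_def by (simp add: power2_commute)
  consider "\<theta> = \<theta>'" | "\<theta> < \<theta>'" | "\<theta>' < \<theta>" by linarith
  then show ?thesis
  proof cases
    case 1
    then show ?thesis by (simp add: hellinger_def)
  next
    case 2
    then show ?thesis using main[OF assms 2] by simp
  next
    case 3
    then show ?thesis using main[OF assms(2,1) 3] comm[of \<theta> \<theta>'] by simp
  qed
qed

definition \<phi> :: "nat \<Rightarrow> real" where "\<phi> = cusp_rate a \<kappa> h \<theta>1"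

lemma theta1_mem: "\<theta>1 \<in> {0..\<tau>}" using theta1 b_le by auto

lemma Gamma_sq: "0 < cusp_Gamma a \<kappa> h \<theta>1" "(cusp_Gamma a \<kappa> h \<theta>1)\<^sup>2 = a\<^sup>2 * cusp_const \<kappa> / h \<theta>1"
proof -
  have e: "2 * a\<^sup>2 * Beta (\<kappa> + 1) (\<kappa> + 1) / h \<theta>1 * (1 / cos (pi * \<kappa>) - 1) = a\<^sup>2 * cusp_const \<kappa> / h \<theta>1"
    by (simp add: cusp_const_def)
  moreover have "0 < a\<^sup>2 * cusp_const \<kappa> / h \<theta>1"
    using a cusp_const_pos[OF kp kh] h_pos[OF theta1_mem] by simp
  ultimately show "0 < cusp_Gamma a \<kappa> h \<theta>1" "(cusp_Gamma a \<kappa> h \<theta>1)\<^sup>2 = a\<^sup>2 * cusp_const \<kappa> / h \<theta>1"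
    unfolding cusp_Gamma_def e by simp_all
qed

lemma rate_eq: "\<phi> n = real n powr (- 1 / (2 * \<kappa> + 1)) * cusp_Gamma a \<kappa> h \<theta>1 powr (- 2 / (2 * \<kappa> + 1))"
proof -
  have "- 1 / (\<kappa> + 1 / 2) = - 2 / (2 * \<kappa> + 1)" using kp by (simp add: field_simps)
  then show ?thesis by (simp add: \<phi>_def cusp_rate_def Let_def distrib_left)
qed

lemma rate_pos: "1 \<le> n \<Longrightarrow> 0 < \<phi> n"
  using Gamma_sq(1) by (simp add: rate_eq)

text \<open>The defining property of the rate, read off from the square of
  \<open>cusp_Gamma\<close>: the quadratic information at unit local distance, \<open>real n *
  \<phi> n powr (2 * \<kappa> + 1) * a^2 * cusp_const \<kappa> / h \<theta>1\<close>, equals 1 for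
  every n.\<close>

lemma rate_scale:
  assumes n: "1 \<le> n"
  shows "real n * \<phi> n powr (2 * \<kappa> + 1) * (a\<^sup>2 * cusp_const \<kappa>) = h \<theta>1"
proof -
  define s where "s = 2 * \<kappa> + 1"
  have s: "s \<noteq> 0" using kp by (simp add: s_def)
  have "\<phi> n powr s = (real n powr (- 1 / s)) powr s * (cusp_Gamma a \<kappa> h \<theta>1 powr (- 2 / s)) powr s"
    unfolding rate_eq s_def[symmetric] by (simp add: powr_mult)
  also have "\<dots> = real n powr (- 1) * cusp_Gamma a \<kappa> h \<theta>1 powr (- 2)"
    using s by (simp add: powr_powr)
  also have "\<dots> = 1 / (real n * (cusp_Gamma a \<kappa> h \<theta>1)\<^sup>2)"
    using n Gamma_sq(1) by (simp add: powr_minus_divide powr_numeral)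
  finally show ?thesis
    using n a cusp_const_pos[OF kp kh] h_pos[OF theta1_mem] unfolding s_def Gamma_sq(2) by simp
qed

lemma rate_tendsto: "\<phi> \<longlonglongrightarrow> 0"
proof -
  have "(\<lambda>n. real n powr (- 1 / (2 * \<kappa> + 1)) * cusp_Gamma a \<kappa> h \<theta>1 powr (- 2 / (2 * \<kappa> + 1))) \<longlonglongrightarrow> 0 * cusp_Gamma a \<kappa> h \<theta>1 powr (- 2 / (2 * \<kappa> + 1))"
    using kp by (intro tendsto_mult tendsto_neg_powr filterlim_real_sequentially tendsto_const) (simp add: divide_neg_pos)
  then show ?thesis by (simp add: rate_eq[abs_def])
qed

text \<open>In local coordinates the accumulated distance lies between two multiples of
  \<open>\<bar>v\<bar> powr (2 * \<kappa> + 1)\<close> that do not depend on n. These multiples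
  enter \<open>field_C\<close> and, halved, \<open>field_q\<close>.\<close>

lemma rate_hellinger:
  assumes n: "1 \<le> n" and th: "\<theta> \<in> \<Theta>" "\<theta> + \<phi> n * v \<in> \<Theta>"
  shows "real n * hellinger (\<theta> + \<phi> n * v) \<theta> \<le> h \<theta>1 / (4 * cl) * \<bar>v\<bar> powr (2 * \<kappa> + 1)" (is ?goalA)
    and "h \<theta>1 * gap\<^sup>2 / (16 * Lm * cusp_const \<kappa>) * \<bar>v\<bar> powr (2 * \<kappa> + 1) \<le> real n * hellinger (\<theta> + \<phi> n * v) \<theta>" (is ?goalB)
proof -
  define V where "V = \<bar>v\<bar> powr (2 * \<kappa> + 1)"
  define F where "F = \<phi> n powr (2 * \<kappa> + 1)"
  have c: "0 < cusp_const \<kappa>" by (rule cusp_const_pos[OF kp kh])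
  have V: "\<bar>\<theta> + \<phi> n * v - \<theta>\<bar> powr (2 * \<kappa> + 1) = F * V"
    using rate_pos[OF n] by (simp add: abs_mult powr_mult V_def F_def)
  have F: "real n * F * (a\<^sup>2 * cusp_const \<kappa>) = h \<theta>1" unfolding F_def by (rule rate_scale[OF n])
  have "real n * hellinger (\<theta> + \<phi> n * v) \<theta> \<le> real n * (a\<^sup>2 * cusp_const \<kappa> / (4 * cl) * (F * V))"
    using hellinger_le[OF th(2,1)] unfolding V by (intro mult_left_mono) auto
  also have "\<dots> = (real n * F * (a\<^sup>2 * cusp_const \<kappa>)) / (4 * cl) * V" by simp
  finally show ?goalA
    unfolding F V_def .
  have "h \<theta>1 * gap\<^sup>2 / (16 * Lm * cusp_const \<kappa>) * V = real n * (a\<^sup>2 * gap\<^sup>2 / (16 * Lm) * (F * V))"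
    unfolding F[symmetric] using c by simp
  also have "\<dots> \<le> real n * hellinger (\<theta> + \<phi> n * v) \<theta>"
    using hellinger_ge[OF th(2,1)] unfolding V by (intro mult_left_mono) auto
  finally show ?goalB
    unfolding V_def .
qed

end

section \<open>Exponential moments of likelihood ratios\<close>

locale cusp_sample = cusp_model +
  fixes n :: nat and \<theta>0 :: real and P :: "'a measure" and X :: "nat \<Rightarrow> 'a \<Rightarrow> real \<Rightarrow> nat"
  assumes theta0: "\<theta>0 \<in> {\<theta>1..<b}" and sample: "poisson_sample P \<tau> n (cusp_intensity a \<kappa> h \<theta>0) X"
begin

sublocale prob_space P using sample by (simp add: poisson_sample_def)

lemma X_poisson: "j < n \<Longrightarrow> poisson_path P \<tau> (lam \<theta>0) (X j) cl Lm"
  using sample tau cl_pos sep[OF theta0] lam_le[OF theta0] prob_space_axioms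
  unfolding poisson_path_def poisson_path_axioms_def poisson_sample_def by auto

lemma X_measurable: "j < n \<Longrightarrow> X j \<in> P \<rightarrow>\<^sub>M path_space \<tau>"
  using poisson_path.Y_measurable[OF X_poisson] .

lemma X_indep: "indep_vars (\<lambda>_. path_space \<tau>) X {..<n}"
  using sample by (simp add: poisson_sample_def)

lemma sample_campbell:
  fixes f :: "real \<Rightarrow> complex"
  assumes f [measurable]: "f \<in> borel_measurable borel" and B: "\<And>u. cmod (f u) \<le> B"
  shows "integrable P (\<lambda>\<omega>. exp (\<Sum>j<n. LINT u|path_measure \<tau> (X j \<omega>). f u))" (is ?goalA)
    and "(LINT \<omega>|P. exp (\<Sum>j<n. LINT u|path_measure \<tau> (X j \<omega>). f u)) =
      exp (of_nat n * (LBINT u:{0<..\<tau>}. (exp (f u) - 1) * complex_of_real (lam \<theta>0 u)))" (is ?goalB)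
proof -
  have c: "integrable P (\<lambda>\<omega>. exp (LINT u|path_measure \<tau> (X j \<omega>). f u)) \<and>
     (LINT \<omega>|P. exp (LINT u|path_measure \<tau> (X j \<omega>). f u)) = exp (LBINT u:{0<..\<tau>}. (exp (f u) - 1) * complex_of_real (lam \<theta>0 u))" if "j < n" for j
  proof -
    interpret Y: poisson_path P \<tau> "lam \<theta>0" "X j" cl Lm by (rule X_poisson[OF that])
    show ?thesis using Y.campbell_measurable[OF f B] unfolding Y.campbell_def .
  qed
  have [measurable]: "(\<lambda>x. LINT u|path_measure \<tau> x. f u) \<in> borel_measurable (path_space \<tau>)"
    by (rule path_integral_measurable_complex[OF tau f B])
  have ind: "indep_vars (\<lambda>_. borel) (\<lambda>j \<omega>. exp (LINT u|path_measure \<tau> (X j \<omega>). f u)) {..<n}"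
    by (rule indep_vars_compose2[OF X_indep, where Y="\<lambda>_ x. exp (LINT u|path_measure \<tau> x. f u)"]) measurable
  show ?goalA
    using indep_vars_integrable[OF _ ind] c by (simp add: exp_sum)
  show ?goalB
    using indep_vars_lebesgue_integral[OF _ ind] c by (simp add: exp_sum exp_of_nat_mult)
qed

definition obs :: "'a \<Rightarrow> nat \<Rightarrow> real \<Rightarrow> nat" where "obs \<omega> = (\<lambda>j\<in>{..<n}. X j \<omega>)"

definition LR :: "real \<Rightarrow> 'a \<Rightarrow> real" where
  "LR \<theta> \<omega> = likelihood \<tau> n (lam \<theta>) (obs \<omega>) / likelihood \<tau> n (lam \<theta>0) (obs \<omega>)"

lemma LR_pos: "0 < LR \<theta> \<omega>" by (simp add: LR_def likelihood_def)

text \<open>Cut off outside the observation window, so that it is a bounded function on the whole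
  line, as Campbell's formula requires.\<close>

definition lr :: "real \<Rightarrow> real \<Rightarrow> real" where
  "lr \<theta> u = indicator {0..\<tau>} u * ln (lam \<theta> u / lam \<theta>0 u)"

lemma lr_measurable [measurable]: "lr \<theta> \<in> borel_measurable borel"
  unfolding lr_def by measurable

lemma lr_bound: "\<theta> \<in> \<Theta> \<Longrightarrow> \<bar>lr \<theta> u\<bar> \<le> ln (Lm / cl)"
proof -
  have "0 \<le> ln (Lm / cl)" using cl_le_Lm cl_pos by (simp add: ln_ge_zero)
  moreover assume "\<theta> \<in> \<Theta>"
  ultimately show ?thesis using ln_ratio_bound[OF _ theta0, of \<theta> u] by (auto simp: lr_def indicator_def)
qed

lemma lam_set_integrable: "\<theta> \<in> \<Theta> \<Longrightarrow> set_integrable lborel {0<..\<tau>} (lam \<theta>)"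
  by (rule bounded_set_integrable[where B=Lm]) (use lam_le[of \<theta>] lam_pos[of \<theta>] in \<open>auto simp: abs_of_pos\<close>)

lemma ln_LR:
  assumes th: "\<theta> \<in> \<Theta>" and w: "\<omega> \<in> space P"
  shows "ln (LR \<theta> \<omega>) = (\<Sum>j<n. LINT u|path_measure \<tau> (X j \<omega>). lr \<theta> u) - real n * (LBINT u:{0<..\<tau>}. lam \<theta> u - lam \<theta>0 u)"
proof -
  have x: "counting_path \<tau> (X j \<omega>)" if "j < n" for j
    using measurable_space[OF X_measurable[OF that] w] counting_path_space by blast
  define B where "B = \<bar>ln cl\<bar> + \<bar>ln Lm\<bar>"
  have lnB: "norm (indicator {0..\<tau>} t *\<^sub>R ln (lam \<theta> t)) \<le> B" if th: "\<theta> \<in> \<Theta>" for \<theta> t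
  proof (cases "t \<in> {0..\<tau>}")
    case True
    have "ln cl \<le> ln (lam \<theta> t)" "ln (lam \<theta> t) \<le> ln Lm"
      using sep[OF th True] lam_le[OF th True] lam_pos[OF th True] cl_pos Lm_pos by (auto simp: ln_le_cancel_iff)
    then show ?thesis using True by (auto simp: B_def)
  qed (simp add: B_def)
  have d: "(LINT t:{0..\<tau>}|path_measure \<tau> (X j \<omega>). ln (lam \<theta> t)) - (LINT t:{0..\<tau>}|path_measure \<tau> (X j \<omega>). ln (lam \<theta>0 t)) = (LINT u|path_measure \<tau> (X j \<omega>). lr \<theta> u)"
    if j: "j < n" for j
  proof -
    have i: "integrable (path_measure \<tau> (X j \<omega>)) (\<lambda>t. indicator {0..\<tau>} t *\<^sub>R ln (lam \<theta> t))" if "\<theta> \<in> \<Theta>" for \<theta>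
      by (rule path_integrable_bounded[OF tau x[OF j]]) (use lnB[OF that] in auto)
    have "indicator {0..\<tau>} t *\<^sub>R ln (lam \<theta> t) - indicator {0..\<tau>} t *\<^sub>R ln (lam \<theta>0 t) = lr \<theta> t" for t
      using lam_pos[OF th, of t] lam_pos[OF theta0, of t] by (cases "t \<in> {0..\<tau>}") (auto simp: lr_def ln_div)
    then show ?thesis unfolding set_lebesgue_integral_def
      using Bochner_Integration.integral_diff[OF i[OF th] i[OF theta0]] by simp
  qed
  have s: "(LBINT t:{0..\<tau>}. lam \<theta> t - 1) = (LBINT u:{0<..\<tau>}. lam \<theta> u) - (LBINT u:{0<..\<tau>}. 1)" if th: "\<theta> \<in> \<Theta>" for \<theta>
  proof -
    have "(LBINT t:{0..\<tau>}. lam \<theta> t - 1) = (LBINT u:{0<..\<tau>}. lam \<theta> u - 1)"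
      unfolding set_lebesgue_integral_def
    proof (rule integral_cong_AE)
      show "AE t in lborel. indicator {0..\<tau>} t *\<^sub>R (lam \<theta> t - 1) = indicator {0<..\<tau>} t *\<^sub>R (lam \<theta> t - 1)"
        using AE_lborel_singleton[of "0::real"] by eventually_elim (auto simp: indicator_def)
    qed measurable
    also have "\<dots> = (LBINT u:{0<..\<tau>}. lam \<theta> u) - (LBINT u:{0<..\<tau>}. 1)"
      by (rule set_integral_diff(2)[OF lam_set_integrable[OF th]]) (rule bounded_set_integrable[where B=1], auto)
    finally show ?thesis .
  qed
  have dl: "(LBINT u:{0<..\<tau>}. lam \<theta> u - lam \<theta>0 u) = (LBINT u:{0<..\<tau>}. lam \<theta> u) - (LBINT u:{0<..\<tau>}. lam \<theta>0 u)"
    by (rule set_integral_diff(2)[OF lam_set_integrable[OF th] lam_set_integrable[OF theta0]])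
  define A where "A \<theta> = (\<Sum>j<n. LINT t:{0..\<tau>}|path_measure \<tau> (X j \<omega>). ln (lam \<theta> t))" for \<theta>
  have l: "likelihood \<tau> n (lam \<theta>) (obs \<omega>) = exp (A \<theta> - real n * (LBINT t:{0..\<tau>}. lam \<theta> t - 1))" for \<theta>
    by (simp add: likelihood_def obs_def A_def)
  have "ln (LR \<theta> \<omega>) = (A \<theta> - A \<theta>0) - real n * ((LBINT t:{0..\<tau>}. lam \<theta> t - 1) - (LBINT t:{0..\<tau>}. lam \<theta>0 t - 1))"
    unfolding LR_def l exp_diff[symmetric] ln_exp by (simp add: algebra_simps)
  also have "A \<theta> - A \<theta>0 = (\<Sum>j<n. LINT u|path_measure \<tau> (X j \<omega>). lr \<theta> u)"
    unfolding A_def sum_subtractf[symmetric] using d by (intro sum.cong) auto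
  finally show ?thesis unfolding s[OF th] s[OF theta0] dl by (simp add: algebra_simps)
qed

text \<open>The deterministic part of the log-likelihood is moved under the integral as a
  compensator. First-order terms then cancel and the integrand is quadratically small in the
  intensity differences, which is what balances the factor n.\<close>

lemma LR_transform:
  fixes z :: "nat \<Rightarrow> complex"
  assumes th: "\<And>k. k < m \<Longrightarrow> \<theta> k \<in> \<Theta>"
  shows "integrable P (\<lambda>\<omega>. exp (\<Sum>k<m. z k * of_real (ln (LR (\<theta> k) \<omega>))))" (is ?goalA)
    and "(LINT \<omega>|P. exp (\<Sum>k<m. z k * of_real (ln (LR (\<theta> k) \<omega>)))) =
      exp (of_nat n * (LBINT u:{0<..\<tau>}.
        (exp (\<Sum>k<m. z k * of_real (ln (lam (\<theta> k) u / lam \<theta>0 u))) - 1) * complex_of_real (lam \<theta>0 u)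
        - (\<Sum>k<m. z k * of_real (lam (\<theta> k) u - lam \<theta>0 u))))" (is ?goalB)
proof -
  define F where "F u = (\<Sum>k<m. z k * of_real (lr (\<theta> k) u))" for u
  have Fm [measurable]: "F \<in> borel_measurable borel" unfolding F_def by measurable
  define B where "B = (\<Sum>k<m. cmod (z k) * ln (Lm / cl))"
  have FB: "cmod (F u) \<le> B" for u
    unfolding F_def B_def using lr_bound[OF th] by (intro order_trans[OF norm_sum] sum_mono) (auto simp: norm_mult intro!: mult_left_mono)
  define D where "D k = (LBINT u:{0<..\<tau>}. lam (\<theta> k) u - lam \<theta>0 u)" for k
  define E where "E = exp (- of_nat n * (\<Sum>k<m. z k * of_real (D k)))"
  have rep: "exp (\<Sum>k<m. z k * of_real (ln (LR (\<theta> k) \<omega>))) = exp (\<Sum>j<n. LINT u|path_measure \<tau> (X j \<omega>). F u) * E"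
    if w: "\<omega> \<in> space P" for \<omega>
  proof -
    have x: "counting_path \<tau> (X j \<omega>)" if "j < n" for j
      using measurable_space[OF X_measurable[OF that] w] counting_path_space by blast
    have F: "(LINT u|path_measure \<tau> (X j \<omega>). F u) = (\<Sum>k<m. z k * of_real (LINT u|path_measure \<tau> (X j \<omega>). lr (\<theta> k) u))" if j: "j < n" for j
    proof -
      have "integrable (path_measure \<tau> (X j \<omega>)) (\<lambda>u. z k * complex_of_real (lr (\<theta> k) u))" if "k < m" for k
        using path_integrable_bounded(1)[OF tau x[OF j] lr_measurable[of "\<theta> k"], of "ln (Lm / cl)"] lr_bound[OF th[OF that]]
        by (intro integrable_mult_right integrable_of_real) auto
      then show ?thesis unfolding F_def by (subst Bochner_Integration.integral_sum) auto
    qed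
    have "(\<Sum>k<m. z k * of_real (ln (LR (\<theta> k) \<omega>))) = (\<Sum>k<m. z k * of_real ((\<Sum>j<n. LINT u|path_measure \<tau> (X j \<omega>). lr (\<theta> k) u) - real n * D k))"
      using ln_LR[OF th w] by (intro sum.cong) (auto simp: D_def)
    also have "\<dots> = (\<Sum>k<m. \<Sum>j<n. z k * of_real (LINT u|path_measure \<tau> (X j \<omega>). lr (\<theta> k) u)) - of_nat n * (\<Sum>k<m. z k * of_real (D k))"
      by (simp add: right_diff_distrib sum_subtractf sum_distrib_left mult_ac)
    also have "(\<Sum>k<m. \<Sum>j<n. z k * of_real (LINT u|path_measure \<tau> (X j \<omega>). lr (\<theta> k) u)) = (\<Sum>j<n. LINT u|path_measure \<tau> (X j \<omega>). F u)"
      by (subst sum.swap) (use F in \<open>auto intro!: sum.cong\<close>)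
    finally show ?thesis by (simp add: E_def exp_diff exp_minus divide_inverse)
  qed
  have I: "integrable P (\<lambda>\<omega>. exp (\<Sum>j<n. LINT u|path_measure \<tau> (X j \<omega>). F u) * E)"
    by (intro integrable_mult_left sample_campbell(1)[OF Fm FB])
  show ?goalA
    by (rule Bochner_Integration.integrable_cong[THEN iffD1, OF refl _ I]) (simp only: rep)
  have "(LINT \<omega>|P. exp (\<Sum>k<m. z k * of_real (ln (LR (\<theta> k) \<omega>)))) = (LINT \<omega>|P. exp (\<Sum>j<n. LINT u|path_measure \<tau> (X j \<omega>). F u) * E)"
    by (rule Bochner_Integration.integral_cong[OF refl]) (simp only: rep)
  also have "\<dots> = exp (of_nat n * (LBINT u:{0<..\<tau>}. (exp (F u) - 1) * complex_of_real (lam \<theta>0 u))) * E"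
    unfolding integral_mult_left_zero sample_campbell(2)[OF Fm FB] ..
  also have "\<dots> = exp (of_nat n * ((LBINT u:{0<..\<tau>}. (exp (F u) - 1) * complex_of_real (lam \<theta>0 u)) - (\<Sum>k<m. z k * of_real (D k))))"
    unfolding E_def exp_add[symmetric] by (simp add: algebra_simps)
  also have "(LBINT u:{0<..\<tau>}. (exp (F u) - 1) * complex_of_real (lam \<theta>0 u)) - (\<Sum>k<m. z k * of_real (D k)) =
     (LBINT u:{0<..\<tau>}. (exp (F u) - 1) * complex_of_real (lam \<theta>0 u) - (\<Sum>k<m. z k * of_real (lam (\<theta> k) u - lam \<theta>0 u)))"
  proof -
    have i1: "set_integrable lborel {0<..\<tau>} (\<lambda>u. (exp (F u) - 1) * complex_of_real (lam \<theta>0 u))"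
    proof (rule bounded_set_integrable[where B="(exp B + 1) * Lm"])
      fix u assume u: "u \<in> {0<..\<tau>}"
      have "cmod (exp (F u)) \<le> exp B" using FB[of u] complex_Re_le_cmod[of "F u"] by (simp add: norm_exp_eq_Re)
      then have "cmod (exp (F u) - 1) \<le> exp B + 1" using norm_triangle_ineq4[of "exp (F u)" 1] unfolding norm_one by linarith
      moreover have "\<bar>lam \<theta>0 u\<bar> \<le> Lm" using u lam_le[OF theta0, of u] lam_pos[OF theta0, of u] by auto
      ultimately show "cmod ((exp (F u) - 1) * complex_of_real (lam \<theta>0 u)) \<le> (exp B + 1) * Lm"
        unfolding norm_mult by (intro mult_mono) (auto intro: add_nonneg_nonneg)
    qed measurable
    have i2: "set_integrable lborel {0<..\<tau>} (\<lambda>u. z k * complex_of_real (lam (\<theta> k) u - lam \<theta>0 u))" if "k < m" for k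
    proof -
      have "set_integrable lborel {0<..\<tau>} (\<lambda>u. lam (\<theta> k) u - lam \<theta>0 u)"
        by (rule set_integral_diff(1)[OF lam_set_integrable[OF th[OF that]] lam_set_integrable[OF theta0]])
      then have "integrable lborel (\<lambda>u. z k * complex_of_real (indicator {0<..\<tau>} u *\<^sub>R (lam (\<theta> k) u - lam \<theta>0 u)))"
        unfolding set_integrable_def by (intro integrable_mult_right integrable_of_real)
      then show ?thesis unfolding set_integrable_def by (simp add: scaleR_conv_of_real mult.left_commute)
    qed
    have e2: "(LBINT u:{0<..\<tau>}. z k * complex_of_real (lam (\<theta> k) u - lam \<theta>0 u)) = z k * of_real (D k)" for k
    proof -
      have "(LBINT u. z k * complex_of_real (indicator {0<..\<tau>} u *\<^sub>R (lam (\<theta> k) u - lam \<theta>0 u))) = z k * of_real (D k)"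
        unfolding D_def set_lebesgue_integral_def integral_mult_right_zero integral_complex_of_real ..
      then show ?thesis unfolding set_lebesgue_integral_def by (simp add: scaleR_conv_of_real mult.left_commute)
    qed
    have i3: "set_integrable lborel {0<..\<tau>} (\<lambda>u. \<Sum>k<m. z k * complex_of_real (lam (\<theta> k) u - lam \<theta>0 u))"
      using i2 unfolding set_integrable_def scaleR_sum_right by (intro Bochner_Integration.integrable_sum) auto
    have e3: "(LBINT u:{0<..\<tau>}. (\<Sum>k<m. z k * complex_of_real (lam (\<theta> k) u - lam \<theta>0 u))) = (\<Sum>k<m. z k * of_real (D k))"
      unfolding set_lebesgue_integral_def scaleR_sum_right
      by (subst Bochner_Integration.integral_sum)
        (use i2[unfolded set_integrable_def] e2[unfolded set_lebesgue_integral_def] in \<open>simp_all only: lessThan_iff\<close>)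
    show ?thesis unfolding set_integral_diff(2)[OF i1 i3] e3 ..
  qed
  also have "\<dots> = (LBINT u:{0<..\<tau>}.
        (exp (\<Sum>k<m. z k * of_real (ln (lam (\<theta> k) u / lam \<theta>0 u))) - 1) * complex_of_real (lam \<theta>0 u)
        - (\<Sum>k<m. z k * of_real (lam (\<theta> k) u - lam \<theta>0 u)))"
    by (rule set_lebesgue_integral_cong) (auto simp: F_def lr_def)
  finally show ?goalB .
qed


lemma LR_real_transform:
  fixes z :: "nat \<Rightarrow> real"
  assumes th: "\<And>k. k < m \<Longrightarrow> \<theta> k \<in> \<Theta>"
  shows "integrable P (\<lambda>\<omega>. exp (\<Sum>k<m. z k * ln (LR (\<theta> k) \<omega>)))" (is ?goalA)
    and "(LINT \<omega>|P. exp (\<Sum>k<m. z k * ln (LR (\<theta> k) \<omega>))) =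
      exp (real n * (LBINT u:{0<..\<tau>}.
        (exp (\<Sum>k<m. z k * ln (lam (\<theta> k) u / lam \<theta>0 u)) - 1) * lam \<theta>0 u
        - (\<Sum>k<m. z k * (lam (\<theta> k) u - lam \<theta>0 u))))" (is ?goalB)
proof -
  have e: "exp (\<Sum>k<m. complex_of_real (z k) * of_real (ln (LR (\<theta> k) \<omega>))) = complex_of_real (exp (\<Sum>k<m. z k * ln (LR (\<theta> k) \<omega>)))" for \<omega>
    by (simp add: exp_of_real[symmetric])
  show ?goalA
    using LR_transform(1)[where z="\<lambda>k. complex_of_real (z k)" and m=m and \<theta>=\<theta>, OF th] unfolding e complex_of_real_integrable_eq by simp
  define G where "G u = (exp (\<Sum>k<m. z k * ln (lam (\<theta> k) u / lam \<theta>0 u)) - 1) * lam \<theta>0 u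
        - (\<Sum>k<m. z k * (lam (\<theta> k) u - lam \<theta>0 u))" for u
  have g: "(exp (\<Sum>k<m. complex_of_real (z k) * of_real (ln (lam (\<theta> k) u / lam \<theta>0 u))) - 1) * complex_of_real (lam \<theta>0 u)
        - (\<Sum>k<m. complex_of_real (z k) * of_real (lam (\<theta> k) u - lam \<theta>0 u)) = of_real (G u)" for u
    by (simp add: G_def exp_of_real[symmetric])
  have "complex_of_real (LINT \<omega>|P. exp (\<Sum>k<m. z k * ln (LR (\<theta> k) \<omega>))) = exp (of_nat n * (LBINT u:{0<..\<tau>}. complex_of_real (G u)))"
    using LR_transform(2)[where z="\<lambda>k. complex_of_real (z k)" and m=m and \<theta>=\<theta>, OF th] unfolding e g integral_complex_of_real by simp
  also have "(LBINT u:{0<..\<tau>}. complex_of_real (G u)) = of_real (LBINT u:{0<..\<tau>}. G u)"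
    by (rule set_integral_complex_of_real)
  also have "exp (of_nat n * complex_of_real (LBINT u:{0<..\<tau>}. G u)) = of_real (exp (real n * (LBINT u:{0<..\<tau>}. G u)))"
    by (simp add: exp_of_real[symmetric])
  finally show ?goalB
    unfolding of_real_eq_iff G_def .
qed

lemma sqrt_LR: "sqrt (LR \<theta> \<omega>) = exp (ln (LR \<theta> \<omega>) / 2)"
  using LR_pos[of \<theta> \<omega>] by (intro real_sqrt_unique) (simp_all add: power2_eq_square exp_add[symmetric])

lemma sqrt_ratio:
  fixes x y :: real
  assumes "0 < x" "0 < y" shows "exp (ln (x / y) / 2) = sqrt x / sqrt y"
proof -
  have "sqrt (x / y) = exp (ln (x / y) / 2)"
    using assms by (intro real_sqrt_unique) (simp_all add: power2_eq_square exp_add[symmetric])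
  then show ?thesis by (simp add: real_sqrt_divide)
qed

text \<open>With both exponents \<open>1 / 2\<close> the compensated integrand is pointwise minus
  half the squared difference of root intensities, whatever the base point. The mean of a likelihood
  ratio and that of its root are the cases \<open>\<theta>' = \<theta>\<close> and
  \<open>\<theta>' = \<theta>0\<close>.\<close>

lemma sqrt_LR_product_expectation:
  assumes th: "\<theta> \<in> \<Theta>" "\<theta>' \<in> \<Theta>"
  shows "integrable P (\<lambda>\<omega>. sqrt (LR \<theta> \<omega>) * sqrt (LR \<theta>' \<omega>))" (is ?goal)
    "(LINT \<omega>|P. sqrt (LR \<theta> \<omega>) * sqrt (LR \<theta>' \<omega>)) = exp (- real n / 2 * hellinger \<theta> \<theta>')"
proof -
  define \<eta> where "\<eta> k = (if k = 0 then \<theta> else \<theta>')" for k :: nat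
  have eta: "\<eta> k \<in> \<Theta>" for k using th by (simp add: \<eta>_def)
  have s2: "(\<Sum>k<2::nat. f k) = f 0 + f 1" for f :: "nat \<Rightarrow> real" by (simp add: numeral_2_eq_2)
  have e: "exp (\<Sum>k<2::nat. 1 / 2 * ln (LR (\<eta> k) \<omega>)) = sqrt (LR \<theta> \<omega>) * sqrt (LR \<theta>' \<omega>)" for \<omega>
    by (simp add: s2 sqrt_LR exp_add \<eta>_def)
  have "(LBINT u:{0<..\<tau>}. (exp (\<Sum>k<2::nat. 1 / 2 * ln (lam (\<eta> k) u / lam \<theta>0 u)) - 1) * lam \<theta>0 u - (\<Sum>k<2::nat. 1 / 2 * (lam (\<eta> k) u - lam \<theta>0 u)))
    = (LBINT u:{0<..\<tau>}. - (1 / 2) * (sqrt (lam \<theta> u) - sqrt (lam \<theta>' u))\<^sup>2)"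
  proof (rule set_lebesgue_integral_cong, simp, intro allI impI)
    fix u assume "u \<in> {0<..\<tau>}"
    then have u: "u \<in> {0..\<tau>}" by auto
    define x y z where "x = sqrt (lam \<theta> u)" "y = sqrt (lam \<theta>0 u)" "z = sqrt (lam \<theta>' u)"
    have xy: "lam \<theta> u = x * x" "lam \<theta>0 u = y * y" "lam \<theta>' u = z * z" "0 < x" "0 < y" "0 < z"
      using lam_pos[OF th(1) u] lam_pos[OF th(2) u] lam_pos[OF theta0 u] by (simp_all add: x_y_z_def)
    have "exp (\<Sum>k<2::nat. 1 / 2 * ln (lam (\<eta> k) u / lam \<theta>0 u)) = x / y * (z / y)"
      using sqrt_ratio[OF lam_pos[OF th(1) u] lam_pos[OF theta0 u]] sqrt_ratio[OF lam_pos[OF th(2) u] lam_pos[OF theta0 u]]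
      by (simp add: s2 exp_add \<eta>_def x_y_z_def)
    moreover have "(x / y * (z / y) - 1) * (y * y) - (1 / 2 * (x * x - y * y) + 1 / 2 * (z * z - y * y)) = - (1 / 2) * (x - z)\<^sup>2"
      using xy by (simp add: field_simps power2_eq_square)
    ultimately show "(exp (\<Sum>k<2::nat. 1 / 2 * ln (lam (\<eta> k) u / lam \<theta>0 u)) - 1) * lam \<theta>0 u - (\<Sum>k<2::nat. 1 / 2 * (lam (\<eta> k) u - lam \<theta>0 u))
      = - (1 / 2) * (sqrt (lam \<theta> u) - sqrt (lam \<theta>' u))\<^sup>2"
      using xy by (simp add: s2 \<eta>_def)
  qed
  also have "\<dots> = - (1 / 2) * hellinger \<theta> \<theta>'" unfolding hellinger_def set_integral_mult_right ..
  finally have "(LBINT u:{0<..\<tau>}. (exp (\<Sum>k<2::nat. 1 / 2 * ln (lam (\<eta> k) u / lam \<theta>0 u)) - 1) * lam \<theta>0 u - (\<Sum>k<2::nat. 1 / 2 * (lam (\<eta> k) u - lam \<theta>0 u)))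
    = - (1 / 2) * hellinger \<theta> \<theta>'" .
  then show ?goal
    "(LINT \<omega>|P. sqrt (LR \<theta> \<omega>) * sqrt (LR \<theta>' \<omega>)) = exp (- real n / 2 * hellinger \<theta> \<theta>')"
    using LR_real_transform[where m=2 and \<theta>=\<eta> and z="\<lambda>_. 1 / 2", OF eta] unfolding e by simp_all
qed

lemma LR_expectation:
  assumes th: "\<theta> \<in> \<Theta>"
  shows "integrable P (LR \<theta>)" "(LINT \<omega>|P. LR \<theta> \<omega>) = 1"
  using sqrt_LR_product_expectation[OF th th] LR_pos[of \<theta>] by (simp_all add: hellinger_def less_imp_le)

lemma nn_LR: "\<theta> \<in> \<Theta> \<Longrightarrow> (\<integral>\<^sup>+ \<omega>. ennreal (LR \<theta> \<omega>) \<partial>P) = 1"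
  using LR_expectation LR_pos by (subst nn_integral_eq_integral) (auto intro!: AE_I2 simp: less_imp_le)

lemma sqrt_LR_expectation:
  assumes th: "\<theta> \<in> \<Theta>"
  shows "integrable P (\<lambda>\<omega>. sqrt (LR \<theta> \<omega>))" "(LINT \<omega>|P. sqrt (LR \<theta> \<omega>)) = exp (- real n / 2 * hellinger \<theta> \<theta>0)"
proof -
  have "LR \<theta>0 \<omega> = 1" for \<omega> by (simp add: LR_def likelihood_def)
  then show "integrable P (\<lambda>\<omega>. sqrt (LR \<theta> \<omega>))" "(LINT \<omega>|P. sqrt (LR \<theta> \<omega>)) = exp (- real n / 2 * hellinger \<theta> \<theta>0)"
    using sqrt_LR_product_expectation[OF th theta0] by simp_all
qed

lemma nn_sqrt_LR:
  assumes th: "\<theta> \<in> \<Theta>"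
  shows "(\<integral>\<^sup>+ \<omega>. ennreal (sqrt (LR \<theta> \<omega>)) \<partial>P) = ennreal (exp (- real n / 2 * hellinger \<theta> \<theta>0))"
  using sqrt_LR_expectation[OF th] LR_pos
  by (subst nn_integral_eq_integral) (auto intro!: AE_I2 simp: less_imp_le)

text \<open>Expanding the square gives \<open>2 - 2 * exp (- x / 2)\<close> with
  \<open>x = real n * hellinger \<theta> \<theta>'\<close>, and this is at most
  \<open>x\<close>.\<close>

lemma nn_sqrt_LR_diff:
  assumes th: "\<theta> \<in> \<Theta>" "\<theta>' \<in> \<Theta>"
  shows "(\<integral>\<^sup>+ \<omega>. ennreal ((sqrt (LR \<theta> \<omega>) - sqrt (LR \<theta>' \<omega>))\<^sup>2) \<partial>P) \<le> ennreal (real n * hellinger \<theta> \<theta>')"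
proof -
  have e: "(sqrt (LR \<theta> \<omega>) - sqrt (LR \<theta>' \<omega>))\<^sup>2 = LR \<theta> \<omega> + LR \<theta>' \<omega> - 2 * (sqrt (LR \<theta> \<omega>) * sqrt (LR \<theta>' \<omega>))" for \<omega>
    using LR_pos[of \<theta> \<omega>] LR_pos[of \<theta>' \<omega>] by (simp add: power2_diff)
  have i: "integrable P (\<lambda>\<omega>. LR \<theta> \<omega> + LR \<theta>' \<omega>)" "integrable P (\<lambda>\<omega>. 2 * (sqrt (LR \<theta> \<omega>) * sqrt (LR \<theta>' \<omega>)))"
    using LR_expectation(1)[OF th(1)] LR_expectation(1)[OF th(2)] sqrt_LR_product_expectation(1)[OF th] by auto
  have "(LINT \<omega>|P. (sqrt (LR \<theta> \<omega>) - sqrt (LR \<theta>' \<omega>))\<^sup>2) = 2 - 2 * exp (- real n / 2 * hellinger \<theta> \<theta>')"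
    unfolding e Bochner_Integration.integral_diff[OF i]
    using LR_expectation[OF th(1)] LR_expectation[OF th(2)] sqrt_LR_product_expectation[OF th] by simp
  also have "\<dots> \<le> real n * hellinger \<theta> \<theta>'"
    using exp_ge_add_one_self[of "- real n / 2 * hellinger \<theta> \<theta>'"] by simp
  finally have "(LINT \<omega>|P. (sqrt (LR \<theta> \<omega>) - sqrt (LR \<theta>' \<omega>))\<^sup>2) \<le> real n * hellinger \<theta> \<theta>'" .
  moreover have "integrable P (\<lambda>\<omega>. (sqrt (LR \<theta> \<omega>) - sqrt (LR \<theta>' \<omega>))\<^sup>2)" unfolding e by (intro Bochner_Integration.integrable_diff i)
  ultimately show ?thesis by (subst nn_integral_eq_integral) (auto intro: ennreal_leI)
qed

end

section \<open>Local asymptotics of the likelihood ratios\<close>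

lemma ln_add_one_bounds:
  fixes r m :: real
  assumes m: "0 < m" "m \<le> 1" "m \<le> 1 + r"
  shows "\<bar>ln (1 + r) - r\<bar> \<le> r\<^sup>2 / m" "\<bar>ln (1 + r)\<bar> \<le> \<bar>r\<bar> / m"
proof -
  have r: "0 < 1 + r" using m by linarith
  have u: "ln (1 + r) \<le> r" using ln_le_minus_one[OF r] by simp
  have "ln (1 / (1 + r)) \<le> 1 / (1 + r) - 1" using r by (intro ln_le_minus_one) simp
  moreover have "ln (1 / (1 + r)) = - ln (1 + r)" using r by (simp add: ln_div)
  moreover have "1 / (1 + r) - 1 = - (r / (1 + r))" using r by (simp add: field_simps)
  ultimately have l: "r / (1 + r) \<le> ln (1 + r)" by linarith
  have "r - r / (1 + r) = r\<^sup>2 / (1 + r)" using r by (simp add: field_simps power2_eq_square)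
  moreover have "r\<^sup>2 / (1 + r) \<le> r\<^sup>2 / m" using m r by (intro divide_left_mono) auto
  ultimately show "\<bar>ln (1 + r) - r\<bar> \<le> r\<^sup>2 / m" using u l by linarith
  have "\<bar>r / (1 + r)\<bar> \<le> \<bar>r\<bar> / m" using m r by (simp add: abs_divide) (intro divide_left_mono, auto)
  moreover have "\<bar>r\<bar> \<le> \<bar>r\<bar> / m" using m mult_left_mono[of m 1 "\<bar>r\<bar>"] by (simp add: le_divide_eq)
  ultimately show "\<bar>ln (1 + r)\<bar> \<le> \<bar>r\<bar> / m" using u l by linarith
qed

text \<open>The value at 0 is the continuous extension, so that second-order expansions need no case
  distinction where the argument vanishes.\<close>

definition ln_remainder :: "real \<Rightarrow> real" where
  "ln_remainder x = (if x = 0 then - 1 / 2 else (ln (1 + x) - x) / x\<^sup>2)"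

lemma ln_remainder_eq: "ln (1 + x) - x = x\<^sup>2 * ln_remainder x"
  by (simp add: ln_remainder_def)

lemma ln_remainder_tendsto:
  assumes "r \<longlonglongrightarrow> 0" shows "(\<lambda>n. ln_remainder (r n)) \<longlonglongrightarrow> - 1 / 2"
proof -
  have "((\<lambda>x::real. (ln (1 + x) - x) / x\<^sup>2) \<longlongrightarrow> - 1 / 2) (at 0)" by real_asymp
  then have "(ln_remainder \<longlongrightarrow> - 1 / 2) (at 0)"
    by (rule Lim_transform_eventually) (auto simp: ln_remainder_def eventually_at_filter)
  then have "isCont ln_remainder 0" by (simp add: isCont_def ln_remainder_def)
  from isCont_tendsto_compose[OF this assms] show ?thesis by (simp add: ln_remainder_def)
qed

text \<open>The integrand of the transform after division by the base intensity; \<open>r k\<close>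
  is the relative deviation of the k-th intensity from it.\<close>

definition compensated_iexp :: "nat \<Rightarrow> (nat \<Rightarrow> real) \<Rightarrow> (nat \<Rightarrow> real) \<Rightarrow> complex" where
  "compensated_iexp m t r = iexp (\<Sum>k<m. t k * ln (1 + r k)) - 1 - \<i> * of_real (\<Sum>k<m. t k * r k)"

text \<open>Quadratic in \<open>r\<close>: the exponential is expanded to first order in the sum of
  logarithms, and the logarithms to first order in \<open>r\<close>. The lower bound
  \<open>m0\<close> on \<open>1 + r k\<close> controls both errors.\<close>

lemma compensated_iexp_bound:
  assumes m0: "0 < m0" "m0 \<le> 1" "\<And>k. k < m \<Longrightarrow> m0 \<le> 1 + r k"
  shows "cmod (compensated_iexp m t r) \<le> (\<Sum>k<m. (real m * (t k)\<^sup>2 / (2 * m0\<^sup>2) + \<bar>t k\<bar> / m0) * (r k)\<^sup>2)"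
proof -
  define y where "y = (\<Sum>k<m. t k * ln (1 + r k))"
  have e: "compensated_iexp m t r = (iexp y - (1 + \<i> * of_real y)) + \<i> * of_real (\<Sum>k<m. t k * (ln (1 + r k) - r k))"
    unfolding compensated_iexp_def y_def by (simp add: algebra_simps sum_subtractf)
  have "cmod (iexp y - (\<Sum>k\<le>1. (\<i> * y) ^ k / fact k)) \<le> \<bar>y\<bar> ^ Suc 1 / fact (Suc 1)" by (rule iexp_approx1)
  then have 1: "cmod (iexp y - (1 + \<i> * of_real y)) \<le> y\<^sup>2 / 2" by (simp add: numeral_2_eq_2[symmetric] power2_eq_square)
  have "y\<^sup>2 \<le> real m * (\<Sum>k<m. (t k * ln (1 + r k))\<^sup>2)"
    unfolding y_def using sum_squared_le_sum_of_squares[of "\<lambda>k. t k * ln (1 + r k)" "{..<m}"] by (simp add: mult.commute)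
  also have "\<dots> \<le> real m * (\<Sum>k<m. (t k)\<^sup>2 * ((r k)\<^sup>2 / m0\<^sup>2))"
  proof (intro mult_left_mono sum_mono)
    fix k assume k: "k \<in> {..<m}"
    have "\<bar>ln (1 + r k)\<bar>\<^sup>2 \<le> (\<bar>r k\<bar> / m0)\<^sup>2" using k m0 by (intro power_mono ln_add_one_bounds) auto
    then show "(t k * ln (1 + r k))\<^sup>2 \<le> (t k)\<^sup>2 * ((r k)\<^sup>2 / m0\<^sup>2)"
      unfolding power_mult_distrib by (intro mult_left_mono) (auto simp: power_divide)
  qed simp
  finally have 2: "y\<^sup>2 / 2 \<le> (\<Sum>k<m. real m * (t k)\<^sup>2 / (2 * m0\<^sup>2) * (r k)\<^sup>2)"
    by (simp add: sum_distrib_left sum_divide_distrib mult_ac)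
  have "\<bar>\<Sum>k<m. t k * (ln (1 + r k) - r k)\<bar> \<le> (\<Sum>k<m. \<bar>t k\<bar> / m0 * (r k)\<^sup>2)"
  proof (intro order_trans[OF sum_abs] sum_mono)
    fix k assume k: "k \<in> {..<m}"
    have "\<bar>ln (1 + r k) - r k\<bar> \<le> (r k)\<^sup>2 / m0" using k m0 by (intro ln_add_one_bounds) auto
    then have "\<bar>t k\<bar> * \<bar>ln (1 + r k) - r k\<bar> \<le> \<bar>t k\<bar> * ((r k)\<^sup>2 / m0)" by (intro mult_left_mono) auto
    then show "\<bar>t k * (ln (1 + r k) - r k)\<bar> \<le> \<bar>t k\<bar> / m0 * (r k)\<^sup>2" by (simp add: abs_mult)
  qed
  then have 3: "cmod (\<i> * of_real (\<Sum>k<m. t k * (ln (1 + r k) - r k))) \<le> (\<Sum>k<m. \<bar>t k\<bar> / m0 * (r k)\<^sup>2)"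
    unfolding norm_mult norm_ii norm_of_real by simp
  have "cmod (compensated_iexp m t r) \<le> (\<Sum>k<m. real m * (t k)\<^sup>2 / (2 * m0\<^sup>2) * (r k)\<^sup>2) + (\<Sum>k<m. \<bar>t k\<bar> / m0 * (r k)\<^sup>2)"
    unfolding e using 1 2 3 by (intro order_trans[OF norm_triangle_ineq] add_mono) linarith+
  then show ?thesis by (simp add: sum.distrib[symmetric] distrib_right)
qed

text \<open>A second-order Taylor expansion: the exponential contributes the square of the linear
  term, the logarithm the terms with \<open>(d k)^2\<close>. After integration these become the
  variance and the drift of the Gaussian limit.\<close>

lemma compensated_iexp_tendsto:
  fixes d t :: "nat \<Rightarrow> real" and \<rho> l :: "nat \<Rightarrow> real"
  assumes rho: "\<rho> \<longlonglongrightarrow> 0" "\<And>n. \<rho> n \<noteq> 0" and l: "l \<longlonglongrightarrow> h1" "0 < h1" "\<And>n. 0 < l n"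
  shows "(\<lambda>n. of_real (l n / (\<rho> n)\<^sup>2) * compensated_iexp m t (\<lambda>k. \<rho> n * d k / l n))
    \<longlonglongrightarrow> - of_real ((\<Sum>k<m. t k * d k)\<^sup>2 / (2 * h1)) - \<i> * of_real ((\<Sum>k<m. t k * (d k)\<^sup>2) / (2 * h1))"
proof -
  define r where "r k n = \<rho> n * d k / l n" for k n
  have h1: "h1 \<noteq> 0" using l by simp
  have r0: "r k \<longlonglongrightarrow> 0" for k
  proof -
    have "(\<lambda>n. \<rho> n * d k / l n) \<longlonglongrightarrow> 0 * d k / h1" by (intro tendsto_intros rho l h1)
    then show ?thesis by (simp add: r_def[abs_def])
  qed
  define y where "y n = (\<Sum>k<m. t k * ln (1 + r k n))" for n
  have L: "ln (1 + r k n) = r k n + (r k n)\<^sup>2 * ln_remainder (r k n)" for k n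
    using ln_remainder_eq[of "r k n"] by simp
  have "(\<lambda>n. \<Sum>k<m. t k * (d k / l n + d k / l n * r k n * ln_remainder (r k n))) \<longlonglongrightarrow> (\<Sum>k<m. t k * (d k / h1 + d k / h1 * 0 * (- 1 / 2)))"
    by (intro tendsto_intros l h1 r0 ln_remainder_tendsto)
  moreover have "(\<Sum>k<m. t k * (d k / l n + d k / l n * r k n * ln_remainder (r k n))) = y n / \<rho> n" for n
    unfolding y_def sum_divide_distrib L using rho(2)[of n]
    by (intro sum.cong refl) (simp add: r_def field_simps power2_eq_square)
  ultimately have yr: "(\<lambda>n. y n / \<rho> n) \<longlonglongrightarrow> (\<Sum>k<m. t k * d k) / h1"
    by (simp add: sum_divide_distrib)
  have y0: "y \<longlonglongrightarrow> 0"
    using tendsto_mult[OF yr rho(1)] rho(2) by simp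
  \<comment> \<open>The remainder of the exponential is of third order in \<open>y n\<close>, and
    \<open>y n\<close> is of the order of \<open>\<rho> n\<close>; it therefore vanishes after
    division by \<open>(\<rho> n)^2\<close>.\<close>
  define R where "R n = iexp (y n) - 1 - \<i> * of_real (y n) + of_real ((y n)\<^sup>2 / 2)" for n
  have "cmod (R n) \<le> \<bar>y n\<bar> ^ 3 / 6" for n
  proof -
    have "(\<Sum>k\<le>2. (\<i> * y n) ^ k / fact k) = 1 + \<i> * of_real (y n) - of_real ((y n)\<^sup>2 / 2)"
      by (simp add: numeral_2_eq_2 power_mult_distrib)
    then have "iexp (y n) - (\<Sum>k\<le>2. (\<i> * y n) ^ k / fact k) = R n" by (simp add: R_def)
    moreover have "Suc 2 = 3" by simp
    ultimately show ?thesis using iexp_approx1[of "y n" 2] by (simp add: fact_numeral)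
  qed
  then have Rb: "cmod (of_real (l n / (\<rho> n)\<^sup>2) * R n) \<le> l n * (y n / \<rho> n)\<^sup>2 * \<bar>y n\<bar> / 6" for n
  proof -
    have "cmod (of_real (l n / (\<rho> n)\<^sup>2) * R n) \<le> l n / (\<rho> n)\<^sup>2 * (\<bar>y n\<bar> ^ 3 / 6)"
      using \<open>cmod (R n) \<le> \<bar>y n\<bar> ^ 3 / 6\<close> l(3)[of n] unfolding norm_mult norm_of_real
      by (intro mult_mono) (auto simp: less_imp_le)
    also have "\<dots> = l n * (y n / \<rho> n)\<^sup>2 * \<bar>y n\<bar> / 6" by (simp add: power_divide power3_eq_cube power2_eq_square)
    finally show ?thesis .
  qed
  have "(\<lambda>n. l n * (y n / \<rho> n)\<^sup>2 * \<bar>y n\<bar> / 6) \<longlonglongrightarrow> h1 * ((\<Sum>k<m. t k * d k) / h1)\<^sup>2 * \<bar>0\<bar> / 6"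
    by (intro tendsto_intros l yr y0) simp
  then have R0: "(\<lambda>n. of_real (l n / (\<rho> n)\<^sup>2) * R n) \<longlonglongrightarrow> 0"
    by (intro Lim_null_comparison[OF always_eventually, OF allI, OF Rb]) simp
  have "(\<lambda>n. l n * (y n / \<rho> n)\<^sup>2 / 2) \<longlonglongrightarrow> h1 * ((\<Sum>k<m. t k * d k) / h1)\<^sup>2 / 2"
    by (intro tendsto_intros l yr) simp
  then have A: "(\<lambda>n. l n * (y n / \<rho> n)\<^sup>2 / 2) \<longlonglongrightarrow> (\<Sum>k<m. t k * d k)\<^sup>2 / (2 * h1)"
    using h1 by (simp add: power2_eq_square mult.commute[of h1 2])
  have "(\<lambda>n. \<Sum>k<m. t k * ((d k)\<^sup>2 / l n * ln_remainder (r k n))) \<longlonglongrightarrow> (\<Sum>k<m. t k * ((d k)\<^sup>2 / h1 * (- 1 / 2)))"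
    by (intro tendsto_intros l h1 r0 ln_remainder_tendsto)
  also have "(\<Sum>k<m. t k * ((d k)\<^sup>2 / h1 * (- 1 / 2))) = - ((\<Sum>k<m. t k * (d k)\<^sup>2) / (2 * h1))"
  proof -
    have "(\<Sum>k<m. t k * ((d k)\<^sup>2 / h1 * (- 1 / 2))) = (\<Sum>k<m. - (1 / (2 * h1)) * (t k * (d k)\<^sup>2))"
      by (intro sum.cong refl) simp
    then show ?thesis by (simp only: sum_distrib_left[symmetric]) simp
  qed
  finally have B: "(\<lambda>n. \<Sum>k<m. t k * ((d k)\<^sup>2 / l n * ln_remainder (r k n))) \<longlonglongrightarrow> - ((\<Sum>k<m. t k * (d k)\<^sup>2) / (2 * h1))" .
  have "(\<lambda>n. of_real (l n / (\<rho> n)\<^sup>2) * R n - of_real (l n * (y n / \<rho> n)\<^sup>2 / 2) + \<i> * of_real (\<Sum>k<m. t k * ((d k)\<^sup>2 / l n * ln_remainder (r k n))))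
    \<longlonglongrightarrow> 0 - of_real ((\<Sum>k<m. t k * d k)\<^sup>2 / (2 * h1)) + \<i> * of_real (- ((\<Sum>k<m. t k * (d k)\<^sup>2) / (2 * h1)))"
    by (intro tendsto_add tendsto_diff tendsto_mult tendsto_const tendsto_of_real R0 A B)
  moreover have "of_real (l n / (\<rho> n)\<^sup>2) * R n - of_real (l n * (y n / \<rho> n)\<^sup>2 / 2) + \<i> * of_real (\<Sum>k<m. t k * ((d k)\<^sup>2 / l n * ln_remainder (r k n)))
    = of_real (l n / (\<rho> n)\<^sup>2) * compensated_iexp m t (\<lambda>k. \<rho> n * d k / l n)" for n
  proof -
    have e1: "(\<Sum>k<m. t k * ((d k)\<^sup>2 / l n * ln_remainder (r k n))) = l n / (\<rho> n)\<^sup>2 * (y n - (\<Sum>k<m. t k * r k n))"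
      unfolding y_def sum_subtractf[symmetric] sum_distrib_left L using rho(2)[of n] l(3)[of n]
      by (intro sum.cong refl) (simp add: r_def field_simps power2_eq_square)
    have e2: "l n * (y n / \<rho> n)\<^sup>2 / 2 = l n / (\<rho> n)\<^sup>2 * ((y n)\<^sup>2 / 2)" by (simp add: power_divide)
    have e3: "compensated_iexp m t (\<lambda>k. \<rho> n * d k / l n) = R n - of_real ((y n)\<^sup>2 / 2) + \<i> * of_real (y n - (\<Sum>k<m. t k * r k n))"
      by (simp add: compensated_iexp_def R_def y_def r_def algebra_simps)
    have "c * R n - c * Y + \<i> * (c * S) = c * (R n - Y + \<i> * S)" for c Y S
      by (simp only: distrib_left right_diff_distrib mult.left_commute)
    then show ?thesis unfolding e1 e2 e3 by (simp only: of_real_mult)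
  qed
  ultimately show ?thesis by simp
qed


context cusp_model
begin

text \<open>Local coordinates centred at the true parameter
  \<open>\<theta>1 + \<phi> n * u0\<close>. The same map also places observation times in the change
  of variables below, so that cusp positions and times share one scale.\<close>

definition local_point :: "nat \<Rightarrow> real \<Rightarrow> real \<Rightarrow> real" where
  "local_point n u0 v = \<theta>1 + \<phi> n * u0 + \<phi> n * v"

lemma local_point_tendsto: "(\<lambda>n. local_point n u0 v) \<longlonglongrightarrow> \<theta>1"
proof -
  have "(\<lambda>n. \<theta>1 + \<phi> n * u0 + \<phi> n * v) \<longlonglongrightarrow> \<theta>1 + 0 * u0 + 0 * v" by (intro tendsto_intros rate_tendsto)
  then show ?thesis by (simp add: local_point_def)
qed

lemma eventually_local_point_mem:
  assumes "- u0 \<le> v"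
  shows "\<forall>\<^sub>F n in sequentially. local_point n u0 v \<in> \<Theta>"
proof -
  have "\<forall>\<^sub>F n in sequentially. local_point n u0 v < b"
    using order_tendstoD(2)[OF local_point_tendsto theta1(2)] .
  then show ?thesis using eventually_ge_at_top[of 1]
  proof eventually_elim
    case (elim n)
    have "0 \<le> \<phi> n * (u0 + v)" using assms rate_pos[OF elim(2)] by (intro mult_nonneg_nonneg) auto
    then show ?case using elim(1) by (simp add: local_point_def algebra_simps)
  qed
qed

text \<open>The known part \<open>h\<close> cancels and the cusp is homogeneous, so the difference
  is exactly a scale factor times a function of \<open>s\<close> and \<open>x\<close>.\<close>

lemma local_difference:
  assumes n: "1 \<le> n"
  shows "lam (local_point n u0 x) (local_point n u0 s) - lam (local_point n u0 0) (local_point n u0 s)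
    = a * \<phi> n powr \<kappa> * (\<bar>s - x\<bar> powr \<kappa> - \<bar>s\<bar> powr \<kappa>)"
proof -
  have p: "0 < \<phi> n" by (rule rate_pos[OF n])
  have "\<bar>local_point n u0 s - local_point n u0 x\<bar> = \<phi> n * \<bar>s - x\<bar>" for x
  proof -
    have "local_point n u0 s - local_point n u0 x = \<phi> n * (s - x)" by (simp add: local_point_def algebra_simps)
    then show ?thesis using p by (simp add: abs_mult)
  qed
  from this[of x] this[of 0] show ?thesis
    using p unfolding lam_diff by (simp add: powr_mult algebra_simps)
qed

lemma compensated_integrand:
  assumes u: "u \<in> {0<..\<tau>}" and th0: "\<theta> \<in> \<Theta>" and th: "\<And>k. k < m \<Longrightarrow> \<eta> k \<in> \<Theta>"
  shows "(exp (\<Sum>k<m. \<i> * of_real (t k) * of_real (ln (lam (\<eta> k) u / lam \<theta> u))) - 1) * complex_of_real (lam \<theta> u)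
      - (\<Sum>k<m. \<i> * of_real (t k) * of_real (lam (\<eta> k) u - lam \<theta> u))
    = of_real (lam \<theta> u) * compensated_iexp m t (\<lambda>k. (lam (\<eta> k) u - lam \<theta> u) / lam \<theta> u)"
proof -
  have u': "u \<in> {0..\<tau>}" using u by auto
  have p: "0 < lam \<theta> u" by (rule lam_pos[OF th0 u'])
  have 1: "1 + (lam (\<eta> k) u - lam \<theta> u) / lam \<theta> u = lam (\<eta> k) u / lam \<theta> u" for k
    using p by (simp add: field_simps)
  have 2: "(\<Sum>k<m. \<i> * of_real (t k) * of_real (ln (lam (\<eta> k) u / lam \<theta> u))) = \<i> * of_real (\<Sum>k<m. t k * ln (lam (\<eta> k) u / lam \<theta> u))"
    by (simp add: sum_distrib_left mult_ac)
  have 3: "(\<Sum>k<m. \<i> * of_real (t k) * of_real (lam (\<eta> k) u - lam \<theta> u))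
    = of_real (lam \<theta> u) * (\<i> * of_real (\<Sum>k<m. t k * ((lam (\<eta> k) u - lam \<theta> u) / lam \<theta> u)))"
  proof -
    have "lam \<theta> u * (\<Sum>k<m. t k * ((lam (\<eta> k) u - lam \<theta> u) / lam \<theta> u)) = (\<Sum>k<m. t k * (lam (\<eta> k) u - lam \<theta> u))"
      unfolding sum_distrib_left using p by (intro sum.cong refl) simp
    then have "of_real (lam \<theta> u) * (\<i> * of_real (\<Sum>k<m. t k * ((lam (\<eta> k) u - lam \<theta> u) / lam \<theta> u))) = \<i> * complex_of_real (\<Sum>k<m. t k * (lam (\<eta> k) u - lam \<theta> u))"
      by (simp only: mult.left_commute[of _ \<i>] of_real_mult[symmetric])
    then show ?thesis by (simp add: sum_distrib_left mult_ac)
  qed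
  show ?thesis unfolding compensated_iexp_def 1 2 3 by (simp only: algebra_simps mult_1_left)
qed

text \<open>The bound no longer depends on n and is integrable in \<open>s\<close> over the whole
  line, by the cusp integral; it is the dominating function for the limit of the exponents.\<close>

lemma local_integrand_bound:
  assumes n: "1 \<le> n" and u: "local_point n u0 s \<in> {0<..\<tau>}" and th0: "local_point n u0 0 \<in> \<Theta>"
    and th: "\<And>k. k < m \<Longrightarrow> local_point n u0 (x k) \<in> \<Theta>"
  defines "l \<equiv> lam (local_point n u0 0) (local_point n u0 s)" and "\<rho> \<equiv> a * \<phi> n powr \<kappa>"
    and "d \<equiv> (\<lambda>k. \<bar>s - x k\<bar> powr \<kappa> - \<bar>s\<bar> powr \<kappa>)"
  shows "cmod (of_real (l / \<rho>\<^sup>2) * compensated_iexp m t (\<lambda>k. \<rho> * d k / l))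
    \<le> (\<Sum>k<m. (real m * (t k)\<^sup>2 / (2 * (cl / Lm)\<^sup>2) + \<bar>t k\<bar> / (cl / Lm)) / cl * (d k)\<^sup>2)"
proof -
  have u': "local_point n u0 s \<in> {0..\<tau>}" using u by auto
  have l: "cl \<le> l" unfolding l_def by (rule sep[OF th0 u'])
  then have lp: "0 < l" using cl_pos by linarith
  have rho: "\<rho> \<noteq> 0" using a rate_pos[OF n] by (simp add: \<rho>_def)
  define c where "c k = real m * (t k)\<^sup>2 / (2 * (cl / Lm)\<^sup>2) + \<bar>t k\<bar> / (cl / Lm)" for k
  have c: "0 \<le> c k" for k using cl_pos Lm_pos by (simp add: c_def)
  have "cl / Lm \<le> 1 + \<rho> * d k / l" if k: "k < m" for k
  proof -
    have "1 + \<rho> * d k / l = lam (local_point n u0 (x k)) (local_point n u0 s) / l"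
      using local_difference[OF n, of u0 "x k" s] lp unfolding \<rho>_def d_def l_def by (simp add: field_simps)
    then show ?thesis using lam_ratio(1)[OF th[OF k] th0 u'] unfolding l_def by simp
  qed
  then have "cmod (compensated_iexp m t (\<lambda>k. \<rho> * d k / l)) \<le> (\<Sum>k<m. c k * (\<rho> * d k / l)\<^sup>2)"
    unfolding c_def using cl_pos Lm_pos cl_le_Lm by (intro compensated_iexp_bound) auto
  then have "cmod (of_real (l / \<rho>\<^sup>2) * compensated_iexp m t (\<lambda>k. \<rho> * d k / l)) \<le> l / \<rho>\<^sup>2 * (\<Sum>k<m. c k * (\<rho> * d k / l)\<^sup>2)"
    unfolding norm_mult norm_of_real using lp by (intro mult_mono) auto
  also have "\<dots> = (\<Sum>k<m. c k / l * (d k)\<^sup>2)"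
    unfolding sum_distrib_left using lp rho by (intro sum.cong refl) (simp add: field_simps power2_eq_square)
  also have "\<dots> \<le> (\<Sum>k<m. c k / cl * (d k)\<^sup>2)"
    using l lp cl_pos c by (intro sum_mono mult_right_mono divide_left_mono) auto
  finally show ?thesis unfolding c_def .
qed


text \<open>A fixed local time shrinks to \<open>\<theta>1\<close>, so the base intensity there
  tends to \<open>h \<theta>1\<close>. This is where continuity of \<open>h\<close> at that point
  enters.\<close>

lemma local_integrand_tendsto:
  fixes x :: "nat \<Rightarrow> real" and u0 :: real
  defines "l \<equiv> \<lambda>n s. lam (local_point n u0 0) (local_point n u0 s)" and "\<rho> \<equiv> \<lambda>n. a * \<phi> n powr \<kappa>"
    and "d \<equiv> \<lambda>s k. \<bar>s - x k\<bar> powr \<kappa> - \<bar>s\<bar> powr \<kappa>"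
  assumes u0: "0 \<le> u0" and \<nu>: "filterlim \<nu> at_top sequentially" "\<And>n. 1 \<le> \<nu> n"
    and th0: "\<And>n. local_point (\<nu> n) u0 0 \<in> \<Theta>"
  shows "(\<lambda>n. indicator {0<..\<tau>} (local_point (\<nu> n) u0 s) *\<^sub>R
      (of_real (l (\<nu> n) s / (\<rho> (\<nu> n))\<^sup>2) * compensated_iexp m t (\<lambda>k. \<rho> (\<nu> n) * d s k / l (\<nu> n) s)))
    \<longlonglongrightarrow> - of_real ((\<Sum>k<m. t k * d s k)\<^sup>2 / (2 * h \<theta>1)) - \<i> * of_real ((\<Sum>k<m. t k * (d s k)\<^sup>2) / (2 * h \<theta>1))"
proof -
  have lp: "(\<lambda>n. local_point (\<nu> n) u0 v) \<longlonglongrightarrow> \<theta>1" for v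
    using filterlim_compose[OF local_point_tendsto \<nu>(1)] .
  have in_J: "\<forall>\<^sub>F n in sequentially. local_point (\<nu> n) u0 s \<in> {0<..\<tau>}"
  proof -
    have "\<forall>\<^sub>F n in sequentially. 0 < local_point (\<nu> n) u0 s" "\<forall>\<^sub>F n in sequentially. local_point (\<nu> n) u0 s < b"
      using order_tendstoD[OF lp] theta1 by auto
    then show ?thesis by eventually_elim (use b_le in auto)
  qed
  have phi0: "(\<lambda>n. \<phi> (\<nu> n)) \<longlonglongrightarrow> 0" using filterlim_compose[OF rate_tendsto \<nu>(1)] .
  have l_lim: "(\<lambda>n. l (\<nu> n) s) \<longlonglongrightarrow> h \<theta>1"
  proof -
    have "(\<lambda>n. h (local_point (\<nu> n) u0 s)) \<longlonglongrightarrow> h \<theta>1" by (rule isCont_tendsto_compose[OF h_cont lp])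
    moreover have "(\<lambda>n. \<bar>local_point (\<nu> n) u0 s - local_point (\<nu> n) u0 0\<bar> powr \<kappa>) \<longlonglongrightarrow> 0"
    proof -
      have "(\<lambda>n. \<bar>local_point (\<nu> n) u0 s - local_point (\<nu> n) u0 0\<bar>) \<longlonglongrightarrow> \<bar>\<theta>1 - \<theta>1\<bar>" by (intro tendsto_intros lp)
      then have "(\<lambda>n. \<bar>local_point (\<nu> n) u0 s - local_point (\<nu> n) u0 0\<bar>) \<longlonglongrightarrow> 0" by simp
      from tendsto_powr'[OF this tendsto_const[of \<kappa>]] kp show ?thesis by simp
    qed
    ultimately have "(\<lambda>n. a * \<bar>local_point (\<nu> n) u0 s - local_point (\<nu> n) u0 0\<bar> powr \<kappa> + h (local_point (\<nu> n) u0 s)) \<longlonglongrightarrow> a * 0 + h \<theta>1"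
      by (intro tendsto_intros)
    then show ?thesis by (simp add: l_def cusp_intensity_def)
  qed
  \<comment> \<open>Outside the window positivity of the intensity is not known. Replacing the
    finitely many such terms makes the expansion applicable for every n.\<close>
  define l' where "l' n = (if local_point (\<nu> n) u0 s \<in> {0<..\<tau>} then l (\<nu> n) s else h \<theta>1)" for n
  have l'_lim: "l' \<longlonglongrightarrow> h \<theta>1"
    by (rule Lim_transform_eventually[OF l_lim]) (use in_J in \<open>eventually_elim, simp add: l'_def\<close>)
  have rho0: "(\<lambda>n. \<rho> (\<nu> n)) \<longlonglongrightarrow> 0"
  proof -
    have "(\<lambda>n. \<phi> (\<nu> n) powr \<kappa>) \<longlonglongrightarrow> 0"
      using tendsto_powr'[OF phi0 tendsto_const[of \<kappa>]] kp rate_pos[OF \<nu>(2)] by (simp add: less_imp_le)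
    from tendsto_mult[OF tendsto_const[of a] this] show ?thesis by (simp add: \<rho>_def)
  qed
  have "(\<lambda>n. of_real (l' n / (\<rho> (\<nu> n))\<^sup>2) * compensated_iexp m t (\<lambda>k. \<rho> (\<nu> n) * d s k / l' n))
    \<longlonglongrightarrow> - of_real ((\<Sum>k<m. t k * d s k)\<^sup>2 / (2 * h \<theta>1)) - \<i> * of_real ((\<Sum>k<m. t k * (d s k)\<^sup>2) / (2 * h \<theta>1))"
  proof (rule compensated_iexp_tendsto[OF rho0 _ l'_lim])
    show "\<rho> (\<nu> n) \<noteq> 0" for n using a rate_pos[OF \<nu>(2)[of n]] by (simp add: \<rho>_def)
    show "0 < h \<theta>1" by (rule h_pos[OF theta1_mem])
    show "0 < l' n" for n
      using h_pos[OF theta1_mem] lam_pos[OF th0[of n], of "local_point (\<nu> n) u0 s"] by (auto simp: l'_def l_def)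
  qed
  then show ?thesis
    by (rule Lim_transform_eventually) (use in_J in \<open>eventually_elim, simp add: l'_def\<close>)
qed

lemma local_square_integral:
  fixes x t :: "nat \<Rightarrow> real"
  defines "d \<equiv> \<lambda>s k. \<bar>s - x k\<bar> powr \<kappa> - \<bar>s\<bar> powr \<kappa>" and "\<gamma> \<equiv> \<lambda>v w. (\<bar>v\<bar> powr (2 * \<kappa> + 1) + \<bar>w\<bar> powr (2 * \<kappa> + 1) - \<bar>v - w\<bar> powr (2 * \<kappa> + 1)) / 2"
  shows "integrable lborel (\<lambda>s. (d s k)\<^sup>2)" "(LBINT s. (d s k)\<^sup>2) = cusp_const \<kappa> * \<bar>x k\<bar> powr (2 * \<kappa> + 1)" (is ?goalA)
    and "integrable lborel (\<lambda>s. (\<Sum>k<m. t k * d s k)\<^sup>2)" (is ?goalB)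
    and "(LBINT s. (\<Sum>k<m. t k * d s k)\<^sup>2) = cusp_const \<kappa> * (\<Sum>k<m. \<Sum>j<m. t k * t j * \<gamma> (x k) (x j))" (is ?goalC)
proof -
  have i: "integrable lborel (\<lambda>s. d s k * d s j)" for k j
    unfolding d_def by (rule cusp_cross_integrable[OF kp kh])
  have v: "(LBINT s. d s k * d s j) = \<gamma> (x k) (x j) * cusp_const \<kappa>" for k j
    unfolding d_def \<gamma>_def by (rule cusp_cross_integral[OF kp kh])
  show "integrable lborel (\<lambda>s. (d s k)\<^sup>2)" using i[of k k] by (simp add: power2_eq_square)
  show ?goalA
    using v[of k k] by (simp add: power2_eq_square \<gamma>_def)
  have e: "(\<Sum>k<m. t k * d s k)\<^sup>2 = (\<Sum>k<m. \<Sum>j<m. t k * t j * (d s k * d s j))" for s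
    by (simp add: power2_eq_square sum_product mult_ac)
  show ?goalB
    unfolding e by (intro Bochner_Integration.integrable_sum integrable_mult_right i)
  have "(LBINT s. (\<Sum>k<m. t k * d s k)\<^sup>2) = (\<Sum>k<m. \<Sum>j<m. t k * t j * (\<gamma> (x k) (x j) * cusp_const \<kappa>))"
    unfolding e by (simp add: Bochner_Integration.integral_sum Bochner_Integration.integrable_sum i v)
  then show ?goalC
    by (simp add: sum_distrib_left mult_ac)
qed

text \<open>After the substitution \<open>u = \<theta> + \<phi> N * s\<close> the domain exhausts
  the line. The prefactor \<open>real N * \<phi> N * (\<rho> N)^2\<close> is the constant
  \<open>h \<theta>1 / cusp_const \<kappa>\<close> by the choice of the rate, and it cancels the
  constants of the limit. The index map \<open>\<nu>\<close> allows initial terms to be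
  skipped.\<close>

lemma lan_exponent:
  fixes x t :: "nat \<Rightarrow> real"
  defines "\<gamma> \<equiv> \<lambda>v w. (\<bar>v\<bar> powr (2 * \<kappa> + 1) + \<bar>w\<bar> powr (2 * \<kappa> + 1) - \<bar>v - w\<bar> powr (2 * \<kappa> + 1)) / 2"
  assumes u0: "0 \<le> u0" and \<nu>: "filterlim \<nu> at_top sequentially" "\<And>n. 1 \<le> \<nu> n"
    and th0: "\<And>n. local_point (\<nu> n) u0 0 \<in> \<Theta>" and th: "\<And>n k. k < m \<Longrightarrow> local_point (\<nu> n) u0 (x k) \<in> \<Theta>"
  shows "(\<lambda>n. of_nat (\<nu> n) * (LBINT u:{0<..\<tau>}.
        (exp (\<Sum>k<m. \<i> * of_real (t k) * of_real (ln (lam (local_point (\<nu> n) u0 (x k)) u / lam (local_point (\<nu> n) u0 0) u))) - 1)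
          * complex_of_real (lam (local_point (\<nu> n) u0 0) u)
        - (\<Sum>k<m. \<i> * of_real (t k) * of_real (lam (local_point (\<nu> n) u0 (x k)) u - lam (local_point (\<nu> n) u0 0) u))))
    \<longlonglongrightarrow> - of_real ((\<Sum>k<m. \<Sum>j<m. t k * t j * \<gamma> (x k) (x j)) / 2) - \<i> * of_real ((\<Sum>k<m. t k * \<bar>x k\<bar> powr (2 * \<kappa> + 1)) / 2)"
proof -
  define \<rho> where "\<rho> n = a * \<phi> n powr \<kappa>" for n
  define d where "d s k = \<bar>s - x k\<bar> powr \<kappa> - \<bar>s\<bar> powr \<kappa>" for s k
  define l where "l n s = lam (local_point n u0 0) (local_point n u0 s)" for n s
  define cc where "cc = cusp_const \<kappa>"
  define h1 where "h1 = h \<theta>1"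
  have cc: "0 < cc" unfolding cc_def by (rule cusp_const_pos[OF kp kh])
  have h1: "0 < h1" unfolding h1_def by (rule h_pos[OF theta1_mem])
  define F where "F n s = indicator {0<..\<tau>} (local_point (\<nu> n) u0 s) *\<^sub>R
      (of_real (l (\<nu> n) s / (\<rho> (\<nu> n))\<^sup>2) * compensated_iexp m t (\<lambda>k. \<rho> (\<nu> n) * d s k / l (\<nu> n) s))" for n s
  define L where "L s = - complex_of_real ((\<Sum>k<m. t k * d s k)\<^sup>2 / (2 * h1)) - \<i> * of_real ((\<Sum>k<m. t k * (d s k)\<^sup>2) / (2 * h1))" for s
  have F_lim: "(\<lambda>n. F n s) \<longlonglongrightarrow> L s" for s
    unfolding F_def L_def l_def \<rho>_def d_def h1_def by (rule local_integrand_tendsto[OF u0 \<nu> th0])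
  define c where "c k = (real m * (t k)\<^sup>2 / (2 * (cl / Lm)\<^sup>2) + \<bar>t k\<bar> / (cl / Lm)) / cl" for k
  have c: "0 \<le> c k" for k using cl_pos Lm_pos by (simp add: c_def)
  have F_bound: "cmod (F n s) \<le> (\<Sum>k<m. c k * (d s k)\<^sup>2)" for n s
  proof (cases "local_point (\<nu> n) u0 s \<in> {0<..\<tau>}")
    case True
    then show ?thesis using local_integrand_bound[OF \<nu>(2) True th0 th] by (simp add: F_def c_def d_def l_def \<rho>_def)
  next
    case False
    then show ?thesis using c by (auto simp: F_def intro!: sum_nonneg)
  qed
  have [measurable]: "(\<lambda>s. d s k) \<in> borel_measurable borel" for k unfolding d_def by measurable
  have [measurable]: "l n \<in> borel_measurable borel" for n
    unfolding l_def[abs_def] local_point_def cusp_intensity_def by measurable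
  have Fm: "F n \<in> borel_measurable lborel" for n
    unfolding F_def[abs_def] compensated_iexp_def local_point_def by measurable
  have Lm: "L \<in> borel_measurable lborel" unfolding L_def[abs_def] by measurable
  have "(\<lambda>n. LBINT s. F n s) \<longlonglongrightarrow> (LBINT s. L s)"
  proof (rule integral_dominated_convergence[where w="\<lambda>s. \<Sum>k<m. c k * (d s k)\<^sup>2"])
    show "integrable lborel (\<lambda>s. \<Sum>k<m. c k * (d s k)\<^sup>2)"
      unfolding d_def by (intro Bochner_Integration.integrable_sum integrable_mult_right local_square_integral(1))
  qed (use Fm Lm F_lim F_bound in auto)
  then have "(\<lambda>n. of_real (h1 / cc) * (LBINT s. F n s)) \<longlonglongrightarrow> of_real (h1 / cc) * (LBINT s. L s)"
    by (intro tendsto_mult tendsto_const)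
  moreover have "of_real (h1 / cc) * (LBINT s. L s)
    = - of_real ((\<Sum>k<m. \<Sum>j<m. t k * t j * \<gamma> (x k) (x j)) / 2) - \<i> * of_real ((\<Sum>k<m. t k * \<bar>x k\<bar> powr (2 * \<kappa> + 1)) / 2)"
  proof -
    have i1: "integrable lborel (\<lambda>s. (\<Sum>k<m. t k * d s k)\<^sup>2 / (2 * h1))"
      unfolding d_def by (intro integrable_divide local_square_integral(3))
    have i2: "integrable lborel (\<lambda>s. (\<Sum>k<m. t k * (d s k)\<^sup>2) / (2 * h1))"
      unfolding d_def by (intro integrable_divide Bochner_Integration.integrable_sum integrable_mult_right local_square_integral(1))
    have v1: "(LBINT s. (\<Sum>k<m. t k * d s k)\<^sup>2 / (2 * h1)) = cc * (\<Sum>k<m. \<Sum>j<m. t k * t j * \<gamma> (x k) (x j)) / (2 * h1)"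
      unfolding integral_divide_zero d_def local_square_integral(4) cc_def \<gamma>_def ..
    have v2: "(LBINT s. (\<Sum>k<m. t k * (d s k)\<^sup>2) / (2 * h1)) = cc * (\<Sum>k<m. t k * \<bar>x k\<bar> powr (2 * \<kappa> + 1)) / (2 * h1)"
    proof -
      have "(LBINT s. (\<Sum>k<m. t k * (d s k)\<^sup>2)) = (\<Sum>k<m. LBINT s. t k * (d s k)\<^sup>2)"
        unfolding d_def by (intro Bochner_Integration.integral_sum integrable_mult_right local_square_integral(1))
      also have "\<dots> = (\<Sum>k<m. cc * (t k * \<bar>x k\<bar> powr (2 * \<kappa> + 1)))"
        unfolding d_def integral_mult_right_zero local_square_integral(2) cc_def by (simp only: mult.left_commute)
      finally show ?thesis unfolding integral_divide_zero sum_distrib_left by simp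
    qed
    have "(LBINT s. L s) = - of_real (LBINT s. (\<Sum>k<m. t k * d s k)\<^sup>2 / (2 * h1)) - \<i> * of_real (LBINT s. (\<Sum>k<m. t k * (d s k)\<^sup>2) / (2 * h1))"
    proof -
      have j1: "integrable lborel (\<lambda>s. - complex_of_real ((\<Sum>k<m. t k * d s k)\<^sup>2 / (2 * h1)))"
        by (intro Bochner_Integration.integrable_minus integrable_of_real i1)
      have j2: "integrable lborel (\<lambda>s. \<i> * complex_of_real ((\<Sum>k<m. t k * (d s k)\<^sup>2) / (2 * h1)))"
        by (intro integrable_mult_right integrable_of_real i2)
      show ?thesis
        unfolding L_def Bochner_Integration.integral_diff[OF j1 j2] Bochner_Integration.integral_minus integral_mult_right_zero
          integral_complex_of_real ..
    qed
    then show ?thesis using cc h1 unfolding v1 v2 by (simp add: field_simps del: of_real_sum)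
  qed
  moreover have "of_real (h1 / cc) * (LBINT s. F n s) = of_nat (\<nu> n) * (LBINT u:{0<..\<tau>}.
        (exp (\<Sum>k<m. \<i> * of_real (t k) * of_real (ln (lam (local_point (\<nu> n) u0 (x k)) u / lam (local_point (\<nu> n) u0 0) u))) - 1)
          * complex_of_real (lam (local_point (\<nu> n) u0 0) u)
        - (\<Sum>k<m. \<i> * of_real (t k) * of_real (lam (local_point (\<nu> n) u0 (x k)) u - lam (local_point (\<nu> n) u0 0) u)))" for n
  proof -
    define N where "N = \<nu> n"
    define \<theta> where "\<theta> = local_point N u0 0"
    define g where "g u = indicator {0<..\<tau>} u *\<^sub>R (of_real (lam \<theta> u) * compensated_iexp m t (\<lambda>k. (lam (local_point N u0 (x k)) u - lam \<theta> u) / lam \<theta> u))" for u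
    have N: "1 \<le> N" unfolding N_def by (rule \<nu>(2))
    have p: "0 < \<phi> N" by (rule rate_pos[OF N])
    have "(LBINT u:{0<..\<tau>}.
        (exp (\<Sum>k<m. \<i> * of_real (t k) * of_real (ln (lam (local_point N u0 (x k)) u / lam \<theta> u))) - 1)
          * complex_of_real (lam \<theta> u)
        - (\<Sum>k<m. \<i> * of_real (t k) * of_real (lam (local_point N u0 (x k)) u - lam \<theta> u)))
      = (LBINT u:{0<..\<tau>}. of_real (lam \<theta> u) * compensated_iexp m t (\<lambda>k. (lam (local_point N u0 (x k)) u - lam \<theta> u) / lam \<theta> u))"
    proof (rule set_lebesgue_integral_cong, simp, intro allI impI)
      fix u assume u: "u \<in> {0<..\<tau>}"
      show "(exp (\<Sum>k<m. \<i> * of_real (t k) * of_real (ln (lam (local_point N u0 (x k)) u / lam \<theta> u))) - 1)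
          * complex_of_real (lam \<theta> u)
        - (\<Sum>k<m. \<i> * of_real (t k) * of_real (lam (local_point N u0 (x k)) u - lam \<theta> u))
       = of_real (lam \<theta> u) * compensated_iexp m t (\<lambda>k. (lam (local_point N u0 (x k)) u - lam \<theta> u) / lam \<theta> u)"
        by (rule compensated_integrand[OF u]) (use th0 th in \<open>auto simp: \<theta>_def N_def\<close>)
    qed
    also have "\<dots> = (LBINT u. g u)" unfolding set_lebesgue_integral_def g_def ..
    also have "\<dots> = \<bar>\<phi> N\<bar> *\<^sub>R (LBINT s. g (\<theta> + \<phi> N * s))"
      using p by (intro lborel_integral_real_affine) simp
    finally have I: "(LBINT u:{0<..\<tau>}.
        (exp (\<Sum>k<m. \<i> * of_real (t k) * of_real (ln (lam (local_point N u0 (x k)) u / lam \<theta> u))) - 1)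
          * complex_of_real (lam \<theta> u)
        - (\<Sum>k<m. \<i> * of_real (t k) * of_real (lam (local_point N u0 (x k)) u - lam \<theta> u)))
      = of_real (\<phi> N) * (LBINT s. g (\<theta> + \<phi> N * s))" using p by (simp add: scaleR_conv_of_real)
    have ap: "\<theta> + \<phi> N * s = local_point N u0 s" for s by (simp add: \<theta>_def local_point_def)
    have rho: "\<rho> N \<noteq> 0" using a p by (simp add: \<rho>_def)
    have gF: "g (\<theta> + \<phi> N * s) = of_real ((\<rho> N)\<^sup>2) * F n s" for s
    proof -
      have "lam (local_point N u0 (x k)) (local_point N u0 s) - lam \<theta> (local_point N u0 s) = \<rho> N * d s k" for k
        unfolding \<theta>_def \<rho>_def d_def by (rule local_difference[OF N])
      then show ?thesis
        unfolding g_def ap F_def N_def[symmetric] using rho by (simp add: l_def \<theta>_def scaleR_conv_of_real)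
    qed
    have "real N * \<phi> N * (\<rho> N)\<^sup>2 = real N * \<phi> N powr (2 * \<kappa> + 1) * a\<^sup>2"
    proof -
      have "(\<phi> N powr \<kappa>)\<^sup>2 = \<phi> N powr (2 * \<kappa>)" using powr_add[of "\<phi> N" \<kappa> \<kappa>] by (simp add: power2_eq_square)
      then show ?thesis using p by (simp add: \<rho>_def power_mult_distrib powr_add)
    qed
    moreover have "real N * \<phi> N powr (2 * \<kappa> + 1) * a\<^sup>2 = h1 / cc"
      using rate_scale[OF N] cc unfolding h1_def[symmetric] cc_def[symmetric] by (simp add: field_simps)
    ultimately have "h1 / cc = real N * \<phi> N * (\<rho> N)\<^sup>2" by simp
    then show ?thesis
      unfolding N_def[symmetric] \<theta>_def[symmetric] I gF integral_mult_right_zero by simp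
  qed
  ultimately show ?thesis by simp
qed


text \<open>\<open>Y\<close> is prescribed only where the local point lies in
  \<open>\<Theta>\<close>, which leaves room for a measurable extension elsewhere. Both
  characteristic functions are explicit: normal with the covariance of fractional Brownian motion
  and drift minus half the variance.\<close>

theorem likelihood_ratio_fdd_conv:
  fixes x t :: "nat \<Rightarrow> real" and P :: "nat \<Rightarrow> 'a measure" and N :: "'b measure"
  assumes u0: "0 \<le> u0" and \<nu>: "filterlim \<nu> at_top sequentially" "\<And>n. 1 \<le> \<nu> n"
    and sample: "\<And>n. cusp_sample \<tau> \<theta>1 b \<kappa> a h cl hm (\<nu> n) (local_point (\<nu> n) u0 0) (P n) X"
    and fbm: "fbm N H W" and H: "H = \<kappa> + 1 / 2" and x: "\<And>k. - u0 \<le> x k"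
    and Y: "\<And>n v \<omega>. local_point (\<nu> n) u0 v \<in> \<Theta> \<Longrightarrow> Y n v \<omega> =
      likelihood \<tau> (\<nu> n) (lam (local_point (\<nu> n) u0 v)) (\<lambda>j\<in>{..<\<nu> n}. X j \<omega>)
      / likelihood \<tau> (\<nu> n) (lam (local_point (\<nu> n) u0 0)) (\<lambda>j\<in>{..<\<nu> n}. X j \<omega>)"
  shows "(\<lambda>n. LINT \<omega>|P n. iexp (\<Sum>i<m. t i * ln (Y n (x i) \<omega>)))
    \<longlonglongrightarrow> (LINT \<omega>|N. iexp (\<Sum>i<m. t i * ln (limit_likelihood H W (x i) \<omega>)))"
proof -
  interpret F: fbm N H W by (rule fbm)
  have ev: "\<forall>\<^sub>F n in sequentially. \<forall>k<m. local_point (\<nu> n) u0 (x k) \<in> \<Theta>"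
  proof -
    have "\<forall>\<^sub>F n in sequentially. local_point (\<nu> n) u0 (x k) \<in> \<Theta>" for k
      using \<nu>(1) eventually_local_point_mem[OF x[of k]] unfolding filterlim_iff by blast
    then have "\<forall>\<^sub>F n in sequentially. \<forall>k\<in>{..<m}. local_point (\<nu> n) u0 (x k) \<in> \<Theta>" by (intro eventually_ball_finite) auto
    then show ?thesis by (simp add: Ball_def)
  qed
  \<comment> \<open>Finitely many points are eventually all inside \<open>\<Theta>\<close>; the
    sequence is started there, and the offset is removed at the end.\<close>
  then obtain n0 where n0: "\<And>n k. n0 \<le> n \<Longrightarrow> k < m \<Longrightarrow> local_point (\<nu> n) u0 (x k) \<in> \<Theta>"
    unfolding eventually_sequentially by blast
  define \<mu> where "\<mu> n = \<nu> (n + n0)" for n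
  have \<mu>: "filterlim \<mu> at_top sequentially" "\<And>n. 1 \<le> \<mu> n"
    unfolding \<mu>_def[abs_def] using filterlim_compose[OF \<nu>(1) filterlim_add_const_nat_at_top] \<nu>(2) by auto
  have S: "cusp_sample \<tau> \<theta>1 b \<kappa> a h cl hm (\<mu> n) (local_point (\<mu> n) u0 0) (P (n + n0)) X" for n
    unfolding \<mu>_def by (rule sample)
  have th0: "local_point (\<mu> n) u0 0 \<in> \<Theta>" for n using cusp_sample.theta0[OF S[of n]] .
  have th: "local_point (\<mu> n) u0 (x k) \<in> \<Theta>" if "k < m" for n k unfolding \<mu>_def using n0 that by simp
  define \<gamma> where "\<gamma> v w = (\<bar>v\<bar> powr (2 * \<kappa> + 1) + \<bar>w\<bar> powr (2 * \<kappa> + 1) - \<bar>v - w\<bar> powr (2 * \<kappa> + 1)) / 2" for v w :: real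
  define I where "I n = of_nat (\<mu> n) * (LBINT u:{0<..\<tau>}.
        (exp (\<Sum>k<m. \<i> * of_real (t k) * of_real (ln (lam (local_point (\<mu> n) u0 (x k)) u / lam (local_point (\<mu> n) u0 0) u))) - 1)
          * complex_of_real (lam (local_point (\<mu> n) u0 0) u)
        - (\<Sum>k<m. \<i> * of_real (t k) * of_real (lam (local_point (\<mu> n) u0 (x k)) u - lam (local_point (\<mu> n) u0 0) u)))" for n
  have "(LINT \<omega>|P (n + n0). iexp (\<Sum>i<m. t i * ln (Y (n + n0) (x i) \<omega>))) = exp (I n)" for n
  proof -
    interpret C: cusp_sample \<tau> \<theta>1 b \<kappa> a h cl hm "\<mu> n" "local_point (\<mu> n) u0 0" "P (n + n0)" X by (rule S)
    have Yn: "Y (n + n0) (x k) \<omega> = C.LR (local_point (\<mu> n) u0 (x k)) \<omega>" if "k < m" for k \<omega>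
      unfolding C.LR_def C.obs_def using Y[of "n + n0" "x k" \<omega>, folded \<mu>_def] th[OF that, of n] by blast
    have "iexp (\<Sum>i<m. t i * ln (Y (n + n0) (x i) \<omega>)) = exp (\<Sum>k<m. \<i> * of_real (t k) * of_real (ln (C.LR (local_point (\<mu> n) u0 (x k)) \<omega>)))" for \<omega>
    proof -
      have "\<i> * of_real (\<Sum>i<m. t i * ln (Y (n + n0) (x i) \<omega>)) = (\<Sum>k<m. \<i> * of_real (t k) * of_real (ln (C.LR (local_point (\<mu> n) u0 (x k)) \<omega>)))"
        unfolding of_real_sum sum_distrib_left by (intro sum.cong refl) (simp add: Yn)
      then show ?thesis by simp
    qed
    then show ?thesis unfolding I_def
      using C.LR_transform(2)[where m=m and z="\<lambda>k. \<i> * of_real (t k)" and \<theta>="\<lambda>k. local_point (\<mu> n) u0 (x k)", OF th]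
      by presburger
  qed
  moreover have "(\<lambda>n. exp (I n)) \<longlonglongrightarrow> exp (- of_real ((\<Sum>k<m. \<Sum>j<m. t k * t j * \<gamma> (x k) (x j)) / 2) - \<i> * of_real ((\<Sum>k<m. t k * \<bar>x k\<bar> powr (2 * \<kappa> + 1)) / 2))"
    unfolding I_def \<gamma>_def by (intro tendsto_exp lan_exponent[OF u0 \<mu> th0 th])
  moreover have "(LINT \<omega>|N. iexp (\<Sum>i<m. t i * ln (limit_likelihood H W (x i) \<omega>)))
    = exp (- of_real ((\<Sum>k<m. \<Sum>j<m. t k * t j * \<gamma> (x k) (x j)) / 2) - \<i> * of_real ((\<Sum>k<m. t k * \<bar>x k\<bar> powr (2 * \<kappa> + 1)) / 2))"
  proof -
    define A where "A = (\<Sum>k<m. t k * \<bar>x k\<bar> powr (2 * \<kappa> + 1)) / 2"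
    define Q where "Q = (\<Sum>k<m. \<Sum>j<m. t k * t j * \<gamma> (x k) (x j)) / 2"
    have H2: "2 * H = 2 * \<kappa> + 1" by (simp add: H)
    have "(\<Sum>i<m. t i * ln (limit_likelihood H W (x i) \<omega>)) = (\<Sum>i<m. t i * W (x i) \<omega>) - A" for \<omega>
      unfolding limit_likelihood_def ln_exp A_def sum_divide_distrib sum_subtractf[symmetric] H2
      by (intro sum.cong refl) (simp add: right_diff_distrib)
    then have e: "iexp (\<Sum>i<m. t i * ln (limit_likelihood H W (x i) \<omega>)) = iexp (\<Sum>i<m. t i * W (x i) \<omega>) * exp (- (\<i> * of_real A))" for \<omega>
      by (simp only: of_real_diff right_diff_distrib exp_diff exp_minus divide_inverse)
    have K: "F.K u v = \<gamma> u v" for u v by (simp add: F.K_def \<gamma>_def H2)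
    have "- (\<Sum>i<m. \<Sum>j<m. t i * t j * F.K (x i) (x j)) / 2 = - Q" by (simp add: Q_def K)
    then have "(LINT \<omega>|N. iexp (\<Sum>i<m. t i * W (x i) \<omega>)) = of_real (exp (- Q))"
      using F.sum_iexp[where m=m and t=t and x=x] by simp
    then show ?thesis
      unfolding e integral_mult_left_zero A_def[symmetric] Q_def[symmetric]
      by (simp only: exp_of_real[symmetric] of_real_minus exp_diff exp_minus divide_inverse of_real_inverse)
  qed
  ultimately have "(\<lambda>n. LINT \<omega>|P (n + n0). iexp (\<Sum>i<m. t i * ln (Y (n + n0) (x i) \<omega>)))
    \<longlonglongrightarrow> (LINT \<omega>|N. iexp (\<Sum>i<m. t i * ln (limit_likelihood H W (x i) \<omega>)))" by presburger
  then show ?thesis by (rule LIMSEQ_offset)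
qed

end

section \<open>The Bayes test\<close>

locale cusp_prior = cusp_model +
  fixes p :: "real \<Rightarrow> real"
  assumes p_cont: "continuous_on {\<theta>1..<b} p" and p_pos: "\<And>\<theta>. \<theta> \<in> {\<theta>1..<b} \<Longrightarrow> 0 < p \<theta>"
    and p_prob: "(LBINT \<theta>:{\<theta>1..<b}. p \<theta>) = 1"
begin

text \<open>Sends parameters outside \<open>\<Theta>\<close> to \<open>\<theta>1\<close>, so that
  likelihoods are bounded and measurable on the whole line. Posterior integrals are unaffected,
  because the prior is extended by 0.\<close>

definition clip :: "real \<Rightarrow> real" where "clip \<theta> = (if \<theta> \<in> \<Theta> then \<theta> else \<theta>1)"

lemma clip_mem: "clip \<theta> \<in> \<Theta>" using theta1 by (simp add: clip_def)
lemma clip_eq: "\<theta> \<in> \<Theta> \<Longrightarrow> clip \<theta> = \<theta>" by (simp add: clip_def)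

lemma clip_measurable [measurable]: "clip \<in> borel_measurable borel"
  unfolding clip_def[abs_def] by measurable

definition log_bound :: real where "log_bound = \<bar>ln cl\<bar> + \<bar>ln Lm\<bar>"

lemma log_lam_bound: "\<bar>indicator {0..\<tau>} t * ln (lam (clip \<theta>) t)\<bar> \<le> log_bound"
proof (cases "t \<in> {0..\<tau>}")
  case True
  have "ln cl \<le> ln (lam (clip \<theta>) t)" "ln (lam (clip \<theta>) t) \<le> ln Lm"
    using sep[OF clip_mem True] lam_le[OF clip_mem True] lam_pos[OF clip_mem True] cl_pos Lm_pos by (auto simp: ln_le_cancel_iff)
  then show ?thesis using True by (auto simp: log_bound_def)
qed (simp add: log_bound_def)

lemma likelihood_clip:
  "likelihood \<tau> n (lam (clip \<theta>)) x = exp ((\<Sum>j<n. LINT t|path_measure \<tau> (x j). indicator {0..\<tau>} t * ln (lam (clip \<theta>) t))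
      - real n * (LBINT t. indicator {0..\<tau>} t * (lam (clip \<theta>) t - 1)))"
  unfolding likelihood_def set_lebesgue_integral_def real_scaleR_def ..

text \<open>Rests on measurability of path integrals with a parameter. Jointness is needed for
  Fubini over local parameters and for the estimator to be a measurable function of the
  sample.\<close>

lemma likelihood_measurable:
  "(\<lambda>(\<theta>, x). likelihood \<tau> n (lam (clip \<theta>)) x) \<in> borel_measurable (borel \<Otimes>\<^sub>M sample_space \<tau> n)"
proof -
  have [measurable]: "(\<lambda>(\<theta>, t). lam (clip \<theta>) t) \<in> borel_measurable (borel \<Otimes>\<^sub>M borel)"
    unfolding cusp_intensity_def by measurable
  have f: "(\<lambda>(\<theta>, t). indicator {0..\<tau>} t * ln (lam (clip \<theta>) t)) \<in> borel_measurable (borel \<Otimes>\<^sub>M borel)"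
    by measurable
  have "(\<lambda>(\<theta>, x). LINT t|path_measure \<tau> x. indicator {0..\<tau>} t * ln (lam (clip \<theta>) t)) \<in> borel_measurable (borel \<Otimes>\<^sub>M path_space \<tau>)"
    by (rule path_integral_measurable[OF tau f log_lam_bound])
  note P = this[unfolded case_prod_beta']
  have 1: "(\<lambda>z. LINT t|path_measure \<tau> (snd z j). indicator {0..\<tau>} t * ln (lam (clip (fst z)) t)) \<in> borel_measurable (borel \<Otimes>\<^sub>M sample_space \<tau> n)"
    if j: "j < n" for j
  proof -
    have "(\<lambda>x. x j) \<in> sample_space \<tau> n \<rightarrow>\<^sub>M path_space \<tau>"
      unfolding sample_space_def by (rule measurable_component_singleton) (use j in auto)
    then have "(\<lambda>z. (fst z, snd z j)) \<in> borel \<Otimes>\<^sub>M sample_space \<tau> n \<rightarrow>\<^sub>M borel \<Otimes>\<^sub>M path_space \<tau>"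
      by (intro measurable_Pair measurable_fst measurable_compose[OF measurable_snd])
    from measurable_compose[OF this P] show ?thesis by simp
  qed
  have 2: "(\<lambda>\<theta>. LBINT t. indicator {0..\<tau>} t * (lam (clip \<theta>) t - 1)) \<in> borel_measurable borel"
    by measurable
  have 3: "(\<lambda>z. LBINT t. indicator {0..\<tau>} t * (lam (clip (fst z)) t - 1)) \<in> borel_measurable (borel \<Otimes>\<^sub>M sample_space \<tau> n)"
    by (rule measurable_compose[OF measurable_fst 2])
  have 4: "(\<lambda>z. \<Sum>j<n. LINT t|path_measure \<tau> (snd z j). indicator {0..\<tau>} t * ln (lam (clip (fst z)) t)) \<in> borel_measurable (borel \<Otimes>\<^sub>M sample_space \<tau> n)"
    by (intro borel_measurable_sum 1) simp
  show ?thesis unfolding likelihood_clip case_prod_beta'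
    by (rule measurable_compose[OF borel_measurable_diff[OF 4 borel_measurable_times[OF borel_measurable_const 3]] borel_measurable_exp])
qed

lemma likelihood_measurable1:
  "x \<in> space (sample_space \<tau> n) \<Longrightarrow> (\<lambda>\<theta>. likelihood \<tau> n (lam (clip \<theta>)) x) \<in> borel_measurable borel"
  using measurable_compose[OF measurable_Pair2' likelihood_measurable] by (simp only: case_prod_conv)

text \<open>The bound depends on the sample but not on \<open>\<theta>\<close>, which is all that
  integrability against the prior requires.\<close>

lemma likelihood_bound:
  assumes x: "x \<in> space (sample_space \<tau> n)"
  shows "\<bar>likelihood \<tau> n (lam (clip \<theta>)) x\<bar> \<le> exp ((\<Sum>j<n. log_bound * real (x j \<tau>)) + real n * \<tau>)"
proof -
  have xj: "counting_path \<tau> (x j)" if "j < n" for j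
    using x that counting_path_space unfolding sample_space_def space_PiM by blast
  have "(\<Sum>j<n. LINT t|path_measure \<tau> (x j). indicator {0..\<tau>} t * ln (lam (clip \<theta>) t)) \<le> (\<Sum>j<n. log_bound * real (x j \<tau>))"
  proof (rule sum_mono)
    fix j assume "j \<in> {..<n}"
    then have "norm (LINT t|path_measure \<tau> (x j). indicator {0..\<tau>} t * ln (lam (clip \<theta>) t)) \<le> log_bound * real (x j \<tau>)"
      by (intro path_integrable_bounded(2)[OF tau xj]) (use log_lam_bound in auto)
    then show "(LINT t|path_measure \<tau> (x j). indicator {0..\<tau>} t * ln (lam (clip \<theta>) t)) \<le> log_bound * real (x j \<tau>)" by auto
  qed
  moreover have "- \<tau> \<le> (LBINT t. indicator {0..\<tau>} t * (lam (clip \<theta>) t - 1))"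
  proof -
    have i0: "integrable lborel (\<lambda>t. indicator {0..\<tau>} t * (-1::real))" using tau by (intro integrable_mult_left) auto
    have i: "integrable lborel (\<lambda>t. indicator {0..\<tau>} t * (lam (clip \<theta>) t - 1))"
    proof (rule integrableI_bounded_set[where A="{0..\<tau>}" and B="Lm + 1"])
      show "AE t in lborel. t \<in> {0..\<tau>} \<longrightarrow> norm (indicator {0..\<tau>} t * (lam (clip \<theta>) t - 1)) \<le> Lm + 1"
      proof (intro AE_I2 impI)
        fix t assume t: "t \<in> {0..\<tau>}"
        have "\<bar>lam (clip \<theta>) t - 1\<bar> \<le> Lm + 1" using lam_le[OF clip_mem t, of \<theta>] lam_pos[OF clip_mem t, of \<theta>] by linarith
        then show "norm (indicator {0..\<tau>} t * (lam (clip \<theta>) t - 1)) \<le> Lm + 1" using t by simp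
      qed
    qed (use tau in auto)
    have "(LBINT t. indicator {0..\<tau>} t * (-1::real)) \<le> (LBINT t. indicator {0..\<tau>} t * (lam (clip \<theta>) t - 1))"
      using lam_pos[OF clip_mem] by (intro integral_mono[OF i0 i]) (auto simp: indicator_def less_imp_le)
    moreover have "(LBINT t. indicator {0..\<tau>} t * (-1::real)) = - \<tau>" using tau by simp
    ultimately show ?thesis by simp
  qed
  then have "real n * (- \<tau>) \<le> real n * (LBINT t. indicator {0..\<tau>} t * (lam (clip \<theta>) t - 1))" by (intro mult_left_mono) auto
  ultimately show ?thesis unfolding likelihood_clip abs_exp_cancel exp_le_cancel_iff by linarith
qed

lemma likelihood_pos: "0 < likelihood \<tau> n l x" by (simp add: likelihood_def)

definition prior :: "real \<Rightarrow> real" where "prior \<theta> = indicator \<Theta> \<theta> * p \<theta>"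

lemma prior_measurable [measurable]: "prior \<in> borel_measurable borel"
  unfolding prior_def[abs_def] using borel_measurable_continuous_on_indicator[OF _ p_cont] by simp

text \<open>The integral of a non-integrable function is 0 by convention, so total mass 1 already
  implies integrability.\<close>

lemma prior_integrable: "integrable lborel prior"
  using p_prob not_integrable_integral_eq[of lborel prior] by (fastforce simp: set_lebesgue_integral_def prior_def[abs_def])

lemma nn_prior: "(\<integral>\<^sup>+\<theta>. ennreal (prior \<theta>) \<partial>lborel) = 1"
proof -
  have "integral\<^sup>L lborel prior = 1" using p_prob by (simp add: set_lebesgue_integral_def prior_def[abs_def])
  then show ?thesis using p_pos
    by (subst nn_integral_eq_integral[OF prior_integrable]) (auto intro!: AE_I2 simp: prior_def indicator_def less_imp_le)
qed

lemma posterior_cong: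
  "(LBINT \<theta>:\<Theta>. g \<theta> * p \<theta> * likelihood \<tau> n (lam \<theta>) x) = (LBINT \<theta>. prior \<theta> * (g \<theta> * likelihood \<tau> n (lam (clip \<theta>)) x))"
proof -
  have "indicator \<Theta> \<theta> *\<^sub>R (g \<theta> * p \<theta> * likelihood \<tau> n (lam \<theta>) x) = prior \<theta> * (g \<theta> * likelihood \<tau> n (lam (clip \<theta>)) x)" for \<theta>
    by (cases "\<theta> \<in> \<Theta>") (simp_all only: prior_def clip_eq indicator_simps, simp_all)
  then show ?thesis unfolding set_lebesgue_integral_def by presburger
qed

context
  fixes n x assumes x: "x \<in> space (sample_space \<tau> n)"
begin

lemma posterior_integrable:
  assumes [measurable]: "g \<in> borel_measurable borel" and g: "\<And>\<theta>. \<theta> \<in> \<Theta> \<Longrightarrow> \<bar>g \<theta>\<bar> \<le> B"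
  shows "integrable lborel (\<lambda>\<theta>. prior \<theta> * (g \<theta> * likelihood \<tau> n (lam (clip \<theta>)) x))"
proof -
  define E where "E = exp ((\<Sum>j<n. log_bound * real (x j \<tau>)) + real n * \<tau>)"
  have [measurable]: "(\<lambda>\<theta>. likelihood \<tau> n (lam (clip \<theta>)) x) \<in> borel_measurable borel" by (rule likelihood_measurable1[OF x])
  show ?thesis
  proof (rule Bochner_Integration.integrable_bound[OF integrable_mult_right[OF prior_integrable, of "B * E"]])
    show "AE \<theta> in lborel. norm (prior \<theta> * (g \<theta> * likelihood \<tau> n (lam (clip \<theta>)) x)) \<le> norm (B * E * (prior \<theta>))"
    proof (intro AE_I2)
      fix \<theta>
      show "norm (prior \<theta> * (g \<theta> * likelihood \<tau> n (lam (clip \<theta>)) x)) \<le> norm (B * E * (prior \<theta>))"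
      proof (cases "\<theta> \<in> \<Theta>")
        case True
        have "\<bar>g \<theta>\<bar> * \<bar>likelihood \<tau> n (lam (clip \<theta>)) x\<bar> \<le> \<bar>B\<bar> * \<bar>E\<bar>"
          using g[OF True] likelihood_bound[OF x, of \<theta>] unfolding E_def by (intro mult_mono) auto
        then have "\<bar>p \<theta>\<bar> * (\<bar>g \<theta>\<bar> * \<bar>likelihood \<tau> n (lam (clip \<theta>)) x\<bar>) \<le> \<bar>p \<theta>\<bar> * (\<bar>B\<bar> * \<bar>E\<bar>)" by (intro mult_left_mono) auto
        then show ?thesis using True by (simp add: abs_mult mult_ac prior_def)
      qed (simp add: prior_def)
    qed
  qed measurable
qed

lemma posterior_mass_pos: "0 < (LBINT \<theta>. prior \<theta> * (1 * likelihood \<tau> n (lam (clip \<theta>)) x))"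
proof -
  have i: "integrable lborel (\<lambda>\<theta>. prior \<theta> * (1 * likelihood \<tau> n (lam (clip \<theta>)) x))"
    by (rule posterior_integrable[where B=1]) auto
  have nn: "0 \<le> prior \<theta> * (1 * likelihood \<tau> n (lam (clip \<theta>)) x)" for \<theta>
    using p_pos[of \<theta>] likelihood_pos[of n "lam (clip \<theta>)" x] by (auto simp: indicator_def prior_def)
  have "(LBINT \<theta>. prior \<theta> * (1 * likelihood \<tau> n (lam (clip \<theta>)) x)) \<noteq> 0"
  proof
    assume "(LBINT \<theta>. prior \<theta> * (1 * likelihood \<tau> n (lam (clip \<theta>)) x)) = 0"
    then have "AE \<theta> in lborel. prior \<theta> * (1 * likelihood \<tau> n (lam (clip \<theta>)) x) = 0"
      using integral_nonneg_eq_0_iff_AE[OF i] nn by auto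
    then have "AE \<theta> in lborel. \<theta> \<notin> \<Theta>"
    proof eventually_elim
      case (elim \<theta>)
      then show ?case using p_pos[of \<theta>] likelihood_pos[of n "lam (clip \<theta>)" x] by (cases "\<theta> \<in> \<Theta>") (auto simp: less_le prior_def)
    qed
    from emeasure_eq_0_AE[OF this] have "emeasure lborel \<Theta> = 0" by (simp only: space_lborel space_borel UNIV_I simp_thms Collect_mem_eq)
    then show False using theta1 by simp
  qed
  moreover have "0 \<le> (LBINT \<theta>. prior \<theta> * (1 * likelihood \<tau> n (lam (clip \<theta>)) x))"
    using nn by (intro integral_nonneg_AE AE_I2)
  ultimately show ?thesis by simp
qed

text \<open>The denominator is positive because prior and likelihood are. Clearing it makes the
  condition linear in the likelihood, so that a common factor of the likelihoods may be divided out
  later.\<close>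

lemma bayes_estimator_gt:
  "bayes_estimator \<tau> lam \<Theta> p n x > y \<longleftrightarrow> 0 < (LBINT \<theta>. prior \<theta> * ((\<theta> - y) * likelihood \<tau> n (lam (clip \<theta>)) x))"
proof -
  define num where "num = (LBINT \<theta>. prior \<theta> * (\<theta> * likelihood \<tau> n (lam (clip \<theta>)) x))"
  define den where "den = (LBINT \<theta>. prior \<theta> * (1 * likelihood \<tau> n (lam (clip \<theta>)) x))"
  have e: "bayes_estimator \<tau> lam \<Theta> p n x = num / den"
    unfolding bayes_estimator_def num_def den_def using posterior_cong[of "\<lambda>\<theta>. \<theta>" n x] posterior_cong[of "\<lambda>_. 1" n x] by simp
  have i: "integrable lborel (\<lambda>\<theta>. prior \<theta> * (\<theta> * likelihood \<tau> n (lam (clip \<theta>)) x))"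
    by (rule posterior_integrable[where B=b]) (use theta1 in auto)
  have j: "integrable lborel (\<lambda>\<theta>. prior \<theta> * (1 * likelihood \<tau> n (lam (clip \<theta>)) x))"
    by (rule posterior_integrable[where B=1]) auto
  have "(LBINT \<theta>. prior \<theta> * ((\<theta> - y) * likelihood \<tau> n (lam (clip \<theta>)) x))
    = (LBINT \<theta>. prior \<theta> * (\<theta> * likelihood \<tau> n (lam (clip \<theta>)) x) - y * (prior \<theta> * (1 * likelihood \<tau> n (lam (clip \<theta>)) x)))"
    by (intro Bochner_Integration.integral_cong refl) (simp add: algebra_simps)
  also have "\<dots> = num - y * den"
    unfolding num_def den_def integral_mult_right_zero[symmetric]
    by (rule Bochner_Integration.integral_diff[OF i integrable_mult_right[OF j]])
  finally have d: "(LBINT \<theta>. prior \<theta> * ((\<theta> - y) * likelihood \<tau> n (lam (clip \<theta>)) x)) = num - y * den" .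
  have "0 < den" unfolding den_def by (rule posterior_mass_pos)
  then show ?thesis unfolding e d by (simp add: less_divide_eq)
qed

end

lemma bayes_estimator_measurable: "bayes_estimator \<tau> lam \<Theta> p n \<in> borel_measurable (sample_space \<tau> n)"
proof -
  have L: "(\<lambda>(x, \<theta>). likelihood \<tau> n (lam (clip \<theta>)) x) \<in> borel_measurable (sample_space \<tau> n \<Otimes>\<^sub>M borel)"
    using measurable_compose[OF measurable_pair_swap' likelihood_measurable] by (simp add: case_prod_beta')
  have [measurable]: "(\<lambda>(x, \<theta>). likelihood \<tau> n (lam (clip \<theta>)) x) \<in> borel_measurable (sample_space \<tau> n \<Otimes>\<^sub>M lborel)"
    using L by (simp cong: measurable_cong_sets)
  have g: "(\<lambda>x. LBINT \<theta>. prior \<theta> * (g \<theta> * likelihood \<tau> n (lam (clip \<theta>)) x)) \<in> borel_measurable (sample_space \<tau> n)"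
    if [measurable]: "g \<in> borel_measurable borel" for g
    by measurable
  have e: "bayes_estimator \<tau> lam \<Theta> p n x = (LBINT \<theta>. prior \<theta> * (\<theta> * likelihood \<tau> n (lam (clip \<theta>)) x))
      / (LBINT \<theta>. prior \<theta> * (1 * likelihood \<tau> n (lam (clip \<theta>)) x))" for x
    unfolding bayes_estimator_def using posterior_cong[of "\<lambda>\<theta>. \<theta>" n x] posterior_cong[of "\<lambda>_. 1" n x] by simp
  show ?thesis unfolding e[abs_def] by (intro borel_measurable_divide g) measurable
qed

end

section \<open>Prior and experiment in local coordinates\<close>

context cusp_prior
begin

lemma prior_nonneg: "0 \<le> prior \<theta>" using p_pos[of \<theta>] by (auto simp: prior_def indicator_def)

lemma theta1_in: "\<theta>1 \<in> \<Theta>" using theta1 by simp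

lemma prior_near:
  assumes e: "0 < e"
  obtains \<delta> where "0 < \<delta>" "\<theta>1 + \<delta> < b" "\<And>\<theta>. \<theta>1 \<le> \<theta> \<Longrightarrow> \<theta> \<le> \<theta>1 + \<delta> \<Longrightarrow> \<bar>prior \<theta> - p \<theta>1\<bar> \<le> e"
proof -
  obtain d where d: "0 < d" "\<And>\<theta>. \<theta> \<in> \<Theta> \<Longrightarrow> dist \<theta> \<theta>1 < d \<Longrightarrow> dist (p \<theta>) (p \<theta>1) < e"
    using p_cont theta1_in e unfolding continuous_on_iff by blast
  define \<delta> where "\<delta> = min (d / 2) ((b - \<theta>1) / 2)"
  have \<delta>: "0 < \<delta>" "\<delta> < d" "\<theta>1 + \<delta> < b" using d(1) theta1 by (auto simp: \<delta>_def min_def field_simps)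
  have "\<bar>prior \<theta> - p \<theta>1\<bar> \<le> e" if "\<theta>1 \<le> \<theta>" "\<theta> \<le> \<theta>1 + \<delta>" for \<theta>
  proof -
    have t: "\<theta> \<in> \<Theta>" using that \<delta> by auto
    moreover have "dist \<theta> \<theta>1 < d" using that \<delta> by (simp add: dist_real_def)
    ultimately have "dist (p \<theta>) (p \<theta>1) < e" by (rule d(2))
    then show ?thesis using t by (simp add: dist_real_def prior_def)
  qed
  then show ?thesis using that \<delta> by blast
qed

lemma local_point_eq: "local_point n u0 v = \<theta>1 + \<phi> n * (u0 + v)"
  by (simp add: local_point_def algebra_simps)

lemma local_point_measurable [measurable]: "local_point n u0 \<in> borel_measurable borel"
  unfolding local_point_def[abs_def] by measurable

text \<open>Far blocks are controlled by the total mass \<open>1 / \<phi> n\<close> of the rescaled prior, which may be unbounded near \<open>b\<close>.\<close>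

lemma block_mass:
  obtains A where "0 \<le> A" "p \<theta>1 \<le> A"
    "\<And>n u0 m. 1 \<le> n \<Longrightarrow> (\<integral>\<^sup>+v. ennreal (prior (local_point n u0 v)) * indicator (block (- u0) m) v \<partial>lborel) \<le> ennreal (A * (1 + real m))"
proof -
  obtain \<delta> where \<delta>: "0 < \<delta>" "\<theta>1 + \<delta> < b" "\<And>\<theta>. \<theta>1 \<le> \<theta> \<Longrightarrow> \<theta> \<le> \<theta>1 + \<delta> \<Longrightarrow> \<bar>prior \<theta> - p \<theta>1\<bar> \<le> 1"
    using prior_near[of 1] by auto
  \<comment> \<open>Blocks within distance \<open>\<delta>\<close> of \<open>\<theta>1\<close> see a
    density of at most \<open>p \<theta>1 + 1\<close>. On any other block
    \<open>\<phi> n * (1 + real m) > \<delta>\<close>, so the total mass \<open>1 / \<phi> n\<close>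
    is below \<open>(1 + real m) / \<delta>\<close>; hence the linear growth in
    \<open>m\<close>.\<close>
  define A where "A = (p \<theta>1 + 1) + 1 / \<delta>"
  have p1: "0 < p \<theta>1" by (rule p_pos[OF theta1_in])
  have A: "0 \<le> A" "p \<theta>1 \<le> A" using p1 \<delta>(1) by (auto simp: A_def intro: add_nonneg_nonneg)
  have "(\<integral>\<^sup>+v. ennreal (prior (local_point n u0 v)) * indicator (block (- u0) m) v \<partial>lborel) \<le> ennreal (A * (1 + real m))"
    if n: "1 \<le> n" for n u0 m
  proof (cases "\<phi> n * (1 + real m) \<le> \<delta>")
    case True
    have f: "0 < \<phi> n" by (rule rate_pos[OF n])
    have "(\<integral>\<^sup>+v. ennreal (prior (local_point n u0 v)) * indicator (block (- u0) m) v \<partial>lborel)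
      \<le> (\<integral>\<^sup>+v. ennreal (p \<theta>1 + 1) * indicator (block (- u0) m) v \<partial>lborel)"
    proof (rule nn_integral_mono)
      fix v
      show "ennreal (prior (local_point n u0 v)) * indicator (block (- u0) m) v \<le> ennreal (p \<theta>1 + 1) * indicator (block (- u0) m) v"
      proof (cases "v \<in> block (- u0) m")
        case v: True
        have "0 \<le> \<phi> n * (u0 + v)" using v f by (intro mult_nonneg_nonneg) auto
        moreover have "\<phi> n * (u0 + v) \<le> \<phi> n * (1 + real m)" using v f by (intro mult_left_mono) auto
        ultimately have "\<bar>prior (local_point n u0 v) - p \<theta>1\<bar> \<le> 1" using True by (intro \<delta>(3)) (auto simp: local_point_eq)
        then have "prior (local_point n u0 v) \<le> p \<theta>1 + 1" by linarith
        then show ?thesis using v by (simp add: ennreal_leI)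
      qed simp
    qed
    also have "\<dots> = ennreal (p \<theta>1 + 1)" by (simp add: nn_integral_cmult_indicator)
    also have "\<dots> \<le> ennreal (A * (1 + real m))"
    proof (rule ennreal_leI)
      have "p \<theta>1 + 1 \<le> A" using \<delta>(1) by (simp add: A_def)
      also have "A \<le> A * (1 + real m)" using A by (simp add: distrib_left)
      finally show "p \<theta>1 + 1 \<le> A * (1 + real m)" .
    qed
    finally show ?thesis .
  next
    case False
    have f: "0 < \<phi> n" by (rule rate_pos[OF n])
    have "(\<integral>\<^sup>+v. ennreal (prior (local_point n u0 v)) * indicator (block (- u0) m) v \<partial>lborel)
      \<le> (\<integral>\<^sup>+v. ennreal (prior (local_point n u0 v)) \<partial>lborel)"
      by (intro nn_integral_mono) (auto simp: indicator_def)
    also have "\<dots> = ennreal (1 / \<phi> n)"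
    proof -
      have "1 = ennreal \<bar>\<phi> n\<bar> * (\<integral>\<^sup>+v. ennreal (prior ((\<theta>1 + \<phi> n * u0) + \<phi> n * v)) \<partial>lborel)"
        unfolding nn_prior[symmetric] using f by (intro nn_integral_real_affine) auto
      also have "(\<integral>\<^sup>+v. ennreal (prior ((\<theta>1 + \<phi> n * u0) + \<phi> n * v)) \<partial>lborel) = (\<integral>\<^sup>+v. ennreal (prior (local_point n u0 v)) \<partial>lborel)"
        by (simp add: local_point_def)
      finally have "ennreal (1 / \<phi> n) * 1 = ennreal (1 / \<phi> n) * (ennreal (\<phi> n) * (\<integral>\<^sup>+v. ennreal (prior (local_point n u0 v)) \<partial>lborel))" using f by simp
      also have "\<dots> = (\<integral>\<^sup>+v. ennreal (prior (local_point n u0 v)) \<partial>lborel)"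
        unfolding mult.assoc[symmetric] using f by (simp add: ennreal_mult[symmetric])
      finally show ?thesis by simp
    qed
    also have "\<dots> \<le> ennreal (A * (1 + real m))"
    proof (rule ennreal_leI)
      have "1 / \<phi> n \<le> 1 / \<delta> * (1 + real m)" using False f \<delta>(1) by (simp add: field_simps)
      also have "\<dots> \<le> A * (1 + real m)" using p1 by (intro mult_right_mono) (auto simp: A_def)
      finally show "1 / \<phi> n \<le> A * (1 + real m)" .
    qed
    finally show ?thesis .
  qed
  then show ?thesis using that A by blast
qed

text \<open>In this and the next constant the model-dependent entry comes from
  \<open>rate_hellinger\<close>, with a further one half in \<open>field_q\<close> from the exponent
  of the root moment. The entries 1/4 and 1/8 let the limit field satisfy the same bounds.\<close>

definition field_C :: real where "field_C = max (1 / 4) (h \<theta>1 / (4 * cl))"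
definition field_q :: real where "field_q = min (1 / 8) (h \<theta>1 * gap\<^sup>2 / (32 * Lm * cusp_const \<kappa>))"

lemma field_q_pos: "0 < field_q"
  unfolding field_q_def using h_pos[OF theta1_mem] gap_pos Lm_pos cusp_const_pos[OF kp kh] by simp

end

locale local_experiment = cusp_prior +
  fixes n :: nat and u0 :: real and P :: "'a measure" and X :: "nat \<Rightarrow> 'a \<Rightarrow> real \<Rightarrow> nat"
  assumes n1: "1 \<le> n" and samp: "cusp_sample \<tau> \<theta>1 b \<kappa> a h cl hm n (local_point n u0 0) P X"
begin

sublocale C: cusp_sample \<tau> \<theta>1 b \<kappa> a h cl hm n "local_point n u0 0" P X by (rule samp)

text \<open>On \<open>S\<close> this is the likelihood ratio to the true parameter. Elsewhere
  clipping keeps it positive and jointly measurable, while the weight \<open>w\<close> is 0.\<close>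

definition Y :: "real \<Rightarrow> 'a \<Rightarrow> real" where
  "Y v \<omega> = likelihood \<tau> n (lam (clip (local_point n u0 v))) (\<lambda>j\<in>{..<n}. X j \<omega>)
      / likelihood \<tau> n (lam (local_point n u0 0)) (\<lambda>j\<in>{..<n}. X j \<omega>)"

definition w :: "real \<Rightarrow> real" where "w v = prior (local_point n u0 v)"
definition S :: "real set" where "S = {v. local_point n u0 v \<in> \<Theta>}"

lemma Y_pos: "0 < Y v \<omega>" by (simp add: Y_def likelihood_pos)

lemma Y_LR: "v \<in> S \<Longrightarrow> Y v = C.LR (local_point n u0 v)"
  by (rule ext) (simp add: Y_def C.LR_def C.obs_def S_def clip_eq)

lemma obs_measurable: "(\<lambda>\<omega>. \<lambda>j\<in>{..<n}. X j \<omega>) \<in> P \<rightarrow>\<^sub>M sample_space \<tau> n"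
  unfolding sample_space_def by (intro measurable_restrict C.X_measurable) auto

lemma Y_measurable: "(\<lambda>(v, \<omega>). Y v \<omega>) \<in> borel_measurable (borel \<Otimes>\<^sub>M P)"
proof -
  have 1: "(\<lambda>z. (local_point n u0 (fst z), \<lambda>j\<in>{..<n}. X j (snd z))) \<in> borel \<Otimes>\<^sub>M P \<rightarrow>\<^sub>M borel \<Otimes>\<^sub>M sample_space \<tau> n"
    by (intro measurable_Pair measurable_compose[OF measurable_fst local_point_measurable] measurable_compose[OF measurable_snd obs_measurable])
  have 2: "(\<lambda>z. (local_point n u0 0, \<lambda>j\<in>{..<n}. X j (snd z))) \<in> borel \<Otimes>\<^sub>M P \<rightarrow>\<^sub>M borel \<Otimes>\<^sub>M sample_space \<tau> n"
    by (intro measurable_Pair measurable_const measurable_compose[OF measurable_snd obs_measurable]) simp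
  have c: "clip (local_point n u0 0) = local_point n u0 0" by (rule clip_eq[OF C.theta0])
  show ?thesis
    unfolding Y_def case_prod_beta'
    using measurable_compose[OF 1 likelihood_measurable] measurable_compose[OF 2 likelihood_measurable]
    by (intro borel_measurable_divide) (simp_all only: case_prod_conv c)
qed

lemma local_point_shift: "local_point n u0 v = local_point n u0 u + \<phi> n * (v - u)"
  by (simp add: local_point_def algebra_simps)

text \<open>Since \<open>2 * \<kappa> + 1 > 1\<close>, the power bounds of
  \<open>rate_hellinger\<close> yield linear ones: from above for distances up to 1, from below for
  \<open>v \<ge> 1\<close>.\<close>

lemma field:
  assumes A: "0 \<le> A"
    and mass: "\<And>m. (\<integral>\<^sup>+v. ennreal (prior (local_point n u0 v)) * indicator (block (- u0) m) v \<partial>lborel) \<le> ennreal (A * (1 + real m))"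
  shows "likelihood_field P Y S w (- u0) field_C field_q A"
proof
  show "(\<lambda>(v, \<omega>). Y v \<omega>) \<in> borel_measurable (borel \<Otimes>\<^sub>M P)" by (rule Y_measurable)
  show "w \<in> borel_measurable borel" unfolding w_def[abs_def] by measurable
  show "0 \<le> Y v \<omega>" for v \<omega> using Y_pos by (rule less_imp_le)
  show "0 \<le> w v" for v by (simp add: w_def prior_nonneg)
  show "S \<subseteq> {- u0..}"
  proof
    fix v assume "v \<in> S"
    then have "0 \<le> \<phi> n * (u0 + v)" by (simp add: S_def local_point_eq)
    then show "v \<in> {- u0..}" using rate_pos[OF n1] by (simp add: zero_le_mult_iff)
  qed
  show "w v = 0" if "v \<notin> S" for v using that by (simp add: w_def S_def prior_def)
  show "0 \<le> field_C" by (simp add: field_C_def)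
  show "0 \<le> A" by (rule A)
  show "0 < field_q" by (rule field_q_pos)
  show "(\<integral>\<^sup>+\<omega>. ennreal (Y v \<omega>) \<partial>P) \<le> 1" if "v \<in> S" for v
    unfolding Y_LR[OF that] using C.nn_LR[of "local_point n u0 v"] that by (simp add: S_def)
  show "(\<integral>\<^sup>+\<omega>. ennreal ((sqrt (Y u \<omega>) - sqrt (Y v \<omega>))\<^sup>2) \<partial>P) \<le> ennreal (field_C * \<bar>u - v\<bar>)"
    if uv: "u \<in> S" "v \<in> S" "\<bar>u - v\<bar> \<le> 1" for u v
  proof -
    have m: "local_point n u0 u \<in> \<Theta>" "local_point n u0 v \<in> \<Theta>" using uv by (simp_all add: S_def)
    have "real n * hellinger (local_point n u0 u) (local_point n u0 v) \<le> h \<theta>1 / (4 * cl) * \<bar>u - v\<bar> powr (2 * \<kappa> + 1)"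
      using rate_hellinger(1)[OF n1 m(2), of "u - v"] m(1) unfolding local_point_shift[of u v, symmetric] by simp
    also have "\<dots> \<le> field_C * \<bar>u - v\<bar>"
    proof (rule mult_mono)
      show "\<bar>u - v\<bar> powr (2 * \<kappa> + 1) \<le> \<bar>u - v\<bar>"
        using powr_mono'[of 1 "2 * \<kappa> + 1" "\<bar>u - v\<bar>"] uv(3) kp by (cases "u = v") auto
    qed (auto simp: field_C_def)
    finally show ?thesis
      unfolding Y_LR[OF uv(1)] Y_LR[OF uv(2)] using C.nn_sqrt_LR_diff[OF m] by (blast intro: order_trans ennreal_leI)
  qed
  show "(\<integral>\<^sup>+\<omega>. ennreal (sqrt (Y v \<omega>)) \<partial>P) \<le> ennreal (exp (- field_q * v))" if v: "v \<in> S" "1 \<le> v" for v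
  proof -
    have m: "local_point n u0 v \<in> \<Theta>" using v by (simp add: S_def)
    define q where "q = h \<theta>1 * gap\<^sup>2 / (32 * Lm * cusp_const \<kappa>)"
    have q: "field_q \<le> q" "0 \<le> q"
      using field_q_pos by (auto simp: field_q_def q_def)
    have sh: "local_point n u0 0 + \<phi> n * v = local_point n u0 v" using local_point_shift[of v 0] by simp
    have "2 * q * \<bar>v\<bar> powr (2 * \<kappa> + 1) \<le> real n * hellinger (local_point n u0 v) (local_point n u0 0)"
    proof -
      have "2 * q = h \<theta>1 * gap\<^sup>2 / (16 * Lm * cusp_const \<kappa>)" by (simp add: q_def)
      then show ?thesis using rate_hellinger(2)[OF n1 C.theta0, of v] m unfolding sh by simp
    qed
    moreover have "field_q * v \<le> q * \<bar>v\<bar> powr (2 * \<kappa> + 1)"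
    proof (rule mult_mono)
      show "v \<le> \<bar>v\<bar> powr (2 * \<kappa> + 1)" using powr_mono[of 1 "2 * \<kappa> + 1" v] v(2) kp by simp
    qed (use q v in auto)
    ultimately have "- real n / 2 * hellinger (local_point n u0 v) (local_point n u0 0) \<le> - field_q * v" by simp
    then show ?thesis unfolding Y_LR[OF v(1)] C.nn_sqrt_LR[OF m] by (intro ennreal_leI) simp
  qed
  show "(\<integral>\<^sup>+v. ennreal (w v) * indicator (block (- u0) m) v \<partial>lborel) \<le> ennreal (A * (1 + real m))" for m
    unfolding w_def by (rule mass)
qed

text \<open>Rescaling the posterior integral around the true parameter shifts the threshold from
  \<open>k\<close> to \<open>k - u0\<close>; the positive factors \<open>\<phi> n\<close> and
  \<open>L0\<close> do not affect the sign.\<close>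

lemma bayes_test_iff:
  assumes om: "\<omega> \<in> space P"
  shows "bayes_test \<tau> lam \<Theta> p \<theta>1 \<phi> k n (\<lambda>j\<in>{..<n}. X j \<omega>) = (if 0 < weighted_integral Y w (k - u0) \<omega> then 1 else 0)"
proof -
  define x where "x = (\<lambda>j\<in>{..<n}. X j \<omega>)"
  have x: "x \<in> space (sample_space \<tau> n)" unfolding x_def by (rule measurable_space[OF obs_measurable om])
  have f: "0 < \<phi> n" by (rule rate_pos[OF n1])
  define L0 where "L0 = likelihood \<tau> n (lam (local_point n u0 0)) x"
  have L0: "0 < L0" unfolding L0_def by (rule likelihood_pos)
  have "(LBINT \<theta>. prior \<theta> * ((\<theta> - (\<theta>1 + \<phi> n * k)) * likelihood \<tau> n (lam (clip \<theta>)) x))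
    = \<bar>\<phi> n\<bar> *\<^sub>R (LBINT v. prior ((\<theta>1 + \<phi> n * u0) + \<phi> n * v) * ((((\<theta>1 + \<phi> n * u0) + \<phi> n * v) - (\<theta>1 + \<phi> n * k)) * likelihood \<tau> n (lam (clip ((\<theta>1 + \<phi> n * u0) + \<phi> n * v))) x))"
    using f by (intro lborel_integral_real_affine) simp
  also have "\<dots> = \<phi> n * (LBINT v. (\<phi> n * L0) * ((v - (k - u0)) * w v * Y v \<omega>))"
  proof -
    have "prior ((\<theta>1 + \<phi> n * u0) + \<phi> n * v) * ((((\<theta>1 + \<phi> n * u0) + \<phi> n * v) - (\<theta>1 + \<phi> n * k)) * likelihood \<tau> n (lam (clip ((\<theta>1 + \<phi> n * u0) + \<phi> n * v))) x)
       = (\<phi> n * L0) * ((v - (k - u0)) * w v * Y v \<omega>)" for v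
    proof -
      have "(\<theta>1 + \<phi> n * u0) + \<phi> n * v - (\<theta>1 + \<phi> n * k) = \<phi> n * (v - (k - u0))" by (simp add: algebra_simps)
      moreover have "likelihood \<tau> n (lam (clip (local_point n u0 v))) x = L0 * Y v \<omega>"
        using L0 by (simp add: Y_def x_def[symmetric] L0_def[symmetric])
      ultimately show ?thesis unfolding local_point_def[symmetric] w_def[symmetric] by simp
    qed
    then show ?thesis using f by simp
  qed
  also have "\<dots> = \<phi> n * (\<phi> n * L0) * weighted_integral Y w (k - u0) \<omega>"
    unfolding integral_mult_right_zero weighted_integral_def by simp
  finally have e: "(LBINT \<theta>. prior \<theta> * ((\<theta> - (\<theta>1 + \<phi> n * k)) * likelihood \<tau> n (lam (clip \<theta>)) x)) = \<phi> n * (\<phi> n * L0) * weighted_integral Y w (k - u0) \<omega>" .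
  have "inverse (\<phi> n) * (bayes_estimator \<tau> lam \<Theta> p n x - \<theta>1) > k \<longleftrightarrow> bayes_estimator \<tau> lam \<Theta> p n x > \<theta>1 + \<phi> n * k"
    using f by (simp add: field_simps)
  also have "\<dots> \<longleftrightarrow> 0 < weighted_integral Y w (k - u0) \<omega>"
  proof -
    have "0 < c \<Longrightarrow> 0 < c * y \<longleftrightarrow> 0 < y" for c y :: real by (simp add: zero_less_mult_iff)
    then show ?thesis unfolding bayes_estimator_gt[OF x] e using f L0 by simp
  qed
  finally show ?thesis unfolding bayes_test_def x_def by simp
qed

end


text \<open>The case \<open>u0 = 0\<close> gives the size and \<open>u0 > 0\<close> the power: the
  alternative enters only through the centre of the local coordinates.\<close>

theorem (in cusp_prior) bayes_test_power_tendsto: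
  fixes P :: "nat \<Rightarrow> real \<Rightarrow> 'a measure" and N :: "'b measure"
  assumes model: "\<And>n \<theta>. \<theta> \<in> \<Theta> \<Longrightarrow> poisson_sample (P n \<theta>) \<tau> n (lam \<theta>) X"
    and fbm: "fbm N H W" and H: "H = \<kappa> + 1 / 2" and u0: "0 \<le> u0"
  shows "(\<lambda>n. expect_sample (P n (\<theta>1 + \<phi> n * u0)) n X (bayes_test \<tau> lam \<Theta> p \<theta>1 \<phi> k n))
    \<longlonglongrightarrow> measure N {\<omega>\<in>space N. limit_bayes H W (- u0) \<omega> > k - u0}"
proof -
  interpret F: fbm N H W by (rule fbm)
  have "\<forall>\<^sub>F n in sequentially. local_point n u0 0 \<in> \<Theta> \<and> 1 \<le> n"
    by (intro eventually_conj eventually_local_point_mem eventually_ge_at_top) (use u0 in simp)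
  then obtain n0 where n0: "\<And>n. n0 \<le> n \<Longrightarrow> local_point n u0 0 \<in> \<Theta> \<and> 1 \<le> n"
    unfolding eventually_sequentially by blast
  \<comment> \<open>The model is given only for parameters in \<open>\<Theta>\<close>, and the rate
    is positive from index 1 on; the shifted index meets both conditions throughout.\<close>
  define \<nu> where "\<nu> n = n + n0" for n
  have \<nu>: "filterlim \<nu> at_top sequentially" "\<And>n. 1 \<le> \<nu> n"
    unfolding \<nu>_def[abs_def] using filterlim_add_const_nat_at_top n0[of "n + n0" for n] by auto
  define Q where "Q n = P (\<nu> n) (local_point (\<nu> n) u0 0)" for n
  have mem: "local_point (\<nu> n) u0 0 \<in> \<Theta>" for n using n0[of "\<nu> n"] by (simp add: \<nu>_def)
  have samp: "cusp_sample \<tau> \<theta>1 b \<kappa> a h cl hm (\<nu> n) (local_point (\<nu> n) u0 0) (Q n) X" for n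
    unfolding Q_def by unfold_locales (use mem model in auto)
  interpret L: local_experiment \<tau> \<theta>1 b \<kappa> a h cl hm p "\<nu> n" u0 "Q n" X for n
    by (intro local_experiment.intro cusp_prior_axioms local_experiment_axioms.intro \<nu> samp)
  obtain A where A: "0 \<le> A" "p \<theta>1 \<le> A"
    "\<And>n u0 m. 1 \<le> n \<Longrightarrow> (\<integral>\<^sup>+v. ennreal (prior (local_point n u0 v)) * indicator (block (- u0) m) v \<partial>lborel) \<le> ennreal (A * (1 + real m))"
    using block_mass by blast
  have p1: "0 < p \<theta>1" by (rule p_pos[OF theta1_in])
  define c where "c = - u0"
  define w' where "w' v = (if c \<le> v then p \<theta>1 else 0)" for v
  have f1: "likelihood_field (Q n) (L.Y n) (L.S n) (L.w n) c field_C field_q A" for n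
    unfolding c_def by (rule L.field[OF A(1) A(3)[OF \<nu>(2)]])
  have f2: "likelihood_field N F.Z {c..} (\<lambda>v. if c \<le> v then p \<theta>1 else 0) c field_C field_q A"
    by (rule F.limit_field) (use p1 A(2) field_q_pos in \<open>auto simp: field_C_def field_q_def\<close>)
  have range: "\<theta>1 \<le> local_point (\<nu> n) u0 v" "local_point (\<nu> n) u0 v \<le> local_point (\<nu> n) u0 (c + real D)"
    if "v \<in> {c..<c + real D}" for n v D
  proof -
    have f: "0 < \<phi> (\<nu> n)" by (rule rate_pos[OF \<nu>(2)])
    have "0 \<le> \<phi> (\<nu> n) * (u0 + v)" using that f by (intro mult_nonneg_nonneg) (auto simp: c_def)
    moreover have "\<phi> (\<nu> n) * (u0 + v) \<le> \<phi> (\<nu> n) * (u0 + (c + real D))" using that f by (intro mult_left_mono) auto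
    ultimately show "\<theta>1 \<le> local_point (\<nu> n) u0 v" "local_point (\<nu> n) u0 v \<le> local_point (\<nu> n) u0 (c + real D)"
      by (simp_all add: local_point_eq)
  qed
  have lp: "(\<lambda>n. local_point (\<nu> n) u0 v) \<longlonglongrightarrow> \<theta>1" for v
    using filterlim_compose[OF local_point_tendsto \<nu>(1)] .
  have conv: "(\<lambda>n. LINT \<omega>|Q n. iexp (s * weighted_integral (L.Y n) (L.w n) (k - u0) \<omega>))
    \<longlonglongrightarrow> (LINT \<omega>|N. iexp (s * weighted_integral F.Z (\<lambda>v. if c \<le> v then p \<theta>1 else 0) (k - u0) \<omega>))" for s
  proof (rule weighted_integral_char_conv[OF f1 f2])
    show "0 < L.Y n v \<omega>" for n v \<omega> by (rule L.Y_pos)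
    show "0 < F.Z v \<omega>" for v \<omega> by (rule F.Z_pos)
    show "0 \<le> p \<theta>1" using p1 by simp
    show "\<forall>\<^sub>F n in sequentially. {c..<c + real D} \<subseteq> L.S n" for D
      using order_tendstoD(2)[OF lp theta1(2), of "c + real D"]
    proof eventually_elim
      case (elim n)
      show ?case
      proof
        fix v assume "v \<in> {c..<c + real D}"
        from range[OF this, of n] elim show "v \<in> L.S n" unfolding L.S_def by simp
      qed
    qed
    show "\<forall>\<^sub>F n in sequentially. \<forall>v\<in>{c..<c + real D}. \<bar>L.w n v - p \<theta>1\<bar> \<le> e" if e: "0 < e" for D and e :: real
    proof -
      obtain \<delta> where \<delta>: "0 < \<delta>" "\<And>\<theta>. \<theta>1 \<le> \<theta> \<Longrightarrow> \<theta> \<le> \<theta>1 + \<delta> \<Longrightarrow> \<bar>prior \<theta> - p \<theta>1\<bar> \<le> e"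
        using prior_near[OF e] by metis
      have "\<forall>\<^sub>F n in sequentially. local_point (\<nu> n) u0 (c + real D) < \<theta>1 + \<delta>"
        using order_tendstoD(2)[OF lp] \<delta>(1) by simp
      then show ?thesis
      proof eventually_elim
        case (elim n)
        show ?case
        proof
          fix v assume "v \<in> {c..<c + real D}"
          from range[OF this, of n] elim show "\<bar>L.w n v - p \<theta>1\<bar> \<le> e" unfolding L.w_def by (intro \<delta>(2)) simp_all
        qed
      qed
    qed
    show "(\<lambda>n. LINT \<omega>|Q n. iexp (\<Sum>i<m. t i * ln (L.Y n (x i) \<omega>))) \<longlonglongrightarrow> (LINT \<omega>|N. iexp (\<Sum>i<m::nat. t i * ln (F.Z (x i) \<omega>)))"
      if x: "\<And>i. c \<le> x i" for m t x
      unfolding F.Z_def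
      by (rule likelihood_ratio_fdd_conv[OF u0 \<nu> samp fbm H]) (use x in \<open>simp_all add: c_def L.Y_def clip_eq\<close>)
  qed
  have "(\<lambda>n. measure (Q n) {\<omega>\<in>space (Q n). weighted_integral (L.Y n) (L.w n) (k - u0) \<omega> > 0})
    \<longlonglongrightarrow> measure N {\<omega>\<in>space N. weighted_integral F.Z (\<lambda>v. if c \<le> v then p \<theta>1 else 0) (k - u0) \<omega> > 0}"
  proof (rule char_conv_imp_prob_pos_conv[OF _ _ _ _ conv F.no_atom_scaled[OF p1]])
    show "prob_space (Q n)" for n by (rule L.C.prob_space_axioms)
    show "prob_space N" by (rule F.prob_space_axioms)
    show "weighted_integral (L.Y n) (L.w n) (k - u0) \<in> borel_measurable (Q n)" for n
      by (rule likelihood_field.weighted_integral_measurable[OF f1])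
    show "weighted_integral F.Z (\<lambda>v. if c \<le> v then p \<theta>1 else 0) (k - u0) \<in> borel_measurable N"
      by (rule likelihood_field.weighted_integral_measurable[OF f2])
  qed
  moreover have "measure (Q n) {\<omega>\<in>space (Q n). weighted_integral (L.Y n) (L.w n) (k - u0) \<omega> > 0}
    = expect_sample (P (n + n0) (\<theta>1 + \<phi> (n + n0) * u0)) (n + n0) X (bayes_test \<tau> lam \<Theta> p \<theta>1 \<phi> k (n + n0))" for n
  proof -
    let ?E = "{\<omega>\<in>space (Q n). weighted_integral (L.Y n) (L.w n) (k - u0) \<omega> > 0}"
    have "Q n = P (n + n0) (\<theta>1 + \<phi> (n + n0) * u0)" by (simp add: Q_def \<nu>_def local_point_def)
    then have "expect_sample (P (n + n0) (\<theta>1 + \<phi> (n + n0) * u0)) (n + n0) X (bayes_test \<tau> lam \<Theta> p \<theta>1 \<phi> k (n + n0))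
      = (LINT \<omega>|Q n. bayes_test \<tau> lam \<Theta> p \<theta>1 \<phi> k (\<nu> n) (\<lambda>j\<in>{..<\<nu> n}. X j \<omega>))"
      by (simp add: expect_sample_def \<nu>_def)
    also have "\<dots> = (LINT \<omega>|Q n. indicator ?E \<omega>)"
      by (intro Bochner_Integration.integral_cong refl) (simp add: L.bayes_test_iff)
    also have "\<dots> = measure (Q n) (?E \<inter> space (Q n))" by (rule Bochner_Integration.integral_indicator)
    also have "?E \<inter> space (Q n) = ?E" by blast
    finally show ?thesis by simp
  qed
  ultimately have "(\<lambda>n. expect_sample (P (n + n0) (\<theta>1 + \<phi> (n + n0) * u0)) (n + n0) X (bayes_test \<tau> lam \<Theta> p \<theta>1 \<phi> k (n + n0)))
    \<longlonglongrightarrow> measure N {\<omega>\<in>space N. limit_bayes H W (- u0) \<omega> > k - u0}"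
    using F.limit_bayes_event[OF p1, where c="- u0" and k="k - u0"] unfolding c_def by simp
  then show ?thesis by (rule LIMSEQ_offset)
qed

section \<open>Reduction to an \<open>h\<close> measurable on the whole line\<close>

lemma likelihood_cong:
  "(\<And>t. t \<in> {0..\<tau>} \<Longrightarrow> l t = l' t) \<Longrightarrow> likelihood \<tau> n l = likelihood \<tau> n l'"
  unfolding likelihood_def set_lebesgue_integral_def
  by (intro ext arg_cong[where f=exp] arg_cong2[where f="(-)"] arg_cong2[where f="(*)"] sum.cong Bochner_Integration.integral_cong refl)
    (auto simp: indicator_def)

lemma poisson_sample_cong:
  assumes "\<And>t. t \<in> {0..\<tau>} \<Longrightarrow> l t = l' t" and "poisson_sample M \<tau> n l X"
  shows "poisson_sample M \<tau> n l' X"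
proof -
  have "(LBINT v:{s..t}. l v) = (LBINT v:{s..t}. l' v)" if "0 \<le> s" "t \<le> \<tau>" for s t
    using that assms(1) by (intro set_lebesgue_integral_cong) auto
  then show ?thesis using assms(2) unfolding poisson_sample_def poisson_process_def by auto
qed

theorem proposition3:
  fixes \<tau> \<theta>\<^sub>1 b \<kappa> a H \<epsilon> k :: real
    and h p :: "real \<Rightarrow> real"
    and P :: "nat \<Rightarrow> real \<Rightarrow> 'a measure"
    and X :: "nat \<Rightarrow> 'a \<Rightarrow> real \<Rightarrow> nat"
    and N :: "'b measure"
    and W :: "real \<Rightarrow> 'b \<Rightarrow> real"
  defines "lam \<equiv> cusp_intensity a \<kappa> h"
    and "\<Theta> \<equiv> {\<theta>\<^sub>1..<b}"
    and "\<phi> \<equiv> cusp_rate a \<kappa> h \<theta>\<^sub>1"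
    and "\<psi> \<equiv> bayes_test \<tau> (cusp_intensity a \<kappa> h) {\<theta>\<^sub>1..<b} p \<theta>\<^sub>1 (cusp_rate a \<kappa> h \<theta>\<^sub>1) k"
  assumes "\<tau> > 0" and "0 < \<theta>\<^sub>1" and "\<theta>\<^sub>1 < b" and "b \<le> \<tau>"
    and "0 < \<kappa>" and "\<kappa> < 1 / 2" and "a \<noteq> 0"
    and h_pos: "\<forall>t\<in>{0..\<tau>}. h t > 0"
    and h_bounded: "bounded (h ` {0..\<tau>})"
    and h_measurable: "h \<in> borel_measurable (restrict_space borel {0..\<tau>})"
    and h_cont: "isCont h \<theta>\<^sub>1"
    and separated: "\<exists>c>0. \<forall>\<theta>\<in>\<Theta>. \<forall>t\<in>{0..\<tau>}. lam \<theta> t \<ge> c"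
    and model: "\<forall>n. \<forall>\<theta>\<in>\<Theta>. poisson_sample (P n \<theta>) \<tau> n (lam \<theta>) X"
    and prior: "continuous_on \<Theta> p" "\<forall>\<theta>\<in>\<Theta>. p \<theta> > 0" "(LBINT \<theta>:\<Theta>. p \<theta>) = 1"
    and H: "H = \<kappa> + 1 / 2"
    and fBm: "fractional_brownian_motion N H W"
    and eps: "0 < \<epsilon>" "\<epsilon> < 1"
    and k: "measure N {\<omega>\<in>space N. limit_bayes H W 0 \<omega> > k} = \<epsilon>"
  shows "\<psi> \<in> test_class \<tau> (\<lambda>n. P n \<theta>\<^sub>1) X \<epsilon> \<and>
    (\<forall>u>0. (\<lambda>n. expect_sample (P n (\<theta>\<^sub>1 + \<phi> n * u)) n X (\<psi> n))
       \<longlonglongrightarrow> measure N {\<omega>\<in>space N. limit_bayes H W (- u) \<omega> > k - u})"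
proof -
  obtain cl where cl: "0 < cl" "\<And>\<theta> t. \<theta> \<in> \<Theta> \<Longrightarrow> t \<in> {0..\<tau>} \<Longrightarrow> cl \<le> lam \<theta> t"
    using separated by blast
  obtain hm where hm: "\<And>t. t \<in> {0..\<tau>} \<Longrightarrow> \<bar>h t\<bar> \<le> hm" using h_bounded unfolding bounded_real by blast
  \<comment> \<open>\<open>h\<close> is measurable on the observation interval only. The extension
    by 1 stays continuous at \<open>\<theta>\<^sub>1\<close>, an interior point, and leaves the
    intensities on the window, the likelihoods and the rate unchanged.\<close>
  define g where "g t = (if t \<in> {0..\<tau>} then h t else 1)" for t
  have g_eq: "cusp_intensity a \<kappa> g \<theta> t = lam \<theta> t" if "t \<in> {0..\<tau>}" for \<theta> t
    using that by (simp add: lam_def cusp_intensity_def g_def)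
  have [measurable]: "g \<in> borel_measurable borel"
    unfolding g_def[abs_def] using h_measurable
    by (subst measurable_If_restrict_space_iff) (simp_all only: Collect_mem_eq, simp_all)
  have "\<forall>\<^sub>F t in nhds \<theta>\<^sub>1. t \<in> {0<..<\<tau>}"
    using assms(5-8) by (intro eventually_nhds_in_open) auto
  then have "\<forall>\<^sub>F t in nhds \<theta>\<^sub>1. g t = h t" by eventually_elim (simp add: g_def)
  then have "isCont g \<theta>\<^sub>1" using h_cont by (simp add: isCont_cong)
  interpret M: cusp_prior \<tau> \<theta>\<^sub>1 b \<kappa> a g cl hm p
  proof unfold_locales
    show "cl \<le> cusp_intensity a \<kappa> g \<theta> t" if "\<theta> \<in> {\<theta>\<^sub>1..<b}" "t \<in> {0..\<tau>}" for \<theta> t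
      using cl(2)[OF _ that(2), of \<theta>] that g_eq[OF that(2)] by (simp add: \<Theta>_def)
    show "g t \<le> hm" if "t \<in> {0..\<tau>}" for t using hm[OF that] that by (simp add: g_def)
    show "0 < g t" if "t \<in> {0..\<tau>}" for t using h_pos that by (simp add: g_def)
    show "isCont g \<theta>\<^sub>1" by fact
    show "g \<in> borel_measurable borel" by measurable
  qed (use assms(5-11) cl prior in \<open>auto simp: \<Theta>_def\<close>)
  have rate: "M.\<phi> = \<phi>"
    using M.theta1_mem by (simp add: M.\<phi>_def \<phi>_def cusp_rate_def[abs_def] cusp_Gamma_def g_def)
  have lik: "likelihood \<tau> n (cusp_intensity a \<kappa> g \<theta>) = likelihood \<tau> n (cusp_intensity a \<kappa> h \<theta>)" for n \<theta>
    by (rule likelihood_cong) (use g_eq in \<open>simp add: lam_def\<close>)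
  have est: "bayes_estimator \<tau> (cusp_intensity a \<kappa> g) {\<theta>\<^sub>1..<b} p = bayes_estimator \<tau> (cusp_intensity a \<kappa> h) {\<theta>\<^sub>1..<b} p"
    unfolding bayes_estimator_def[abs_def] lik ..
  have test: "bayes_test \<tau> (cusp_intensity a \<kappa> g) {\<theta>\<^sub>1..<b} p \<theta>\<^sub>1 \<phi> k = \<psi>"
    unfolding bayes_test_def[abs_def] \<psi>_def est \<phi>_def ..
  have F: "fbm N H W"
  proof (intro fbm.intro fbm_axioms.intro)
    show "prob_space N" using fBm by (simp only: fractional_brownian_motion_def)
    show "1 / 2 < H" using H \<open>0 < \<kappa>\<close> by simp
  qed (rule fBm)
  have model': "poisson_sample (P n \<theta>) \<tau> n (cusp_intensity a \<kappa> g \<theta>) X" if "\<theta> \<in> {\<theta>\<^sub>1..<b}" for n \<theta>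
  proof (rule poisson_sample_cong)
    show "poisson_sample (P n \<theta>) \<tau> n (lam \<theta>) X" using model that by (simp add: \<Theta>_def)
  qed (simp add: g_eq)
  have power: "(\<lambda>n. expect_sample (P n (\<theta>\<^sub>1 + \<phi> n * u)) n X (\<psi> n))
       \<longlonglongrightarrow> measure N {\<omega>\<in>space N. limit_bayes H W (- u) \<omega> > k - u}" if "0 \<le> u" for u
    using M.bayes_test_power_tendsto[OF model' F H that, of k] unfolding rate test .
  \<comment> \<open>At \<open>u = 0\<close> the limiting rejection probability is
    \<open>\<epsilon>\<close> by the choice of \<open>k\<close>.\<close>
  have "(\<lambda>n. expect_sample (P n \<theta>\<^sub>1) n X (\<psi> n)) \<longlonglongrightarrow> \<epsilon>" using power[of 0] k by simp
  moreover have "\<psi> n \<in> borel_measurable (sample_space \<tau> n)" for n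
  proof -
    have [measurable]: "bayes_estimator \<tau> (cusp_intensity a \<kappa> h) \<Theta> p n \<in> borel_measurable (sample_space \<tau> n)"
      using M.bayes_estimator_measurable[of n] unfolding est \<Theta>_def .
    show ?thesis unfolding \<psi>_def bayes_test_def[abs_def] \<Theta>_def[symmetric] by measurable
  qed
  moreover have "\<psi> n x \<in> {0..1}" for n x by (simp add: \<psi>_def bayes_test_def)
  ultimately show ?thesis using power by (simp add: test_class_def)
qed

end
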